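(* Let $G$ be a group with a braiding operator $r:G\times G\to G\times G$, and let $H_{\omega_m}$ be the co-quasitriangular Hopf algebra in $\mathrm{SupLat}$ reconstructed from the functor $\omega_m:\tilde{\mathcal{B}}_m\to\mathrm{SupLat}$ associated with $(G,r)$. Then the remnant of $H_{\omega_m}$ recovers $(G,r)$; that is, there is a group isomorphism $R(H_{\omega_m})\cong G$ under which the braiding operator induced on $R(H_{\omega_m})$ by the co-quasitriangular structure corresponds to $r$.
   Context: A braiding operator on a group $(G,m,e)$ is a map $r:G\times G\to G\times G$ with, for all $f,g,h\in G$: $m\,r(g,h)=g.h$; $r(e,g)=(g,e)$, $r(g,e)=(e,g)$; $r(g.h,f)=(\mathrm{id}\times m)(r\times\mathrm{id})(g,r(h,f))$; $r(g,h.f)=(m\times\mathrm{id})(\mathrm{id}\times r)(r(g,h),f)$. Such an $r$ is bijective and satisfies $(\mathrm{id}\times r)(r\times\mathrm{id})(\mathrm{id}\times r)=(r\times\mathrm{id})(\mathrm{id}\times r)(r\times\mathrm{id})$; write $r(x,y)=(\sigma_x(y),\gamma_y(x))$, $r^{-1}(x,y)=(\tau_x(y),\rho_y(x))$, where all maps $\sigma_x,\gamma_y,\tau_x,\rho_y:G\to G$ are bijections. $\mathrm{SupLat}$: objects are complete lattices, morphisms are maps preserving arbitrary joins; least elements are denoted $\emptyset$; $\mathcal{L}\otimes\mathcal{M}$ is universal for maps on $\mathcal{L}\times\mathcal{M}$ preserving joins in each variable, $(l,m)$ denotes the image of a pair; unit $\mathcal{P}(1)=\{\emptyset,1\}$,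 acting on lattices by $1.l=l$, $\emptyset.l=\emptyset$; $\mathcal{P}(X)\otimes\mathcal{P}(Y)\cong\mathcal{P}(X\times Y)$. Hopf algebras $(\mathcal{H},m,1,\Delta,\epsilon,S)$ in this symmetric monoidal category are as usual, with $S$ invertible. Sweedler notation $\Delta(a)=\vee(a_{(1)},a_{(2)})$; expressions denote joins over all terms. A co-quasitriangular structure is a join-preserving, convolution-invertible $\mathcal{R}:\mathcal{H}\otimes\mathcal{H}\to\mathcal{P}(1)$ with $\mathcal{R}(a.b,c)=\mathcal{R}(b,c_{(1)}).\mathcal{R}(a,c_{(2)})$, $\mathcal{R}(a,b.c)=\mathcal{R}(a_{(1)},b).\mathcal{R}(a_{(2)},c)$, $\mathcal{R}(b_{(1)},a_{(1)})a_{(2)}.b_{(2)}=b_{(1)}.a_{(1)}\mathcal{R}(b_{(2)},a_{(2)})$. Remnant. For a Hopf algebra $\mathcal{H}$ let $D=\vee\epsilon^{-1}(\emptyset)$, let $\mathcal{Q}$ be the quotient of $\mathcal{H}$ by $h\sim h\vee D$ (ordered by $\overline{a}\le\overline{b}$ iff $a\vee D\le b\vee D$), $\pi(h)=\overline{h}$, $\iota(\overline{h})=h\vee D$. $\mathcal{Q}$ has a Hopf algebra structure making $\pi$ a Hopf algebra morphism, and with it is isomorphic to the group algebra $\mathcal{P}(R(\mathcal{H}))$ of a group $R(\mathcal{H})$, the remnant ($\{g\}.\{h\}=\{gh\}$, $\Delta\{g\}=(\{g\},\{g\})$, $\epsilon\{g\}=1$, $S\{g\}=\{g^{-1}\}$);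 concretely $R(\mathcal{H})$ is the set of $q\neq\emptyset$ in $\mathcal{Q}$ with $\Delta(q)=(q,q)$. If $\mathcal{R}$ is a co-quasitriangular structure on $\mathcal{H}$ and $\Gamma(a,b)=\mathcal{R}(a_{(1)},b_{(1)}).(b_{(2)},a_{(2)}).\mathcal{R}^{-1}(a_{(3)},b_{(3)})$, then $(\pi\otimes\pi)\Gamma(\iota\otimes\iota)$ sends singletons of $\mathcal{Q}\otimes\mathcal{Q}\cong\mathcal{P}(R(\mathcal{H})\times R(\mathcal{H}))$ to singletons, and the resulting map on $R(\mathcal{H})\times R(\mathcal{H})$ is the induced braiding operator. The category $\tilde{\mathcal{B}}_m$ is the smallest rigid braided monoidal category generated by a commutative monoid: the strict braided rigid monoidal category generated by objects $\mathbf{x},\mathbf{y}$, morphisms $\mathrm{ev}:\mathbf{x}\otimes\mathbf{y}\to\mathtt{1}$, $\mathrm{coev}:\mathtt{1}\to\mathbf{y}\otimes\mathbf{x}$, invertible $\kappa_{\mathbf{a},\mathbf{b}}:\mathbf{a}\otimes\mathbf{b}\to\mathbf{b}\otimes\mathbf{a}$ ($\mathbf{a},\mathbf{b}\in\{\mathbf{x},\mathbf{y}\}$), and $m:\mathbf{x}\otimes\mathbf{x}\to\mathbf{x}$, $u:\mathtt{1}\to\mathbf{x}$, subject to the relations making $\kappa$ (extended to tensor products) a braiding, $\mathbf{y}$ the right dual of $\mathbf{x}$, and $(\mathbf{x},m,u)$ a commutative monoid: $m(u\otimes\mathrm{id})=\mathrm{id}=m(\mathrm{id}\otimes u)$, $m(m\otimes\mathrm{id})=m(\mathrm{id}\otimes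 m)$, $m\kappa_{\mathbf{x},\mathbf{x}}=m$, $\kappa_{\mathbf{x},\mathbf{x}}(u\otimes\mathrm{id})=\mathrm{id}\otimes u$, $\kappa_{\mathbf{x},\mathbf{x}}(\mathrm{id}\otimes u)=u\otimes\mathrm{id}$. Objects $\mathbf{a}$ are words of length $n$ in $\mathbf{x},\mathbf{y}$; put $X_{\mathbf{a}}=G^n$. The strong monoidal functor $\omega_m:\tilde{\mathcal{B}}_m\to\mathrm{SupLat}$ has $\omega_m(\mathbf{a})=\mathcal{P}(X_{\mathbf{a}})$ and is determined by $\omega_m(\mathrm{ev})(\{(x,y)\})=1$ iff $x=y$ (else $\emptyset$), $\omega_m(\mathrm{coev})(1)=\{(x,x)\mid x\in G\}$, $\omega_m(m)(\{(x,y)\})=\{x.y\}$, $\omega_m(u)(1)=\{e\}$, and $\omega_m(\kappa_{\mathbf{a},\mathbf{b}})$ induced by the bijections of $G\times G$: $\kappa_{\mathbf{x},\mathbf{x}}:(x,y)\mapsto r(x,y)$; $\kappa_{\mathbf{x},\mathbf{y}}:(x,y)\mapsto(\rho_x^{-1}(y),\gamma_y^{-1}(x))$; $\kappa_{\mathbf{y},\mathbf{x}}:(x,y)\mapsto(\sigma_x^{-1}(y),\tau_y^{-1}(x))$; $\kappa_{\mathbf{y},\mathbf{y}}:(x,y)\mapsto(\rho_x(y),\tau_y(x))$. $H_{\omega_m}$ is the coend $\int^{\mathbf{a}\in\tilde{\mathcal{B}}_m}\omega_m(\mathbf{a})\otimes\omega_m(\mathbf{a})^{\vee}$ in $\mathrm{SupLat}$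 (each $\mathcal{P}(X_{\mathbf a})$ being self-dual). Explicitly, it is the complete lattice generated under joins by symbols $[p,q]_{\mathbf{a}}$ ($\mathbf{a}$ an object, $p,q\in X_{\mathbf{a}}$), universal subject to the relations, for each morphism $f:\mathbf{a}\to\mathbf{b}$ of $\tilde{\mathcal{B}}_m$, $p\in X_{\mathbf{a}}$, $q\in X_{\mathbf{b}}$: $$\vee\{[p',q]_{\mathbf{b}}\mid p'\in\omega_m(f)(\{p\})\}=\vee\{[p,q']_{\mathbf{a}}\mid q'\in X_{\mathbf{a}},\ q\in\omega_m(f)(\{q'\})\}.$$ Its structure is: $[p,q]_{\mathbf{a}}.[p',q']_{\mathbf{b}}=[pp',qq']_{\mathbf{a}\otimes\mathbf{b}}$ (concatenation), unit the generator indexed by $\mathtt{1}$, $\Delta([p,q]_{\mathbf{a}})=\vee_{l\in X_{\mathbf{a}}}([p,l]_{\mathbf{a}},[l,q]_{\mathbf{a}})$, $\epsilon([p,q]_{\mathbf{a}})=1$ iff $p=q$ (else $\emptyset$). This bialgebra has a (necessarily unique) bijective antipode, and the co-quasitriangular structure is $\mathcal{R}([p,q]_{\mathbf{a}},[p',q']_{\mathbf{b}})=1$ iff the bijection $\omega_m(\kappa_{\mathbf{a},\mathbf{b}}):X_{\mathbf{a}}\times X_{\mathbf{b}}\to X_{\mathbf{b}}\times X_{\mathbf{a}}$ sends $(p,p')$ to $(q',q)$ (else $\emptyset$). *)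

theory Defs
  imports "HOL-Algebra.Group" "HOL-Algebra.Complete_Lattice"
begin

section \<open>Braiding operators\<close>

definition braiding_operator ::
  "('g, 'm) monoid_scheme \<Rightarrow> ('g \<times> 'g \<Rightarrow> 'g \<times> 'g) \<Rightarrow> bool" where
  "braiding_operator G r \<longleftrightarrow>
     r \<in> carrier G \<times> carrier G \<rightarrow> carrier G \<times> carrier G \<and>
     (\<forall>g\<in>carrier G. \<forall>h\<in>carrier G. fst (r (g, h)) \<otimes>\<^bsub>G\<^esub> snd (r (g, h)) = g \<otimes>\<^bsub>G\<^esub> h) \<and>
     (\<forall>g\<in>carrier G. r (\<one>\<^bsub>G\<^esub>, g) = (g, \<one>\<^bsub>G\<^esub>) \<and> r (g, \<one>\<^bsub>G\<^esub>) = (\<one>\<^bsub>G\<^esub>, g)) \<and>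
     (\<forall>g\<in>carrier G. \<forall>h\<in>carrier G. \<forall>f\<in>carrier G.
        r (g \<otimes>\<^bsub>G\<^esub> h, f) =
          (let (a, b) = r (h, f); (c, d) = r (g, a) in (c, d \<otimes>\<^bsub>G\<^esub> b))) \<and>
     (\<forall>g\<in>carrier G. \<forall>h\<in>carrier G. \<forall>f\<in>carrier G.
        r (g, h \<otimes>\<^bsub>G\<^esub> f) =
          (let (a, b) = r (g, h); (c, d) = r (b, f) in (a \<otimes>\<^bsub>G\<^esub> c, d)))"

(* r(x,y) = (br_sigma x y, br_gamma y x) and r^{-1}(x,y) = (br_tau x y, br_rho y x). *)

definition br_inv ::
  "('g, 'm) monoid_scheme \<Rightarrow> ('g \<times> 'g \<Rightarrow> 'g \<times> 'g) \<Rightarrow> 'g \<times> 'g \<Rightarrow> 'g \<times> 'g" where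
  "br_inv G r = inv_into (carrier G \<times> carrier G) r"

definition br_sigma :: "('g \<times> 'g \<Rightarrow> 'g \<times> 'g) \<Rightarrow> 'g \<Rightarrow> 'g \<Rightarrow> 'g" where
  "br_sigma r x y = fst (r (x, y))"

definition br_gamma :: "('g \<times> 'g \<Rightarrow> 'g \<times> 'g) \<Rightarrow> 'g \<Rightarrow> 'g \<Rightarrow> 'g" where
  "br_gamma r y x = snd (r (x, y))"

definition br_tau ::
  "('g, 'm) monoid_scheme \<Rightarrow> ('g \<times> 'g \<Rightarrow> 'g \<times> 'g) \<Rightarrow> 'g \<Rightarrow> 'g \<Rightarrow> 'g" where
  "br_tau G r x y = fst (br_inv G r (x, y))"

definition br_rho ::
  "('g, 'm) monoid_scheme \<Rightarrow> ('g \<times> 'g \<Rightarrow> 'g \<times> 'g) \<Rightarrow> 'g \<Rightarrow> 'g \<Rightarrow> 'g" where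
  "br_rho G r y x = snd (br_inv G r (x, y))"


section \<open>Complete lattices and join-preserving maps\<close>

definition sup_hom ::
  "('a, 'x) gorder_scheme \<Rightarrow> ('b, 'y) gorder_scheme \<Rightarrow> ('a \<Rightarrow> 'b) \<Rightarrow> bool" where
  "sup_hom L M f \<longleftrightarrow> f \<in> carrier L \<rightarrow> carrier M \<and>
     (\<forall>A \<subseteq> carrier L. f (\<Squnion>\<^bsub>L\<^esub> A) = \<Squnion>\<^bsub>M\<^esub> (f ` A))"

definition bi_sup_hom ::
  "('a, 'x) gorder_scheme \<Rightarrow> ('b, 'y) gorder_scheme \<Rightarrow> ('c, 'z) gorder_scheme \<Rightarrow>
   ('a \<Rightarrow> 'b \<Rightarrow> 'c) \<Rightarrow> bool" where
  "bi_sup_hom L M N f \<longleftrightarrow>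
     (\<forall>l\<in>carrier L. sup_hom M N (f l)) \<and> (\<forall>m\<in>carrier M. sup_hom L N (\<lambda>l. f l m))"

(* The unit object: True is the element 1, False is the least element, and
   the product of scalars is conjunction. *)
definition sup_unit :: "bool gorder" where
  "sup_unit = \<lparr>carrier = UNIV, eq = (=), le = (\<le>)\<rparr>"

definition scal :: "('a, 'x) gorder_scheme \<Rightarrow> bool \<Rightarrow> 'a \<Rightarrow> 'a" where
  "scal L s l = (if s then l else \<bottom>\<^bsub>L\<^esub>)"


subsection \<open>Presentations\<close>

(* The complete lattice generated under joins by the symbols X subject to
   \<Or>A = \<Or>B for all (A, B) in Rel.  An element is encoded by the set of all
   generators lying below it; see suplat_pres_universal. *)
definition suplat_pres :: "'a set \<Rightarrow> ('a set \<times> 'a set) set \<Rightarrow> 'a set gorder" where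
  "suplat_pres X Rel =
     \<lparr>carrier = {S. S \<subseteq> X \<and> (\<forall>(A, B)\<in>Rel. A \<subseteq> S \<longleftrightarrow> B \<subseteq> S)}, eq = (=), le = (\<subseteq>)\<rparr>"

definition suplat_gen :: "'a set \<Rightarrow> ('a set \<times> 'a set) set \<Rightarrow> 'a \<Rightarrow> 'a set" where
  "suplat_gen X Rel x = \<Inter> {S \<in> carrier (suplat_pres X Rel). x \<in> S}"

lemma suplat_pres_carrier_iff:
  "S \<in> carrier (suplat_pres X Rel) \<longleftrightarrow>
     S \<subseteq> X \<and> (\<forall>A B. (A, B) \<in> Rel \<longrightarrow> (A \<subseteq> S \<longleftrightarrow> B \<subseteq> S))"
  unfolding suplat_pres_def by auto

lemma suplat_pres_subset: "S \<in> carrier (suplat_pres X Rel) \<Longrightarrow> S \<subseteq> X"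
  unfolding suplat_pres_carrier_iff by simp

lemma suplat_pres_le [simp]: "S \<sqsubseteq>\<^bsub>suplat_pres X Rel\<^esub> T \<longleftrightarrow> S \<subseteq> T"
  by (simp add: suplat_pres_def)

lemma suplat_pres_Inter_closed:
  assumes "\<A> \<subseteq> carrier (suplat_pres X Rel)" "\<A> \<noteq> {}"
  shows "\<Inter>\<A> \<in> carrier (suplat_pres X Rel)"
  unfolding suplat_pres_carrier_iff
proof (intro conjI allI impI)
  show "\<Inter>\<A> \<subseteq> X"
    using assms suplat_pres_subset by blast
  fix A B assume "(A, B) \<in> Rel"
  then have "A \<subseteq> S \<longleftrightarrow> B \<subseteq> S" if "S \<in> \<A>" for S
    using suplat_pres_carrier_iff[THEN iffD1, OF subsetD[OF assms(1) that]] by blast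
  then show "A \<subseteq> \<Inter>\<A> \<longleftrightarrow> B \<subseteq> \<Inter>\<A>"
    by (simp add: le_Inf_iff)
qed

lemma suplat_pres_top_closed:
  assumes "Rel \<subseteq> Pow X \<times> Pow X"
  shows "X \<in> carrier (suplat_pres X Rel)"
  unfolding suplat_pres_carrier_iff using assms by blast

lemma suplat_pres_complete_lattice:
  assumes Rel: "Rel \<subseteq> Pow X \<times> Pow X"
  shows "complete_lattice (suplat_pres X Rel)" (is "complete_lattice ?L")
proof (rule partial_order.complete_latticeI)
  show "partial_order ?L"
    by unfold_locales (auto simp: suplat_pres_def)
next
  fix A assume A: "A \<subseteq> carrier ?L"
  let ?I = "\<Inter> (insert X A)"
  have I: "?I \<in> carrier ?L"
    using A suplat_pres_top_closed[OF Rel] by (intro suplat_pres_Inter_closed) auto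
  have "greatest ?L ?I (Lower ?L A)"
    unfolding greatest_def Lower_def
  proof (intro conjI ballI)
    show "?I \<in> {l. \<forall>x. x \<in> A \<inter> carrier ?L \<longrightarrow> l \<sqsubseteq>\<^bsub>?L\<^esub> x} \<inter> carrier ?L"
      using I by auto
    fix l assume "l \<in> {l. \<forall>x. x \<in> A \<inter> carrier ?L \<longrightarrow> l \<sqsubseteq>\<^bsub>?L\<^esub> x} \<inter> carrier ?L"
    then have "l \<subseteq> X" "\<forall>x\<in>A. l \<subseteq> x"
      using A suplat_pres_subset[of l X Rel] by auto
    then show "l \<sqsubseteq>\<^bsub>?L\<^esub> ?I"
      by (simp add: le_Inf_iff)
  qed simp
  then show "\<exists>i. greatest ?L i (Lower ?L A)" by blast
next
  fix A assume A: "A \<subseteq> carrier ?L"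
  let ?U = "{S \<in> carrier ?L. \<Union>A \<subseteq> S}"
  have ne: "X \<in> ?U"
    using A suplat_pres_top_closed[OF Rel] by (auto dest!: suplat_pres_subset)
  then have I: "\<Inter>?U \<in> carrier ?L"
    by (intro suplat_pres_Inter_closed) auto
  have "least ?L (\<Inter>?U) (Upper ?L A)"
    unfolding least_def Upper_def
  proof (intro conjI ballI)
    show "\<Inter>?U \<in> {u. \<forall>x. x \<in> A \<inter> carrier ?L \<longrightarrow> x \<sqsubseteq>\<^bsub>?L\<^esub> u} \<inter> carrier ?L"
      using I by auto
    fix u assume "u \<in> {u. \<forall>x. x \<in> A \<inter> carrier ?L \<longrightarrow> x \<sqsubseteq>\<^bsub>?L\<^esub> u} \<inter> carrier ?L"
    then have "u \<in> ?U" using A by auto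
    then show "\<Inter>?U \<sqsubseteq>\<^bsub>?L\<^esub> u" by (simp add: Inter_lower)
  qed simp
  then show "\<exists>s. least ?L s (Upper ?L A)" by blast
qed

lemma suplat_gen_closed:
  assumes "Rel \<subseteq> Pow X \<times> Pow X" "x \<in> X"
  shows "suplat_gen X Rel x \<in> carrier (suplat_pres X Rel)"
  unfolding suplat_gen_def
  using assms suplat_pres_top_closed[OF assms(1)] by (intro suplat_pres_Inter_closed) auto

lemma suplat_gen_le_iff:
  assumes "x \<in> X" "S \<in> carrier (suplat_pres X Rel)"
  shows "suplat_gen X Rel x \<subseteq> S \<longleftrightarrow> x \<in> S"
  using assms unfolding suplat_gen_def by blast

lemma suplat_pres_le_iff_gen:
  assumes Rel: "Rel \<subseteq> Pow X \<times> Pow X" and "A \<subseteq> X" "S \<in> carrier (suplat_pres X Rel)"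
  shows "\<Squnion>\<^bsub>suplat_pres X Rel\<^esub> (suplat_gen X Rel ` A) \<subseteq> S \<longleftrightarrow> A \<subseteq> S"
proof -
  interpret L: complete_lattice "suplat_pres X Rel"
    by (rule suplat_pres_complete_lattice[OF Rel])
  have c: "suplat_gen X Rel ` A \<subseteq> carrier (suplat_pres X Rel)"
    by (intro image_subsetI suplat_gen_closed[OF Rel] subsetD[OF assms(2)])
  have "\<Squnion>\<^bsub>suplat_pres X Rel\<^esub> (suplat_gen X Rel ` A) \<subseteq> S \<longleftrightarrow> (\<forall>x\<in>A. suplat_gen X Rel x \<subseteq> S)"
  proof
    assume "\<Squnion>\<^bsub>suplat_pres X Rel\<^esub> (suplat_gen X Rel ` A) \<subseteq> S"
    then show "\<forall>x\<in>A. suplat_gen X Rel x \<subseteq> S"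
      using L.sup_upper[OF c imageI] unfolding suplat_pres_le by (meson subset_trans)
  next
    assume "\<forall>x\<in>A. suplat_gen X Rel x \<subseteq> S"
    then show "\<Squnion>\<^bsub>suplat_pres X Rel\<^esub> (suplat_gen X Rel ` A) \<subseteq> S"
      using L.sup_least[OF c assms(3)] unfolding suplat_pres_le by blast
  qed
  also have "\<dots> \<longleftrightarrow> A \<subseteq> S"
    using suplat_gen_le_iff[OF subsetD[OF assms(2)] assms(3)] by blast
  finally show ?thesis .
qed

lemma suplat_pres_relation:
  assumes Rel: "Rel \<subseteq> Pow X \<times> Pow X" and AB: "(A, B) \<in> Rel"
  shows "\<Squnion>\<^bsub>suplat_pres X Rel\<^esub> (suplat_gen X Rel ` A) = \<Squnion>\<^bsub>suplat_pres X Rel\<^esub> (suplat_gen X Rel ` B)"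
    (is "?a = ?b")
proof -
  interpret L: complete_lattice "suplat_pres X Rel"
    by (rule suplat_pres_complete_lattice[OF Rel])
  have sub: "A \<subseteq> X" "B \<subseteq> X" using Rel AB by auto
  have c: "?a \<in> carrier (suplat_pres X Rel)" "?b \<in> carrier (suplat_pres X Rel)"
    by (intro L.sup_closed image_subsetI suplat_gen_closed[OF Rel] subsetD[OF sub(1)]
        subsetD[OF sub(2)]; assumption)+
  have "A \<subseteq> S \<longleftrightarrow> B \<subseteq> S" if "S \<in> carrier (suplat_pres X Rel)" for S
    using suplat_pres_carrier_iff[THEN iffD1, OF that] AB by blast
  then have iff: "?a \<subseteq> S \<longleftrightarrow> ?b \<subseteq> S" if "S \<in> carrier (suplat_pres X Rel)" for S
    using that suplat_pres_le_iff_gen[OF Rel sub(1) that] suplat_pres_le_iff_gen[OF Rel sub(2) that]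
    by simp
  show ?thesis
    using iff[OF c(1)] iff[OF c(2)] by blast
qed

lemma suplat_pres_generated:
  assumes Rel: "Rel \<subseteq> Pow X \<times> Pow X" and S: "S \<in> carrier (suplat_pres X Rel)"
  shows "S = \<Squnion>\<^bsub>suplat_pres X Rel\<^esub> (suplat_gen X Rel ` S)"
proof -
  interpret L: complete_lattice "suplat_pres X Rel"
    by (rule suplat_pres_complete_lattice[OF Rel])
  have SX: "S \<subseteq> X" using S by (rule suplat_pres_subset)
  have c: "\<Squnion>\<^bsub>suplat_pres X Rel\<^esub> (suplat_gen X Rel ` S) \<in> carrier (suplat_pres X Rel)"
    by (intro L.sup_closed image_subsetI suplat_gen_closed[OF Rel] subsetD[OF SX])
  show ?thesis
    using suplat_pres_le_iff_gen[OF Rel SX S] suplat_pres_le_iff_gen[OF Rel SX c] by blast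
qed

theorem suplat_pres_universal:
  assumes Rel: "Rel \<subseteq> Pow X \<times> Pow X" and M: "complete_lattice M" and f: "f \<in> X \<rightarrow> carrier M"
    and resp: "\<And>A B. (A, B) \<in> Rel \<Longrightarrow> \<Squnion>\<^bsub>M\<^esub> (f ` A) = \<Squnion>\<^bsub>M\<^esub> (f ` B)"
  shows "sup_hom (suplat_pres X Rel) M (\<lambda>S. \<Squnion>\<^bsub>M\<^esub> (f ` S))" (is "sup_hom ?L M ?F")
    and "\<And>x. x \<in> X \<Longrightarrow> \<Squnion>\<^bsub>M\<^esub> (f ` suplat_gen X Rel x) = f x"
    and "\<And>F S. \<lbrakk>sup_hom (suplat_pres X Rel) M F; \<And>x. x \<in> X \<Longrightarrow> F (suplat_gen X Rel x) = f x;
           S \<in> carrier (suplat_pres X Rel)\<rbrakk> \<Longrightarrow> F S = \<Squnion>\<^bsub>M\<^esub> (f ` S)"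
proof -
  interpret M: complete_lattice M by (rule M)
  interpret L: complete_lattice ?L
    by (rule suplat_pres_complete_lattice[OF Rel])
  define K where "K y = {x \<in> X. f x \<sqsubseteq>\<^bsub>M\<^esub> y}" for y
  have fc: "f ` A \<subseteq> carrier M" if "A \<subseteq> X" for A
    using f that by blast
  have le: "\<Squnion>\<^bsub>M\<^esub> (f ` A) \<sqsubseteq>\<^bsub>M\<^esub> y \<longleftrightarrow> A \<subseteq> K y" if "A \<subseteq> X" "y \<in> carrier M" for A y
  proof
    assume l: "\<Squnion>\<^bsub>M\<^esub> (f ` A) \<sqsubseteq>\<^bsub>M\<^esub> y"
    show "A \<subseteq> K y"
    proof
      fix x assume "x \<in> A"
      then have "f x \<sqsubseteq>\<^bsub>M\<^esub> \<Squnion>\<^bsub>M\<^esub> (f ` A)"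
        by (intro M.sup_upper fc that) auto
      then have "f x \<sqsubseteq>\<^bsub>M\<^esub> y"
        using fc[OF that(1)] \<open>x \<in> A\<close>
        by (intro M.le_trans[OF _ l _ _ that(2)] M.sup_closed) auto
      then show "x \<in> K y" using \<open>x \<in> A\<close> that unfolding K_def by blast
    qed
  next
    assume "A \<subseteq> K y"
    then show "\<Squnion>\<^bsub>M\<^esub> (f ` A) \<sqsubseteq>\<^bsub>M\<^esub> y"
      by (intro M.sup_least fc that) (auto simp: K_def)
  qed
  have K: "K y \<in> carrier ?L" if "y \<in> carrier M" for y
    unfolding suplat_pres_carrier_iff
  proof (intro conjI allI impI)
    show "K y \<subseteq> X" by (auto simp: K_def)
    fix A B assume AB: "(A, B) \<in> Rel"
    then have "A \<subseteq> X" "B \<subseteq> X" using Rel by auto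
    then show "A \<subseteq> K y \<longleftrightarrow> B \<subseteq> K y"
      using le[OF _ that] resp[OF AB] by metis
  qed
  have SX: "S \<subseteq> X" if "S \<in> carrier ?L" for S
    using that by (rule suplat_pres_subset)
  have eqI: "a = b" if "a \<in> carrier M" "b \<in> carrier M"
    "\<And>y. y \<in> carrier M \<Longrightarrow> a \<sqsubseteq>\<^bsub>M\<^esub> y \<longleftrightarrow> b \<sqsubseteq>\<^bsub>M\<^esub> y" for a b
    using that by (meson M.le_antisym M.le_refl)
  have Fc: "?F S \<in> carrier M" if "S \<in> carrier ?L" for S
    by (rule M.sup_closed[OF fc[OF SX[OF that]]])
  show "sup_hom ?L M ?F"
    unfolding sup_hom_def
  proof (intro conjI allI impI)
    show "?F \<in> carrier ?L \<rightarrow> carrier M" using Fc by blast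
    fix \<A> assume \<A>: "\<A> \<subseteq> carrier ?L"
    have c1: "\<Squnion>\<^bsub>?L\<^esub> \<A> \<in> carrier ?L" using \<A> by (rule L.sup_closed)
    have c2: "?F ` \<A> \<subseteq> carrier M" using Fc \<A> by blast
    show "?F (\<Squnion>\<^bsub>?L\<^esub> \<A>) = \<Squnion>\<^bsub>M\<^esub> (?F ` \<A>)"
    proof (rule eqI)
      fix y assume y: "y \<in> carrier M"
      have "?F (\<Squnion>\<^bsub>?L\<^esub> \<A>) \<sqsubseteq>\<^bsub>M\<^esub> y \<longleftrightarrow> \<Squnion>\<^bsub>?L\<^esub> \<A> \<subseteq> K y"
        by (rule le[OF SX[OF c1] y])
      also have "\<dots> \<longleftrightarrow> (\<forall>S\<in>\<A>. S \<subseteq> K y)"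
      proof
        assume "\<Squnion>\<^bsub>?L\<^esub> \<A> \<subseteq> K y"
        then show "\<forall>S\<in>\<A>. S \<subseteq> K y"
          using L.sup_upper[OF \<A>] unfolding suplat_pres_le by (meson subset_trans)
      next
        assume "\<forall>S\<in>\<A>. S \<subseteq> K y"
        then show "\<Squnion>\<^bsub>?L\<^esub> \<A> \<subseteq> K y"
          using L.sup_least[OF \<A> K[OF y]] unfolding suplat_pres_le by blast
      qed
      also have "\<dots> \<longleftrightarrow> (\<forall>S\<in>\<A>. ?F S \<sqsubseteq>\<^bsub>M\<^esub> y)"
        by (intro ball_cong refl le[OF SX y, symmetric] subsetD[OF \<A>])
      also have "\<dots> \<longleftrightarrow> \<Squnion>\<^bsub>M\<^esub> (?F ` \<A>) \<sqsubseteq>\<^bsub>M\<^esub> y"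
      proof
        assume "\<forall>S\<in>\<A>. ?F S \<sqsubseteq>\<^bsub>M\<^esub> y"
        then show "\<Squnion>\<^bsub>M\<^esub> (?F ` \<A>) \<sqsubseteq>\<^bsub>M\<^esub> y"
          by (intro M.sup_least[OF c2 y]) blast
      next
        assume l: "\<Squnion>\<^bsub>M\<^esub> (?F ` \<A>) \<sqsubseteq>\<^bsub>M\<^esub> y"
        show "\<forall>S\<in>\<A>. ?F S \<sqsubseteq>\<^bsub>M\<^esub> y"
        proof
          fix S assume S: "S \<in> \<A>"
          then have u: "?F S \<sqsubseteq>\<^bsub>M\<^esub> \<Squnion>\<^bsub>M\<^esub> (?F ` \<A>)"
            by (intro M.sup_upper[OF c2]) blast
          have "?F S \<in> carrier M" using S \<A> Fc by blast
          then show "?F S \<sqsubseteq>\<^bsub>M\<^esub> y"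
            using M.le_trans[OF u l _ M.sup_closed[OF c2] y] by blast
        qed
      qed
      finally show "?F (\<Squnion>\<^bsub>?L\<^esub> \<A>) \<sqsubseteq>\<^bsub>M\<^esub> y \<longleftrightarrow> \<Squnion>\<^bsub>M\<^esub> (?F ` \<A>) \<sqsubseteq>\<^bsub>M\<^esub> y" .
    qed (rule Fc[OF c1], rule M.sup_closed[OF c2])
  qed
  show "\<Squnion>\<^bsub>M\<^esub> (f ` suplat_gen X Rel x) = f x" if x: "x \<in> X" for x
  proof (rule eqI)
    fix y assume y: "y \<in> carrier M"
    have "\<Squnion>\<^bsub>M\<^esub> (f ` suplat_gen X Rel x) \<sqsubseteq>\<^bsub>M\<^esub> y \<longleftrightarrow> suplat_gen X Rel x \<subseteq> K y"
      by (rule le[OF SX[OF suplat_gen_closed[OF Rel x]] y])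
    also have "\<dots> \<longleftrightarrow> x \<in> K y"
      by (rule suplat_gen_le_iff[OF x K[OF y]])
    also have "\<dots> \<longleftrightarrow> f x \<sqsubseteq>\<^bsub>M\<^esub> y"
      using x by (simp add: K_def)
    finally show "\<Squnion>\<^bsub>M\<^esub> (f ` suplat_gen X Rel x) \<sqsubseteq>\<^bsub>M\<^esub> y \<longleftrightarrow> f x \<sqsubseteq>\<^bsub>M\<^esub> y" .
  qed (rule Fc[OF suplat_gen_closed[OF Rel x]], use f x in blast)
  show "F S = ?F S"
    if F: "sup_hom ?L M F" "\<And>x. x \<in> X \<Longrightarrow> F (suplat_gen X Rel x) = f x" and S: "S \<in> carrier ?L" for F S
  proof -
    have c: "suplat_gen X Rel ` S \<subseteq> carrier ?L"
      by (intro image_subsetI suplat_gen_closed[OF Rel] subsetD[OF SX[OF S]])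
    have "F S = F (\<Squnion>\<^bsub>?L\<^esub> (suplat_gen X Rel ` S))"
      by (rule arg_cong[OF suplat_pres_generated[OF Rel S]])
    also have "\<dots> = \<Squnion>\<^bsub>M\<^esub> (F ` suplat_gen X Rel ` S)"
      by (rule conjunct2[OF F(1)[unfolded sup_hom_def], rule_format, OF c])
    also have "F ` suplat_gen X Rel ` S = f ` S"
      unfolding image_image by (intro image_cong refl F(2) subsetD[OF SX[OF S]])
    finally show ?thesis .
  qed
qed


subsection \<open>Tensor products\<close>

definition tensor_rel ::
  "('a, 'x) gorder_scheme \<Rightarrow> ('b, 'y) gorder_scheme \<Rightarrow> (('a \<times> 'b) set \<times> ('a \<times> 'b) set) set" where
  "tensor_rel L M =
     {(A \<times> {m}, {(\<Squnion>\<^bsub>L\<^esub> A, m)}) | A m. A \<subseteq> carrier L \<and> m \<in> carrier M} \<union>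
     {({l} \<times> B, {(l, \<Squnion>\<^bsub>M\<^esub> B)}) | l B. l \<in> carrier L \<and> B \<subseteq> carrier M}"

definition tensor ::
  "('a, 'x) gorder_scheme \<Rightarrow> ('b, 'y) gorder_scheme \<Rightarrow> ('a \<times> 'b) set gorder" where
  "tensor L M = suplat_pres (carrier L \<times> carrier M) (tensor_rel L M)"

lemma tensor_rel_subset:
  assumes "complete_lattice L" "complete_lattice M"
  shows "tensor_rel L M \<subseteq> Pow (carrier L \<times> carrier M) \<times> Pow (carrier L \<times> carrier M)"
proof -
  interpret L: complete_lattice L by fact
  interpret M: complete_lattice M by fact
  show ?thesis
    unfolding tensor_rel_def by (auto intro: L.sup_closed M.sup_closed)
qed

(* The element of the tensor product denoted (l, m). *)
definition pure ::
  "('a, 'x) gorder_scheme \<Rightarrow> ('b, 'y) gorder_scheme \<Rightarrow> 'a \<Rightarrow> 'b \<Rightarrow> ('a \<times> 'b) set" where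
  "pure L M l m = suplat_gen (carrier L \<times> carrier M) (tensor_rel L M) (l, m)"

(* The tensor product of f and g, as a map into the tensor product of L' and M'. *)
definition tensor_map ::
  "('c, 'x) gorder_scheme \<Rightarrow> ('d, 'y) gorder_scheme \<Rightarrow> ('a \<Rightarrow> 'c) \<Rightarrow> ('b \<Rightarrow> 'd) \<Rightarrow>
   ('a \<times> 'b) set \<Rightarrow> ('c \<times> 'd) set" where
  "tensor_map L' M' f g t = \<Squnion>\<^bsub>tensor L' M'\<^esub> {pure L' M' (f l) (g m) | l m. (l, m) \<in> t}"


section \<open>Hopf algebras of complete lattices\<close>

(* The product is given as a map of two variables preserving joins in each.
   By the encoding of presentations, comult H a is literally the set of pairs
   (b, c) whose pure tensor lies below the coproduct of a, and the coproduct is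
   the join of these pure tensors.  Sweedler expressions, which preserve joins in
   each leg, are therefore joins over (a1, a2) in comult H a. *)
record 'h suplat_hopf = "'h gorder" +
  hprod :: "'h \<Rightarrow> 'h \<Rightarrow> 'h"
  hone :: "'h"
  comult :: "'h \<Rightarrow> ('h \<times> 'h) set"
  counit :: "'h \<Rightarrow> bool"

locale suplat_bialgebra = complete_lattice H for H :: "('h, 'z) suplat_hopf_scheme" (structure) +
  assumes prod_hom: "bi_sup_hom H H H (hprod H)"
    and one_closed: "hone H \<in> carrier H"
    and prod_assoc: "\<lbrakk>a \<in> carrier H; b \<in> carrier H; c \<in> carrier H\<rbrakk> \<Longrightarrow>
      hprod H (hprod H a b) c = hprod H a (hprod H b c)"
    and one_prod: "a \<in> carrier H \<Longrightarrow> hprod H (hone H) a = a"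
    and prod_one: "a \<in> carrier H \<Longrightarrow> hprod H a (hone H) = a"
    and comult_hom: "sup_hom H (tensor H H) (comult H)"
    and counit_hom: "sup_hom H sup_unit (counit H)"
    and coassoc: "a \<in> carrier H \<Longrightarrow>
      \<Squnion>\<^bsub>tensor (tensor H H) H\<^esub> {pure (tensor H H) H (pure H H a1 a2) a3 | a1 a2 a3 u.
          (u, a3) \<in> comult H a \<and> (a1, a2) \<in> comult H u} =
      \<Squnion>\<^bsub>tensor (tensor H H) H\<^esub> {pure (tensor H H) H (pure H H a1 a2) a3 | a1 a2 a3 u.
          (a1, u) \<in> comult H a \<and> (a2, a3) \<in> comult H u}"
    and counit_left: "a \<in> carrier H \<Longrightarrow>
      \<Squnion> {scal H (counit H a1) a2 | a1 a2. (a1, a2) \<in> comult H a} = a"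
    and counit_right: "a \<in> carrier H \<Longrightarrow>
      \<Squnion> {scal H (counit H a2) a1 | a1 a2. (a1, a2) \<in> comult H a} = a"
    and comult_prod: "\<lbrakk>a \<in> carrier H; b \<in> carrier H\<rbrakk> \<Longrightarrow>
      comult H (hprod H a b) =
      \<Squnion>\<^bsub>tensor H H\<^esub> {pure H H (hprod H a1 b1) (hprod H a2 b2) | a1 a2 b1 b2.
          (a1, a2) \<in> comult H a \<and> (b1, b2) \<in> comult H b}"
    and comult_one: "comult H (hone H) = pure H H (hone H) (hone H)"
    and counit_prod: "\<lbrakk>a \<in> carrier H; b \<in> carrier H\<rbrakk> \<Longrightarrow>
      counit H (hprod H a b) = (counit H a \<and> counit H b)"
    and counit_one: "counit H (hone H) = True"

definition antipode :: "('h, 'z) suplat_hopf_scheme \<Rightarrow> ('h \<Rightarrow> 'h) \<Rightarrow> bool" where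
  "antipode H S \<longleftrightarrow> sup_hom H H S \<and>
     (\<forall>a\<in>carrier H.
        \<Squnion>\<^bsub>H\<^esub> {hprod H (S a1) a2 | a1 a2. (a1, a2) \<in> comult H a} = scal H (counit H a) (hone H) \<and>
        \<Squnion>\<^bsub>H\<^esub> {hprod H a1 (S a2) | a1 a2. (a1, a2) \<in> comult H a} = scal H (counit H a) (hone H))"

locale suplat_hopf_algebra = suplat_bialgebra +
  assumes antipode_exists: "\<exists>S. antipode H S \<and> bij_betw S (carrier H) (carrier H)"


subsection \<open>Co-quasitriangular structures\<close>

definition convolution_inverse ::
  "('h, 'z) suplat_hopf_scheme \<Rightarrow> ('h \<Rightarrow> 'h \<Rightarrow> bool) \<Rightarrow> ('h \<Rightarrow> 'h \<Rightarrow> bool) \<Rightarrow> bool" where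
  "convolution_inverse H R R' \<longleftrightarrow> bi_sup_hom H H sup_unit R' \<and>
     (\<forall>a\<in>carrier H. \<forall>b\<in>carrier H.
        (\<exists>(a1, a2)\<in>comult H a. \<exists>(b1, b2)\<in>comult H b. R a1 b1 \<and> R' a2 b2)
          = (counit H a \<and> counit H b) \<and>
        (\<exists>(a1, a2)\<in>comult H a. \<exists>(b1, b2)\<in>comult H b. R' a1 b1 \<and> R a2 b2)
          = (counit H a \<and> counit H b))"

locale coquasitriangular = suplat_bialgebra +
  fixes R :: "'a \<Rightarrow> 'a \<Rightarrow> bool"
  assumes R_hom: "bi_sup_hom H H sup_unit R"
    and R_invertible: "\<exists>R'. convolution_inverse H R R'"
    and R_prod_left: "\<lbrakk>a \<in> carrier H; b \<in> carrier H; c \<in> carrier H\<rbrakk> \<Longrightarrow>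
      R (hprod H a b) c = (\<exists>(c1, c2)\<in>comult H c. R b c1 \<and> R a c2)"
    and R_prod_right: "\<lbrakk>a \<in> carrier H; b \<in> carrier H; c \<in> carrier H\<rbrakk> \<Longrightarrow>
      R a (hprod H b c) = (\<exists>(a1, a2)\<in>comult H a. R a1 b \<and> R a2 c)"
    and R_commute: "\<lbrakk>a \<in> carrier H; b \<in> carrier H\<rbrakk> \<Longrightarrow>
      \<Squnion> {scal H (R b1 a1) (hprod H a2 b2) | a1 a2 b1 b2.
          (a1, a2) \<in> comult H a \<and> (b1, b2) \<in> comult H b} =
      \<Squnion> {scal H (R b2 a2) (hprod H b1 a1) | a1 a2 b1 b2.
          (a1, a2) \<in> comult H a \<and> (b1, b2) \<in> comult H b}"

locale coquasitriangular_hopf_algebra = suplat_hopf_algebra + coquasitriangular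

(* Convolution inverses agree on the carrier. *)
definition conv_inv ::
  "('h, 'z) suplat_hopf_scheme \<Rightarrow> ('h \<Rightarrow> 'h \<Rightarrow> bool) \<Rightarrow> 'h \<Rightarrow> 'h \<Rightarrow> bool" where
  "conv_inv H R = (SOME R'. convolution_inverse H R R')"

definition comult3 :: "('h, 'z) suplat_hopf_scheme \<Rightarrow> 'h \<Rightarrow> ('h \<times> 'h \<times> 'h) set" where
  "comult3 H a = {(a1, a2, a3) | a1 a2 a3 u. (a1, u) \<in> comult H a \<and> (a2, a3) \<in> comult H u}"

definition Gamma ::
  "('h, 'z) suplat_hopf_scheme \<Rightarrow> ('h \<Rightarrow> 'h \<Rightarrow> bool) \<Rightarrow> 'h \<Rightarrow> 'h \<Rightarrow> ('h \<times> 'h) set" where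
  "Gamma H R a b =
     \<Squnion>\<^bsub>tensor H H\<^esub> {scal (tensor H H) (R a1 b1 \<and> conv_inv H R a3 b3) (pure H H b2 a2)
       | a1 a2 a3 b1 b2 b3. (a1, a2, a3) \<in> comult3 H a \<and> (b1, b2, b3) \<in> comult3 H b}"


section \<open>The remnant\<close>

definition rem_D :: "('h, 'z) suplat_hopf_scheme \<Rightarrow> 'h" where
  "rem_D H = \<Squnion>\<^bsub>H\<^esub> {h \<in> carrier H. counit H h = False}"

(* h and k are identified by the relation generated by h ~ h \<or> D iff h \<or> D = k \<or> D. *)
definition rem_proj :: "('h, 'z) suplat_hopf_scheme \<Rightarrow> 'h \<Rightarrow> 'h set" where
  "rem_proj H h = {k \<in> carrier H. k \<squnion>\<^bsub>H\<^esub> rem_D H = h \<squnion>\<^bsub>H\<^esub> rem_D H}"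

definition rem_incl :: "('h, 'z) suplat_hopf_scheme \<Rightarrow> 'h set \<Rightarrow> 'h" where
  "rem_incl H q = (THE k. \<exists>h\<in>q. k = h \<squnion>\<^bsub>H\<^esub> rem_D H)"

definition rem_lattice :: "('h, 'z) suplat_hopf_scheme \<Rightarrow> 'h set gorder" where
  "rem_lattice H =
     \<lparr>carrier = rem_proj H ` carrier H, eq = (=),
      le = (\<lambda>p q. rem_incl H p \<sqsubseteq>\<^bsub>H\<^esub> rem_incl H q)\<rparr>"

(* As rem_proj is surjective, with right inverse rem_incl, this is the only
   structure for which rem_proj is a morphism. *)
definition rem_quot :: "('h, 'z) suplat_hopf_scheme \<Rightarrow> 'h set suplat_hopf" where
  "rem_quot H =
     \<lparr>carrier = carrier (rem_lattice H), eq = (=), le = le (rem_lattice H),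
      hprod = (\<lambda>p q. rem_proj H (hprod H (rem_incl H p) (rem_incl H q))),
      hone = rem_proj H (hone H),
      comult = (\<lambda>q. tensor_map (rem_lattice H) (rem_lattice H) (rem_proj H) (rem_proj H)
                      (comult H (rem_incl H q))),
      counit = (\<lambda>q. counit H (rem_incl H q))\<rparr>"

definition remnant :: "('h, 'z) suplat_hopf_scheme \<Rightarrow> 'h set monoid" where
  "remnant H =
     \<lparr>carrier = {q \<in> carrier (rem_quot H). q \<noteq> \<bottom>\<^bsub>rem_quot H\<^esub> \<and>
                  comult (rem_quot H) q = pure (rem_quot H) (rem_quot H) q q},
      mult = hprod (rem_quot H), one = hone (rem_quot H)\<rparr>"

(* An element g of the remnant is the singleton {g} of the quotient, and the
   pair (g, h) is the pure tensor of g and h. *)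
definition induced_braiding ::
  "('h, 'z) suplat_hopf_scheme \<Rightarrow> ('h \<Rightarrow> 'h \<Rightarrow> bool) \<Rightarrow>
   'h set \<times> 'h set \<Rightarrow> 'h set \<times> 'h set" where
  "induced_braiding H R = (\<lambda>(g, h).
     THE (g', h'). g' \<in> carrier (remnant H) \<and> h' \<in> carrier (remnant H) \<and>
       tensor_map (rem_quot H) (rem_quot H) (rem_proj H) (rem_proj H)
         (Gamma H R (rem_incl H g) (rem_incl H h))
       = pure (rem_quot H) (rem_quot H) g' h')"


section \<open>The rigid braided category generated by a commutative monoid\<close>

datatype letter = Lx | Ly

type_synonym obj = "letter list"

(* KapInv a b is the inverse of Kap a b. *)
datatype mor =
    Id obj
  | Comp mor mor  (infixr "\<bullet>" 55)
  | Tens mor mor  (infixr "\<boxtimes>" 60)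
  | Ev
  | Coev
  | Kap letter letter
  | KapInv letter letter
  | Mul
  | Unt

inductive arr :: "mor \<Rightarrow> obj \<Rightarrow> obj \<Rightarrow> bool" where
  "arr (Id a) a a"
| "\<lbrakk>arr f a b; arr g b c\<rbrakk> \<Longrightarrow> arr (g \<bullet> f) a c"
| "\<lbrakk>arr f a b; arr g c d\<rbrakk> \<Longrightarrow> arr (f \<boxtimes> g) (a @ c) (b @ d)"
| "arr Ev [Lx, Ly] []"
| "arr Coev [] [Ly, Lx]"
| "arr (Kap a b) [a, b] [b, a]"
| "arr (KapInv a b) [b, a] [a, b]"
| "arr Mul [Lx, Lx] [Lx]"
| "arr Unt [] [Lx]"

(* The extension of Kap to words by the hexagon identities. *)
primrec braid1 :: "letter \<Rightarrow> obj \<Rightarrow> mor" where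
  "braid1 a [] = Id [a]"
| "braid1 a (b # bs) = (Id [b] \<boxtimes> braid1 a bs) \<bullet> (Kap a b \<boxtimes> Id bs)"

primrec braid :: "obj \<Rightarrow> obj \<Rightarrow> mor" where
  "braid [] bs = Id bs"
| "braid (a # as) bs = (braid1 a bs \<boxtimes> Id as) \<bullet> (Id [a] \<boxtimes> braid as bs)"

(* Equality of morphisms from a to b. *)
inductive mor_eq :: "obj \<Rightarrow> obj \<Rightarrow> mor \<Rightarrow> mor \<Rightarrow> bool" where
  refl: "arr f a b \<Longrightarrow> mor_eq a b f f"
| sym: "mor_eq a b f g \<Longrightarrow> mor_eq a b g f"
| trans: "\<lbrakk>mor_eq a b f g; mor_eq a b g h\<rbrakk> \<Longrightarrow> mor_eq a b f h"
| comp_cong: "\<lbrakk>mor_eq a b f f'; mor_eq b c g g'\<rbrakk> \<Longrightarrow> mor_eq a c (g \<bullet> f) (g' \<bullet> f')"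
| tens_cong: "\<lbrakk>mor_eq a b f f'; mor_eq c d g g'\<rbrakk> \<Longrightarrow>
    mor_eq (a @ c) (b @ d) (f \<boxtimes> g) (f' \<boxtimes> g')"
| id_comp: "arr f a b \<Longrightarrow> mor_eq a b (Id b \<bullet> f) f"
| comp_id: "arr f a b \<Longrightarrow> mor_eq a b (f \<bullet> Id a) f"
| comp_assoc: "\<lbrakk>arr f a b; arr g b c; arr h c d\<rbrakk> \<Longrightarrow>
    mor_eq a d ((h \<bullet> g) \<bullet> f) (h \<bullet> (g \<bullet> f))"
| tens_id: "mor_eq (a @ b) (a @ b) (Id a \<boxtimes> Id b) (Id (a @ b))"
| interchange: "\<lbrakk>arr f a b; arr g b c; arr f' a' b'; arr g' b' c'\<rbrakk> \<Longrightarrow>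
    mor_eq (a @ a') (c @ c') ((g \<bullet> f) \<boxtimes> (g' \<bullet> f')) ((g \<boxtimes> g') \<bullet> (f \<boxtimes> f'))"
| tens_assoc: "\<lbrakk>arr f a b; arr g c d; arr h i j\<rbrakk> \<Longrightarrow>
    mor_eq (a @ c @ i) (b @ d @ j) ((f \<boxtimes> g) \<boxtimes> h) (f \<boxtimes> (g \<boxtimes> h))"
| unit_tens: "arr f a b \<Longrightarrow> mor_eq a b (Id [] \<boxtimes> f) f"
| tens_unit: "arr f a b \<Longrightarrow> mor_eq a b (f \<boxtimes> Id []) f"
| kap_inv_left: "mor_eq [a, b] [a, b] (KapInv a b \<bullet> Kap a b) (Id [a, b])"
| kap_inv_right: "mor_eq [b, a] [b, a] (Kap a b \<bullet> KapInv a b) (Id [b, a])"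
| braid_natural_left: "arr f a b \<Longrightarrow>
    mor_eq (a @ c) (c @ b) (braid b c \<bullet> (f \<boxtimes> Id c)) ((Id c \<boxtimes> f) \<bullet> braid a c)"
| braid_natural_right: "arr f a b \<Longrightarrow>
    mor_eq (c @ a) (b @ c) (braid c b \<bullet> (Id c \<boxtimes> f)) ((f \<boxtimes> Id c) \<bullet> braid c a)"
| zigzag_x: "mor_eq [Lx] [Lx] ((Ev \<boxtimes> Id [Lx]) \<bullet> (Id [Lx] \<boxtimes> Coev)) (Id [Lx])"
| zigzag_y: "mor_eq [Ly] [Ly] ((Id [Ly] \<boxtimes> Ev) \<bullet> (Coev \<boxtimes> Id [Ly])) (Id [Ly])"
| mul_unit_left: "mor_eq [Lx] [Lx] (Mul \<bullet> (Unt \<boxtimes> Id [Lx])) (Id [Lx])"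
| mul_unit_right: "mor_eq [Lx] [Lx] (Mul \<bullet> (Id [Lx] \<boxtimes> Unt)) (Id [Lx])"
| mul_assoc: "mor_eq [Lx, Lx, Lx] [Lx]
    (Mul \<bullet> (Mul \<boxtimes> Id [Lx])) (Mul \<bullet> (Id [Lx] \<boxtimes> Mul))"
| mul_comm: "mor_eq [Lx, Lx] [Lx] (Mul \<bullet> Kap Lx Lx) Mul"
| kap_unit_left: "mor_eq [Lx] [Lx, Lx] (Kap Lx Lx \<bullet> (Unt \<boxtimes> Id [Lx])) (Id [Lx] \<boxtimes> Unt)"
| kap_unit_right: "mor_eq [Lx] [Lx, Lx] (Kap Lx Lx \<bullet> (Id [Lx] \<boxtimes> Unt)) (Unt \<boxtimes> Id [Lx])"

definition mor_rel :: "obj \<Rightarrow> obj \<Rightarrow> (mor \<times> mor) set" where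
  "mor_rel a b = {(f, g). arr f a b \<and> arr g a b \<and> mor_eq a b f g}"

definition Hom :: "obj \<Rightarrow> obj \<Rightarrow> mor set set" where
  "Hom a b = {f. arr f a b} // mor_rel a b"

definition kappa :: "obj \<Rightarrow> obj \<Rightarrow> mor set" where
  "kappa a b = mor_rel (a @ b) (b @ a) `` {braid a b}"


section \<open>The functor of a braiding operator\<close>

(* The points of a word of length n are the n-tuples of group elements. *)
definition points :: "('g, 'm) monoid_scheme \<Rightarrow> obj \<Rightarrow> 'g list set" where
  "points G a = {p. length p = length a \<and> set p \<subseteq> carrier G}"

fun kap_map ::
  "('g, 'm) monoid_scheme \<Rightarrow> ('g \<times> 'g \<Rightarrow> 'g \<times> 'g) \<Rightarrow> letter \<Rightarrow> letter \<Rightarrow> 'g \<times> 'g \<Rightarrow> 'g \<times> 'g" where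
  "kap_map G r Lx Lx (x, y) = r (x, y)"
| "kap_map G r Lx Ly (x, y) =
     (inv_into (carrier G) (br_rho G r x) y, inv_into (carrier G) (br_gamma r y) x)"
| "kap_map G r Ly Lx (x, y) =
     (inv_into (carrier G) (br_sigma r x) y, inv_into (carrier G) (br_tau G r y) x)"
| "kap_map G r Ly Ly (x, y) = (br_rho G r x y, br_tau G r y x)"

(* The image of the singleton {p} under the map denoted by a term. *)
primrec omega_term ::
  "('g, 'm) monoid_scheme \<Rightarrow> ('g \<times> 'g \<Rightarrow> 'g \<times> 'g) \<Rightarrow> mor \<Rightarrow> 'g list \<Rightarrow> 'g list set" where
  "omega_term G r (Id a) p = {q \<in> points G a. q = p}"
| "omega_term G r (g \<bullet> f) p = (\<Union>q\<in>omega_term G r f p. omega_term G r g q)"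
| "omega_term G r (f \<boxtimes> g) p =
     {q1 @ q2 | q1 q2 p1 p2. p = p1 @ p2 \<and> q1 \<in> omega_term G r f p1 \<and> q2 \<in> omega_term G r g p2}"
| "omega_term G r Ev p = {[] | x. x \<in> carrier G \<and> p = [x, x]}"
| "omega_term G r Coev p = {[x, x] | x. x \<in> carrier G \<and> p = []}"
| "omega_term G r (Kap a b) p =
     {[x', y'] | x y x' y'. x \<in> carrier G \<and> y \<in> carrier G \<and> p = [x, y] \<and>
        (x', y') = kap_map G r a b (x, y)}"
| "omega_term G r (KapInv a b) p =
     {[x, y] | x y x' y'. x \<in> carrier G \<and> y \<in> carrier G \<and> p = [x', y'] \<and>
        (x', y') = kap_map G r a b (x, y)}"
| "omega_term G r Mul p =
     {[x \<otimes>\<^bsub>G\<^esub> y] | x y. x \<in> carrier G \<and> y \<in> carrier G \<and> p = [x, y]}"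
| "omega_term G r Unt p = (if p = [] then {[\<one>\<^bsub>G\<^esub>]} else {})"

(* All terms f representing a morphism F have the same value, and the map is
   determined by its values on singletons. *)
definition omega_m ::
  "('g, 'm) monoid_scheme \<Rightarrow> ('g \<times> 'g \<Rightarrow> 'g \<times> 'g) \<Rightarrow> mor set \<Rightarrow> 'g list set \<Rightarrow> 'g list set" where
  "omega_m G r F P = (\<Union>f\<in>F. \<Union>p\<in>P. omega_term G r f p)"


section \<open>The reconstructed co-quasitriangular Hopf algebra\<close>

(* (a, p, q) is the symbol [p,q] indexed by a. *)
type_synonym 'g sym = "obj \<times> 'g list \<times> 'g list"

definition coend_syms :: "('g, 'm) monoid_scheme \<Rightarrow> 'g sym set" where
  "coend_syms G = {(a, p, q). p \<in> points G a \<and> q \<in> points G a}"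

definition coend_rel ::
  "('g, 'm) monoid_scheme \<Rightarrow> ('g \<times> 'g \<Rightarrow> 'g \<times> 'g) \<Rightarrow> ('g sym set \<times> 'g sym set) set" where
  "coend_rel G r =
     {({(b, p', q) | p'. p' \<in> omega_m G r F {p}},
       {(a, p, q') | q'. q' \<in> points G a \<and> q \<in> omega_m G r F {q'}})
      | a b F p q. F \<in> Hom a b \<and> p \<in> points G a \<and> q \<in> points G b}"

definition coend :: "('g, 'm) monoid_scheme \<Rightarrow> ('g \<times> 'g \<Rightarrow> 'g \<times> 'g) \<Rightarrow> 'g sym set gorder" where
  "coend G r = suplat_pres (coend_syms G) (coend_rel G r)"

definition coend_gen ::
  "('g, 'm) monoid_scheme \<Rightarrow> ('g \<times> 'g \<Rightarrow> 'g \<times> 'g) \<Rightarrow> obj \<Rightarrow> 'g list \<Rightarrow> 'g list \<Rightarrow> 'g sym set" where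
  "coend_gen G r a p q = suplat_gen (coend_syms G) (coend_rel G r) (a, p, q)"

(* Each structure map is the join-preserving extension of its values on the
   generators, as given by suplat_pres_universal: an element S of the coend is the
   join of the generators in S. *)
definition H_omega ::
  "('g, 'm) monoid_scheme \<Rightarrow> ('g \<times> 'g \<Rightarrow> 'g \<times> 'g) \<Rightarrow> 'g sym set suplat_hopf" where
  "H_omega G r =
     \<lparr>carrier = carrier (coend G r), eq = (=), le = le (coend G r),
      hprod = (\<lambda>S T. \<Squnion>\<^bsub>coend G r\<^esub>
        {coend_gen G r (a @ b) (p @ p') (q @ q') | a p q b p' q'. (a, p, q) \<in> S \<and> (b, p', q') \<in> T}),
      hone = coend_gen G r [] [] [],
      comult = (\<lambda>S. \<Squnion>\<^bsub>tensor (coend G r) (coend G r)\<^esub>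
        {pure (coend G r) (coend G r) (coend_gen G r a p l) (coend_gen G r a l q)
          | a p q l. (a, p, q) \<in> S \<and> l \<in> points G a}),
      counit = (\<lambda>S. \<exists>(a, p, q)\<in>S. p = q)\<rparr>"

(* Since kappa a b acts by a bijection from pairs (p, p') to pairs (q', q) with q'
   of length length b, pairs of tuples are written as concatenations. *)
definition R_omega ::
  "('g, 'm) monoid_scheme \<Rightarrow> ('g \<times> 'g \<Rightarrow> 'g \<times> 'g) \<Rightarrow> 'g sym set \<Rightarrow> 'g sym set \<Rightarrow> bool" where
  "R_omega G r S T \<longleftrightarrow>
     (\<exists>(a, p, q)\<in>S. \<exists>(b, p', q')\<in>T. omega_m G r (kappa a b) {p @ p'} = {q' @ q})"

end

theory Submission
  imports Defs
begin

text \<open>A morphism term acts on tuples of group elements by a relation. The proof rests on a change of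
  coordinates: an entry x at a dual letter Ly is recorded as inv x. The identities
  r_inv_right, r_inv_left and r_inv_both show that all four crossings of letters then
  become the single map r, while Ev and Coev become the relation x * y = 1 and its converse. In these
  coordinates the letters of an object no longer matter, and the braiding of two objects is the
  extension cross of r to words. Naturality of the braiding is proved by induction on terms
  (natural_left, natural_right), from the two multiplicativity axioms of r and the Yang-Baxter
  equation, and with it all relations of the category hold (sem_sound).

  An element of the coend is a set S of symbols that respects the relations. The axioms of a
  co-quasitriangular Hopf algebra equate joins, and two joins are equal if they have the same upper
  bounds. A predicate "lies below z" is compatible with joins in its argument (principal_pred), and so
  is determined by the symbols that satisfy it. Every axiom thereby reduces to a statement about
  symbols, where it follows from a relation of the coend: the antipode equations from the evaluation
  and coevaluation of an object, the commutation rule of R from the braiding. The antipode sends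
  [p, q] at a to [rev q, rev p] at the dual of a, and R (S a, b) is the convolution inverse of R.

  The counit vanishes on an element iff it contains no symbol [p, p], so D consists of all symbols
  [p, q] with p and q different. An element above D is therefore a set of points that is closed under
  the action of morphisms, and the quotient is the power set of the connected components of the
  category of points. The product of the coordinates of a point is an invariant of its component
  (sem_word_prod), and every point is connected to the one-letter point given by this product
  (invariant_word_val). Hence the components are the elements of G, the quotient is the
  power set of G with the diagonal coproduct, and the group-like elements are the singletons.
  Finally r acts on the products of two words as the braiding acts on the words
  (r_word_prod), so the operator induced on the remnant is r.\<close>

section \<open>Braiding operators on a group\<close>

locale braided_group = group G for G (structure) +
  fixes r :: "'a \<times> 'a \<Rightarrow> 'a \<times> 'a"
  assumes braiding: "braiding_operator G r"
begin

lemma r_closed: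
  assumes "r (x, y) = (a, b)" "x \<in> carrier G" "y \<in> carrier G"
  shows "a \<in> carrier G" "b \<in> carrier G"
proof -
  have "r \<in> carrier G \<times> carrier G \<rightarrow> carrier G \<times> carrier G"
    using braiding unfolding braiding_operator_def by blast
  from funcset_mem[OF this, of "(x, y)"] show "a \<in> carrier G" "b \<in> carrier G" using assms by auto
qed

lemma r_mult:
  assumes "r (x, y) = (a, b)" "x \<in> carrier G" "y \<in> carrier G"
  shows "a \<otimes> b = x \<otimes> y"
proof -
  have "\<forall>g\<in>carrier G. \<forall>h\<in>carrier G. fst (r (g, h)) \<otimes> snd (r (g, h)) = g \<otimes> h"
    using braiding unfolding braiding_operator_def by blast
  with assms show ?thesis by force
qed

lemma r_one: "x \<in> carrier G \<Longrightarrow> r (\<one>, x) = (x, \<one>)" "x \<in> carrier G \<Longrightarrow> r (x, \<one>) = (\<one>, x)"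
  using braiding unfolding braiding_operator_def by auto

lemma r_mult_left:
  assumes "r (h, f) = (a, b)" "r (g, a) = (c, d)"
    and "g \<in> carrier G" "h \<in> carrier G" "f \<in> carrier G"
  shows "r (g \<otimes> h, f) = (c, d \<otimes> b)"
proof -
  have "r (g \<otimes> h, f) = (let (a, b) = r (h, f); (c, d) = r (g, a) in (c, d \<otimes> b))"
    using braiding assms(3-5) unfolding braiding_operator_def by blast
  then show ?thesis by (simp add: assms(1,2))
qed

lemma r_mult_right:
  assumes "r (g, h) = (a, b)" "r (b, f) = (c, d)"
    and "g \<in> carrier G" "h \<in> carrier G" "f \<in> carrier G"
  shows "r (g, h \<otimes> f) = (a \<otimes> c, d)"
proof -
  have "r (g, h \<otimes> f) = (let (a, b) = r (g, h); (c, d) = r (b, f) in (a \<otimes> c, d))"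
    using braiding assms(3-5) unfolding braiding_operator_def by blast
  then show ?thesis by (simp add: assms(1,2))
qed

text \<open>Compare r (g, h * inv h) = (1, g) with the axiom for a product in the second argument.\<close>

lemma r_inv_right:
  assumes "r (g, h) = (a, b)" "g \<in> carrier G" "h \<in> carrier G"
  shows "r (b, inv h) = (inv a, g)"
proof -
  obtain c d where cd: "r (b, inv h) = (c, d)" by fastforce
  note ab = r_closed[OF assms]
  note c = r_closed[OF cd ab(2) inv_closed[OF assms(3)]]
  have "(\<one>, g) = (a \<otimes> c, d)"
    using r_mult_right[OF assms(1) cd] assms r_one by simp
  then show ?thesis using cd ab c inv_equality[of c a] inv_comm[of a c] by simp
qed

text \<open>Compare r (inv g * g, h) = (h, 1) with the axiom for a product in the first argument.\<close>

lemma r_inv_left: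
  assumes "r (g, h) = (a, b)" "g \<in> carrier G" "h \<in> carrier G"
  shows "r (inv g, a) = (h, inv b)"
proof -
  obtain c d where cd: "r (inv g, a) = (c, d)" by fastforce
  note ab = r_closed[OF assms]
  note c = r_closed[OF cd inv_closed[OF assms(2)] ab(1)]
  have "(h, \<one>) = (c, d \<otimes> b)"
    using r_mult_left[OF assms(1) cd] assms r_one by simp
  then show ?thesis using cd ab c by (simp add: inv_equality)
qed

lemma r_inv_both:
  assumes "r (g, h) = (a, b)" "g \<in> carrier G" "h \<in> carrier G"
  shows "r (inv b, inv a) = (inv h, inv g)"
  using r_inv_left[OF r_inv_right[OF assms]] r_closed[OF assms] assms by simp

text \<open>By r_inv_both, conjugating r with (x, y) \<mapsto> (inv y, inv x) gives its inverse.\<close>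

lemma r_inj:
  assumes "r (g, h) = (a, b)" "r (g', h') = (a, b)"
    and "g \<in> carrier G" "h \<in> carrier G" "g' \<in> carrier G" "h' \<in> carrier G"
  shows "g = g'" "h = h'"
  using r_inv_both[of g h a b] r_inv_both[of g' h' a b] assms inv_inj
  by (auto dest: inj_onD)

lemma r_surj:
  assumes "a \<in> carrier G" "b \<in> carrier G"
  obtains g h where "g \<in> carrier G" "h \<in> carrier G" "r (g, h) = (a, b)"
proof -
  obtain c d where cd: "r (inv b, inv a) = (c, d)" by fastforce
  have "c \<in> carrier G" "d \<in> carrier G" using r_closed[OF cd] assms by auto
  then show thesis using that[of "inv d" "inv c"] r_inv_both[OF cd] assms by simp
qed

lemma br_inv_eq:
  assumes "r (g, h) = (a, b)" "g \<in> carrier G" "h \<in> carrier G"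
  shows "br_inv G r (a, b) = (g, h)"
proof -
  have "inj_on r (carrier G \<times> carrier G)"
    using r_inj by (auto simp: inj_on_def) (metis surj_pair)+
  then show ?thesis unfolding br_inv_def using assms by (intro inv_into_f_eq) auto
qed

text \<open>The outer components agree because both composites compute r (x * y, z) and r (x, y * z).
  The middle components then agree because r preserves products.\<close>

lemma yang_baxter:
  assumes "r (x, y) = (a, b)" "r (b, z) = (c, d)" "r (a, c) = (e, f)"
    and "r (y, z) = (p, q)" "r (x, p) = (u, v)" "r (v, q) = (w, t)"
    and "x \<in> carrier G" "y \<in> carrier G" "z \<in> carrier G"
  shows "e = u" "f = w" "d = t"
proof -
  note c1 = r_closed[OF assms(1) assms(7,8)] r_closed[OF assms(4) assms(8,9)]
  note c2 = r_closed[OF assms(2) c1(2) assms(9)] r_closed[OF assms(5) assms(7) c1(3)]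
  note c3 = r_closed[OF assms(3) c1(1) c2(1)] r_closed[OF assms(6) c2(4) c1(4)]
  note c = c1 c2 c3
  have "r (x \<otimes> y, z) = (u, v \<otimes> q)" using r_mult_left[OF assms(4,5)] assms by simp
  moreover have "r (a \<otimes> b, z) = (e, f \<otimes> d)" using r_mult_left[OF assms(2,3)] assms c by simp
  ultimately show "e = u" using r_mult[OF assms(1)] assms by simp
  have "r (x, y \<otimes> z) = (a \<otimes> c, d)" using r_mult_right[OF assms(1,2)] assms by simp
  moreover have "r (x, p \<otimes> q) = (u \<otimes> w, t)" using r_mult_right[OF assms(5,6)] assms c by simp
  ultimately have *: "d = t" "a \<otimes> c = u \<otimes> w" using r_mult[OF assms(4)] assms by simp_all
  show "d = t" by (rule *)
  have "u \<otimes> f = u \<otimes> w" using * r_mult[OF assms(3)] \<open>e = u\<close> c by simp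
  then show "f = w" using c by simp
qed

text \<open>Entries at a dual letter are recorded by their inverse. In the coordinate val all four
  crossings of letters become r itself. Since val a is an involution of G, it translates in
  both directions.\<close>

definition val :: "letter \<Rightarrow> 'a \<Rightarrow> 'a" where
  "val a x = (case a of Lx \<Rightarrow> x | Ly \<Rightarrow> inv x)"

lemma val_closed [simp]: "x \<in> carrier G \<Longrightarrow> val a x \<in> carrier G"
  by (simp add: val_def split: letter.split)

lemma val_val [simp]: "x \<in> carrier G \<Longrightarrow> val a (val a x) = x"
  by (simp add: val_def split: letter.split)

lemma inj_sigma: "x \<in> carrier G \<Longrightarrow> inj_on (br_sigma r x) (carrier G)"
  unfolding br_sigma_def inj_on_def using r_inv_left by (metis prod.collapse fst_conv)

lemma inj_gamma: "y \<in> carrier G \<Longrightarrow> inj_on (br_gamma r y) (carrier G)"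
  unfolding br_gamma_def inj_on_def using r_inv_right by (metis prod.collapse snd_conv)

lemma inj_tau:
  assumes "x \<in> carrier G" shows "inj_on (br_tau G r x) (carrier G)"
proof (rule inj_onI)
  fix y y' assume y: "y \<in> carrier G" "y' \<in> carrier G" "br_tau G r x y = br_tau G r x y'"
  obtain g h where g: "g \<in> carrier G" "h \<in> carrier G" "r (g, h) = (x, y)"
    using r_surj[OF assms y(1)] by metis
  obtain g' h' where g': "g' \<in> carrier G" "h' \<in> carrier G" "r (g', h') = (x, y')"
    using r_surj[OF assms y(2)] by metis
  have "g = g'" using y(3) br_inv_eq[OF g(3,1,2)] br_inv_eq[OF g'(3,1,2)] by (simp add: br_tau_def)
  then have "h = h'" using r_inv_left[OF g(3,1,2)] r_inv_left[OF g'(3,1,2)] by simp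
  then show "y = y'" using \<open>g = g'\<close> g g' by simp
qed

lemma inj_rho:
  assumes "y \<in> carrier G" shows "inj_on (br_rho G r y) (carrier G)"
proof (rule inj_onI)
  fix x x' assume x: "x \<in> carrier G" "x' \<in> carrier G" "br_rho G r y x = br_rho G r y x'"
  obtain g h where g: "g \<in> carrier G" "h \<in> carrier G" "r (g, h) = (x, y)"
    using r_surj[OF x(1) assms] by metis
  obtain g' h' where g': "g' \<in> carrier G" "h' \<in> carrier G" "r (g', h') = (x', y)"
    using r_surj[OF x(2) assms] by metis
  have "h = h'" using x(3) br_inv_eq[OF g(3,1,2)] br_inv_eq[OF g'(3,1,2)] by (simp add: br_rho_def)
  then have "g = g'" using r_inv_right[OF g(3,1,2)] r_inv_right[OF g'(3,1,2)] by simp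
  then show "x = x'" using \<open>h = h'\<close> g g' by simp
qed

text \<open>A crossing with dual letters is a partial transpose of r, and r_inv_right,
  r_inv_left and r_inv_both say that a partial transpose of r is r conjugated by
  inversion of the dual entries.\<close>

lemma kap_map_eq:
  assumes "x \<in> carrier G" "y \<in> carrier G" "r (val a x, val b y) = (y', x')"
  shows "kap_map G r a b (x, y) = (val b y', val a x')"
proof -
  have c: "y' \<in> carrier G" "x' \<in> carrier G" using r_closed[OF assms(3)] assms by auto
  show ?thesis
  proof (cases a; cases b)
    assume "a = Lx" "b = Lx"
    then show ?thesis using assms by (simp add: val_def)
  next
    assume ab: "a = Lx" "b = Ly"
    then have *: "r (x', y) = (inv y', x)"
      using r_inv_right[of x "inv y" y' x'] assms by (simp add: val_def)
    have "br_gamma r y x' = x" "br_rho G r x (inv y') = y"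
      using * br_inv_eq[OF *] assms c by (simp_all add: br_gamma_def br_rho_def)
    then show ?thesis
      using ab inj_gamma[of y] inj_rho[of x] assms c by (simp add: val_def inv_into_f_eq)
  next
    assume ab: "a = Ly" "b = Lx"
    then have *: "r (x, y') = (y, inv x')"
      using r_inv_left[of "inv x" y y' x'] assms by (simp add: val_def)
    have "br_sigma r x y' = y" "br_tau G r y (inv x') = x"
      using * br_inv_eq[OF *] assms c by (simp_all add: br_sigma_def br_tau_def)
    then show ?thesis
      using ab inj_sigma[of x] inj_tau[of y] assms c by (simp add: val_def inv_into_f_eq)
  next
    assume ab: "a = Ly" "b = Ly"
    then have *: "r (inv x', inv y') = (y, x)"
      using r_inv_both[of "inv x" "inv y" y' x'] assms by (simp add: val_def)
    then show ?thesis using br_inv_eq[OF *] c ab by (simp add: val_def br_rho_def br_tau_def)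
  qed
qed

section \<open>Crossing words of group elements\<close>

abbreviation L :: "'a list set" where "L \<equiv> lists (carrier G)"

text \<open>The braiding of the category in the coordinates val: strand moves one letter through a word
  and cross moves a word through a word. The recursion is that of braid1 and braid, so that
  they compute the action of these terms.\<close>

primrec strand :: "'a \<Rightarrow> 'a list \<Rightarrow> 'a list \<times> 'a" where
  "strand x [] = ([], x)"
| "strand x (y # ys) =
    (let (y', x1) = r (x, y); (ys', x') = strand x1 ys in (y' # ys', x'))"

primrec cross :: "'a list \<Rightarrow> 'a list \<Rightarrow> 'a list \<times> 'a list" where
  "cross [] ys = (ys, [])"
| "cross (x # xs) ys =
    (let (ys1, xs') = cross xs ys; (ys2, x') = strand x ys1 in (ys2, x' # xs'))"

lemma strand_closed:
  "strand x ys = (ys', x') \<Longrightarrow> x \<in> carrier G \<Longrightarrow> ys \<in> L \<Longrightarrow>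
     ys' \<in> L \<and> x' \<in> carrier G \<and> length ys' = length ys"
proof (induction ys arbitrary: x ys' x')
  case (Cons y ys)
  obtain y' x1 where 1: "r (x, y) = (y', x1)" by fastforce
  obtain zs z where 2: "strand x1 ys = (zs, z)" by fastforce
  show ?case using Cons.IH[OF 2] Cons.prems r_closed[OF 1] 1 2 by auto
qed auto

lemma cross_closed:
  "cross xs ys = (ys', xs') \<Longrightarrow> xs \<in> L \<Longrightarrow> ys \<in> L \<Longrightarrow>
     ys' \<in> L \<and> xs' \<in> L \<and> length ys' = length ys \<and> length xs' = length xs"
proof (induction xs arbitrary: ys' xs')
  case (Cons x xs)
  obtain ys1 xs1 where 1: "cross xs ys = (ys1, xs1)" by fastforce
  obtain ys2 x' where 2: "strand x ys1 = (ys2, x')" by fastforce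
  show ?case using Cons.IH[OF 1] Cons.prems strand_closed[OF 2] 1 2 by auto
qed auto

lemma strand_append:
  "strand x (ys @ zs) = (let (ys', x1) = strand x ys; (zs', x') = strand x1 zs in (ys' @ zs', x'))"
  by (induction ys arbitrary: x) (auto simp: split: prod.splits)

lemma cross_Nil_right [simp]: "cross xs [] = ([], xs)"
  by (induction xs) auto

lemma cross_append_right:
  "cross xs (ys @ zs) = (let (ys', xs1) = cross xs ys; (zs', xs') = cross xs1 zs in (ys' @ zs', xs'))"
  by (induction xs arbitrary: ys zs) (auto simp: strand_append split: prod.splits)

lemma cross_append_left:
  "cross (xs @ zs) ys = (let (ys1, zs') = cross zs ys; (ys', xs') = cross xs ys1 in (ys', xs' @ zs'))"
  by (induction xs) (auto split: prod.splits)

text \<open>The coordinates of a point of the dual object: the word is reversed, and the exchange of the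
  two letters inverts every coordinate.\<close>

definition dualize :: "'a list \<Rightarrow> 'a list" where
  "dualize u = rev (map (\<lambda>x. inv x) u)"

lemma dualize_L [simp]: "u \<in> L \<Longrightarrow> dualize u \<in> L"
  by (auto simp: dualize_def)

lemma dualize_dualize [simp]: "u \<in> L \<Longrightarrow> dualize (dualize u) = u"
  by (auto simp: dualize_def rev_map o_def intro!: map_idI)

lemma dualize_simps [simp]: "dualize [] = []" "dualize (x # u) = dualize u @ [inv x]"
  "dualize (u @ v) = dualize v @ dualize u" "length (dualize u) = length u"
  "set (dualize u) = (\<lambda>x. inv x) ` set u"
  by (simp_all add: dualize_def)

lemma strand_dualize:
  "strand x ys = (ys', x') \<Longrightarrow> x \<in> carrier G \<Longrightarrow> ys \<in> L \<Longrightarrow>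
     strand (inv x) ys' = (ys, inv x') \<and> strand (inv x') (dualize ys') = (dualize ys, inv x)"
proof (induction ys arbitrary: x ys' x')
  case (Cons y ys)
  obtain y' x1 where 1: "r (x, y) = (y', x1)" by fastforce
  obtain zs z where 2: "strand x1 ys = (zs, z)" by fastforce
  have "strand (inv x1) zs = (ys, inv z)" "strand (inv z) (dualize zs) = (dualize ys, inv x1)"
    using Cons.IH[OF 2] Cons.prems r_closed[OF 1] by auto
  then show ?case
    using 1 2 Cons.prems r_inv_left[OF 1] r_inv_both[OF 1] by (auto simp: strand_append)
qed auto

text \<open>The word form of r_inv_left: moving the dual of u back through t undoes the effect of u
  on s.\<close>

lemma cross_dualize_left:
  "cross u s = (t, v) \<Longrightarrow> u \<in> L \<Longrightarrow> s \<in> L \<Longrightarrow> cross (dualize u) t = (s, dualize v)"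
proof (induction u arbitrary: t v)
  case (Cons x u)
  obtain s1 v1 where 1: "cross u s = (s1, v1)" by fastforce
  obtain s2 x' where 2: "strand x s1 = (s2, x')" by fastforce
  show ?case
    using Cons.IH[OF 1] Cons.prems 1 2 strand_dualize[OF 2] cross_closed[OF 1]
    by (auto simp: cross_append_left)
qed auto

text \<open>The word form of r_inv_both. It exhibits the inverse of cross.\<close>

lemma cross_dualize:
  "cross u s = (t, v) \<Longrightarrow> u \<in> L \<Longrightarrow> s \<in> L \<Longrightarrow> cross (dualize v) (dualize t) = (dualize s, dualize u)"
proof (induction u arbitrary: t v)
  case (Cons x u)
  obtain s1 v1 where 1: "cross u s = (s1, v1)" by fastforce
  obtain s2 x' where 2: "strand x s1 = (s2, x')" by fastforce
  show ?case
    using Cons.IH[OF 1] Cons.prems 1 2 strand_dualize[OF 2] cross_closed[OF 1]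
    by (auto simp: cross_append_left)
qed auto

lemma cross_inj:
  assumes "cross u s = (t, v)" "cross u' s' = (t, v)" "u \<in> L" "u' \<in> L" "s \<in> L" "s' \<in> L"
  shows "u = u' \<and> s = s'"
  using cross_dualize[OF assms(1)] cross_dualize[OF assms(2)] assms dualize_dualize
  by (metis prod.inject)

lemma cross_surj:
  assumes "t \<in> L" "v \<in> L"
  obtains u s where "u \<in> L" "s \<in> L" "cross u s = (t, v)" "length u = length v" "length s = length t"
proof -
  obtain a b where ab: "cross (dualize v) (dualize t) = (a, b)" by fastforce
  have "cross (dualize b) (dualize a) = (t, v)" using cross_dualize[OF ab] assms by simp
  then show thesis using that[of "dualize b" "dualize a"] cross_closed[OF ab] assms by simp
qed

definition word_prod :: "'a list \<Rightarrow> 'a" where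
  "word_prod xs = foldr (\<otimes>) xs \<one>"

lemma word_prod_simps [simp]: "word_prod [] = \<one>" "word_prod (x # xs) = x \<otimes> word_prod xs"
  by (simp_all add: word_prod_def)

lemma word_prod_closed [simp]: "xs \<in> L \<Longrightarrow> word_prod xs \<in> carrier G"
  by (induction xs) auto

lemma word_prod_append [simp]: "xs \<in> L \<Longrightarrow> ys \<in> L \<Longrightarrow> word_prod (xs @ ys) = word_prod xs \<otimes> word_prod ys"
  by (induction xs) (auto simp: m_assoc)

lemma r_word_prod_strand:
  "strand x ys = (ys', x') \<Longrightarrow> x \<in> carrier G \<Longrightarrow> ys \<in> L \<Longrightarrow> r (x, word_prod ys) = (word_prod ys', x')"
proof (induction ys arbitrary: x ys' x')
  case (Cons y ys)
  obtain y' x1 where 1: "r (x, y) = (y', x1)" by fastforce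
  obtain zs z where 2: "strand x1 ys = (zs, z)" by fastforce
  have "r (x1, word_prod ys) = (word_prod zs, z)" using Cons.IH[OF 2] r_closed[OF 1] Cons.prems by auto
  from r_mult_right[OF 1 this] show ?case using Cons.prems 1 2 by auto
qed (auto simp: r_one)

text \<open>Iterating the two multiplicativity axioms: on the products of the words, crossing acts by r.
  This is what turns the braiding of the category into the operator r on the remnant.\<close>

lemma r_word_prod:
  "cross xs ys = (ys', xs') \<Longrightarrow> xs \<in> L \<Longrightarrow> ys \<in> L \<Longrightarrow>
     r (word_prod xs, word_prod ys) = (word_prod ys', word_prod xs')"
proof (induction xs arbitrary: ys' xs')
  case (Cons x xs)
  obtain ys1 xs1 where 1: "cross xs ys = (ys1, xs1)" by fastforce
  obtain ys2 x' where 2: "strand x ys1 = (ys2, x')" by fastforce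
  have "r (word_prod xs, word_prod ys) = (word_prod ys1, word_prod xs1)" using Cons.IH[OF 1] Cons.prems by auto
  moreover have "r (x, word_prod ys1) = (word_prod ys2, x')"
    using r_word_prod_strand[OF 2] Cons.prems cross_closed[OF 1] by auto
  ultimately show ?case using r_mult_left[of "word_prod xs" "word_prod ys"] Cons.prems 1 2 by auto
qed (auto simp: r_one)

section \<open>The relation of a morphism term\<close>

text \<open>The relation of a term in the coordinates val. Which letters an object has matters for the
  coordinates only, so only the length of an object remains, and naturality is proved by
  induction on terms of any type.\<close>

primrec sem :: "mor \<Rightarrow> 'a list \<Rightarrow> 'a list \<Rightarrow> bool" where
  "sem (Id a) u v \<longleftrightarrow> u = v \<and> u \<in> L \<and> length u = length a"
| "sem (g \<bullet> f) u v \<longleftrightarrow> (\<exists>w. sem f u w \<and> sem g w v)"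
| "sem (f \<boxtimes> g) u v \<longleftrightarrow>
    (\<exists>u1 u2 v1 v2. u = u1 @ u2 \<and> v = v1 @ v2 \<and> sem f u1 v1 \<and> sem g u2 v2)"
| "sem Ev u v \<longleftrightarrow> (\<exists>x\<in>carrier G. u = [x, inv x] \<and> v = [])"
| "sem Coev u v \<longleftrightarrow> (\<exists>x\<in>carrier G. u = [] \<and> v = [inv x, x])"
| "sem (Kap a b) u v \<longleftrightarrow>
    (\<exists>x\<in>carrier G. \<exists>y\<in>carrier G. u = [x, y] \<and> v = [fst (r (x, y)), snd (r (x, y))])"
| "sem (KapInv a b) u v \<longleftrightarrow>
    (\<exists>x\<in>carrier G. \<exists>y\<in>carrier G. v = [x, y] \<and> u = [fst (r (x, y)), snd (r (x, y))])"
| "sem Mul u v \<longleftrightarrow> (\<exists>x\<in>carrier G. \<exists>y\<in>carrier G. u = [x, y] \<and> v = [x \<otimes> y])"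
| "sem Unt u v \<longleftrightarrow> u = [] \<and> v = [\<one>]"

lemma r_fst_closed [simp]: "x \<in> carrier G \<Longrightarrow> y \<in> carrier G \<Longrightarrow> fst (r (x, y)) \<in> carrier G"
  and r_snd_closed [simp]: "x \<in> carrier G \<Longrightarrow> y \<in> carrier G \<Longrightarrow> snd (r (x, y)) \<in> carrier G"
  using r_closed[of x y "fst (r (x, y))" "snd (r (x, y))"] by auto

lemma sem_L: "sem f u v \<Longrightarrow> u \<in> L \<and> v \<in> L"
proof (induction f arbitrary: u v)
  case (Comp f g)
  then show ?case by (metis sem.simps(2))
next
  case (Tens f g)
  then show ?case unfolding sem.simps(3) by (metis append_in_lists_conv)
qed auto

lemma sem_length: "arr f a b \<Longrightarrow> sem f u v \<Longrightarrow> length u = length a \<and> length v = length b"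
proof (induction arbitrary: u v rule: arr.induct)
  case (2 f a b g c)
  then show ?case by (metis sem.simps(2))
next
  case (3 f a b g c d)
  then show ?case by fastforce
qed auto

text \<open>The product of the coordinates is invariant under all morphisms. It will tell apart the
  elements of the remnant.\<close>

lemma sem_word_prod: "sem f u v \<Longrightarrow> word_prod u = word_prod v"
proof (induction f arbitrary: u v)
  case (Comp f g) then show ?case by fastforce
next
  case (Tens f g)
  then obtain u1 u2 v1 v2 where *: "u = u1 @ u2" "v = v1 @ v2" "sem f u1 v1" "sem g u2 v2" by auto
  then show ?case using Tens.IH(1)[OF *(3)] Tens.IH(2)[OF *(4)] sem_L[OF *(3)] sem_L[OF *(4)] by simp
next
  case (Kap a b) then show ?case using r_mult by (fastforce simp: m_assoc)
next
  case (KapInv a b) then show ?case using r_mult by (fastforce simp: m_assoc)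
qed auto

lemma sem_Tens_Id:
  "sem (f \<boxtimes> Id c) u v \<longleftrightarrow> (\<exists>u1 v1 s. u = u1 @ s \<and> v = v1 @ s \<and> sem f u1 v1 \<and> s \<in> L \<and> length s = length c)"
  by auto

lemma sem_Id_Tens:
  "sem (Id c \<boxtimes> f) u v \<longleftrightarrow> (\<exists>u1 v1 s. u = s @ u1 \<and> v = s @ v1 \<and> sem f u1 v1 \<and> s \<in> L \<and> length s = length c)"
  by auto

lemma sem_Id_Tens_append:
  assumes "length s = length c"
  shows "sem (Id c \<boxtimes> f) (s @ u) v \<longleftrightarrow> s \<in> L \<and> (\<exists>v1. v = s @ v1 \<and> sem f u v1)"
proof
  assume "sem (Id c \<boxtimes> f) (s @ u) v"
  then obtain u1 v1 s' where "s @ u = s' @ u1" "v = s' @ v1" "sem f u1 v1" "s' \<in> L" "length s' = length c"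
    unfolding sem_Id_Tens by blast
  with assms show "s \<in> L \<and> (\<exists>v1. v = s @ v1 \<and> sem f u v1)"
    using append_eq_append_conv[of s s' u u1] by metis
qed (use assms in \<open>unfold sem_Id_Tens, blast\<close>)

lemma sem_Tens_Id_append:
  assumes "length s = length c"
  shows "sem (f \<boxtimes> Id c) (u @ s) v \<longleftrightarrow> s \<in> L \<and> (\<exists>v1. v = v1 @ s \<and> sem f u v1)"
proof
  assume "sem (f \<boxtimes> Id c) (u @ s) v"
  then obtain u1 v1 s' where "u @ s = u1 @ s'" "v = v1 @ s'" "sem f u1 v1" "s' \<in> L" "length s' = length c"
    unfolding sem_Tens_Id by blast
  with assms show "s \<in> L \<and> (\<exists>v1. v = v1 @ s \<and> sem f u v1)"
    using append_eq_append_conv[of u u1 s s'] by metis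
qed (use assms in \<open>unfold sem_Tens_Id, blast\<close>)

lemma sem_braid1:
  "sem (braid1 a bs) u v \<longleftrightarrow> (\<exists>x\<in>carrier G. \<exists>ys\<in>L. length ys = length bs \<and> u = x # ys \<and>
     v = fst (strand x ys) @ [snd (strand x ys)])"
proof (induction bs arbitrary: u v)
  case Nil
  show ?case by (auto simp: length_Suc_conv)
next
  case (Cons b bs)
  have step: "sem (Id [b] \<boxtimes> braid1 a bs) ([x', y'] @ s) v \<longleftrightarrow>
      x' \<in> carrier G \<and> y' \<in> carrier G \<and> s \<in> L \<and> length s = length bs \<and>
      v = x' # fst (strand y' s) @ [snd (strand y' s)]" for x' y' s
    using sem_Id_Tens_append[of "[x']" "[b]" "braid1 a bs" "y' # s" v] unfolding Cons.IH by auto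
  show ?case
  proof
    assume "sem (braid1 a (b # bs)) u v"
    then obtain w where w: "sem (Kap a b \<boxtimes> Id bs) u w" "sem (Id [b] \<boxtimes> braid1 a bs) w v"
      by (auto simp del: sem.simps(3))
    obtain u1 w1 s where s: "u = u1 @ s" "w = w1 @ s" "sem (Kap a b) u1 w1" "s \<in> L"
      "length s = length bs"
      using w(1)[unfolded sem_Tens_Id] by (elim exE conjE) (rule that; assumption)
    then obtain x y where x: "x \<in> carrier G" "y \<in> carrier G" "u = [x, y] @ s" "s \<in> L"
      "length s = length bs" "w = [fst (r (x, y)), snd (r (x, y))] @ s"
      by auto
    show "\<exists>x\<in>carrier G. \<exists>ys\<in>L. length ys = length (b # bs) \<and> u = x # ys \<and>
      v = fst (strand x ys) @ [snd (strand x ys)]"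
      using w(2) x unfolding x(6) step
      by (intro bexI[of _ x] bexI[of _ "y # s"]) (auto split: prod.splits)
  next
    assume "\<exists>x\<in>carrier G. \<exists>ys\<in>L. length ys = length (b # bs) \<and> u = x # ys \<and>
      v = fst (strand x ys) @ [snd (strand x ys)]"
    then obtain x y s where x: "x \<in> carrier G" "y \<in> carrier G" "u = [x, y] @ s" "s \<in> L"
      "length s = length bs" "v = fst (strand x (y # s)) @ [snd (strand x (y # s))]"
      by (auto simp: length_Suc_conv in_lists_conv_set)
    have "sem (Kap a b \<boxtimes> Id bs) u ([fst (r (x, y)), snd (r (x, y))] @ s)"
      unfolding sem_Tens_Id sem.simps using x by blast
    moreover have "sem (Id [b] \<boxtimes> braid1 a bs) ([fst (r (x, y)), snd (r (x, y))] @ s) v"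
      unfolding step using x by (auto split: prod.splits)
    ultimately show "sem (braid1 a (b # bs)) u v" by (auto simp del: sem.simps(3))
  qed
qed

lemma sem_braid:
  "sem (braid as bs) u v \<longleftrightarrow> (\<exists>xs\<in>L. \<exists>ys\<in>L. length xs = length as \<and> length ys = length bs \<and>
     u = xs @ ys \<and> v = fst (cross xs ys) @ snd (cross xs ys))"
proof (induction as arbitrary: u v)
  case Nil
  show ?case by auto
next
  case (Cons a as)
  have step: "sem (braid1 a bs \<boxtimes> Id as) ((x # ys) @ xs) v \<longleftrightarrow>
      x \<in> carrier G \<and> ys \<in> L \<and> xs \<in> L \<and> length ys = length bs \<and>
      v = fst (strand x ys) @ snd (strand x ys) # xs" if "length xs = length as" for x xs ys
    using sem_Tens_Id_append[OF that, of "braid1 a bs" "x # ys" v] unfolding sem_braid1 by auto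
  show ?case
  proof
    assume "sem (braid (a # as) bs) u v"
    then obtain w where w: "sem (Id [a] \<boxtimes> braid as bs) u w" "sem (braid1 a bs \<boxtimes> Id as) w v"
      by (auto simp del: sem.simps(3))
    then obtain s xs ys where x: "s \<in> L" "length s = length [a]" "u = s @ xs @ ys"
        "xs \<in> L" "ys \<in> L" "length xs = length as" "length ys = length bs"
        "w = s @ fst (cross xs ys) @ snd (cross xs ys)"
      unfolding sem_Id_Tens Cons.IH by blast
    then obtain x where s: "s = [x]" by (auto simp: length_Suc_conv)
    obtain ys1 xs1 where 1: "cross xs ys = (ys1, xs1)" by fastforce
    show "\<exists>xs\<in>L. \<exists>ys\<in>L. length xs = length (a # as) \<and> length ys = length bs \<and>
      u = xs @ ys \<and> v = fst (cross xs ys) @ snd (cross xs ys)"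
      using w(2) x step[of xs1 x ys1] 1 cross_closed[OF 1 x(4,5)] s
      by (intro bexI[of _ "x # xs"] bexI[of _ ys]) (auto split: prod.splits)
  next
    assume "\<exists>xs\<in>L. \<exists>ys\<in>L. length xs = length (a # as) \<and> length ys = length bs \<and>
      u = xs @ ys \<and> v = fst (cross xs ys) @ snd (cross xs ys)"
    then obtain x xs ys where x: "x \<in> carrier G" "xs \<in> L" "ys \<in> L" "length xs = length as"
        "length ys = length bs" "u = [x] @ xs @ ys"
        "v = fst (cross (x # xs) ys) @ snd (cross (x # xs) ys)"
      by (auto simp: length_Suc_conv in_lists_conv_set)
    obtain ys1 xs1 where 1: "cross xs ys = (ys1, xs1)" by fastforce
    have "sem (Id [a] \<boxtimes> braid as bs) u ([x] @ ys1 @ xs1)"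
      unfolding x(6) by (subst sem_Id_Tens_append) (use x 1 in \<open>auto simp: Cons.IH intro!: bexI\<close>)
    moreover have "sem (braid1 a bs \<boxtimes> Id as) ([x] @ ys1 @ xs1) v"
      using x step[of xs1 x ys1] 1 cross_closed[OF 1 x(2,3)] by (auto split: prod.splits)
    ultimately show "sem (braid (a # as) bs) u v" by (auto simp del: sem.simps(3))
  qed
qed

section \<open>Naturality of the braiding\<close>

text \<open>The naturality square of the braiding at f, as an equality of relations: it does not matter
  whether the word s passes before or after f is applied. The word s starts on the right of f in
  natural_left and on its left in natural_right.\<close>

definition natural_left :: "mor \<Rightarrow> 'a list \<Rightarrow> bool" where
  "natural_left f s \<longleftrightarrow> (\<forall>u\<in>L. \<forall>t v.
     (\<exists>u'. sem f u u' \<and> cross u' s = (t, v)) \<longleftrightarrow> (\<exists>v0. cross u s = (t, v0) \<and> sem f v0 v))"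

definition natural_right :: "mor \<Rightarrow> 'a list \<Rightarrow> bool" where
  "natural_right f s \<longleftrightarrow> (\<forall>u\<in>L. \<forall>t v.
     (\<exists>u'. sem f u u' \<and> cross s u' = (v, t)) \<longleftrightarrow> (\<exists>v0. cross s u = (v0, t) \<and> sem f v0 v))"

lemma natural_leftD1:
  "natural_left f s \<Longrightarrow> sem f u u' \<Longrightarrow> cross u' s = (t, v) \<Longrightarrow> \<exists>v0. cross u s = (t, v0) \<and> sem f v0 v"
  unfolding natural_left_def by (meson sem_L)

lemma natural_leftD2:
  "natural_left f s \<Longrightarrow> u \<in> L \<Longrightarrow> cross u s = (t, v0) \<Longrightarrow> sem f v0 v \<Longrightarrow> \<exists>u'. sem f u u' \<and> cross u' s = (t, v)"
  unfolding natural_left_def by meson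

lemma natural_rightD1:
  "natural_right f s \<Longrightarrow> sem f u u' \<Longrightarrow> cross s u' = (v, t) \<Longrightarrow> \<exists>v0. cross s u = (v0, t) \<and> sem f v0 v"
  unfolding natural_right_def by (meson sem_L)

lemma natural_rightD2:
  "natural_right f s \<Longrightarrow> u \<in> L \<Longrightarrow> cross s u = (v0, t) \<Longrightarrow> sem f v0 v \<Longrightarrow> \<exists>u'. sem f u u' \<and> cross s u' = (v, t)"
  unfolding natural_right_def by meson

text \<open>Since crossing is a bijection, a naturality square can be read backwards. This yields the
  squares of KapInv and Coev from those of Kap and Ev.\<close>

lemma natural_left_converse:
  assumes f: "\<And>s. s \<in> L \<Longrightarrow> natural_left f s" and g: "\<And>u v. sem g u v \<longleftrightarrow> sem f v u" and s: "s \<in> L"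
  shows "natural_left g s"
  unfolding natural_left_def g
proof (intro ballI allI iffI)
  fix u t v assume u: "u \<in> L"
  { assume "\<exists>u'. sem f u' u \<and> cross u' s = (t, v)"
    then obtain u' where u': "sem f u' u" "cross u' s = (t, v)" by blast
    obtain t0 v0 where "cross u s = (t0, v0)" by fastforce
    then show "\<exists>v0. cross u s = (t, v0) \<and> sem f v v0"
      using natural_leftD1[OF f[OF s] u'(1)] u'(2) by auto }
  { assume "\<exists>v0. cross u s = (t, v0) \<and> sem f v v0"
    then obtain v0 where v0: "cross u s = (t, v0)" "sem f v v0" by blast
    then have "t \<in> L" "v \<in> L" using cross_closed[OF v0(1) u s] sem_L by blast+
    then obtain x y where xy: "x \<in> L" "y \<in> L" "cross x y = (t, v)" by (rule cross_surj)
    obtain u' where u': "sem f x u'" "cross u' y = (t, v0)"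
      using natural_leftD2[OF f[OF xy(2)] xy(1,3) v0(2)] by blast
    then have "u' = u \<and> y = s" using cross_inj[OF u'(2) v0(1)] sem_L xy u s by blast
    then show "\<exists>u'. sem f u' u \<and> cross u' s = (t, v)" using u' xy by blast }
qed

lemma natural_right_converse:
  assumes f: "\<And>s. s \<in> L \<Longrightarrow> natural_right f s" and g: "\<And>u v. sem g u v \<longleftrightarrow> sem f v u" and s: "s \<in> L"
  shows "natural_right g s"
  unfolding natural_right_def g
proof (intro ballI allI iffI)
  fix u t v assume u: "u \<in> L"
  { assume "\<exists>u'. sem f u' u \<and> cross s u' = (v, t)"
    then obtain u' where u': "sem f u' u" "cross s u' = (v, t)" by blast
    obtain v0 t0 where "cross s u = (v0, t0)" by fastforce
    then show "\<exists>v0. cross s u = (v0, t) \<and> sem f v v0"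
      using natural_rightD1[OF f[OF s] u'(1)] u'(2) by auto }
  { assume "\<exists>v0. cross s u = (v0, t) \<and> sem f v v0"
    then obtain v0 where v0: "cross s u = (v0, t)" "sem f v v0" by blast
    then have "t \<in> L" "v \<in> L" using cross_closed[OF v0(1) s u] sem_L by blast+
    then obtain y x where xy: "y \<in> L" "x \<in> L" "cross y x = (v, t)" using cross_surj by metis
    obtain u' where u': "sem f x u'" "cross y u' = (v0, t)"
      using natural_rightD2[OF f[OF xy(1)] xy(2,3) v0(2)] by blast
    then have "y = s \<and> u' = u" using cross_inj[OF u'(2) v0(1)] sem_L xy u s by blast
    then show "\<exists>u'. sem f u' u \<and> cross s u' = (v, t)" using u' xy by blast }
qed

text \<open>By cross_append_right a word passes if its letters pass one after the other.\<close>

lemma natural_leftI: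
  assumes "\<And>z. z \<in> carrier G \<Longrightarrow> natural_left f [z]" "s \<in> L"
  shows "natural_left f s"
  using assms(2)
proof (induction s rule: list.induct)
  case Nil
  show ?case unfolding natural_left_def by (auto simp: in_lists_conv_set dest: sem_L)
next
  case (Cons z s)
  have z: "natural_left f [z]" using assms(1) Cons.prems by simp
  have s: "natural_left f s" using Cons by simp
  have split: "cross w (z # s) = (t, v) \<longleftrightarrow>
      (\<exists>t1 w1 t2. cross w [z] = (t1, w1) \<and> cross w1 s = (t2, v) \<and> t = t1 @ t2)" for w t v
    using cross_append_right[of w "[z]" s] by (auto split: prod.splits)
  show ?case
    unfolding natural_left_def
  proof (intro ballI allI)
    fix u t v assume u: "u \<in> L"
    have "(\<exists>u'. sem f u u' \<and> cross u' (z # s) = (t, v)) \<longleftrightarrow>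
      (\<exists>t1 t2 w1. t = t1 @ t2 \<and> cross w1 s = (t2, v) \<and> (\<exists>u'. sem f u u' \<and> cross u' [z] = (t1, w1)))"
      unfolding split by blast
    also have "\<dots> \<longleftrightarrow> (\<exists>t1 t2 w1. t = t1 @ t2 \<and> cross w1 s = (t2, v) \<and>
        (\<exists>v0. cross u [z] = (t1, v0) \<and> sem f v0 w1))"
      using z u unfolding natural_left_def by simp
    also have "\<dots> \<longleftrightarrow> (\<exists>t1 t2 v0. t = t1 @ t2 \<and> cross u [z] = (t1, v0) \<and>
        (\<exists>w1. sem f v0 w1 \<and> cross w1 s = (t2, v)))" by blast
    also have "\<dots> \<longleftrightarrow> (\<exists>t1 t2 v0. t = t1 @ t2 \<and> cross u [z] = (t1, v0) \<and>
        (\<exists>w1. cross v0 s = (t2, w1) \<and> sem f w1 v))"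
    proof -
      have "(\<exists>w1. sem f v0 w1 \<and> cross w1 s = (t2, v)) \<longleftrightarrow> (\<exists>w1. cross v0 s = (t2, w1) \<and> sem f w1 v)"
        if "cross u [z] = (t1, v0)" for t1 t2 v0
      proof -
        have "v0 \<in> L" using cross_closed[OF that] u Cons.prems by auto
        then show ?thesis using s unfolding natural_left_def by simp
      qed
      then show ?thesis by (simp cong: conj_cong)
    qed
    also have "\<dots> \<longleftrightarrow> (\<exists>v0. cross u (z # s) = (t, v0) \<and> sem f v0 v)"
      unfolding split by blast
    finally show "(\<exists>u'. sem f u u' \<and> cross u' (z # s) = (t, v)) \<longleftrightarrow> (\<exists>v0. cross u (z # s) = (t, v0) \<and> sem f v0 v)" .
  qed
qed

lemma cross_Cons_iff:
  "cross (z # s) w = (v, t) \<longleftrightarrow>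
      (\<exists>t1 w1 t2. cross s w = (w1, t2) \<and> cross [z] w1 = (v, t1) \<and> t = t1 @ t2)"
  using cross_append_left[of "[z]" s w] by (auto split: prod.splits)

lemma natural_rightI:
  assumes "\<And>z. z \<in> carrier G \<Longrightarrow> natural_right f [z]" "s \<in> L"
  shows "natural_right f s"
  using assms(2)
proof (induction s rule: list.induct)
  case Nil
  show ?case unfolding natural_right_def by (auto simp: in_lists_conv_set dest: sem_L)
next
  case (Cons z s)
  have z: "natural_right f [z]" using assms(1) Cons.prems by simp
  have s: "natural_right f s" using Cons by simp
  show ?case
    unfolding natural_right_def
  proof (intro ballI allI)
    fix u t v assume u: "u \<in> L"
    have "(\<exists>u'. sem f u u' \<and> cross (z # s) u' = (v, t)) \<longleftrightarrow>
      (\<exists>t1 t2 w1. t = t1 @ t2 \<and> cross [z] w1 = (v, t1) \<and> (\<exists>u'. sem f u u' \<and> cross s u' = (w1, t2)))"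
      unfolding cross_Cons_iff[of z s] by blast
    also have "\<dots> \<longleftrightarrow> (\<exists>t1 t2 w1. t = t1 @ t2 \<and> cross [z] w1 = (v, t1) \<and>
        (\<exists>v0. cross s u = (v0, t2) \<and> sem f v0 w1))"
      using s u unfolding natural_right_def by simp
    also have "\<dots> \<longleftrightarrow> (\<exists>t1 t2 v0. t = t1 @ t2 \<and> cross s u = (v0, t2) \<and>
        (\<exists>w1. sem f v0 w1 \<and> cross [z] w1 = (v, t1)))" by blast
    also have "\<dots> \<longleftrightarrow> (\<exists>t1 t2 v0. t = t1 @ t2 \<and> cross s u = (v0, t2) \<and>
        (\<exists>w1. cross [z] v0 = (w1, t1) \<and> sem f w1 v))"
    proof -
      have "(\<exists>w1. sem f v0 w1 \<and> cross [z] w1 = (v, t1)) \<longleftrightarrow> (\<exists>w1. cross [z] v0 = (w1, t1) \<and> sem f w1 v)"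
        if "cross s u = (v0, t2)" for t1 t2 v0
      proof -
        have "v0 \<in> L" using cross_closed[OF that] u Cons.prems by auto
        then show ?thesis using z unfolding natural_right_def by simp
      qed
      then show ?thesis by (simp cong: conj_cong del: cross.simps)
    qed
    also have "\<dots> \<longleftrightarrow> (\<exists>v0. cross (z # s) u = (v0, t) \<and> sem f v0 v)"
      unfolding cross_Cons_iff[of z s] by blast
    finally show "(\<exists>u'. sem f u u' \<and> cross (z # s) u' = (v, t)) \<longleftrightarrow> (\<exists>v0. cross (z # s) u = (v0, t) \<and> sem f v0 v)" .
  qed
qed

text \<open>For a crossing, naturality is the Yang-Baxter equation.\<close>

lemma natural_left_Kap: "natural_left (Kap a b) s" if "s \<in> L"
proof (rule natural_leftI[OF _ that])
  fix z assume z: "z \<in> carrier G"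
  have eq: "cross [fst (r (x, y)), snd (r (x, y))] [z] = (t, v) \<longleftrightarrow>
     (\<exists>x' y'. cross [x, y] [z] = (t, [x', y']) \<and> v = [fst (r (x', y')), snd (r (x', y'))])"
    if xy: "x \<in> carrier G" "y \<in> carrier G" for x y t v
  proof -
    obtain a b c d e f p q u v' w t' where h: "r (x, y) = (a, b)" "r (b, z) = (c, d)" "r (a, c) = (e, f)"
      "r (y, z) = (p, q)" "r (x, p) = (u, v')" "r (v', q) = (w, t')" by (meson surj_pair)
    show ?thesis using yang_baxter[OF h xy z] h by auto
  qed
  show "natural_left (Kap a b) [z]"
    unfolding natural_left_def
  proof (intro ballI allI)
    fix u t v assume u: "u \<in> L"
    have "(\<exists>u'. sem (Kap a b) u u' \<and> cross u' [z] = (t, v)) \<longleftrightarrow>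
      (\<exists>x\<in>carrier G. \<exists>y\<in>carrier G. u = [x, y] \<and>
       cross [fst (r (x, y)), snd (r (x, y))] [z] = (t, v))"
      unfolding sem.simps by blast
    also have "\<dots> \<longleftrightarrow> (\<exists>x\<in>carrier G. \<exists>y\<in>carrier G. u = [x, y] \<and>
       (\<exists>x' y'. cross [x, y] [z] = (t, [x', y']) \<and> v = [fst (r (x', y')), snd (r (x', y'))]))"
      by (intro bex_cong conj_cong HOL.refl eq)
    also have "\<dots> \<longleftrightarrow> (\<exists>v0. cross u [z] = (t, v0) \<and> sem (Kap a b) v0 v)"
    proof
      assume "\<exists>x\<in>carrier G. \<exists>y\<in>carrier G. u = [x, y] \<and>
       (\<exists>x' y'. cross [x, y] [z] = (t, [x', y']) \<and> v = [fst (r (x', y')), snd (r (x', y'))])"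
      then obtain x y x' y' where *: "u = [x, y]" "cross u [z] = (t, [x', y'])"
        "v = [fst (r (x', y')), snd (r (x', y'))]" by blast
      then have "[x', y'] \<in> L" using cross_closed[OF *(2) u] z by simp
      then show "\<exists>v0. cross u [z] = (t, v0) \<and> sem (Kap a b) v0 v" using * by auto
    next
      assume "\<exists>v0. cross u [z] = (t, v0) \<and> sem (Kap a b) v0 v"
      then obtain x' y' where *: "cross u [z] = (t, [x', y'])"
        "v = [fst (r (x', y')), snd (r (x', y'))]" by auto
      then have "length u = 2" using cross_closed[OF *(1) u] z by simp
      then obtain x y where "u = [x, y]" by (auto simp: length_Suc_conv numeral_2_eq_2)
      then show "\<exists>x\<in>carrier G. \<exists>y\<in>carrier G. u = [x, y] \<and>
       (\<exists>x' y'. cross [x, y] [z] = (t, [x', y']) \<and> v = [fst (r (x', y')), snd (r (x', y'))])"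
        using * u by auto
    qed
    finally show "(\<exists>u'. sem (Kap a b) u u' \<and> cross u' [z] = (t, v)) \<longleftrightarrow>
      (\<exists>v0. cross u [z] = (t, v0) \<and> sem (Kap a b) v0 v)" .
  qed
qed

lemma natural_right_Kap: "natural_right (Kap a b) s" if "s \<in> L"
proof (rule natural_rightI[OF _ that])
  fix z assume z: "z \<in> carrier G"
  have eq: "cross [z] [fst (r (x, y)), snd (r (x, y))] = (v, t) \<longleftrightarrow>
     (\<exists>x' y'. cross [z] [x, y] = ([x', y'], t) \<and> v = [fst (r (x', y')), snd (r (x', y'))])"
    if xy: "x \<in> carrier G" "y \<in> carrier G" for x y t v
  proof -
    obtain a b c d e f p q u v' w t' where h: "r (z, x) = (a, b)" "r (b, y) = (c, d)" "r (a, c) = (e, f)"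
      "r (x, y) = (p, q)" "r (z, p) = (u, v')" "r (v', q) = (w, t')" by (meson surj_pair)
    show ?thesis using yang_baxter[OF h z xy] h by auto
  qed
  show "natural_right (Kap a b) [z]"
    unfolding natural_right_def
  proof (intro ballI allI)
    fix u t v assume u: "u \<in> L"
    have "(\<exists>u'. sem (Kap a b) u u' \<and> cross [z] u' = (v, t)) \<longleftrightarrow>
      (\<exists>x\<in>carrier G. \<exists>y\<in>carrier G. u = [x, y] \<and>
       cross [z] [fst (r (x, y)), snd (r (x, y))] = (v, t))"
      unfolding sem.simps by blast
    also have "\<dots> \<longleftrightarrow> (\<exists>x\<in>carrier G. \<exists>y\<in>carrier G. u = [x, y] \<and>
       (\<exists>x' y'. cross [z] [x, y] = ([x', y'], t) \<and> v = [fst (r (x', y')), snd (r (x', y'))]))"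
      by (intro bex_cong conj_cong HOL.refl eq)
    also have "\<dots> \<longleftrightarrow> (\<exists>v0. cross [z] u = (v0, t) \<and> sem (Kap a b) v0 v)"
    proof
      assume "\<exists>x\<in>carrier G. \<exists>y\<in>carrier G. u = [x, y] \<and>
       (\<exists>x' y'. cross [z] [x, y] = ([x', y'], t) \<and> v = [fst (r (x', y')), snd (r (x', y'))])"
      then obtain x y x' y' where *: "u = [x, y]" "cross [z] u = ([x', y'], t)"
        "v = [fst (r (x', y')), snd (r (x', y'))]" by blast
      then have "[x', y'] \<in> L" using cross_closed[OF *(2) _ u] z by simp
      then show "\<exists>v0. cross [z] u = (v0, t) \<and> sem (Kap a b) v0 v" using * by auto
    next
      assume "\<exists>v0. cross [z] u = (v0, t) \<and> sem (Kap a b) v0 v"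
      then obtain x' y' where *: "cross [z] u = ([x', y'], t)"
        "v = [fst (r (x', y')), snd (r (x', y'))]" unfolding sem.simps by blast
      then have "length u = 2" using cross_closed[OF *(1) _ u] z by simp
      then obtain x y where "u = [x, y]" by (auto simp: length_Suc_conv numeral_2_eq_2)
      then show "\<exists>x\<in>carrier G. \<exists>y\<in>carrier G. u = [x, y] \<and>
       (\<exists>x' y'. cross [z] [x, y] = ([x', y'], t) \<and> v = [fst (r (x', y')), snd (r (x', y'))])"
        using * u by auto
    qed
    finally show "(\<exists>u'. sem (Kap a b) u u' \<and> cross [z] u' = (v, t)) \<longleftrightarrow>
      (\<exists>v0. cross [z] u = (v0, t) \<and> sem (Kap a b) v0 v)" .
  qed
qed

lemma sem_KapInv: "sem (KapInv a b) u v \<longleftrightarrow> sem (Kap a b) v u" by auto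

lemma sem_Kap_total: "u \<in> L \<Longrightarrow> length u = 2 \<Longrightarrow> \<exists>v. sem (Kap a b) u v"
  by (auto simp: length_Suc_conv numeral_2_eq_2)

lemma sem_Kap_surj: assumes "v \<in> L" "length v = 2" shows "\<exists>u. sem (Kap a b) u v"
proof -
  obtain x' y' where v: "v = [x', y']" using assms by (auto simp: length_Suc_conv numeral_2_eq_2)
  with assms obtain x y where "x \<in> carrier G" "y \<in> carrier G" "r (x, y) = (x', y')"
    by (auto elim: r_surj)
  then show ?thesis using v by (intro exI[of _ "[x, y]"]) auto
qed

lemma sem_Kap_fun: "sem (Kap a b) u v \<Longrightarrow> sem (Kap a b) u v' \<Longrightarrow> v = v'" by auto

lemma sem_Kap_inj: "sem (Kap a b) u v \<Longrightarrow> sem (Kap a b) u' v \<Longrightarrow> u = u'"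
proof -
  assume "sem (Kap a b) u v" "sem (Kap a b) u' v"
  then obtain x y x' y' where *: "x \<in> carrier G" "y \<in> carrier G" "x' \<in> carrier G" "y' \<in> carrier G"
    "u = [x, y]" "u' = [x', y']" and r: "fst (r (x, y)) = fst (r (x', y'))" "snd (r (x, y)) = snd (r (x', y'))"
    unfolding sem.simps by force
  have "r (x', y') = (fst (r (x, y)), snd (r (x, y)))" unfolding r by simp
  from r_inj[OF prod.collapse[symmetric] this] show "u = u'" using * by simp
qed

lemma sem_Kap_length: "sem (Kap a b) u v \<Longrightarrow> length u = 2 \<and> length v = 2" by auto

text \<open>A pair with product 1 does not change the letter that passes it, because r (1, z) = (z, 1).
  Injectivity of r gives the converse.\<close>

lemma cross_pair_one:
  assumes "cross [x, y] [z] = (t, [x', y'])" "x \<in> carrier G" "y \<in> carrier G" "z \<in> carrier G"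
  shows "x \<otimes> y = \<one> \<and> t = [z] \<longleftrightarrow> x' \<otimes> y' = \<one> \<and> t = [z]" "x \<otimes> y = \<one> \<Longrightarrow> t = [z]"
    "x' \<otimes> y' = \<one> \<Longrightarrow> t = [z]"
proof -
  have c: "t \<in> L" "x' \<in> carrier G" "y' \<in> carrier G" "length t = 1"
    using cross_closed[OF assms(1)] assms by auto
  then obtain z' where t: "t = [z']" "z' \<in> carrier G" by (auto simp: length_Suc_conv)
  have r: "r (x \<otimes> y, z) = (z', x' \<otimes> y')"
    using r_word_prod[OF assms(1)] assms c t by simp
  show 1: "x \<otimes> y = \<one> \<Longrightarrow> t = [z]" using r r_one(1) assms t by simp
  show 2: "x' \<otimes> y' = \<one> \<Longrightarrow> t = [z]"
    using r_inj[OF _ r, of \<one> z'] r_one(1) assms t by simp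
  show "x \<otimes> y = \<one> \<and> t = [z] \<longleftrightarrow> x' \<otimes> y' = \<one> \<and> t = [z]"
    using r r_one(1)[of z] r_inj[OF _ r, of \<one> z] assms t by auto
qed

lemma cross_one_pair:
  assumes "cross [z] [x, y] = ([x', y'], t)" "x \<in> carrier G" "y \<in> carrier G" "z \<in> carrier G"
  shows "x \<otimes> y = \<one> \<and> t = [z] \<longleftrightarrow> x' \<otimes> y' = \<one> \<and> t = [z]" "x \<otimes> y = \<one> \<Longrightarrow> t = [z]"
    "x' \<otimes> y' = \<one> \<Longrightarrow> t = [z]"
proof -
  have c: "t \<in> L" "x' \<in> carrier G" "y' \<in> carrier G" "length t = 1"
    using cross_closed[OF assms(1)] assms by auto
  then obtain z' where t: "t = [z']" "z' \<in> carrier G" by (auto simp: length_Suc_conv)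
  have r: "r (z, x \<otimes> y) = (x' \<otimes> y', z')"
    using r_word_prod[OF assms(1)] assms c t by simp
  show 1: "x \<otimes> y = \<one> \<Longrightarrow> t = [z]" using r r_one(2) assms t by simp
  show 2: "x' \<otimes> y' = \<one> \<Longrightarrow> t = [z]"
    using r_inj[OF _ r, of z' \<one>] r_one(2) assms t by simp
  show "x \<otimes> y = \<one> \<and> t = [z] \<longleftrightarrow> x' \<otimes> y' = \<one> \<and> t = [z]"
    using r r_one(2)[of z] r_inj[OF _ r, of z \<one>] assms t by auto
qed

lemma pair_one_iff:
  assumes "u \<in> L"
  shows "(\<exists>x\<in>carrier G. u = [x, inv x]) \<longleftrightarrow> (\<exists>x y. u = [x, y] \<and> x \<otimes> y = \<one>)"
    and "(\<exists>x\<in>carrier G. u = [inv x, x]) \<longleftrightarrow> (\<exists>x y. u = [x, y] \<and> x \<otimes> y = \<one>)"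
proof -
  have "y = inv x" "x = inv y" if "x \<in> carrier G" "y \<in> carrier G" "x \<otimes> y = \<one>" for x y
    using that inv_equality[of x y] inv_equality[of y x] inv_comm[of x y] by auto
  note inv_eq = this
  show "(\<exists>x\<in>carrier G. u = [x, inv x]) \<longleftrightarrow> (\<exists>x y. u = [x, y] \<and> x \<otimes> y = \<one>)"
    "(\<exists>x\<in>carrier G. u = [inv x, x]) \<longleftrightarrow> (\<exists>x y. u = [x, y] \<and> x \<otimes> y = \<one>)"
    using assms by (auto dest: inv_eq)
qed

lemma natural_left_Ev: "natural_left Ev s" if "s \<in> L"
proof (rule natural_leftI[OF _ that])
  fix z assume z: "z \<in> carrier G"
  show "natural_left Ev [z]"
    unfolding natural_left_def
  proof (intro ballI allI iffI)
    fix u t v assume u: "u \<in> L"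
    obtain t' w where tw: "cross u [z] = (t', w)" by fastforce
    have w: "w \<in> L" "length w = length u" using cross_closed[OF tw u] z by auto
    have evu: "sem Ev u u' \<longleftrightarrow> u' = [] \<and> (\<exists>x y. u = [x, y] \<and> x \<otimes> y = \<one>)" for u'
      using pair_one_iff(1)[OF u] by auto
    have evw: "sem Ev w u' \<longleftrightarrow> u' = [] \<and> (\<exists>x y. w = [x, y] \<and> x \<otimes> y = \<one>)" for u'
      using pair_one_iff(1)[OF w(1)] by auto
    { assume "\<exists>u'. sem Ev u u' \<and> cross u' [z] = (t, v)"
      then obtain x y where *: "u = [x, y]" "x \<otimes> y = \<one>" "t = [z]" "v = []" using evu by auto
      then obtain x' y' where w': "w = [x', y']" using w by (auto simp: length_Suc_conv)
      show "\<exists>v0. cross u [z] = (t, v0) \<and> sem Ev v0 v"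
        using cross_pair_one[of x y z t' x' y'] tw * w' u z evw[of v] by auto }
    { assume "\<exists>v0. cross u [z] = (t, v0) \<and> sem Ev v0 v"
      then obtain x' y' where *: "w = [x', y']" "x' \<otimes> y' = \<one>" "t = t'" "v = []" using evw tw by auto
      then obtain x y where u': "u = [x, y]" using w by (auto simp: Suc_length_conv length_Suc_conv)
      show "\<exists>u'. sem Ev u u' \<and> cross u' [z] = (t, v)"
        using cross_pair_one[of x y z t' x' y'] tw * u' u z evu by auto }
  qed
qed

lemma natural_right_Ev: "natural_right Ev s" if "s \<in> L"
proof (rule natural_rightI[OF _ that])
  fix z assume z: "z \<in> carrier G"
  show "natural_right Ev [z]"
    unfolding natural_right_def
  proof (intro ballI allI iffI)
    fix u t v assume u: "u \<in> L"
    obtain t' w where tw: "cross [z] u = (w, t')" by fastforce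
    have w: "w \<in> L" "length w = length u" using cross_closed[OF tw _ u] z by auto
    have evu: "sem Ev u u' \<longleftrightarrow> u' = [] \<and> (\<exists>x y. u = [x, y] \<and> x \<otimes> y = \<one>)" for u'
      using pair_one_iff(1)[OF u] by auto
    have evw: "sem Ev w u' \<longleftrightarrow> u' = [] \<and> (\<exists>x y. w = [x, y] \<and> x \<otimes> y = \<one>)" for u'
      using pair_one_iff(1)[OF w(1)] by auto
    { assume "\<exists>u'. sem Ev u u' \<and> cross [z] u' = (v, t)"
      then obtain x y where *: "u = [x, y]" "x \<otimes> y = \<one>" "t = [z]" "v = []" using evu by auto
      then obtain x' y' where w': "w = [x', y']" using w by (auto simp: length_Suc_conv)
      show "\<exists>v0. cross [z] u = (v0, t) \<and> sem Ev v0 v"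
        using cross_one_pair[of z x y x' y' t'] tw * w' u z evw[of v] by auto }
    { assume "\<exists>v0. cross [z] u = (v0, t) \<and> sem Ev v0 v"
      then obtain x' y' where *: "w = [x', y']" "x' \<otimes> y' = \<one>" "t = t'" "v = []" using evw tw by auto
      then obtain x y where u': "u = [x, y]" using w by (auto simp: Suc_length_conv length_Suc_conv)
      show "\<exists>u'. sem Ev u u' \<and> cross [z] u' = (v, t)"
        using cross_one_pair[of z x y x' y' t'] tw * u' u z evu by auto }
  qed
qed

lemma sem_Ev: "sem Ev u v \<longleftrightarrow> v = [] \<and> u \<in> L \<and> (\<exists>x y. u = [x, y] \<and> x \<otimes> y = \<one>)"
proof (cases "u \<in> L")
  case True then show ?thesis using pair_one_iff(1)[OF True] by auto
qed auto

lemma sem_Coev: "sem Coev u v \<longleftrightarrow> u = [] \<and> v \<in> L \<and> (\<exists>x y. v = [x, y] \<and> x \<otimes> y = \<one>)"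
proof (cases "v \<in> L")
  case True then show ?thesis using pair_one_iff(2)[OF True] by auto
qed auto

text \<open>In coordinates both relations state that the two entries multiply to 1.\<close>

lemma sem_Coev_Ev: "sem Coev u v \<longleftrightarrow> sem Ev v u"
  unfolding sem_Coev sem_Ev by blast

lemmas natural_left_Coev = natural_left_converse[OF natural_left_Ev sem_Coev_Ev]
  and natural_right_Coev = natural_right_converse[OF natural_right_Ev sem_Coev_Ev]
  and natural_left_KapInv = natural_left_converse[OF natural_left_Kap sem_KapInv]
  and natural_right_KapInv = natural_right_converse[OF natural_right_Kap sem_KapInv]

text \<open>Letting z pass x * y is the axiom of r for a product in the first argument.\<close>

lemma natural_left_Mul: "natural_left Mul s" if "s \<in> L"
proof (rule natural_leftI[OF _ that])
  fix z assume z: "z \<in> carrier G"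
  have eq: "cross [x \<otimes> y] [z] = (fst (cross [x, y] [z]), [word_prod (snd (cross [x, y] [z]))])"
    if xy: "x \<in> carrier G" "y \<in> carrier G" for x y
  proof -
    obtain z1 y' where 1: "r (y, z) = (z1, y')" by fastforce
    obtain z2 x' where 2: "r (x, z1) = (z2, x')" by fastforce
    show ?thesis using r_mult_left[OF 1 2] 1 2 xy z r_closed[OF 1] r_closed[OF 2] by auto
  qed
  show "natural_left Mul [z]"
    unfolding natural_left_def
  proof (intro ballI allI iffI)
    fix u t v assume u: "u \<in> L"
    obtain t' w where tw: "cross u [z] = (t', w)" by fastforce
    have w: "w \<in> L" "length w = length u" using cross_closed[OF tw u] z by auto
    { assume "\<exists>u'. sem Mul u u' \<and> cross u' [z] = (t, v)"
      then obtain x y where *: "u = [x, y]" "x \<in> carrier G" "y \<in> carrier G" "cross [x \<otimes> y] [z] = (t, v)"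
        unfolding sem.simps by blast
      then obtain x' y' where w': "w = [x', y']" using w by (auto simp: length_Suc_conv)
      show "\<exists>v0. cross u [z] = (t, v0) \<and> sem Mul v0 v"
        using eq[OF *(2,3)] * w' w tw by auto }
    { assume "\<exists>v0. cross u [z] = (t, v0) \<and> sem Mul v0 v"
      then obtain x' y' where *: "w = [x', y']" "t = t'" "v = [x' \<otimes> y']" using tw by auto
      then obtain x y where u': "u = [x, y]" using w by (auto simp: Suc_length_conv length_Suc_conv)
      then have "sem Mul u [x \<otimes> y]" using u by auto
      moreover have "cross [x \<otimes> y] [z] = (t, v)"
        using eq[of x y] tw * u' u w by (auto simp del: cross.simps)
      ultimately show "\<exists>u'. sem Mul u u' \<and> cross u' [z] = (t, v)" by blast }
  qed
qed

lemma natural_right_Mul: "natural_right Mul s" if "s \<in> L"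
proof (rule natural_rightI[OF _ that])
  fix z assume z: "z \<in> carrier G"
  have eq: "cross [z] [x \<otimes> y] = ([word_prod (fst (cross [z] [x, y]))], snd (cross [z] [x, y]))"
    if xy: "x \<in> carrier G" "y \<in> carrier G" for x y
  proof -
    obtain x' z1 where 1: "r (z, x) = (x', z1)" by fastforce
    obtain y' z2 where 2: "r (z1, y) = (y', z2)" by fastforce
    show ?thesis using r_mult_right[OF 1 2] 1 2 xy z r_closed[OF 1] r_closed[OF 2] by auto
  qed
  show "natural_right Mul [z]"
    unfolding natural_right_def
  proof (intro ballI allI iffI)
    fix u t v assume u: "u \<in> L"
    obtain t' w where tw: "cross [z] u = (w, t')" by fastforce
    have w: "w \<in> L" "length w = length u" using cross_closed[OF tw _ u] z by auto
    { assume "\<exists>u'. sem Mul u u' \<and> cross [z] u' = (v, t)"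
      then obtain x y where *: "u = [x, y]" "x \<in> carrier G" "y \<in> carrier G" "cross [z] [x \<otimes> y] = (v, t)"
        unfolding sem.simps by blast
      then obtain x' y' where w': "w = [x', y']" using w by (auto simp: length_Suc_conv)
      show "\<exists>v0. cross [z] u = (v0, t) \<and> sem Mul v0 v"
        using eq[OF *(2,3)] * w' w tw by auto }
    { assume "\<exists>v0. cross [z] u = (v0, t) \<and> sem Mul v0 v"
      then obtain x' y' where *: "w = [x', y']" "t = t'" "v = [x' \<otimes> y']" using tw by auto
      then obtain x y where u': "u = [x, y]" using w by (auto simp: Suc_length_conv length_Suc_conv)
      then have "sem Mul u [x \<otimes> y]" using u by auto
      moreover have "cross [z] [x \<otimes> y] = (v, t)"
        using eq[of x y] tw * u' u w by (auto simp del: cross.simps)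
      ultimately show "\<exists>u'. sem Mul u u' \<and> cross [z] u' = (v, t)" by blast }
  qed
qed

lemma natural_left_Unt: "natural_left Unt s" if "s \<in> L"
proof (rule natural_leftI[OF _ that])
  fix z assume z: "z \<in> carrier G"
  have "cross u [z] = (t, []) \<longleftrightarrow> u = [] \<and> t = [z]" if "u \<in> L" for u t
    using cross_closed[of u "[z]" t "[]"] that z by (cases u) auto
  then show "natural_left Unt [z]" unfolding natural_left_def using z by (auto simp: r_one)
qed

lemma natural_right_Unt: "natural_right Unt s" if "s \<in> L"
proof (rule natural_rightI[OF _ that])
  fix z assume z: "z \<in> carrier G"
  have "cross [z] u = ([], t) \<longleftrightarrow> u = [] \<and> t = [z]" if "u \<in> L" for u t
    using cross_closed[of "[z]" u "[]" t] that z by (cases u) auto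
  then show "natural_right Unt [z]" unfolding natural_right_def using z
    by (auto simp: r_one simp del: cross.simps(2)) (auto simp: r_one)
qed

lemma natural_left_Comp:
  assumes f: "natural_left f s" and g: "natural_left g s" and s: "s \<in> L"
  shows "natural_left (g \<bullet> f) s"
  unfolding natural_left_def
proof (intro ballI allI)
  fix u t v assume u: "u \<in> L"
  have "(\<exists>u'. sem (g \<bullet> f) u u' \<and> cross u' s = (t, v)) \<longleftrightarrow>
      (\<exists>w. sem f u w \<and> (\<exists>u'. sem g w u' \<and> cross u' s = (t, v)))" by auto
  also have "\<dots> \<longleftrightarrow> (\<exists>w. sem f u w \<and> (\<exists>v0. cross w s = (t, v0) \<and> sem g v0 v))"
    using g unfolding natural_left_def by (meson sem_L)
  also have "\<dots> \<longleftrightarrow> (\<exists>v0. (\<exists>w. sem f u w \<and> cross w s = (t, v0)) \<and> sem g v0 v)" by blast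
  also have "\<dots> \<longleftrightarrow> (\<exists>v0. (\<exists>w. cross u s = (t, w) \<and> sem f w v0) \<and> sem g v0 v)"
    using f u unfolding natural_left_def by simp
  also have "\<dots> \<longleftrightarrow> (\<exists>v0. cross u s = (t, v0) \<and> sem (g \<bullet> f) v0 v)" by auto
  finally show "(\<exists>u'. sem (g \<bullet> f) u u' \<and> cross u' s = (t, v)) \<longleftrightarrow>
    (\<exists>v0. cross u s = (t, v0) \<and> sem (g \<bullet> f) v0 v)" .
qed

lemma natural_right_Comp:
  assumes f: "natural_right f s" and g: "natural_right g s" and s: "s \<in> L"
  shows "natural_right (g \<bullet> f) s"
  unfolding natural_right_def
proof (intro ballI allI)
  fix u t v assume u: "u \<in> L"
  have "(\<exists>u'. sem (g \<bullet> f) u u' \<and> cross s u' = (v, t)) \<longleftrightarrow>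
      (\<exists>w. sem f u w \<and> (\<exists>u'. sem g w u' \<and> cross s u' = (v, t)))" by auto
  also have "\<dots> \<longleftrightarrow> (\<exists>w. sem f u w \<and> (\<exists>v0. cross s w = (v0, t) \<and> sem g v0 v))"
    using g unfolding natural_right_def by (meson sem_L)
  also have "\<dots> \<longleftrightarrow> (\<exists>v0. (\<exists>w. sem f u w \<and> cross s w = (v0, t)) \<and> sem g v0 v)" by blast
  also have "\<dots> \<longleftrightarrow> (\<exists>v0. (\<exists>w. cross s u = (w, t) \<and> sem f w v0) \<and> sem g v0 v)"
    using f u unfolding natural_right_def by simp
  also have "\<dots> \<longleftrightarrow> (\<exists>v0. cross s u = (v0, t) \<and> sem (g \<bullet> f) v0 v)" by auto
  finally show "(\<exists>u'. sem (g \<bullet> f) u u' \<and> cross s u' = (v, t)) \<longleftrightarrow>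
    (\<exists>v0. cross s u = (v0, t) \<and> sem (g \<bullet> f) v0 v)" .
qed

text \<open>The word s passes the two factors one after the other. Lengths are preserved, so a splitting
  of the word after the crossing determines one before it.\<close>

lemma natural_left_Tens:
  assumes f: "\<And>s. s \<in> L \<Longrightarrow> natural_left f s" and g: "\<And>s. s \<in> L \<Longrightarrow> natural_left g s" and s: "s \<in> L"
  shows "natural_left (f \<boxtimes> g) s"
  unfolding natural_left_def
proof (intro ballI allI iffI)
  fix u t v assume u: "u \<in> L"
  { assume "\<exists>u'. sem (f \<boxtimes> g) u u' \<and> cross u' s = (t, v)"
    then obtain u1 u2 v1 v2 where *: "u = u1 @ u2" "sem f u1 v1" "sem g u2 v2" "cross (v1 @ v2) s = (t, v)"
      by auto
    obtain t2 w2 where 2: "cross v2 s = (t2, w2)" by fastforce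
    obtain t1 w1 where 1: "cross v1 t2 = (t1, w1)" by fastforce
    have v: "t = t1" "v = w1 @ w2" using *(4) 1 2 by (auto simp: cross_append_left)
    have t2: "t2 \<in> L" using cross_closed[OF 2 _ s] sem_L *(3) by blast
    obtain x2 where x2: "cross u2 s = (t2, x2)" "sem g x2 w2"
      using natural_leftD1[OF g[OF s] *(3) 2] by blast
    obtain x1 where x1: "cross u1 t2 = (t1, x1)" "sem f x1 w1"
      using natural_leftD1[OF f[OF t2] *(2) 1] by blast
    show "\<exists>v0. cross u s = (t, v0) \<and> sem (f \<boxtimes> g) v0 v"
      using x1 x2 v *(1) by (intro exI[of _ "x1 @ x2"]) (auto simp: cross_append_left) }
  { assume "\<exists>v0. cross u s = (t, v0) \<and> sem (f \<boxtimes> g) v0 v"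
    then obtain x1 x2 w1 w2 where *: "cross u s = (t, x1 @ x2)" "sem f x1 w1" "sem g x2 w2" "v = w1 @ w2"
      by auto
    have "length u = length x1 + length x2" using cross_closed[OF *(1) u s] by simp
    then obtain u1 u2 where u12: "u = u1 @ u2" "length u1 = length x1" "length u2 = length x2"
      by (metis add_diff_cancel_left' append_take_drop_id length_drop length_take min.absorb2 le_add1)
    have uL: "u1 \<in> L" "u2 \<in> L" using u u12 by auto
    obtain t2 y2 where 2: "cross u2 s = (t2, y2)" by fastforce
    obtain t1 y1 where 1: "cross u1 t2 = (t1, y1)" by fastforce
    have t2: "t2 \<in> L" "length y2 = length x2" using cross_closed[OF 2 uL(2) s] u12 by auto
    have y: "t = t1" "y1 = x1" "y2 = x2"
      using *(1) 1 2 t2(2) unfolding u12 by (auto simp: cross_append_left)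
    obtain v2 where v2: "sem g u2 v2" "cross v2 s = (t2, w2)"
      using natural_leftD2[OF g[OF s] uL(2) 2] *(3) y by blast
    obtain v1 where v1: "sem f u1 v1" "cross v1 t2 = (t1, w1)"
      using natural_leftD2[OF f[OF t2(1)] uL(1) 1] *(2) y by blast
    have "sem (f \<boxtimes> g) u (v1 @ v2)" using u12 v1 v2 by auto
    moreover have "cross (v1 @ v2) s = (t, v)" using v1 v2 y *(4) by (auto simp: cross_append_left)
    ultimately show "\<exists>u'. sem (f \<boxtimes> g) u u' \<and> cross u' s = (t, v)" by blast }
qed

lemma natural_right_Tens:
  assumes f: "\<And>s. s \<in> L \<Longrightarrow> natural_right f s" and g: "\<And>s. s \<in> L \<Longrightarrow> natural_right g s" and s: "s \<in> L"
  shows "natural_right (f \<boxtimes> g) s"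
  unfolding natural_right_def
proof (intro ballI allI iffI)
  fix u t v assume u: "u \<in> L"
  { assume "\<exists>u'. sem (f \<boxtimes> g) u u' \<and> cross s u' = (v, t)"
    then obtain u1 u2 v1 v2 where *: "u = u1 @ u2" "sem f u1 v1" "sem g u2 v2" "cross s (v1 @ v2) = (v, t)"
      by auto
    obtain t1 w1 where 1: "cross s v1 = (w1, t1)" by fastforce
    obtain t2 w2 where 2: "cross t1 v2 = (w2, t2)" by fastforce
    have v: "t = t2" "v = w1 @ w2" using *(4) 1 2 by (auto simp: cross_append_right)
    have t1: "t1 \<in> L" using cross_closed[OF 1 s] sem_L *(2) by blast
    obtain x1 where x1: "cross s u1 = (x1, t1)" "sem f x1 w1"
      using natural_rightD1[OF f[OF s] *(2) 1] by blast
    obtain x2 where x2: "cross t1 u2 = (x2, t2)" "sem g x2 w2"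
      using natural_rightD1[OF g[OF t1] *(3) 2] by blast
    show "\<exists>v0. cross s u = (v0, t) \<and> sem (f \<boxtimes> g) v0 v"
      using x1 x2 v *(1) by (intro exI[of _ "x1 @ x2"]) (auto simp: cross_append_right) }
  { assume "\<exists>v0. cross s u = (v0, t) \<and> sem (f \<boxtimes> g) v0 v"
    then obtain x1 x2 w1 w2 where *: "cross s u = (x1 @ x2, t)" "sem f x1 w1" "sem g x2 w2" "v = w1 @ w2"
      by auto
    have "length u = length x1 + length x2" using cross_closed[OF *(1) s u] by simp
    then obtain u1 u2 where u12: "u = u1 @ u2" "length u1 = length x1" "length u2 = length x2"
      by (metis add_diff_cancel_left' append_take_drop_id length_drop length_take min.absorb2 le_add1)
    have uL: "u1 \<in> L" "u2 \<in> L" using u u12 by auto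
    obtain t1 y1 where 1: "cross s u1 = (y1, t1)" by fastforce
    obtain t2 y2 where 2: "cross t1 u2 = (y2, t2)" by fastforce
    have t1: "t1 \<in> L" "length y1 = length x1" using cross_closed[OF 1 s uL(1)] u12 by auto
    have y: "t = t2" "y1 = x1" "y2 = x2"
      using *(1) 1 2 t1(2) unfolding u12 by (auto simp: cross_append_right)
    obtain v1 where v1: "sem f u1 v1" "cross s v1 = (w1, t1)"
      using natural_rightD2[OF f[OF s] uL(1) 1] *(2) y by blast
    obtain v2 where v2: "sem g u2 v2" "cross t1 v2 = (w2, t2)"
      using natural_rightD2[OF g[OF t1(1)] uL(2) 2] *(3) y by blast
    have "sem (f \<boxtimes> g) u (v1 @ v2)" using u12 v1 v2 by auto
    moreover have "cross s (v1 @ v2) = (v, t)" using v1 v2 y *(4) by (auto simp: cross_append_right)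
    ultimately show "\<exists>u'. sem (f \<boxtimes> g) u u' \<and> cross s u' = (v, t)" by blast }
qed

lemma natural_left_Id: "natural_left (Id a) s" if "s \<in> L"
  unfolding natural_left_def using that by (auto dest: cross_closed)

lemma natural_right_Id: "natural_right (Id a) s" if "s \<in> L"
  unfolding natural_right_def using that by (auto dest: cross_closed)

theorem natural_left: "s \<in> L \<Longrightarrow> natural_left f s"
  by (induction f arbitrary: s)
    (simp_all add: natural_left_Id natural_left_Comp natural_left_Tens natural_left_Ev
      natural_left_Coev natural_left_Kap natural_left_KapInv natural_left_Mul natural_left_Unt)

theorem natural_right: "s \<in> L \<Longrightarrow> natural_right f s"
  by (induction f arbitrary: s)
    (simp_all add: natural_right_Id natural_right_Comp natural_right_Tens natural_right_Ev
      natural_right_Coev natural_right_Kap natural_right_KapInv natural_right_Mul natural_right_Unt)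

section \<open>The relations of the category\<close>

lemma sem_length_L:
  assumes "arr f a b" "sem f u v"
  shows "u \<in> L" "v \<in> L" "length u = length a" "length v = length b"
  using sem_length[OF assms] sem_L[OF assms(2)] by auto

lemma sem_interchange:
  assumes "arr f a b" "arr g b c" "arr f' a' b'" "arr g' b' c'"
  shows "sem ((g \<bullet> f) \<boxtimes> (g' \<bullet> f')) u v \<longleftrightarrow> sem ((g \<boxtimes> g') \<bullet> (f \<boxtimes> f')) u v"
proof
  assume "sem ((g \<boxtimes> g') \<bullet> (f \<boxtimes> f')) u v"
  then obtain u1 u2 w1 w2 w1' w2' v1 v2 where *: "u = u1 @ u2" "sem f u1 w1" "sem f' u2 w2"
    "w1 @ w2 = w1' @ w2'" "sem g w1' v1" "sem g' w2' v2" "v = v1 @ v2"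
    unfolding sem.simps by (elim exE conjE) (rule that; simp)
  have "length w1 = length w1'" using sem_length[OF assms(1) *(2)] sem_length[OF assms(2) *(5)] by simp
  then have "w1 = w1'" "w2 = w2'" using *(4) by auto
  then show "sem ((g \<bullet> f) \<boxtimes> (g' \<bullet> f')) u v" using * unfolding sem.simps by blast
next
  assume "sem ((g \<bullet> f) \<boxtimes> (g' \<bullet> f')) u v"
  then show "sem ((g \<boxtimes> g') \<bullet> (f \<boxtimes> f')) u v" unfolding sem.simps by blast
qed

lemma sem_braid_natural_left:
  assumes f: "arr f a b"
  shows "sem (braid b c \<bullet> (f \<boxtimes> Id c)) u v \<longleftrightarrow> sem ((Id c \<boxtimes> f) \<bullet> braid a c) u v"
proof
  assume "sem (braid b c \<bullet> (f \<boxtimes> Id c)) u v"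
  then obtain w where w: "sem (f \<boxtimes> Id c) u w" "sem (braid b c) w v" by (auto simp del: sem.simps(3))
  then obtain u1 w1 s where s: "u = u1 @ s" "w = w1 @ s" "sem f u1 w1" "s \<in> L" "length s = length c"
    unfolding sem_Tens_Id by (elim exE conjE) (rule that; assumption)
  obtain t x where tx: "cross w1 s = (t, x)" by fastforce
  have "v = t @ x" using w(2) s sem_length_L[OF f s(3)] tx unfolding sem_braid by auto
  obtain y where y: "cross u1 s = (t, y)" "sem f y x"
    using natural_leftD1[OF natural_left[OF s(4)] s(3) tx] by blast
  have t: "t \<in> L" "length t = length c" using cross_closed[OF tx _ s(4)] s sem_length_L[OF f s(3)] by auto
  have "sem (braid a c) u (t @ y)"
    unfolding sem_braid using s y sem_length_L[OF f s(3)] by (intro bexI[of _ u1] bexI[of _ s]) auto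
  moreover have "sem (Id c \<boxtimes> f) (t @ y) v"
    using sem_Id_Tens_append[OF t(2)] t y \<open>v = t @ x\<close> by auto
  ultimately show "sem ((Id c \<boxtimes> f) \<bullet> braid a c) u v" by (auto simp del: sem.simps(3))
next
  assume "sem ((Id c \<boxtimes> f) \<bullet> braid a c) u v"
  then obtain w where w: "sem (braid a c) u w" "sem (Id c \<boxtimes> f) w v" by (auto simp del: sem.simps(3))
  then obtain u1 s where u: "u1 \<in> L" "s \<in> L" "length u1 = length a" "length s = length c" "u = u1 @ s"
    "w = fst (cross u1 s) @ snd (cross u1 s)" unfolding sem_braid by blast
  obtain t y where ty: "cross u1 s = (t, y)" by fastforce
  have t: "t \<in> L" "length t = length c" using cross_closed[OF ty] u by auto
  obtain x where x: "sem f y x" "v = t @ x" using sem_Id_Tens_append[OF t(2), of f y v] w(2) u(6) ty by auto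
  obtain w1 where w1: "sem f u1 w1" "cross w1 s = (t, x)"
    using natural_leftD2[OF natural_left[OF u(2)] u(1) ty x(1)] by blast
  have "sem (f \<boxtimes> Id c) u (w1 @ s)" using u w1 unfolding sem_Tens_Id by blast
  moreover have "sem (braid b c) (w1 @ s) v"
    unfolding sem_braid using w1 u x sem_length_L[OF f w1(1)] by (intro bexI[of _ w1] bexI[of _ s]) auto
  ultimately show "sem (braid b c \<bullet> (f \<boxtimes> Id c)) u v" by (auto simp del: sem.simps(3))
qed

lemma sem_braid_natural_right:
  assumes f: "arr f a b"
  shows "sem (braid c b \<bullet> (Id c \<boxtimes> f)) u v \<longleftrightarrow> sem ((f \<boxtimes> Id c) \<bullet> braid c a) u v"
proof
  assume "sem (braid c b \<bullet> (Id c \<boxtimes> f)) u v"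
  then obtain w where w: "sem (Id c \<boxtimes> f) u w" "sem (braid c b) w v" by (auto simp del: sem.simps(3))
  then obtain u1 w1 s where s: "u = s @ u1" "w = s @ w1" "sem f u1 w1" "s \<in> L" "length s = length c"
    unfolding sem_Id_Tens by (elim exE conjE) (rule that; assumption)
  obtain t x where tx: "cross s w1 = (x, t)" by fastforce
  have "v = x @ t" using w(2) s sem_length_L[OF f s(3)] tx unfolding sem_braid by auto
  obtain y where y: "cross s u1 = (y, t)" "sem f y x"
    using natural_rightD1[OF natural_right[OF s(4)] s(3) tx] by blast
  have t: "t \<in> L" "length t = length c" using cross_closed[OF tx s(4)] s sem_length_L[OF f s(3)] by auto
  have "sem (braid c a) u (y @ t)"
    unfolding sem_braid using s y sem_length_L[OF f s(3)] by (intro bexI[of _ u1] bexI[of _ s]) auto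
  moreover have "sem (f \<boxtimes> Id c) (y @ t) v"
    using sem_Tens_Id_append[OF t(2)] t y \<open>v = x @ t\<close> by auto
  ultimately show "sem ((f \<boxtimes> Id c) \<bullet> braid c a) u v" by (auto simp del: sem.simps(3))
next
  assume "sem ((f \<boxtimes> Id c) \<bullet> braid c a) u v"
  then obtain w where w: "sem (braid c a) u w" "sem (f \<boxtimes> Id c) w v" by (auto simp del: sem.simps(3))
  then obtain u1 s where u: "u1 \<in> L" "s \<in> L" "length u1 = length a" "length s = length c" "u = s @ u1"
    "w = fst (cross s u1) @ snd (cross s u1)" unfolding sem_braid by blast
  obtain t y where ty: "cross s u1 = (y, t)" by fastforce
  have t: "t \<in> L" "length t = length c" using cross_closed[OF ty] u by auto
  obtain x where x: "sem f y x" "v = x @ t" using sem_Tens_Id_append[OF t(2), of f y v] w(2) u(6) ty by auto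
  obtain w1 where w1: "sem f u1 w1" "cross s w1 = (x, t)"
    using natural_rightD2[OF natural_right[OF u(2)] u(1) ty x(1)] by blast
  have "sem (Id c \<boxtimes> f) u (s @ w1)" using u w1 unfolding sem_Id_Tens by blast
  moreover have "sem (braid c b) (s @ w1) v"
    unfolding sem_braid using w1 u x sem_length_L[OF f w1(1)] by (intro bexI[of _ w1] bexI[of _ s]) auto
  ultimately show "sem (braid c b \<bullet> (Id c \<boxtimes> f)) u v" by (auto simp del: sem.simps(3))
qed

text \<open>All relations of the category hold for the relations of terms, so the functor is well
  defined on morphisms.\<close>

theorem sem_sound: "mor_eq a b f g \<Longrightarrow> sem f = sem g"
proof (induction rule: mor_eq.induct)
  case (comp_cong a b f f' c g g')
  then show ?case by (auto intro!: ext)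
next
  case (tens_cong a b f f' c d g g')
  then show ?case by (auto intro!: ext)
next
  case (id_comp f a b)
  then show ?case using sem_length_L(2,4)[OF id_comp] by (intro ext) (unfold sem.simps, blast)
next
  case (comp_id f a b)
  then show ?case using sem_length_L(1,3)[OF comp_id] by (intro ext) (unfold sem.simps, blast)
next
  case (comp_assoc f a b g c h d)
  then show ?case by (intro ext) auto
next
  case (tens_id a b)
  show ?case
  proof (intro ext iffI)
    fix u v assume "sem (Id (a @ b)) u v"
    then show "sem (Id a \<boxtimes> Id b) u v"
      unfolding sem.simps
      by (intro exI[of _ "take (length a) u"] exI[of _ "drop (length a) u"])
        (auto dest: in_set_takeD in_set_dropD simp: in_lists_conv_set)
  qed auto
next
  case (interchange f a b g c f' a' b' g' c')
  then show ?case by (intro ext sem_interchange)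
next
  case (tens_assoc f a b g c d h i j)
  show ?case by (intro ext) (auto, (metis append_assoc)+)
next
  case (unit_tens f a b)
  show ?case by (intro ext) (use sem_Id_Tens_append[of "[]" "[]" f] in \<open>simp del: sem.simps(3)\<close>)
next
  case (tens_unit f a b)
  show ?case
    by (intro ext) (use sem_Tens_Id_append[of "[]" "[]" f] in \<open>simp del: sem.simps(3)\<close>)
next
  case (kap_inv_left a b)
  show ?case
  proof (intro ext iffI)
    fix u v assume "sem (KapInv a b \<bullet> Kap a b) u v"
    then obtain w where "sem (Kap a b) u w" "sem (Kap a b) v w" by (auto simp only: sem.simps(2) sem_KapInv)
    then show "sem (Id [a, b]) u v"
      using sem_Kap_inj[of a b u w v] sem_Kap_length[of a b u w] sem_L[of "Kap a b" u w] by simp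
  next
    fix u v assume "sem (Id [a, b]) u v"
    then have "u = v" "u \<in> L" "length u = 2" by auto
    then show "sem (KapInv a b \<bullet> Kap a b) u v"
      using sem_Kap_total[of u a b] by (auto simp only: sem.simps(2) sem_KapInv)
  qed
next
  case (kap_inv_right b a)
  show ?case
  proof (intro ext iffI)
    fix u v assume "sem (Kap a b \<bullet> KapInv a b) u v"
    then obtain w where "sem (Kap a b) w u" "sem (Kap a b) w v" by (auto simp only: sem.simps(2) sem_KapInv)
    then show "sem (Id [b, a]) u v"
      using sem_Kap_fun[of a b w u v] sem_Kap_length[of a b w u] sem_L[of "Kap a b" w u] by simp
  next
    fix u v assume "sem (Id [b, a]) u v"
    then have "u = v" "u \<in> L" "length u = 2" by auto
    then show "sem (Kap a b \<bullet> KapInv a b) u v"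
      using sem_Kap_surj[of u a b] by (auto simp only: sem.simps(2) sem_KapInv)
  qed
next
  case (braid_natural_left f a b c)
  then show ?case by (intro ext sem_braid_natural_left)
next
  case (braid_natural_right f a b c)
  then show ?case by (intro ext sem_braid_natural_right)
next
  case zigzag_x
  show ?case
  proof (intro ext iffI)
    fix u v assume "sem ((Ev \<boxtimes> Id [Lx]) \<bullet> (Id [Lx] \<boxtimes> Coev)) u v"
    then show "sem (Id [Lx]) u v"
      by (auto simp: length_Suc_conv dest: inj_onD[OF inv_inj])
  next
    fix u v assume "sem (Id [Lx]) u v"
    then obtain x where "u = [x]" "v = [x]" "x \<in> carrier G" by (auto simp: length_Suc_conv)
    then have "sem (Id [Lx] \<boxtimes> Coev) u ([x] @ [inv x, x])" "sem (Ev \<boxtimes> Id [Lx]) ([x, inv x] @ [x]) v"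
      unfolding sem_Id_Tens sem_Tens_Id by (fastforce simp: length_Suc_conv)+
    then show "sem ((Ev \<boxtimes> Id [Lx]) \<bullet> (Id [Lx] \<boxtimes> Coev)) u v" by (auto simp del: sem.simps(3))
  qed
next
  case zigzag_y
  show ?case
  proof (intro ext iffI)
    fix u v assume "sem ((Id [Ly] \<boxtimes> Ev) \<bullet> (Coev \<boxtimes> Id [Ly])) u v"
    then show "sem (Id [Ly]) u v"
      by (auto simp: length_Suc_conv)
  next
    fix u v assume "sem (Id [Ly]) u v"
    then obtain x where "u = [x]" "v = [x]" "x \<in> carrier G" by (auto simp: length_Suc_conv)
    moreover define y where "y = inv x"
    ultimately have "u = [inv y]" "v = [inv y]" "y \<in> carrier G" by auto
    then have "sem (Coev \<boxtimes> Id [Ly]) u ([inv y, y] @ [inv y])" "sem (Id [Ly] \<boxtimes> Ev) ([inv y] @ [y, inv y]) v"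
      unfolding sem_Id_Tens sem_Tens_Id by (fastforce simp: length_Suc_conv)+
    then show "sem ((Id [Ly] \<boxtimes> Ev) \<bullet> (Coev \<boxtimes> Id [Ly])) u v" by (auto simp del: sem.simps(3))
  qed
next
  case mul_unit_left
  show ?case by (intro ext) (auto simp: length_Suc_conv)
next
  case mul_unit_right
  show ?case by (intro ext) (auto simp: length_Suc_conv)
next
  case mul_assoc
  show ?case
  proof (intro ext)
    fix u v
    have "sem (Mul \<bullet> (Mul \<boxtimes> Id [Lx])) u v \<longleftrightarrow>
      (\<exists>x\<in>carrier G. \<exists>y\<in>carrier G. \<exists>z\<in>carrier G. u = [x, y, z] \<and> v = [x \<otimes> y \<otimes> z])" (is "?l \<longleftrightarrow> ?r")
    proof
      assume ?l then show ?r by (auto simp: length_Suc_conv)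
    next
      assume ?r
      then obtain x y z where *: "x \<in> carrier G" "y \<in> carrier G" "z \<in> carrier G" "u = [x, y] @ [z]"
        "v = [x \<otimes> y \<otimes> z]" by auto
      then have "sem (Mul \<boxtimes> Id [Lx]) u ([x \<otimes> y] @ [z])"
        unfolding *(4) by (subst sem_Tens_Id_append) auto
      with * show ?l by (auto simp del: sem.simps(3))
    qed
    moreover have "sem (Mul \<bullet> (Id [Lx] \<boxtimes> Mul)) u v \<longleftrightarrow>
      (\<exists>x\<in>carrier G. \<exists>y\<in>carrier G. \<exists>z\<in>carrier G. u = [x, y, z] \<and> v = [x \<otimes> (y \<otimes> z)])" (is "?l \<longleftrightarrow> ?r")
    proof
      assume ?l then show ?r by (auto simp: length_Suc_conv)
    next
      assume ?r
      then obtain x y z where *: "x \<in> carrier G" "y \<in> carrier G" "z \<in> carrier G" "u = [x] @ [y, z]"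
        "v = [x \<otimes> (y \<otimes> z)]" by auto
      then have "sem (Id [Lx] \<boxtimes> Mul) u ([x] @ [y \<otimes> z])"
        unfolding *(4) by (subst sem_Id_Tens_append) auto
      with * show ?l by (auto simp del: sem.simps(3))
    qed
    ultimately show "sem (Mul \<bullet> (Mul \<boxtimes> Id [Lx])) u v = sem (Mul \<bullet> (Id [Lx] \<boxtimes> Mul)) u v"
      by (simp add: m_assoc cong: bex_cong)
  qed
next
  case mul_comm
  show ?case
  proof (intro ext)
    fix u v show "sem (Mul \<bullet> Kap Lx Lx) u v = sem Mul u v"
      using r_mult[OF prod.collapse[symmetric]] by auto
  qed
next
  case kap_unit_left
  show ?case by (intro ext) (auto simp: length_Suc_conv r_one)
next
  case kap_unit_right
  show ?case by (intro ext) (auto simp: length_Suc_conv r_one)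
qed auto

end

section \<open>Duals\<close>

fun flip :: "letter \<Rightarrow> letter" where "flip Lx = Ly" | "flip Ly = Lx"

lemma flip_flip [simp]: "flip (flip a) = a" by (cases a) auto

definition dual :: "obj \<Rightarrow> obj" where "dual a = rev (map flip a)"

lemma dual_simps [simp]: "dual [] = []" "dual (x # a) = dual a @ [flip x]"
  "dual (a @ b) = dual b @ dual a" "length (dual a) = length a"
  by (simp_all add: dual_def)

lemma dual_dual [simp]: "dual (dual a) = a"
  by (induction a) auto

text \<open>An evaluation for Ly is obtained from that of Lx by a crossing. The crossing does not change
  the relation, because it preserves the product of the two entries and both evaluations
  require this product to be 1.\<close>

fun ev1 :: "letter \<Rightarrow> mor" where "ev1 Lx = Ev" | "ev1 Ly = Ev \<bullet> Kap Ly Lx"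
fun coev1 :: "letter \<Rightarrow> mor" where "coev1 Lx = Coev" | "coev1 Ly = Kap Ly Lx \<bullet> Coev"

lemma arr_ev1: "arr (ev1 a) [a, flip a] []" and arr_coev1: "arr (coev1 a) [] [flip a, a]"
  by (cases a; auto intro: arr.intros)+

primrec ev_word :: "obj \<Rightarrow> mor" where
  "ev_word [] = Id []"
| "ev_word (x # a) = ev1 x \<bullet> (Id [x] \<boxtimes> (ev_word a \<boxtimes> Id [flip x]))"

primrec coev_word :: "obj \<Rightarrow> mor" where
  "coev_word [] = Id []"
| "coev_word (x # a) = (Id (dual a) \<boxtimes> (coev1 x \<boxtimes> Id a)) \<bullet> coev_word a"

lemma arr_ev_word: "arr (ev_word a) (a @ dual a) []"
proof (induction a)
  case (Cons x a)
  have "arr (Id [x] \<boxtimes> (ev_word a \<boxtimes> Id [flip x])) ([x] @ (a @ dual a) @ [flip x]) ([x] @ [] @ [flip x])"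
    by (intro arr.intros Cons)
  then show ?case using arr_ev1[of x] by (auto intro: arr.intros)
qed (auto intro: arr.intros)

lemma arr_coev_word: "arr (coev_word a) [] (dual a @ a)"
proof (induction a)
  case (Cons x a)
  have "arr (Id (dual a) \<boxtimes> (coev1 x \<boxtimes> Id a)) (dual a @ [] @ a) (dual a @ [flip x, x] @ a)"
    by (intro arr.intros arr_coev1)
  then show ?case using Cons by (auto intro: arr.intros)
qed (auto intro: arr.intros)

text \<open>The mate of Mul with respect to the duality of [Lx] and of [Lx, Lx].\<close>

definition comul_y :: mor where
  "comul_y = (Id [Ly, Ly] \<boxtimes> Ev) \<bullet> (Id [Ly, Ly] \<boxtimes> (Mul \<boxtimes> Id [Ly])) \<bullet> (coev_word [Lx, Lx] \<boxtimes> Id [Ly])"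

lemma arr_comul_y: "arr comul_y [Ly] [Ly, Ly]"
proof -
  have "arr (coev_word [Lx, Lx] \<boxtimes> Id [Ly]) ([] @ [Ly]) ([Ly, Ly, Lx, Lx] @ [Ly])"
    using arr_coev_word[of "[Lx, Lx]"] by (intro arr.intros) auto
  moreover have "arr (Id [Ly, Ly] \<boxtimes> (Mul \<boxtimes> Id [Ly])) ([Ly, Ly] @ [Lx, Lx] @ [Ly]) ([Ly, Ly] @ [Lx] @ [Ly])"
    by (intro arr.intros)
  moreover have "arr (Id [Ly, Ly] \<boxtimes> Ev) ([Ly, Ly] @ [Lx, Ly]) ([Ly, Ly] @ [])"
    by (intro arr.intros)
  ultimately show ?thesis unfolding comul_y_def by (auto intro: arr.intros)
qed

text \<open>The transpose of a morphism, from the dual of its target to the dual of its source. It makes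
  the antipode respect the relations of the coend.\<close>

primrec dual_mor :: "mor \<Rightarrow> mor" where
  "dual_mor (Id a) = Id (dual a)"
| "dual_mor (g \<bullet> f) = dual_mor f \<bullet> dual_mor g"
| "dual_mor (f \<boxtimes> g) = dual_mor g \<boxtimes> dual_mor f"
| "dual_mor Ev = coev1 Ly"
| "dual_mor Coev = ev1 Ly"
| "dual_mor (Kap a b) = Kap (flip a) (flip b)"
| "dual_mor (KapInv a b) = KapInv (flip a) (flip b)"
| "dual_mor Mul = comul_y"
| "dual_mor Unt = Ev \<bullet> (Unt \<boxtimes> Id [Ly])"

lemma arr_dual_mor: "arr f a b \<Longrightarrow> arr (dual_mor f) (dual b) (dual a)"
proof (induction rule: arr.induct)
  case 4 then show ?case using arr_coev1[of Ly] by simp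
next
  case 5 then show ?case using arr_ev1[of Ly] by simp
next
  case 8 then show ?case using arr_comul_y by simp
next
  case 9
  have "arr (Unt \<boxtimes> Id [Ly]) ([] @ [Ly]) ([Lx] @ [Ly])" by (intro arr.intros)
  then show ?case by (auto intro: arr.intros)
qed (auto intro: arr.intros)

context braided_group
begin

lemma sem_ev1: "sem (ev1 a) u v \<longleftrightarrow> sem Ev u v"
proof (cases a)
  case Ly
  have "sem (Ev \<bullet> Kap Ly Lx) u v \<longleftrightarrow> sem Ev u v"
  proof
    assume "sem (Ev \<bullet> Kap Ly Lx) u v"
    then obtain w where w: "sem (Kap Ly Lx) u w" "sem Ev w v" by auto
    then obtain x y where "u = [x, y]" "u \<in> L" using sem_L by auto
    then show "sem Ev u v" using sem_word_prod[OF w(1)] sem_word_prod[OF w(2)] w unfolding sem_Ev by auto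
  next
    assume v: "sem Ev u v"
    then obtain w where w: "sem (Kap Ly Lx) u w" using sem_Kap_total[of u] sem_L by fastforce
    then obtain x y where "w = [x, y]" "w \<in> L" using sem_L by auto
    then have "sem Ev w v" using sem_word_prod[OF v] sem_word_prod[OF w] v unfolding sem_Ev by auto
    then show "sem (Ev \<bullet> Kap Ly Lx) u v" using w by auto
  qed
  then show ?thesis using Ly by simp
qed simp

lemma sem_coev1: "sem (coev1 a) u v \<longleftrightarrow> sem Coev u v"
proof (cases a)
  case Ly
  have "sem (Kap Ly Lx \<bullet> Coev) u v \<longleftrightarrow> sem Coev u v"
  proof
    assume "sem (Kap Ly Lx \<bullet> Coev) u v"
    then obtain w where w: "sem Coev u w" "sem (Kap Ly Lx) w v" by auto
    then obtain x y where "v = [x, y]" "v \<in> L" using sem_L by auto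
    then show "sem Coev u v" using sem_word_prod[OF w(1)] sem_word_prod[OF w(2)] w unfolding sem_Coev by auto
  next
    assume v: "sem Coev u v"
    then obtain w where w: "sem (Kap Ly Lx) w v" using sem_Kap_surj[of v] sem_L[OF v] by fastforce
    then have "w \<in> L" "length w = 2" using sem_L sem_Kap_length by blast+
    then obtain x y where "w = [x, y]" "w \<in> L" by (auto simp: length_Suc_conv numeral_2_eq_2)
    moreover have "u = []" using v by simp
    moreover have "word_prod w = \<one>" using sem_word_prod[OF v] sem_word_prod[OF w] \<open>u = []\<close> by simp
    ultimately have "sem Coev u w" unfolding sem_Coev by simp
    then show "sem (Kap Ly Lx \<bullet> Coev) u v" using w unfolding sem.simps(2) by blast
  qed
  then show ?thesis using Ly by simp
qed simp

lemma sem_ev_word: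
  "sem (ev_word a) u v \<longleftrightarrow> v = [] \<and> (\<exists>p\<in>L. length p = length a \<and> u = p @ dualize p)"
proof (induction a arbitrary: u v)
  case (Cons x a)
  show ?case
  proof
    assume "sem (ev_word (x # a)) u v"
    then obtain w where w: "sem (Id [x] \<boxtimes> (ev_word a \<boxtimes> Id [flip x])) u w" "sem (ev1 x) w v"
      by (auto simp del: sem.simps(3))
    then obtain s p t where *: "u = s @ (p @ dualize p) @ t" "w = s @ [] @ t" "s \<in> L" "t \<in> L"
      "length s = 1" "length t = 1" "p \<in> L" "length p = length a"
      unfolding sem_Id_Tens sem_Tens_Id Cons.IH by (auto simp: in_lists_conv_set)
    then obtain y z where "s = [y]" "t = [z]" by (auto simp: length_Suc_conv)
    with w(2) * have "z = inv y" "y \<in> carrier G" "v = []" unfolding sem_ev1 by auto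
    then show "v = [] \<and> (\<exists>p\<in>L. length p = length (x # a) \<and> u = p @ dualize p)"
      using * \<open>s = [y]\<close> \<open>t = [z]\<close> by (intro conjI bexI[of _ "y # p"]) auto
  next
    assume "v = [] \<and> (\<exists>p\<in>L. length p = length (x # a) \<and> u = p @ dualize p)"
    then obtain y p where p: "v = []" "y \<in> carrier G" "p \<in> L" "length p = length a"
      "u = [y] @ (p @ dualize p) @ [inv y]" by (auto simp: length_Suc_conv in_lists_conv_set)
    have "sem (ev_word a \<boxtimes> Id [flip x]) ((p @ dualize p) @ [inv y]) ([] @ [inv y])"
      by (subst sem_Tens_Id_append) (use p in \<open>auto simp: Cons.IH\<close>)
    then have "sem (Id [x] \<boxtimes> (ev_word a \<boxtimes> Id [flip x])) u ([y] @ [inv y])"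
      by (subst p(5), subst sem_Id_Tens_append) (use p in auto)
    moreover have "sem (ev1 x) ([y] @ [inv y]) v" unfolding sem_ev1 using p by auto
    ultimately show "sem (ev_word (x # a)) u v" by (auto simp del: sem.simps(3))
  qed
qed auto

lemma sem_coev_word:
  "sem (coev_word a) u v \<longleftrightarrow> u = [] \<and> (\<exists>p\<in>L. length p = length a \<and> v = dualize p @ p)"
proof (induction a arbitrary: u v)
  case (Cons x a)
  show ?case
  proof
    assume "sem (coev_word (x # a)) u v"
    then obtain w where w: "sem (coev_word a) u w" "sem (Id (dual a) \<boxtimes> (coev1 x \<boxtimes> Id a)) w v"
      by (auto simp del: sem.simps(3))
    then obtain p where p: "u = []" "p \<in> L" "length p = length a" "w = dualize p @ p"
      unfolding Cons.IH by auto
    obtain v1 where v1: "v = dualize p @ v1" "sem (coev1 x \<boxtimes> Id a) ([] @ p) v1"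
      using w(2) sem_Id_Tens_append[of "dualize p" "dual a" "coev1 x \<boxtimes> Id a" p v] p by auto
    then obtain v2 where v2: "v1 = v2 @ p" "sem (coev1 x) [] v2"
      using sem_Tens_Id_append[OF p(3)] by blast
    then obtain y where "y \<in> carrier G" "v2 = [inv y, y]" unfolding sem_coev1 by auto
    then show "u = [] \<and> (\<exists>p\<in>L. length p = length (x # a) \<and> v = dualize p @ p)"
      using p v1 v2 by (intro conjI bexI[of _ "y # p"]) auto
  next
    assume "u = [] \<and> (\<exists>p\<in>L. length p = length (x # a) \<and> v = dualize p @ p)"
    then obtain y p where p: "u = []" "y \<in> carrier G" "p \<in> L" "length p = length a"
      "v = dualize p @ [inv y, y] @ p" by (auto simp: length_Suc_conv in_lists_conv_set)
    have "sem (coev1 x \<boxtimes> Id a) ([] @ p) ([inv y, y] @ p)"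
      by (subst sem_Tens_Id_append) (use p in \<open>auto simp: sem_coev1\<close>)
    then have "sem (Id (dual a) \<boxtimes> (coev1 x \<boxtimes> Id a)) (dualize p @ p) v"
      by (subst sem_Id_Tens_append) (use p in \<open>auto\<close>)
    moreover have "sem (coev_word a) u (dualize p @ p)" unfolding Cons.IH using p by auto
    ultimately show "sem (coev_word (x # a)) u v" by (auto simp del: sem.simps(3))
  qed
qed auto

lemma sem_comul_y: "sem comul_y u v \<longleftrightarrow>
   (\<exists>x\<in>carrier G. \<exists>y\<in>carrier G. v = [x, y] \<and> u = [x \<otimes> y])"
proof
  assume "sem comul_y u v"
  then obtain w1 w2 where w: "sem (coev_word [Lx, Lx] \<boxtimes> Id [Ly]) u w1"
    "sem (Id [Ly, Ly] \<boxtimes> (Mul \<boxtimes> Id [Ly])) w1 w2" "sem (Id [Ly, Ly] \<boxtimes> Ev) w2 v"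
    unfolding comul_y_def sem.simps(2) by (elim exE conjE) (rule that)
  obtain p s where p: "p \<in> L" "length p = 2" "length s = 1" "s \<in> L" "u = s" "w1 = (dualize p @ p) @ s"
    using w(1) unfolding sem_Tens_Id sem_coev_word by (auto simp: in_lists_conv_set)
  then obtain x y z where xyz: "p = [x, y]" "s = [z]" "x \<in> carrier G" "y \<in> carrier G" "z \<in> carrier G"
    by (auto simp: length_Suc_conv numeral_2_eq_2)
  obtain w2' where w2: "w2 = [inv y, inv x] @ w2'" "sem (Mul \<boxtimes> Id [Ly]) ([x, y] @ [z]) w2'"
    using w(2) sem_Id_Tens_append[of "[inv y, inv x]" "[Ly, Ly]" "Mul \<boxtimes> Id [Ly]" "[x, y, z]" w2] p xyz
    by (auto simp del: sem.simps(3))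
  then have w2': "w2' = [x \<otimes> y, z]"
    using sem_Tens_Id_append[of "[z]" "[Ly]" Mul "[x, y]" w2'] by (auto simp del: sem.simps(3))
  obtain v' where "v = [inv y, inv x] @ v'" "sem Ev [x \<otimes> y, z] v'"
    using w(3) sem_Id_Tens_append[of "[inv y, inv x]" "[Ly, Ly]" Ev "[x \<otimes> y, z]" v] w2 w2'
    by (auto simp del: sem.simps(3))
  then show "\<exists>x\<in>carrier G. \<exists>y\<in>carrier G. v = [x, y] \<and> u = [x \<otimes> y]"
    using xyz p by (auto simp: inv_mult_group)
next
  assume "\<exists>x\<in>carrier G. \<exists>y\<in>carrier G. v = [x, y] \<and> u = [x \<otimes> y]"
  then obtain x y where xy: "x \<in> carrier G" "y \<in> carrier G" "v = [x, y]" "u = [] @ [x \<otimes> y]" by auto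
  have "sem (coev_word [Lx, Lx]) [] [x, y, inv y, inv x]"
    unfolding sem_coev_word using xy by (intro conjI bexI[of _ "[inv y, inv x]"]) auto
  then have 1: "sem (coev_word [Lx, Lx] \<boxtimes> Id [Ly]) u ([x, y, inv y, inv x] @ [x \<otimes> y])"
    unfolding xy(4) by (subst sem_Tens_Id_append) (use xy in auto)
  have "sem (Mul \<boxtimes> Id [Ly]) ([inv y, inv x] @ [x \<otimes> y]) ([inv (x \<otimes> y)] @ [x \<otimes> y])"
    by (subst sem_Tens_Id_append) (use xy in \<open>auto simp: inv_mult_group\<close>)
  then have 2: "sem (Id [Ly, Ly] \<boxtimes> (Mul \<boxtimes> Id [Ly])) ([x, y] @ ([inv y, inv x] @ [x \<otimes> y]))
      ([x, y] @ [inv (x \<otimes> y)] @ [x \<otimes> y])"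
    by (subst sem_Id_Tens_append) (use xy in auto)
  have "sem Ev ([inv (x \<otimes> y)] @ [x \<otimes> y]) []" unfolding sem_Ev using xy by auto
  then have 3: "sem (Id [Ly, Ly] \<boxtimes> Ev) ([x, y] @ [inv (x \<otimes> y)] @ [x \<otimes> y]) v"
    by (subst sem_Id_Tens_append) (use xy in auto)
  show "sem comul_y u v"
    using 1 2 3 unfolding comul_y_def sem.simps(2) append.simps by blast
qed

lemma sem_dual_mor1: "sem f u v \<Longrightarrow> sem (dual_mor f) (dualize v) (dualize u)"
proof (induction f arbitrary: u v)
  case (Id a) then show ?case by (auto simp: in_lists_conv_set)
next
  case (Comp f g) then show ?case unfolding dual_mor.simps sem.simps by blast
next
  case (Tens f g)
  then obtain u1 u2 v1 v2 where *: "u = u1 @ u2" "v = v1 @ v2" "sem f u1 v1" "sem g u2 v2" by auto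
  show ?case unfolding *(1,2) dualize_simps dual_mor.simps sem.simps(3)
    using Tens.IH(1)[OF *(3)] Tens.IH(2)[OF *(4)] by blast
next
  case Ev then show ?case unfolding dual_mor.simps sem_coev1 by auto
next
  case Coev then show ?case unfolding dual_mor.simps sem_ev1 by auto
next
  case (Kap a b)
  then show ?case using r_inv_both[OF prod.collapse[symmetric]] by auto
next
  case (KapInv a b)
  then show ?case using r_inv_both[OF prod.collapse[symmetric]] by auto
next
  case Mul then show ?case unfolding dual_mor.simps sem_comul_y by (auto simp: inv_mult_group)
next
  case Unt
  have "sem (Unt \<boxtimes> Id [Ly]) ([] @ [\<one>]) ([\<one>] @ [\<one>])"
    unfolding sem_Tens_Id by (intro exI conjI) auto
  moreover have "sem Ev [\<one>, \<one>] []" using inv_one by fastforce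
  ultimately show ?case using Unt by (auto simp del: sem.simps(3))
qed

lemma sem_dual_mor2: "sem (dual_mor f) v u \<Longrightarrow> sem f (dualize u) (dualize v)"
proof (induction f arbitrary: u v)
  case (Id a) then show ?case by (auto simp: in_lists_conv_set)
next
  case (Comp f g) then show ?case unfolding dual_mor.simps sem.simps by blast
next
  case (Tens f g)
  then obtain u1 u2 v1 v2 where *: "u = u1 @ u2" "v = v1 @ v2" "sem (dual_mor g) v1 u1" "sem (dual_mor f) v2 u2"
    by auto
  show ?case unfolding *(1,2) dualize_simps dual_mor.simps sem.simps(3)
    using Tens.IH(2)[OF *(3)] Tens.IH(1)[OF *(4)] by blast
next
  case Ev then show ?case unfolding dual_mor.simps sem_coev1 by auto
next
  case Coev then show ?case unfolding dual_mor.simps sem_ev1 by auto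
next
  case (Kap a b)
  then show ?case using r_inv_both[OF prod.collapse[symmetric]] by auto
next
  case (KapInv a b)
  then show ?case using r_inv_both[OF prod.collapse[symmetric]] by auto
next
  case Mul then show ?case unfolding dual_mor.simps sem_comul_y by (auto simp: inv_mult_group)
next
  case Unt
  then show ?case by (auto simp: length_Suc_conv)
qed

lemma sem_dual_mor:
  "u \<in> L \<Longrightarrow> v \<in> L \<Longrightarrow> sem (dual_mor f) (dualize v) (dualize u) \<longleftrightarrow> sem f u v"
  using sem_dual_mor1[of f u v] sem_dual_mor2[of f "dualize v" "dualize u"] by auto

section \<open>The functor on points\<close>

definition coords :: "obj \<Rightarrow> 'a list \<Rightarrow> 'a list" where
  "coords a p = map2 val a p"

lemma coords_simps [simp]: "coords [] p = []" "coords a [] = []" "coords (x # a) (y # p) = val x y # coords a p"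
  "length (coords a p) = min (length a) (length p)"
  by (auto simp: coords_def)

lemma coords_append [simp]: "length p = length a \<Longrightarrow> coords (a @ b) (p @ q) = coords a p @ coords b q"
  by (simp add: coords_def)

lemma points_iff: "p \<in> points G a \<longleftrightarrow> p \<in> L \<and> length p = length a"
  by (auto simp: points_def in_lists_conv_set)

lemma points_simps [simp]: "p \<in> points G [] \<longleftrightarrow> p = []"
  "x # p \<in> points G (z # as) \<longleftrightarrow> x \<in> carrier G \<and> p \<in> points G as"
  "rev p \<in> points G (dual a) \<longleftrightarrow> p \<in> points G a"
  by (auto simp: points_def)

lemma points_append [simp]: "p \<in> points G a \<Longrightarrow> q \<in> points G b \<Longrightarrow> p @ q \<in> points G (a @ b)"
  by (auto simp: points_def)

lemma points_appendE:
  assumes "p \<in> points G (a @ b)"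
  obtains p1 p2 where "p = p1 @ p2" "p1 \<in> points G a" "p2 \<in> points G b"
proof (rule that[of "take (length a) p" "drop (length a) p"])
qed (use assms in \<open>auto simp: points_def dest: in_set_takeD in_set_dropD\<close>)

lemma coords_points: "p \<in> points G a \<Longrightarrow> coords a p \<in> points G a"
proof (induction a arbitrary: p)
  case (Cons x a) then show ?case by (cases p) (auto simp: points_def)
qed (auto simp: points_def)

lemma coords_dec: "p \<in> points G a \<Longrightarrow> coords a (coords a p) = p"
proof (induction a arbitrary: p)
  case (Cons x a) then show ?case by (cases p) (auto simp: points_def)
qed (auto simp: points_def)

lemma coords_inj: "p \<in> points G a \<Longrightarrow> q \<in> points G a \<Longrightarrow> coords a p = coords a q \<longleftrightarrow> p = q"
  by (metis coords_dec)

lemma coords_in_L: "p \<in> points G a \<Longrightarrow> coords a p \<in> L" "p \<in> points G a \<Longrightarrow> length (coords a p) = length a"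
  using coords_points[of p a] by (auto simp: points_iff)

lemma coords_dual: "p \<in> points G a \<Longrightarrow> coords (dual a) (rev p) = dualize (coords a p)"
proof (induction a arbitrary: p)
  case (Cons x a)
  then obtain y q where "p = y # q" by (cases p) (auto simp: points_def)
  moreover have "val (flip x) y = inv (val x y)" if "y \<in> carrier G"
    using that by (cases x) (auto simp: val_def)
  ultimately show ?case using Cons by (auto simp: points_def)
qed (auto simp: points_def)

text \<open>The functor on points is the relation of the term read in coordinates.\<close>

lemma omega_iff_sem:
  "arr f a b \<Longrightarrow> q \<in> omega_term G r f p \<longleftrightarrow>
     p \<in> points G a \<and> q \<in> points G b \<and> sem f (coords a p) (coords b q)"
proof (induction arbitrary: p q rule: arr.induct)
  case (1 a)
  then show ?case
    using coords_in_L[of p a] by (auto simp: coords_inj simp del: in_lists_conv_set)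
next
  case (2 f a b g c)
  have "(\<exists>w. sem f (coords a p) w \<and> sem g w (coords c q)) \<longleftrightarrow>
      (\<exists>w\<in>points G b. sem f (coords a p) (coords b w) \<and> sem g (coords b w) (coords c q))"
    if "p \<in> points G a" "q \<in> points G c"
  proof
    assume "\<exists>w. sem f (coords a p) w \<and> sem g w (coords c q)"
    then obtain w where w: "sem f (coords a p) w" "sem g w (coords c q)" by blast
    then have "w \<in> points G b" using sem_length_L[OF 2(1)] by (auto simp: points_iff)
    then show "\<exists>w\<in>points G b. sem f (coords a p) (coords b w) \<and> sem g (coords b w) (coords c q)"
      using w coords_dec coords_points by (intro bexI[of _ "coords b w"]) auto
  qed blast
  moreover have "q \<in> omega_term G r (g \<bullet> f) p \<longleftrightarrow>
    (\<exists>w. w \<in> omega_term G r f p \<and> q \<in> omega_term G r g w)" by auto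
  ultimately show ?case unfolding "2.IH" sem.simps by blast
next
  case (3 f a b g c d)
  show ?case
  proof
    assume "q \<in> omega_term G r (f \<boxtimes> g) p"
    then obtain q1 q2 p1 p2 where *: "q = q1 @ q2" "p = p1 @ p2" "q1 \<in> omega_term G r f p1"
      "q2 \<in> omega_term G r g p2" by auto
    then have "length p1 = length a" "length q1 = length b" using 3 by (auto simp: points_def)
    then show "p \<in> points G (a @ c) \<and> q \<in> points G (b @ d) \<and> sem (f \<boxtimes> g) (coords (a @ c) p) (coords (b @ d) q)"
      using * 3 by auto
  next
    assume *: "p \<in> points G (a @ c) \<and> q \<in> points G (b @ d) \<and> sem (f \<boxtimes> g) (coords (a @ c) p) (coords (b @ d) q)"
    obtain p1 p2 where p: "p = p1 @ p2" "p1 \<in> points G a" "p2 \<in> points G c"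
      using * by (auto elim: points_appendE)
    obtain q1 q2 where q: "q = q1 @ q2" "q1 \<in> points G b" "q2 \<in> points G d"
      using * by (auto elim: points_appendE)
    have len: "length p1 = length a" "length q1 = length b" using p q by (auto simp: points_def)
    obtain u1 u2 v1 v2 where u: "coords a p1 @ coords c p2 = u1 @ u2" "coords b q1 @ coords d q2 = v1 @ v2"
      "sem f u1 v1" "sem g u2 v2" using * p q len by auto
    have "u1 = coords a p1" "v1 = coords b q1" "u2 = coords c p2" "v2 = coords d q2"
      using u sem_length_L[OF 3(1) u(3)] coords_in_L[OF p(2)] coords_in_L[OF q(2)] by auto
    then show "q \<in> omega_term G r (f \<boxtimes> g) p" using u p q 3 by auto
  qed
next
  case 4
  have "inv y = inv x \<longleftrightarrow> y = x" if "x \<in> carrier G" "y \<in> carrier G" for x y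
    using that inj_onD[OF inv_inj] by blast
  then show ?case by (auto simp: points_def length_Suc_conv val_def)
next
  case 5
  have "inv y = inv x \<longleftrightarrow> y = x" if "x \<in> carrier G" "y \<in> carrier G" for x y
    using that inj_onD[OF inv_inj] by blast
  then show ?case by (auto simp: points_def length_Suc_conv val_def)
next
  case (6 a b)
  have k: "kap_map G r a b (x, y) = (val b (fst (r (val a x, val b y))), val a (snd (r (val a x, val b y))))"
    if "x \<in> carrier G" "y \<in> carrier G" for x y
    using kap_map_eq[OF that prod.collapse[symmetric]] .
  have v: "val a x = y \<longleftrightarrow> x = val a y" if "x \<in> carrier G" "y \<in> carrier G" for a x y
    using that by auto
  show ?case by (auto simp: points_def length_Suc_conv k v) (metis val_closed val_val)
next
  case (7 a b)
  have k: "kap_map G r a b (x, y) = (val b (fst (r (val a x, val b y))), val a (snd (r (val a x, val b y))))"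
    if "x \<in> carrier G" "y \<in> carrier G" for x y
    using kap_map_eq[OF that prod.collapse[symmetric]] .
  have v: "val a x = y \<longleftrightarrow> x = val a y" if "x \<in> carrier G" "y \<in> carrier G" for a x y
    using that by auto
  show ?case by (auto simp: points_def length_Suc_conv k v) (metis val_closed val_val)
next
  case 8
  show ?case by (auto simp: points_def length_Suc_conv val_def)
next
  case 9
  show ?case by (auto simp: points_def length_Suc_conv val_def)
qed

lemma arr_braid1: "arr (braid1 a bs) (a # bs) (bs @ [a])"
proof (induction bs)
  case (Cons b bs)
  have "arr (Kap a b \<boxtimes> Id bs) ([a, b] @ bs) ([b, a] @ bs)" by (intro arr.intros)
  moreover have "arr (Id [b] \<boxtimes> braid1 a bs) ([b] @ (a # bs)) ([b] @ (bs @ [a]))" by (intro arr.intros Cons)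
  ultimately show ?case by (auto intro: arr.intros)
qed (auto intro: arr.intros)

lemma arr_braid: "arr (braid a b) (a @ b) (b @ a)"
proof (induction a)
  case (Cons x a)
  have "arr (Id [x] \<boxtimes> braid a b) ([x] @ (a @ b)) ([x] @ (b @ a))" by (intro arr.intros Cons)
  moreover have "arr (braid1 x b \<boxtimes> Id a) ((x # b) @ a) ((b @ [x]) @ a)" by (intro arr.intros arr_braid1)
  ultimately show ?case by (auto intro: arr.intros)
qed (auto intro: arr.intros)

text \<open>By soundness all representatives of a morphism act in the same way.\<close>

lemma omega_m_class:
  assumes "arr f a b"
  shows "omega_m G r (mor_rel a b `` {f}) P = (\<Union>p\<in>P. omega_term G r f p)"
proof -
  have "omega_term G r g p = omega_term G r f p" if "g \<in> mor_rel a b `` {f}" for g p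
    using that sem_sound[of a b f g] omega_iff_sem[OF assms] omega_iff_sem[of g a b]
    by (auto simp: mor_rel_def)
  moreover have "f \<in> mor_rel a b `` {f}" using assms mor_eq.refl by (auto simp: mor_rel_def)
  ultimately show ?thesis unfolding omega_m_def by blast
qed

lemma Hom_iff: "F \<in> Hom a b \<longleftrightarrow> (\<exists>f. arr f a b \<and> F = mor_rel a b `` {f})"
  unfolding Hom_def quotient_def by auto

text \<open>The bijection of pairs of points by which the braiding of a and b acts.\<close>

definition kappa_map :: "obj \<Rightarrow> obj \<Rightarrow> 'a list \<Rightarrow> 'a list \<Rightarrow> 'a list \<times> 'a list" where
  "kappa_map a b p s = (let (t, q) = cross (coords a p) (coords b s) in (coords b t, coords a q))"

lemma kappa_map_iff:
  assumes "p \<in> points G a" "s \<in> points G b"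
  shows "kappa_map a b p s = (t, q) \<longleftrightarrow>
    t \<in> points G b \<and> q \<in> points G a \<and> cross (coords a p) (coords b s) = (coords b t, coords a q)"
proof -
  obtain t' q' where c: "cross (coords a p) (coords b s) = (t', q')" by fastforce
  have "t' \<in> points G b" "q' \<in> points G a"
    using cross_closed[OF c] coords_in_L[OF assms(1)] coords_in_L[OF assms(2)] by (auto simp: points_iff)
  then show ?thesis using c unfolding kappa_map_def by (auto simp: coords_points coords_dec)
qed

lemma kappa_map_closed:
  assumes "kappa_map a b p s = (t, q)" "p \<in> points G a" "s \<in> points G b"
  shows "t \<in> points G b" "q \<in> points G a"
  using assms kappa_map_iff by auto

lemma omega_m_kappa:
  assumes "p \<in> points G a" "s \<in> points G b"
  shows "omega_m G r (kappa a b) {p @ s} = {fst (kappa_map a b p s) @ snd (kappa_map a b p s)}"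
proof -
  obtain t q where k: "kappa_map a b p s = (t, q)" by fastforce
  note c = k[unfolded kappa_map_iff[OF assms]]
  have len: "length p = length a" "length t = length b" using assms c by (auto simp: points_iff)
  have "u \<in> omega_term G r (braid a b) (p @ s) \<longleftrightarrow> u = t @ q" for u
  proof -
    have "u \<in> omega_term G r (braid a b) (p @ s) \<longleftrightarrow>
      u \<in> points G (b @ a) \<and> sem (braid a b) (coords a p @ coords b s) (coords (b @ a) u)"
      using omega_iff_sem[OF arr_braid] assms len by auto
    also have "sem (braid a b) (coords a p @ coords b s) (coords (b @ a) u) \<longleftrightarrow> coords (b @ a) u = coords b t @ coords a q"
      (is "?l \<longleftrightarrow> ?r")
    proof
      assume ?l
      then obtain xs ys where *: "coords a p @ coords b s = xs @ ys" "length xs = length a"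
        "coords (b @ a) u = fst (cross xs ys) @ snd (cross xs ys)" unfolding sem_braid by blast
      then have "xs = coords a p" "ys = coords b s" using coords_in_L[OF assms(1)] by auto
      then show ?r using * c by simp
    next
      assume ?r
      then show ?l unfolding sem_braid using coords_in_L[OF assms(1)] coords_in_L[OF assms(2)] c
        by (intro bexI[of _ "coords a p"] bexI[of _ "coords b s"] conjI) auto
    qed
    also have "u \<in> points G (b @ a) \<and> coords (b @ a) u = coords b t @ coords a q \<longleftrightarrow> u = t @ q"
      using coords_inj[of u "b @ a" "t @ q"] c len by auto
    finally show ?thesis .
  qed
  then show ?thesis using k unfolding kappa_def omega_m_class[OF arr_braid] by auto
qed

lemma kappa_map_surj:
  assumes "t \<in> points G b" "q \<in> points G a"
  obtains p s where "p \<in> points G a" "s \<in> points G b" "kappa_map a b p s = (t, q)"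
proof -
  obtain u v where uv: "u \<in> L" "v \<in> L" "cross u v = (coords b t, coords a q)"
    using cross_surj[OF coords_in_L(1)[OF assms(1)] coords_in_L(1)[OF assms(2)]] by metis
  then have "u \<in> points G a" "v \<in> points G b"
    using cross_closed[OF uv(3)] coords_in_L(2)[OF assms(1)] coords_in_L(2)[OF assms(2)] by (auto simp: points_iff)
  then show thesis using that[of "coords a u" "coords b v"] uv assms by (simp add: kappa_map_iff coords_points coords_dec)
qed

lemma kappa_map_inj:
  assumes "kappa_map a b p s = (t, q)" "kappa_map a b p' s' = (t, q)"
    and "p \<in> points G a" "s \<in> points G b" "p' \<in> points G a" "s' \<in> points G b"
  shows "p = p'" "s = s'"
proof -
  have "coords a p = coords a p' \<and> coords b s = coords b s'"
    using assms coords_in_L by (intro cross_inj[of _ _ "coords b t" "coords a q"]) (auto simp: kappa_map_iff)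
  then show "p = p'" "s = s'" using assms by (auto simp: coords_inj)
qed

text \<open>The braiding of the dual of a is a partial transpose of the inverse braiding of a. This
  identifies the convolution inverse of the co-quasitriangular structure.\<close>

lemma kappa_map_dual:
  assumes "p \<in> points G a" "q \<in> points G a" "s \<in> points G b" "t \<in> points G b"
  shows "kappa_map (dual a) b (rev q) s = (t, rev p) \<longleftrightarrow> kappa_map a b q t = (s, p)"
proof -
  have "cross (dualize (coords a q)) (coords b s) = (coords b t, dualize (coords a p)) \<longleftrightarrow>
    cross (coords a q) (coords b t) = (coords b s, coords a p)"
    using cross_dualize_left[of "coords a q" "coords b t" "coords b s" "coords a p"]
      cross_dualize_left[of "dualize (coords a q)" "coords b s" "coords b t" "dualize (coords a p)"] assms coords_in_L(1)
    by auto
  then show ?thesis using assms by (simp add: kappa_map_iff coords_dual)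
qed

lemma kappa_map_append_left:
  assumes "p \<in> points G a" "p2 \<in> points G a2" "s \<in> points G b" "q \<in> points G a" "q2 \<in> points G a2" "t \<in> points G b"
  shows "kappa_map (a @ a2) b (p @ p2) s = (t, q @ q2) \<longleftrightarrow>
    (\<exists>l\<in>points G b. kappa_map a2 b p2 s = (l, q2) \<and> kappa_map a b p l = (t, q))"
proof -
  have len: "length p = length a" "length q = length a" using assms by (auto simp: points_iff)
  obtain l x2 where 1: "kappa_map a2 b p2 s = (l, x2)" by fastforce
  note l = kappa_map_closed[OF 1 assms(2,3)]
  obtain t' x where 2: "kappa_map a b p l = (t', x)" by fastforce
  note t = kappa_map_closed[OF 2 assms(1) l(1)]
  have "length x = length a" using t by (auto simp: points_iff)
  then have "kappa_map (a @ a2) b (p @ p2) s = (t', x @ x2)"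
    using 1 2 assms l t len by (auto simp: kappa_map_iff cross_append_left)
  moreover have "x @ x2 = q @ q2 \<longleftrightarrow> x = q \<and> x2 = q2" using t len by (auto simp: points_iff)
  ultimately show ?thesis using 1 2 l by auto
qed

lemma kappa_map_append_right:
  assumes "p \<in> points G a" "s \<in> points G b" "s2 \<in> points G b2" "q \<in> points G a" "t \<in> points G b" "t2 \<in> points G b2"
  shows "kappa_map a (b @ b2) p (s @ s2) = (t @ t2, q) \<longleftrightarrow>
    (\<exists>l\<in>points G a. kappa_map a b p s = (t, l) \<and> kappa_map a b2 l s2 = (t2, q))"
proof -
  have len: "length s = length b" "length t = length b" using assms by (auto simp: points_iff)
  obtain x l where 1: "kappa_map a b p s = (x, l)" by fastforce
  note l = kappa_map_closed[OF 1 assms(1,2)]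
  obtain x2 q' where 2: "kappa_map a b2 l s2 = (x2, q')" by fastforce
  note t = kappa_map_closed[OF 2 l(2) assms(3)]
  have "length x = length b" using l by (auto simp: points_iff)
  then have "kappa_map a (b @ b2) p (s @ s2) = (x @ x2, q')"
    using 1 2 assms l t len by (auto simp: kappa_map_iff cross_append_right)
  moreover have "x @ x2 = t @ t2 \<longleftrightarrow> x = t \<and> x2 = t2" using l len by (auto simp: points_iff)
  ultimately show ?thesis using 1 2 l by auto
qed

abbreviation W :: "mor \<Rightarrow> 'a list \<Rightarrow> 'a list \<Rightarrow> bool" where
  "W f p q \<equiv> q \<in> omega_term G r f p"

lemma W_points: "arr f a b \<Longrightarrow> W f p q \<Longrightarrow> p \<in> points G a" "arr f a b \<Longrightarrow> W f p q \<Longrightarrow> q \<in> points G b"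
  using omega_iff_sem by blast+

text \<open>The braiding of points is natural in its first argument, here expressed by the action of
  terms.\<close>

lemma kappa_map_natural_left:
  assumes f: "arr f a b" and p: "p \<in> points G a" "s \<in> points G c" "t \<in> points G c" "q \<in> points G b"
  shows "(\<exists>p'. W f p p' \<and> kappa_map b c p' s = (t, q)) \<longleftrightarrow>
    (\<exists>q'\<in>points G a. kappa_map a c p s = (t, q') \<and> W f q' q)"
proof
  assume "\<exists>p'. W f p p' \<and> kappa_map b c p' s = (t, q)"
  then obtain p' where p': "W f p p'" "kappa_map b c p' s = (t, q)" by blast
  have pb: "p' \<in> points G b" using W_points[OF f p'(1)] by simp
  have "cross (coords b p') (coords c s) = (coords c t, coords b q)" using p'(2) pb p by (simp add: kappa_map_iff)
  moreover have "sem f (coords a p) (coords b p')" using p'(1) omega_iff_sem[OF f] by simp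
  ultimately obtain v where v: "cross (coords a p) (coords c s) = (coords c t, v)" "sem f v (coords b q)"
    using natural_leftD1[OF natural_left] coords_in_L p by metis
  have "v \<in> points G a"
    using cross_closed[OF v(1)] coords_in_L[OF p(1)] coords_in_L[OF p(2)] by (auto simp: points_iff)
  then show "\<exists>q'\<in>points G a. kappa_map a c p s = (t, q') \<and> W f q' q"
    using v p by (intro bexI[of _ "coords a v"]) (auto simp: kappa_map_iff omega_iff_sem[OF f] coords_dec coords_points)
next
  assume "\<exists>q'\<in>points G a. kappa_map a c p s = (t, q') \<and> W f q' q"
  then obtain q' where q': "q' \<in> points G a" "kappa_map a c p s = (t, q')" "W f q' q" by blast
  have "cross (coords a p) (coords c s) = (coords c t, coords a q')" using q' p by (simp add: kappa_map_iff)
  moreover have "sem f (coords a q') (coords b q)" using q'(3) omega_iff_sem[OF f] by simp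
  ultimately obtain v where v: "sem f (coords a p) v" "cross v (coords c s) = (coords c t, coords b q)"
    using natural_leftD2[OF natural_left] coords_in_L p by metis
  have "v \<in> points G b" using sem_length_L[OF f v(1)] by (auto simp: points_iff)
  then show "\<exists>p'. W f p p' \<and> kappa_map b c p' s = (t, q)"
    using v p by (intro exI[of _ "coords b v"]) (auto simp: kappa_map_iff omega_iff_sem[OF f] coords_dec coords_points)
qed

lemma kappa_map_natural_right:
  assumes f: "arr f a b" and p: "p \<in> points G a" "s \<in> points G c" "t \<in> points G c" "q \<in> points G b"
  shows "(\<exists>p'. W f p p' \<and> kappa_map c b s p' = (q, t)) \<longleftrightarrow>
    (\<exists>q'\<in>points G a. kappa_map c a s p = (q', t) \<and> W f q' q)"
proof
  assume "\<exists>p'. W f p p' \<and> kappa_map c b s p' = (q, t)"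
  then obtain p' where p': "W f p p'" "kappa_map c b s p' = (q, t)" by blast
  have pb: "p' \<in> points G b" using W_points[OF f p'(1)] by simp
  have "cross (coords c s) (coords b p') = (coords b q, coords c t)" using p'(2) pb p by (simp add: kappa_map_iff)
  moreover have "sem f (coords a p) (coords b p')" using p'(1) omega_iff_sem[OF f] by simp
  ultimately obtain v where v: "cross (coords c s) (coords a p) = (v, coords c t)" "sem f v (coords b q)"
    using natural_rightD1[OF natural_right] coords_in_L p by metis
  have "v \<in> points G a"
    using cross_closed[OF v(1)] coords_in_L[OF p(1)] coords_in_L[OF p(2)] by (auto simp: points_iff)
  then show "\<exists>q'\<in>points G a. kappa_map c a s p = (q', t) \<and> W f q' q"
    using v p by (intro bexI[of _ "coords a v"]) (auto simp: kappa_map_iff omega_iff_sem[OF f] coords_dec coords_points)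
next
  assume "\<exists>q'\<in>points G a. kappa_map c a s p = (q', t) \<and> W f q' q"
  then obtain q' where q': "q' \<in> points G a" "kappa_map c a s p = (q', t)" "W f q' q" by blast
  have "cross (coords c s) (coords a p) = (coords a q', coords c t)" using q' p by (simp add: kappa_map_iff)
  moreover have "sem f (coords a q') (coords b q)" using q'(3) omega_iff_sem[OF f] by simp
  ultimately obtain v where v: "sem f (coords a p) v" "cross (coords c s) v = (coords b q, coords c t)"
    using natural_rightD2[OF natural_right] coords_in_L p by metis
  have "v \<in> points G b" using sem_length_L[OF f v(1)] by (auto simp: points_iff)
  then show "\<exists>p'. W f p p' \<and> kappa_map c b s p' = (q, t)"
    using v p by (intro exI[of _ "coords b v"]) (auto simp: kappa_map_iff omega_iff_sem[OF f] coords_dec coords_points)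
qed

lemma W_dual_mor:
  assumes "arr f a b" "p \<in> points G a" "q \<in> points G b"
  shows "W (dual_mor f) (rev q) (rev p) \<longleftrightarrow> W f p q"
  using omega_iff_sem[OF assms(1)] omega_iff_sem[OF arr_dual_mor[OF assms(1)]] assms
  by (simp add: coords_dual sem_dual_mor coords_in_L)

lemma W_ev_word:
  assumes "p \<in> points G a" "q \<in> points G (dual a)"
  shows "W (ev_word a) (p @ q) [] \<longleftrightarrow> q = rev p"
proof -
  have len: "length p = length a" using assms by (auto simp: points_iff)
  have "W (ev_word a) (p @ q) [] \<longleftrightarrow> sem (ev_word a) (coords a p @ coords (dual a) q) []"
    using omega_iff_sem[OF arr_ev_word] assms len by simp
  also have "\<dots> \<longleftrightarrow> coords (dual a) q = dualize (coords a p)"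
    unfolding sem_ev_word using coords_in_L[OF assms(1)] by (auto intro!: bexI[of _ "coords a p"])
  also have "\<dots> \<longleftrightarrow> q = rev p"
    using assms coords_inj[OF assms(2), of "rev p"] by (simp add: coords_dual[symmetric])
  finally show ?thesis .
qed

lemma W_coev_word:
  assumes "q \<in> points G (dual a)" "p \<in> points G a"
  shows "W (coev_word a) [] (q @ p) \<longleftrightarrow> q = rev p"
proof -
  have len: "length q = length (dual a)" using assms by (auto simp: points_iff)
  have "W (coev_word a) [] (q @ p) \<longleftrightarrow> sem (coev_word a) [] (coords (dual a) q @ coords a p)"
    using omega_iff_sem[OF arr_coev_word] assms len by simp
  also have "\<dots> \<longleftrightarrow> coords (dual a) q = dualize (coords a p)"
    unfolding sem_coev_word using coords_in_L[OF assms(1)] coords_in_L[OF assms(2)]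
    by (auto intro!: bexI[of _ "coords a p"])
  also have "\<dots> \<longleftrightarrow> q = rev p"
    using assms coords_inj[OF assms(1), of "rev p"] by (simp add: coords_dual[symmetric])
  finally show ?thesis .
qed

lemma W_Tens_Id:
  assumes "arr f a b" "p \<in> points G a" "s \<in> points G c"
  shows "W (f \<boxtimes> Id c) (p @ s) v \<longleftrightarrow> (\<exists>q. v = q @ s \<and> W f p q)"
proof
  assume "W (f \<boxtimes> Id c) (p @ s) v"
  then obtain q1 p1 p2 where *: "v = q1 @ p2" "p @ s = p1 @ p2" "W f p1 q1" by auto
  then have "p = p1" "s = p2" using W_points[OF assms(1) *(3)] assms by (auto simp: points_iff)
  then show "\<exists>q. v = q @ s \<and> W f p q" using * by auto
qed (use assms in auto)

lemma W_Id_Tens: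
  assumes "arr f a b" "p \<in> points G a" "s \<in> points G c"
  shows "W (Id c \<boxtimes> f) (s @ p) v \<longleftrightarrow> (\<exists>q. v = s @ q \<and> W f p q)"
proof
  assume "W (Id c \<boxtimes> f) (s @ p) v"
  then obtain q1 p1 p2 where *: "v = p2 @ q1" "s @ p = p2 @ p1" "W f p1 q1" by auto
  then have "p = p1" "s = p2" using W_points[OF assms(1) *(3)] assms by (auto simp: points_iff)
  then show "\<exists>q. v = s @ q \<and> W f p q" using * by auto
qed (use assms in auto)

definition word_val :: "obj \<Rightarrow> 'a list \<Rightarrow> 'a" where
  "word_val a p = word_prod (coords a p)"

lemma word_val_closed: "p \<in> points G a \<Longrightarrow> word_val a p \<in> carrier G"
  by (simp add: word_val_def coords_in_L)

lemma word_val_W: "arr f a b \<Longrightarrow> W f p q \<Longrightarrow> word_val a p = word_val b q"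
  using sem_word_prod[of f "coords a p" "coords b q"] by (simp add: omega_iff_sem word_val_def)

lemma word_val_append: "p \<in> points G a \<Longrightarrow> q \<in> points G b \<Longrightarrow> word_val (a @ b) (p @ q) = word_val a p \<otimes> word_val b q"
  using coords_in_L[of p a] coords_in_L[of q b] by (simp add: word_val_def points_iff)

lemma word_val_Nil [simp]: "word_val [] [] = \<one>" and word_val_Lx: "x \<in> carrier G \<Longrightarrow> word_val [Lx] [x] = x"
  by (auto simp: word_val_def val_def)

lemma r_word_val:
  assumes "kappa_map a b p s = (t, q)" "p \<in> points G a" "s \<in> points G b"
  shows "r (word_val a p, word_val b s) = (word_val b t, word_val a q)"
  unfolding word_val_def using assms kappa_map_iff by (intro r_word_prod) (auto simp: coords_in_L)

text \<open>Every point is connected to the one-letter point given by its value. By induction on the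
  word, the remaining letters are first collected in one letter Lx. A leading Lx is then
  absorbed by Mul. A leading Ly is created by a morphism from [Lx] to [Ly, Lx] built from Coev
  and Mul. The empty word is sent to the letter 1 by Unt.\<close>

lemma invariant_word_val:
  assumes "\<And>f a b p q. arr f a b \<Longrightarrow> W f p q \<Longrightarrow> P a p \<longleftrightarrow> P b q"
    and "p \<in> points G a"
  shows "P a p \<longleftrightarrow> P [Lx] [word_val a p]"
  using assms
proof (induction a arbitrary: p P)
  case Nil
  have "arr Unt [] [Lx]" "W Unt [] [\<one>]" by (auto intro: arr.intros)
  then show ?case using Nil by auto
next
  case (Cons z a)
  then obtain x p' where p: "p = x # p'" "x \<in> carrier G" "p' \<in> points G a"
    by (cases p) (auto simp: points_def)
  have "P ([z] @ a) ([x] @ p') \<longleftrightarrow> P ([z] @ [Lx]) ([x] @ [word_val a p'])"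
  proof (rule Cons.IH[of "\<lambda>a p. P ([z] @ a) ([x] @ p)"])
    fix f a b p q assume f: "arr f a b" "W f p q"
    have "arr (Id [z] \<boxtimes> f) ([z] @ a) ([z] @ b)" by (intro arr.intros f)
    moreover have "W (Id [z] \<boxtimes> f) ([x] @ p) ([x] @ q)"
      using W_Id_Tens[OF f(1) W_points(1)[OF f], of "[x]" "[z]"] f p by auto
    ultimately show "P ([z] @ a) ([x] @ p) \<longleftrightarrow> P ([z] @ b) ([x] @ q)" by (rule Cons.prems)
  qed (use p in auto)
  also have "\<dots> \<longleftrightarrow> P [Lx] [word_val (z # a) p]"
  proof (cases z)
    case Lx
    have "arr Mul [Lx, Lx] [Lx]" "W Mul [x, word_val a p'] [x \<otimes> word_val a p']"
      using p word_val_closed by (auto intro: arr.intros)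
    then show ?thesis using Cons.prems(1) p Lx by (simp add: word_val_def val_def)
  next
    case Ly
    define h where "h = word_val a p'"
    have h: "h \<in> carrier G" using word_val_closed p h_def by simp
    \<comment> \<open>This morphism sends inv x * h to (x, x, inv x * h) and then to (x, h).\<close>
    let ?f = "(Id [Ly] \<boxtimes> Mul) \<bullet> (Coev \<boxtimes> Id [Lx])"
    have "arr (Coev \<boxtimes> Id [Lx]) ([] @ [Lx]) ([Ly, Lx] @ [Lx])" by (intro arr.intros)
    moreover have "arr (Id [Ly] \<boxtimes> Mul) ([Ly] @ [Lx, Lx]) ([Ly] @ [Lx])" by (intro arr.intros)
    ultimately have a: "arr ?f [Lx] [Ly, Lx]" by (auto intro: arr.intros)
    have "W (Coev \<boxtimes> Id [Lx]) ([] @ [inv x \<otimes> h]) ([x, x] @ [inv x \<otimes> h])"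
      by (subst W_Tens_Id[OF arr.intros(5)]) (use p h in auto)
    moreover have "W (Id [Ly] \<boxtimes> Mul) ([x] @ [x, inv x \<otimes> h]) ([x] @ [h])"
      by (subst W_Id_Tens[OF arr.intros(8)]) (use p h in \<open>auto simp: m_assoc[symmetric]\<close>)
    ultimately have "W ?f [inv x \<otimes> h] [x, h]" by (auto simp del: omega_term.simps(3))
    from Cons.prems(1)[OF a this] show ?thesis using p Ly by (simp add: word_val_def h_def val_def)
  qed
  finally show ?case using p by simp
qed

end

section \<open>Principal predicates on complete lattices\<close>

text \<open>On a complete lattice these are exactly the predicates "lies below m", where m is the join
  of all elements that satisfy the predicate. An equation between joins is proved by showing
  that both sides have the same upper bounds, that is, satisfy the same predicates of this
  kind. This replaces rewriting of nested joins by first-order reasoning.\<close>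

definition principal_pred :: "('a, 'x) gorder_scheme \<Rightarrow> ('a \<Rightarrow> bool) \<Rightarrow> bool" where
  "principal_pred L P \<longleftrightarrow> (\<forall>A\<subseteq>carrier L. P (\<Squnion>\<^bsub>L\<^esub> A) \<longleftrightarrow> (\<forall>a\<in>A. P a))"

definition biprincipal ::
  "('a, 'x) gorder_scheme \<Rightarrow> ('b, 'y) gorder_scheme \<Rightarrow> ('a \<Rightarrow> 'b \<Rightarrow> bool) \<Rightarrow> bool" where
  "biprincipal L M B \<longleftrightarrow>
     (\<forall>l\<in>carrier L. principal_pred M (B l)) \<and> (\<forall>m\<in>carrier M. principal_pred L (\<lambda>l. B l m))"

lemma principalD: "principal_pred L P \<Longrightarrow> A \<subseteq> carrier L \<Longrightarrow> P (\<Squnion>\<^bsub>L\<^esub> A) \<longleftrightarrow> (\<forall>a\<in>A. P a)"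
  by (simp add: principal_pred_def)

lemma sup_le_iff:
  assumes "complete_lattice L" "A \<subseteq> carrier L" "z \<in> carrier L"
  shows "\<Squnion>\<^bsub>L\<^esub> A \<sqsubseteq>\<^bsub>L\<^esub> z \<longleftrightarrow> (\<forall>a\<in>A. a \<sqsubseteq>\<^bsub>L\<^esub> z)"
proof -
  interpret complete_lattice L by fact
  show ?thesis
    using sup_upper[OF assms(2)] sup_least[OF assms(2,3)] sup_closed[OF assms(2)] assms(2,3)
    by (meson le_trans subsetD)
qed

lemma principal_le: "complete_lattice L \<Longrightarrow> z \<in> carrier L \<Longrightarrow> principal_pred L (\<lambda>a. a \<sqsubseteq>\<^bsub>L\<^esub> z)"
  by (simp add: principal_pred_def sup_le_iff)

lemma principal_ball: "(\<And>i. i \<in> I \<Longrightarrow> principal_pred L (P i)) \<Longrightarrow> principal_pred L (\<lambda>a. \<forall>i\<in>I. P i a)"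
  unfolding principal_pred_def by blast

lemma principal_imp: "principal_pred L P \<Longrightarrow> principal_pred L (\<lambda>a. Q \<longrightarrow> P a)"
  unfolding principal_pred_def by blast

lemma principal_not_imp: "principal_pred L (\<lambda>a. \<not> P a) \<Longrightarrow> principal_pred L (\<lambda>a. P a \<longrightarrow> Q)"
  unfolding principal_pred_def by blast

lemma principal_cong:
  assumes "complete_lattice L" "\<And>a. a \<in> carrier L \<Longrightarrow> P a \<longleftrightarrow> P' a"
  shows "principal_pred L P \<longleftrightarrow> principal_pred L P'"
proof -
  interpret complete_lattice L by fact
  have "P (\<Squnion>\<^bsub>L\<^esub> A) \<longleftrightarrow> P' (\<Squnion>\<^bsub>L\<^esub> A)" "(\<forall>a\<in>A. P a) \<longleftrightarrow> (\<forall>a\<in>A. P' a)" if "A \<subseteq> carrier L" for A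
    using assms(2) sup_closed[OF that] that by blast+
  then show ?thesis unfolding principal_pred_def by simp
qed

lemma eq_via_upper_bounds:
  assumes "complete_lattice L" "a \<in> carrier L" "b \<in> carrier L"
    and "\<And>z. z \<in> carrier L \<Longrightarrow> a \<sqsubseteq>\<^bsub>L\<^esub> z \<longleftrightarrow> b \<sqsubseteq>\<^bsub>L\<^esub> z"
  shows "a = b"
proof -
  interpret complete_lattice L by fact
  show ?thesis using assms(2-4) by (meson le_antisym le_refl)
qed

lemma sup_hom_via_principal:
  assumes "complete_lattice L" "complete_lattice M" "f \<in> carrier L \<rightarrow> carrier M"
    and "\<And>z. z \<in> carrier M \<Longrightarrow> principal_pred L (\<lambda>a. f a \<sqsubseteq>\<^bsub>M\<^esub> z)"
  shows "sup_hom L M f"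
  unfolding sup_hom_def
proof (intro conjI allI impI assms(3))
  interpret L: complete_lattice L by fact
  interpret M: complete_lattice M by fact
  fix A assume A: "A \<subseteq> carrier L"
  have fA: "f ` A \<subseteq> carrier M" using assms(3) A by blast
  show "f (\<Squnion>\<^bsub>L\<^esub> A) = \<Squnion>\<^bsub>M\<^esub> (f ` A)"
  proof (rule eq_via_upper_bounds[OF assms(2)])
    fix z assume "z \<in> carrier M"
    then show "f (\<Squnion>\<^bsub>L\<^esub> A) \<sqsubseteq>\<^bsub>M\<^esub> z \<longleftrightarrow> \<Squnion>\<^bsub>M\<^esub> (f ` A) \<sqsubseteq>\<^bsub>M\<^esub> z"
      using principalD[OF assms(4) A] sup_le_iff[OF assms(2) fA] by simp
  qed (use assms(3) A fA in auto)
qed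

lemma sup_sup_unit: "\<Squnion>\<^bsub>sup_unit\<^esub> B \<longleftrightarrow> True \<in> B"
proof -
  have U: "Upper sup_unit B = (if True \<in> B then {True} else UNIV)"
    unfolding Upper_def sup_unit_def by (auto simp: le_bool_def)
  have l: "least sup_unit x (Upper sup_unit B) \<longleftrightarrow> x = (True \<in> B)" for x
    unfolding least_def U by (cases "True \<in> B"; cases x) (auto simp: sup_unit_def)
  show ?thesis unfolding Lattice.sup_def l by simp
qed

lemma sup_hom_sup_unit: "sup_hom L sup_unit f \<longleftrightarrow> principal_pred L (\<lambda>a. \<not> f a)"
  unfolding sup_hom_def principal_pred_def sup_sup_unit by (auto simp: sup_unit_def)

lemma scal_le_iff:
  assumes "complete_lattice L" "z \<in> carrier L"
  shows "scal L s a \<sqsubseteq>\<^bsub>L\<^esub> z \<longleftrightarrow> (s \<longrightarrow> a \<sqsubseteq>\<^bsub>L\<^esub> z)"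
proof -
  interpret complete_lattice L by fact
  show ?thesis using bottom_lower assms(2) by (simp add: scal_def)
qed

lemma scal_closed: "complete_lattice L \<Longrightarrow> a \<in> carrier L \<Longrightarrow> scal L s a \<in> carrier L"
proof -
  assume "complete_lattice L" "a \<in> carrier L"
  then interpret complete_lattice L by simp
  show ?thesis using \<open>a \<in> carrier L\<close> by (simp add: scal_def)
qed

text \<open>Applies to a Hopf algebra record and its underlying lattice, which share carrier and order.\<close>

lemma gorder_cong:
  assumes "carrier L = carrier M" "le L = le M"
  shows "Lattice.sup L = Lattice.sup M" "bottom L = bottom M" "principal_pred L = principal_pred M"
proof -
  show 1: "Lattice.sup L = Lattice.sup M" by (rule ext) (simp add: Lattice.sup_def least_def Upper_def assms)
  show "bottom L = bottom M" by (simp add: bottom_def least_def assms)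
  show "principal_pred L = principal_pred M" by (rule ext) (simp add: principal_pred_def 1 assms)
qed

lemma complete_lattice_cong:
  assumes "complete_lattice M" "carrier L = carrier M" "le L = le M" "eq L = (=)"
  shows "complete_lattice L"
proof (rule partial_order.complete_latticeI)
  interpret M: complete_lattice M by fact
  show "partial_order L"
    using assms(2-4) M.le_refl M.le_trans M.le_antisym by unfold_locales (auto)
  fix A assume "A \<subseteq> carrier L"
  then show "\<exists>s. least L s (Upper L A)" "\<exists>i. greatest L i (Lower L A)"
    using M.sup_exists M.inf_exists assms(2,3)
    by (auto simp: least_def Upper_def greatest_def Lower_def)
qed

lemma tensor_cong:
  assumes "carrier L = carrier L'" "le L = le L'" "carrier M = carrier M'" "le M = le M'"
  shows "tensor L M = tensor L' M'" "pure L M = pure L' M'"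
  using gorder_cong[OF assms(1,2)] gorder_cong[OF assms(3,4)] assms
  by (auto simp: tensor_def pure_def tensor_rel_def intro!: ext)

section \<open>Presentations and tensor products\<close>

text \<open>A principal predicate is determined by the generators that satisfy it, and these form an
  element of the presented lattice.\<close>

lemma principal_pres:
  assumes Rel: "Rel \<subseteq> Pow X \<times> Pow X" and P: "principal_pred (suplat_pres X Rel) P"
  shows "{x \<in> X. P (suplat_gen X Rel x)} \<in> carrier (suplat_pres X Rel)"
    and "S \<in> carrier (suplat_pres X Rel) \<Longrightarrow> P S \<longleftrightarrow> (\<forall>x\<in>S. P (suplat_gen X Rel x))"
proof -
  have gen: "suplat_gen X Rel ` A \<subseteq> carrier (suplat_pres X Rel)" if "A \<subseteq> X" for A
    using that suplat_gen_closed[OF Rel] by blast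
  have *: "P (\<Squnion>\<^bsub>suplat_pres X Rel\<^esub> (suplat_gen X Rel ` A)) \<longleftrightarrow> (\<forall>x\<in>A. P (suplat_gen X Rel x))"
    if "A \<subseteq> X" for A
    using principalD[OF P gen[OF that]] by simp
  show "{x \<in> X. P (suplat_gen X Rel x)} \<in> carrier (suplat_pres X Rel)"
    unfolding suplat_pres_carrier_iff
  proof (intro conjI allI impI)
    fix A B assume AB: "(A, B) \<in> Rel"
    then have "A \<subseteq> X" "B \<subseteq> X" using Rel by auto
    then show "A \<subseteq> {x \<in> X. P (suplat_gen X Rel x)} \<longleftrightarrow> B \<subseteq> {x \<in> X. P (suplat_gen X Rel x)}"
      using *[of A] *[of B] suplat_pres_relation[OF Rel AB] by auto
  qed auto
  show "P S \<longleftrightarrow> (\<forall>x\<in>S. P (suplat_gen X Rel x))" if S: "S \<in> carrier (suplat_pres X Rel)"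
    using *[OF suplat_pres_subset[OF S]] suplat_pres_generated[OF Rel S] by simp
qed

text \<open>Conversely, a predicate on generators that is compatible with the relations extends to a
  principal predicate.\<close>

lemma principal_pres_ext:
  assumes Rel: "Rel \<subseteq> Pow X \<times> Pow X" and Q: "{x \<in> X. Q x} \<in> carrier (suplat_pres X Rel)"
  shows "principal_pred (suplat_pres X Rel) (\<lambda>S. \<forall>x\<in>S. Q x)"
    and "x \<in> X \<Longrightarrow> (\<forall>y\<in>suplat_gen X Rel x. Q y) \<longleftrightarrow> Q x"
proof -
  note cl = suplat_pres_complete_lattice[OF Rel]
  have *: "(\<forall>x\<in>S. Q x) \<longleftrightarrow> S \<sqsubseteq>\<^bsub>suplat_pres X Rel\<^esub> {x \<in> X. Q x}" if "S \<in> carrier (suplat_pres X Rel)" for S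
    using suplat_pres_subset[OF that] by auto
  show "principal_pred (suplat_pres X Rel) (\<lambda>S. \<forall>x\<in>S. Q x)"
    using principal_le[OF cl Q]
    by (subst principal_cong[OF cl, where P' = "\<lambda>S. S \<sqsubseteq>\<^bsub>suplat_pres X Rel\<^esub> {x \<in> X. Q x}"]) (use * in blast)+
  show "x \<in> X \<Longrightarrow> (\<forall>y\<in>suplat_gen X Rel x. Q y) \<longleftrightarrow> Q x"
    using *[OF suplat_gen_closed[OF Rel]] suplat_gen_le_iff[OF _ Q, of x] by auto
qed

lemma tensor_complete_lattice:
  "complete_lattice L \<Longrightarrow> complete_lattice M \<Longrightarrow> complete_lattice (tensor L M)"
  unfolding tensor_def by (intro suplat_pres_complete_lattice tensor_rel_subset)

lemma tensor_subset: "Z \<in> carrier (tensor L M) \<Longrightarrow> Z \<subseteq> carrier L \<times> carrier M"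
  unfolding tensor_def by (rule suplat_pres_subset)

lemma tensor_le [simp]: "S \<sqsubseteq>\<^bsub>tensor L M\<^esub> T \<longleftrightarrow> S \<subseteq> T"
  by (simp add: tensor_def)

text \<open>The elements of a tensor product are the predicates that are principal in each variable.\<close>

lemma tensor_carrier_iff:
  "Z \<in> carrier (tensor L M) \<longleftrightarrow>
     Z \<subseteq> carrier L \<times> carrier M \<and> biprincipal L M (\<lambda>l m. (l, m) \<in> Z)"
proof -
  have "(\<forall>A B. (A, B) \<in> tensor_rel L M \<longrightarrow> (A \<subseteq> Z \<longleftrightarrow> B \<subseteq> Z)) \<longleftrightarrow>
     (\<forall>A m. A \<subseteq> carrier L \<longrightarrow> m \<in> carrier M \<longrightarrow> (A \<times> {m} \<subseteq> Z \<longleftrightarrow> {(\<Squnion>\<^bsub>L\<^esub> A, m)} \<subseteq> Z)) \<and>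
     (\<forall>l B. l \<in> carrier L \<longrightarrow> B \<subseteq> carrier M \<longrightarrow> ({l} \<times> B \<subseteq> Z \<longleftrightarrow> {(l, \<Squnion>\<^bsub>M\<^esub> B)} \<subseteq> Z))"
    (is "?l \<longleftrightarrow> ?a \<and> ?b")
  proof
   assume l: ?l show "?a \<and> ?b"
   proof (intro conjI allI impI)
    fix A m assume "A \<subseteq> carrier L" "m \<in> carrier M"
    then have "(A \<times> {m}, {(\<Squnion>\<^bsub>L\<^esub> A, m)}) \<in> tensor_rel L M"
      unfolding tensor_rel_def by blast
    then show "A \<times> {m} \<subseteq> Z \<longleftrightarrow> {(\<Squnion>\<^bsub>L\<^esub> A, m)} \<subseteq> Z" using l by blast
   next
    fix l B assume "l \<in> carrier L" "B \<subseteq> carrier M"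
    then have "({l} \<times> B, {(l, \<Squnion>\<^bsub>M\<^esub> B)}) \<in> tensor_rel L M"
      unfolding tensor_rel_def by blast
    then show "{l} \<times> B \<subseteq> Z \<longleftrightarrow> {(l, \<Squnion>\<^bsub>M\<^esub> B)} \<subseteq> Z" using l by blast
   qed
  next
   assume ab: "?a \<and> ?b"
   show ?l
   proof (intro allI impI)
    fix A B assume "(A, B) \<in> tensor_rel L M"
    then consider A' m where "A = A' \<times> {m}" "B = {(\<Squnion>\<^bsub>L\<^esub> A', m)}" "A' \<subseteq> carrier L" "m \<in> carrier M"
      | l B' where "A = {l} \<times> B'" "B = {(l, \<Squnion>\<^bsub>M\<^esub> B')}" "l \<in> carrier L" "B' \<subseteq> carrier M"
      unfolding tensor_rel_def by (elim UnE CollectE exE conjE) auto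
    then show "A \<subseteq> Z \<longleftrightarrow> B \<subseteq> Z"
    proof cases
      case 1 show ?thesis unfolding 1(1,2) using ab 1(3,4) by blast
    next
      case 2 show ?thesis unfolding 2(1,2) using ab 2(3,4) by blast
    qed
   qed
  qed
  also have "\<dots> \<longleftrightarrow> biprincipal L M (\<lambda>l m. (l, m) \<in> Z)"
  proof -
    have sub: "A \<times> {m} \<subseteq> Z \<longleftrightarrow> (\<forall>a\<in>A. (a, m) \<in> Z)" "{l} \<times> B \<subseteq> Z \<longleftrightarrow> (\<forall>b\<in>B. (l, b) \<in> Z)" for A m l B
      by auto
    show ?thesis
      unfolding biprincipal_def principal_pred_def sub insert_subset
      by (simp only: empty_subsetI simp_thms) blast
  qed
  finally show ?thesis unfolding tensor_def suplat_pres_carrier_iff by simp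
qed

lemma pure_closed:
  "complete_lattice L \<Longrightarrow> complete_lattice M \<Longrightarrow> l \<in> carrier L \<Longrightarrow> m \<in> carrier M \<Longrightarrow>
     pure L M l m \<in> carrier (tensor L M)"
  unfolding tensor_def pure_def by (intro suplat_gen_closed tensor_rel_subset) auto

lemma pure_le_iff:
  assumes "l \<in> carrier L" "m \<in> carrier M" "Z \<in> carrier (tensor L M)"
  shows "pure L M l m \<subseteq> Z \<longleftrightarrow> (l, m) \<in> Z"
  using assms unfolding tensor_def pure_def by (intro suplat_gen_le_iff) auto

lemma biprincipal_tensor:
  "Z \<in> carrier (tensor L M) \<Longrightarrow> biprincipal L M (\<lambda>l m. (l, m) \<in> Z)"
  by (simp add: tensor_carrier_iff)

lemma biprincipal_cong:
  assumes "complete_lattice L" "complete_lattice M"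
    "\<And>l m. l \<in> carrier L \<Longrightarrow> m \<in> carrier M \<Longrightarrow> B l m \<longleftrightarrow> B' l m"
  shows "biprincipal L M B \<longleftrightarrow> biprincipal L M B'"
proof -
  have "principal_pred M (B l) \<longleftrightarrow> principal_pred M (B' l)" if "l \<in> carrier L" for l
    using assms(3)[OF that] by (intro principal_cong[OF assms(2)])
  moreover have "principal_pred L (\<lambda>l. B l m) \<longleftrightarrow> principal_pred L (\<lambda>l. B' l m)" if "m \<in> carrier M" for m
    using assms(3)[OF _ that] by (intro principal_cong[OF assms(1)])
  ultimately show ?thesis unfolding biprincipal_def by simp
qed

lemma biprincipal_set:
  assumes "complete_lattice L" "complete_lattice M" "biprincipal L M B"
  shows "{(l, m). l \<in> carrier L \<and> m \<in> carrier M \<and> B l m} \<in> carrier (tensor L M)"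
  unfolding tensor_carrier_iff using assms(3)
  by (subst biprincipal_cong[OF assms(1,2), of _ B]) auto

lemma principal_pure:
  assumes "complete_lattice L" "complete_lattice M" "principal_pred (tensor L M) P"
  shows "biprincipal L M (\<lambda>l m. P (pure L M l m))"
    and "t \<in> carrier (tensor L M) \<Longrightarrow> P t \<longleftrightarrow> (\<forall>(l, m)\<in>t. P (pure L M l m))"
proof -
  note pres = principal_pres[OF tensor_rel_subset[OF assms(1,2)] assms(3)[unfolded tensor_def],
      folded tensor_def]
  have "(\<lambda>x. P (suplat_gen (carrier L \<times> carrier M) (tensor_rel L M) x)) = (\<lambda>(l, m). P (pure L M l m))"
    by (auto simp: pure_def)
  note pres' = pres[unfolded this]
  show "biprincipal L M (\<lambda>l m. P (pure L M l m))"
    using biprincipal_tensor[OF pres(1)] unfolding pure_def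
    by (subst (asm) biprincipal_cong[OF assms(1,2)]) auto
  show "t \<in> carrier (tensor L M) \<Longrightarrow> P t \<longleftrightarrow> (\<forall>(l, m)\<in>t. P (pure L M l m))"
    using pres(2) by (auto simp: pure_def)
qed

text \<open>The universal property of the tensor product for predicates.\<close>

lemma biprincipal_lift:
  assumes "complete_lattice L" "complete_lattice M" "biprincipal L M B"
  shows "principal_pred (tensor L M) (\<lambda>t. \<forall>(l, m)\<in>t. B l m)"
    and "l \<in> carrier L \<Longrightarrow> m \<in> carrier M \<Longrightarrow> (\<forall>(x, y)\<in>pure L M l m. B x y) \<longleftrightarrow> B l m"
proof -
  have "{x \<in> carrier L \<times> carrier M. case x of (l, m) \<Rightarrow> B l m} =
      {(l, m). l \<in> carrier L \<and> m \<in> carrier M \<and> B l m}" by auto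
  then have *: "{x \<in> carrier L \<times> carrier M. case x of (l, m) \<Rightarrow> B l m} \<in>
      carrier (suplat_pres (carrier L \<times> carrier M) (tensor_rel L M))"
    using biprincipal_set[OF assms] by (simp add: tensor_def)
  show "principal_pred (tensor L M) (\<lambda>t. \<forall>(l, m)\<in>t. B l m)"
    using principal_pres_ext(1)[OF tensor_rel_subset[OF assms(1,2)] *] by (simp add: tensor_def)
  show "l \<in> carrier L \<Longrightarrow> m \<in> carrier M \<Longrightarrow> (\<forall>(x, y)\<in>pure L M l m. B x y) \<longleftrightarrow> B l m"
    using principal_pres_ext(2)[OF tensor_rel_subset[OF assms(1,2)] *, of "(l, m)"] by (simp add: pure_def)
qed

lemma ball_comprehension2: "(\<forall>x\<in>{f u v | u v. (u, v) \<in> A}. P x) \<longleftrightarrow> (\<forall>(u, v)\<in>A. P (f u v))"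
  by blast

lemma ball_comprehension4:
  "(\<forall>x\<in>{f a b c d | a b c d. (a, b) \<in> A \<and> (c, d) \<in> B}. P x) \<longleftrightarrow>
    (\<forall>(a, b)\<in>A. \<forall>(c, d)\<in>B. P (f a b c d))"
  by blast

lemma ball_comprehension6:
  "(\<forall>x\<in>{f a b c a' b' c' | a b c a' b' c'. (a, b, c) \<in> A \<and> (a', b', c') \<in> B}. P x) \<longleftrightarrow>
    (\<forall>(a, b, c)\<in>A. \<forall>(a', b', c')\<in>B. P (f a b c a' b' c'))"
  by (intro iffI ballI) (auto, blast)

lemma subset_singleton_eqI:
  assumes "\<And>X. S \<subseteq> X \<longleftrightarrow> x \<in> X" shows "S = {x}"
  using assms[of S] assms[of "{x}"] by blast

section \<open>Elements of the coend\<close>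

context braided_group
begin

abbreviation (input) C :: "'a sym set gorder" where "C \<equiv> coend G r"
abbreviation (input) H :: "'a sym set suplat_hopf" where "H \<equiv> H_omega G r"
abbreviation (input) gen :: "obj \<Rightarrow> 'a list \<Rightarrow> 'a list \<Rightarrow> 'a sym set" where "gen \<equiv> coend_gen G r"

text \<open>The relations can be indexed by terms in place of morphisms, which are classes of terms.\<close>

lemma coend_rel_eq:
  "coend_rel G r = {({(b, p', q) | p'. W f p p'}, {(a, p, q') | q'. q' \<in> points G a \<and> W f q' q})
     | a b f p q. arr f a b \<and> p \<in> points G a \<and> q \<in> points G b}"
proof -
  have *: "P a b (omega_m G r F) \<longleftrightarrow> P a b (\<lambda>S. \<Union>p\<in>S. omega_term G r f p)"
    if "F = mor_rel a b `` {f}" "arr f a b" for P :: "obj \<Rightarrow> obj \<Rightarrow> _ \<Rightarrow> bool" and F f a b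
  proof -
    have "omega_m G r F = (\<lambda>S. \<Union>p\<in>S. omega_term G r f p)"
      unfolding that(1) by (rule ext) (rule omega_m_class[OF that(2)])
    then show ?thesis by simp
  qed
  show ?thesis
    unfolding coend_rel_def Hom_iff
  proof (intro Set.set_eqI iffI)
    fix x assume "x \<in> {({(b, p', q) |p'. p' \<in> omega_m G r F {p}},
       {(a, p, q') |q'. q' \<in> points G a \<and> q \<in> omega_m G r F {q'}}) |
      a b F p q. (\<exists>f. arr f a b \<and> F = mor_rel a b `` {f}) \<and> p \<in> points G a \<and> q \<in> points G b}"
    then obtain a b p q f where *: "arr f a b" "p \<in> points G a" "q \<in> points G b"
      "x = ({(b, p', q) |p'. p' \<in> omega_m G r (mor_rel a b `` {f}) {p}},
       {(a, p, q') |q'. q' \<in> points G a \<and> q \<in> omega_m G r (mor_rel a b `` {f}) {q'}})" by blast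
    have "x = ({(b, p', q) | p'. W f p p'}, {(a, p, q') | q'. q' \<in> points G a \<and> W f q' q})"
      unfolding *(4) omega_m_class[OF *(1)] by simp
    with *(1-3) show "x \<in> {({(b, p', q) | p'. W f p p'}, {(a, p, q') | q'. q' \<in> points G a \<and> W f q' q})
     | a b f p q. arr f a b \<and> p \<in> points G a \<and> q \<in> points G b}" by blast
  next
    fix x assume "x \<in> {({(b, p', q) | p'. W f p p'}, {(a, p, q') | q'. q' \<in> points G a \<and> W f q' q})
     | a b f p q. arr f a b \<and> p \<in> points G a \<and> q \<in> points G b}"
    then obtain a b p q f where *: "arr f a b" "p \<in> points G a" "q \<in> points G b"
      "x = ({(b, p', q) | p'. W f p p'}, {(a, p, q') | q'. q' \<in> points G a \<and> W f q' q})" by blast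
    have "x = ({(b, p', q) |p'. p' \<in> omega_m G r (mor_rel a b `` {f}) {p}},
       {(a, p, q') |q'. q' \<in> points G a \<and> q \<in> omega_m G r (mor_rel a b `` {f}) {q'}})"
      unfolding *(4) omega_m_class[OF *(1)] by simp
    with *(1-3) show "x \<in> {({(b, p', q) |p'. p' \<in> omega_m G r F {p}},
       {(a, p, q') |q'. q' \<in> points G a \<and> q \<in> omega_m G r F {q'}}) |
      a b F p q. (\<exists>f. arr f a b \<and> F = mor_rel a b `` {f}) \<and> p \<in> points G a \<and> q \<in> points G b}"
      by blast
  qed
qed

lemma coend_rel_subset: "coend_rel G r \<subseteq> Pow (coend_syms G) \<times> Pow (coend_syms G)"
  unfolding coend_rel_eq coend_syms_def using W_points by blast

lemma coend_complete_lattice: "complete_lattice C"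
  unfolding coend_def by (rule suplat_pres_complete_lattice[OF coend_rel_subset])

text \<open>The predicates on symbols that respect the relations of the coend. They are the elements of
  the coend by compatible_iff.\<close>

definition compatible :: "(obj \<Rightarrow> 'a list \<Rightarrow> 'a list \<Rightarrow> bool) \<Rightarrow> bool" where
  "compatible Q \<longleftrightarrow> (\<forall>f a b p q. arr f a b \<longrightarrow> p \<in> points G a \<longrightarrow> q \<in> points G b \<longrightarrow>
     ((\<forall>p'. W f p p' \<longrightarrow> Q b p' q) \<longleftrightarrow> (\<forall>q'. W f q' q \<longrightarrow> Q a p q')))"

lemma compatibleI:
  assumes "\<And>f a b p q. arr f a b \<Longrightarrow> p \<in> points G a \<Longrightarrow> q \<in> points G b \<Longrightarrow>
     (\<forall>p'. W f p p' \<longrightarrow> Q b p' q) \<longleftrightarrow> (\<forall>q'. W f q' q \<longrightarrow> Q a p q')"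
  shows "compatible Q"
  using assms unfolding compatible_def by blast

lemma compatibleD:
  assumes "compatible Q" "arr f a b" "p \<in> points G a" "q \<in> points G b"
  shows "(\<forall>p'. W f p p' \<longrightarrow> Q b p' q) \<longleftrightarrow> (\<forall>q'. W f q' q \<longrightarrow> Q a p q')"
  using assms unfolding compatible_def by blast

definition allsym :: "(obj \<Rightarrow> 'a list \<Rightarrow> 'a list \<Rightarrow> bool) \<Rightarrow> 'a sym set \<Rightarrow> bool" where
  "allsym Q S \<longleftrightarrow> (\<forall>(a, p, q)\<in>S. Q a p q)"

lemma coend_subset: "S \<in> carrier C \<Longrightarrow> S \<subseteq> coend_syms G"
  unfolding coend_def by (rule suplat_pres_subset)

lemma symD:
  assumes "S \<in> carrier C" "(a, p, q) \<in> S" shows "p \<in> points G a" "q \<in> points G a"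
  using coend_subset[OF assms(1)] assms(2) by (auto simp: coend_syms_def)

lemma allsymD: "allsym K S \<Longrightarrow> (a, p, q) \<in> S \<Longrightarrow> K a p q"
  unfolding allsym_def by auto

lemma allsymI: "(\<And>a p q. (a, p, q) \<in> S \<Longrightarrow> K a p q) \<Longrightarrow> allsym K S"
  unfolding allsym_def by auto

lemma allsym_cong:
  assumes "S \<in> carrier C" "\<And>a p q. p \<in> points G a \<Longrightarrow> q \<in> points G a \<Longrightarrow> Q a p q \<longleftrightarrow> Q' a p q"
  shows "allsym Q S \<longleftrightarrow> allsym Q' S"
  using symD[OF assms(1)] assms(2) unfolding allsym_def by blast

lemma compatible_iff: "compatible Q \<longleftrightarrow> {(a, p, q). p \<in> points G a \<and> q \<in> points G a \<and> Q a p q} \<in> carrier C"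
    (is "_ \<longleftrightarrow> ?K \<in> _")
proof -
  have "?K \<in> carrier C \<longleftrightarrow> (\<forall>A B. (A, B) \<in> coend_rel G r \<longrightarrow> (A \<subseteq> ?K \<longleftrightarrow> B \<subseteq> ?K))"
    unfolding coend_def suplat_pres_carrier_iff by (auto simp: coend_syms_def)
  also have "\<dots> \<longleftrightarrow> (\<forall>f a b p q. arr f a b \<longrightarrow> p \<in> points G a \<longrightarrow> q \<in> points G b \<longrightarrow>
      ({(b, p', q) | p'. W f p p'} \<subseteq> ?K \<longleftrightarrow> {(a, p, q') | q'. q' \<in> points G a \<and> W f q' q} \<subseteq> ?K))"
    (is "?l \<longleftrightarrow> ?r")
  proof
    assume l: ?l
    show ?r
    proof (intro allI impI)
      fix f a b p q assume "arr f a b" "p \<in> points G a" "q \<in> points G b"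
      then have "({(b, p', q) | p'. W f p p'}, {(a, p, q') | q'. q' \<in> points G a \<and> W f q' q}) \<in> coend_rel G r"
        unfolding coend_rel_eq by blast
      then show "{(b, p', q) | p'. W f p p'} \<subseteq> ?K \<longleftrightarrow> {(a, p, q') | q'. q' \<in> points G a \<and> W f q' q} \<subseteq> ?K"
        by (rule l[rule_format])
    qed
  next
    assume r: ?r
    show ?l
    proof (intro allI impI)
      fix A B assume "(A, B) \<in> coend_rel G r"
      then obtain a b f p q where *: "arr f a b" "p \<in> points G a" "q \<in> points G b"
        "A = {(b, p', q) | p'. W f p p'}" "B = {(a, p, q') | q'. q' \<in> points G a \<and> W f q' q}"
        unfolding coend_rel_eq by (elim CollectE exE conjE) simp
      show "A \<subseteq> ?K \<longleftrightarrow> B \<subseteq> ?K" unfolding *(4,5) by (rule r[rule_format, OF *(1-3)])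
    qed
  qed
  also have "\<dots> \<longleftrightarrow> compatible Q"
  proof -
    have "{(b, p', q) | p'. W f p p'} \<subseteq> ?K \<longleftrightarrow> (\<forall>p'. W f p p' \<longrightarrow> Q b p' q)"
      "{(a, p, q') | q'. q' \<in> points G a \<and> W f q' q} \<subseteq> ?K \<longleftrightarrow> (\<forall>q'. W f q' q \<longrightarrow> Q a p q')"
      if "arr f a b" "p \<in> points G a" "q \<in> points G b" for f a b p q
      using that W_points[OF that(1)] by blast+
    then show ?thesis unfolding compatible_def by simp
  qed
  finally show ?thesis by simp
qed

lemma allsym_principal: "compatible Q \<Longrightarrow> principal_pred C (allsym Q)"
  and allsym_gen: "compatible Q \<Longrightarrow> p \<in> points G a \<Longrightarrow> q \<in> points G a \<Longrightarrow> allsym Q (gen a p q) \<longleftrightarrow> Q a p q"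
proof -
  assume "compatible Q"
  moreover have "{(a, p, q). p \<in> points G a \<and> q \<in> points G a \<and> Q a p q} =
      {x \<in> coend_syms G. (\<lambda>(a, p, q). Q a p q) x}" by (auto simp: coend_syms_def)
  ultimately have *: "{x \<in> coend_syms G. (\<lambda>(a, p, q). Q a p q) x} \<in> carrier (suplat_pres (coend_syms G) (coend_rel G r))"
    unfolding compatible_iff by (simp add: coend_def)
  have eq: "allsym Q = (\<lambda>S. \<forall>x\<in>S. (\<lambda>(a, p, q). Q a p q) x)"
    unfolding allsym_def by (rule ext) auto
  show "principal_pred C (allsym Q)"
    unfolding eq coend_def by (rule principal_pres_ext(1)[OF coend_rel_subset *])
  show "p \<in> points G a \<Longrightarrow> q \<in> points G a \<Longrightarrow> allsym Q (gen a p q) \<longleftrightarrow> Q a p q"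
    using principal_pres_ext(2)[OF coend_rel_subset *, of "(a, p, q)"]
    unfolding eq coend_gen_def by (simp add: coend_syms_def)
qed

lemma gen_closed: "p \<in> points G a \<Longrightarrow> q \<in> points G a \<Longrightarrow> gen a p q \<in> carrier C"
  unfolding coend_gen_def coend_def by (intro suplat_gen_closed coend_rel_subset) (simp add: coend_syms_def)

lemma coend_le [simp]: "S \<sqsubseteq>\<^bsub>coend G r\<^esub> T \<longleftrightarrow> S \<subseteq> T"
  by (simp add: coend_def)

lemma gen_le_iff:
  "p \<in> points G a \<Longrightarrow> q \<in> points G a \<Longrightarrow> S \<in> carrier C \<Longrightarrow> gen a p q \<subseteq> S \<longleftrightarrow> (a, p, q) \<in> S"
  unfolding coend_gen_def coend_def by (intro suplat_gen_le_iff) (auto simp: coend_syms_def)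

lemma principal_compatible: "principal_pred C P \<Longrightarrow> compatible (\<lambda>a p q. P (gen a p q))"
  and principal_allsym: "principal_pred C P \<Longrightarrow> S \<in> carrier C \<Longrightarrow> P S \<longleftrightarrow> allsym (\<lambda>a p q. P (gen a p q)) S"
proof -
  assume P: "principal_pred C P"
  note pres = principal_pres[OF coend_rel_subset P[unfolded coend_def]]
  show "compatible (\<lambda>a p q. P (gen a p q))"
    unfolding compatible_iff
  proof -
    have "{(a, p, q). p \<in> points G a \<and> q \<in> points G a \<and> P (gen a p q)} =
      {x \<in> coend_syms G. P (suplat_gen (coend_syms G) (coend_rel G r) x)}"
      by (auto simp: coend_syms_def coend_gen_def)
    then show "{(a, p, q). p \<in> points G a \<and> q \<in> points G a \<and> P (gen a p q)} \<in> carrier C"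
      using pres(1) by (simp add: coend_def)
  qed
  show "S \<in> carrier C \<Longrightarrow> P S \<longleftrightarrow> allsym (\<lambda>a p q. P (gen a p q)) S"
    using pres(2)[of S] by (auto simp: coend_def allsym_def coend_gen_def)
qed

lemma mem_compatible: "S \<in> carrier C \<Longrightarrow> compatible (\<lambda>a p q. (a, p, q) \<in> S)"
proof -
  assume S: "S \<in> carrier C"
  have "{(a, p, q). p \<in> points G a \<and> q \<in> points G a \<and> (a, p, q) \<in> S} = S" using symD[OF S] by auto
  then show ?thesis unfolding compatible_iff using S by simp
qed

section \<open>Product, coproduct and counit\<close>

lemma H_simps [simp]: "carrier H = carrier C" "eq H = (=)" "le H = le C"
  by (simp_all add: H_omega_def)

lemma H_cong [simp]: "Lattice.sup H = Lattice.sup C" "bottom H = bottom C"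
    "principal_pred H = principal_pred C" "tensor H H = tensor C C" "pure H H = pure C C"
  using gorder_cong[of H C] tensor_cong[of H C H C] by simp_all

lemma H_complete_lattice: "complete_lattice H"
  by (rule complete_lattice_cong[OF coend_complete_lattice]) simp_all

abbreviation (input) T where "T \<equiv> tensor C C"
abbreviation (input) "prod_H \<equiv> hprod H"

lemma T_complete_lattice: "complete_lattice T"
  by (intro tensor_complete_lattice coend_complete_lattice)

lemma prod_principal:
  assumes P: "principal_pred C P" and S: "S \<in> carrier C" "U \<in> carrier C"
  shows "P (prod_H S U) \<longleftrightarrow>
    allsym (\<lambda>a p q. allsym (\<lambda>b p' q'. P (gen (a @ b) (p @ p') (q @ q'))) U) S"
proof -
  have sub: "{gen (a @ b) (p @ p') (q @ q') | a p q b p' q'. (a, p, q) \<in> S \<and> (b, p', q') \<in> U} \<subseteq> carrier C"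
    using symD[OF S(1)] symD[OF S(2)] by (auto intro!: gen_closed points_append)
  have "P (prod_H S U) \<longleftrightarrow>
    (\<forall>x\<in>{gen (a @ b) (p @ p') (q @ q') | a p q b p' q'. (a, p, q) \<in> S \<and> (b, p', q') \<in> U}. P x)"
    unfolding H_omega_def using principalD[OF P sub] by simp
  also have "\<dots> \<longleftrightarrow> allsym (\<lambda>a p q. allsym (\<lambda>b p' q'. P (gen (a @ b) (p @ p') (q @ q'))) U) S"
    unfolding allsym_def by blast
  finally show ?thesis .
qed

lemma prod_closed: "S \<in> carrier C \<Longrightarrow> U \<in> carrier C \<Longrightarrow> prod_H S U \<in> carrier C"
proof -
  assume S: "S \<in> carrier C" "U \<in> carrier C"
  interpret complete_lattice C by (rule coend_complete_lattice)
  show ?thesis unfolding H_omega_def using symD[OF S(1)] symD[OF S(2)]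
    by (auto intro!: sup_closed gen_closed)
qed

text \<open>Tensoring a morphism with an identity turns the relation of the coend for f into the
  relation needed for multiplication by a symbol to be defined.\<close>

lemma prod_compatible_left:
  assumes P: "principal_pred C P" and b: "s \<in> points G c" "t \<in> points G c"
  shows "compatible (\<lambda>a p q. P (gen (a @ c) (p @ s) (q @ t)))"
proof (rule compatibleI)
  fix f a b p q assume f: "arr f a b" "p \<in> points G a" "q \<in> points G b"
  have a: "arr (f \<boxtimes> Id c) (a @ c) (b @ c)" by (intro arr.intros f)
  have "(\<forall>p'. W (f \<boxtimes> Id c) (p @ s) p' \<longrightarrow> P (gen (b @ c) p' (q @ t))) \<longleftrightarrow>
        (\<forall>q'. W (f \<boxtimes> Id c) q' (q @ t) \<longrightarrow> P (gen (a @ c) (p @ s) q'))"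
    using compatibleD[OF principal_compatible[OF P] a, of "p @ s" "q @ t"] f b by simp
  moreover have "W (f \<boxtimes> Id c) (p @ s) p' \<longleftrightarrow> (\<exists>x. p' = x @ s \<and> W f p x)" for p'
    using W_Tens_Id[OF f(1,2) b(1)] by simp
  moreover have "W (f \<boxtimes> Id c) q' (q @ t) \<longleftrightarrow> (\<exists>x. q' = x @ t \<and> W f x q)" for q'
  proof
    assume "W (f \<boxtimes> Id c) q' (q @ t)"
    then obtain q1 p1 p2 where *: "q @ t = q1 @ p2" "q' = p1 @ p2" "W f p1 q1" by auto
    then have "q = q1" "t = p2" using W_points[OF f(1) *(3)] f b by (auto simp: points_iff)
    then show "\<exists>x. q' = x @ t \<and> W f x q" using * by auto
  qed (use b in auto)
  ultimately show "(\<forall>p'. W f p p' \<longrightarrow> P (gen (b @ c) (p' @ s) (q @ t))) \<longleftrightarrow>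
     (\<forall>q'. W f q' q \<longrightarrow> P (gen (a @ c) (p @ s) (q' @ t)))" by auto
qed

lemma prod_compatible_right:
  assumes P: "principal_pred C P" and b: "s \<in> points G c" "t \<in> points G c"
  shows "compatible (\<lambda>a p q. P (gen (c @ a) (s @ p) (t @ q)))"
proof (rule compatibleI)
  fix f a b p q assume f: "arr f a b" "p \<in> points G a" "q \<in> points G b"
  have a: "arr (Id c \<boxtimes> f) (c @ a) (c @ b)" by (intro arr.intros f)
  have "(\<forall>p'. W (Id c \<boxtimes> f) (s @ p) p' \<longrightarrow> P (gen (c @ b) p' (t @ q))) \<longleftrightarrow>
        (\<forall>q'. W (Id c \<boxtimes> f) q' (t @ q) \<longrightarrow> P (gen (c @ a) (s @ p) q'))"
    using compatibleD[OF principal_compatible[OF P] a, of "s @ p" "t @ q"] f b by simp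
  moreover have "W (Id c \<boxtimes> f) (s @ p) p' \<longleftrightarrow> (\<exists>x. p' = s @ x \<and> W f p x)" for p'
    using W_Id_Tens[OF f(1,2) b(1)] by simp
  moreover have "W (Id c \<boxtimes> f) q' (t @ q) \<longleftrightarrow> (\<exists>x. q' = t @ x \<and> W f x q)" for q'
  proof
    assume "W (Id c \<boxtimes> f) q' (t @ q)"
    then obtain q1 p1 p2 where *: "t @ q = p2 @ q1" "q' = p2 @ p1" "W f p1 q1" by auto
    then have "q = q1" "t = p2" using W_points[OF f(1) *(3)] f b by (auto simp: points_iff)
    then show "\<exists>x. q' = t @ x \<and> W f x q" using * by auto
  qed (use b in auto)
  ultimately show "(\<forall>p'. W f p p' \<longrightarrow> P (gen (c @ b) (s @ p') (t @ q))) \<longleftrightarrow>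
     (\<forall>q'. W f q' q \<longrightarrow> P (gen (c @ a) (s @ p) (t @ q')))" by auto
qed

lemma allsym_principal_param:
  assumes U: "U \<in> carrier C"
    and "\<And>b p' q'. p' \<in> points G b \<Longrightarrow> q' \<in> points G b \<Longrightarrow> compatible (\<lambda>a p q. Q a p q b p' q')"
  shows "compatible (\<lambda>a p q. allsym (\<lambda>b p' q'. Q a p q b p' q') U)"
  unfolding compatible_def
proof (intro allI impI)
  fix f a b p q assume f: "arr f a b" "p \<in> points G a" "q \<in> points G b"
  have "(\<forall>p'. W f p p' \<longrightarrow> Q b p' q c s t) \<longleftrightarrow> (\<forall>q'. W f q' q \<longrightarrow> Q a p q' c s t)" if "(c, s, t) \<in> U" for c s t
    using compatibleD[OF assms(2) f] symD[OF U that] by blast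
  then show "(\<forall>p'. W f p p' \<longrightarrow> allsym (Q b p' q) U) \<longleftrightarrow> (\<forall>q'. W f q' q \<longrightarrow> allsym (Q a p q') U)"
    unfolding allsym_def by blast
qed

lemma allsym_swap: "allsym (\<lambda>a p q. allsym (Q a p q) U) S \<longleftrightarrow> allsym (\<lambda>b p' q'. allsym (\<lambda>a p q. Q a p q b p' q') S) U"
  unfolding allsym_def by blast

lemma prod_principal_left:
  assumes P: "principal_pred C P" and U: "U \<in> carrier C"
  shows "principal_pred C (\<lambda>S. P (prod_H S U))"
proof -
  have "compatible (\<lambda>a p q. allsym (\<lambda>b p' q'. P (gen (a @ b) (p @ p') (q @ q'))) U)"
    by (intro allsym_principal_param U prod_compatible_left P)
  from allsym_principal[OF this] show ?thesis
    using prod_principal[OF P _ U]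
    by (subst principal_cong[OF coend_complete_lattice]) auto
qed

lemma prod_principal_right:
  assumes P: "principal_pred C P" and S: "S \<in> carrier C"
  shows "principal_pred C (\<lambda>U. P (prod_H S U))"
proof -
  have "compatible (\<lambda>b p' q'. allsym (\<lambda>a p q. P (gen (a @ b) (p @ p') (q @ q'))) S)"
    by (intro allsym_principal_param S prod_compatible_right P)
  from allsym_principal[OF this] show ?thesis
    using prod_principal[OF P S] allsym_swap[of _ _ S]
    by (subst principal_cong[OF coend_complete_lattice]) auto
qed

lemma prod_biprincipal: "principal_pred C P \<Longrightarrow> biprincipal C C (\<lambda>S U. P (prod_H S U))"
  unfolding biprincipal_def using prod_principal_left prod_principal_right by blast

lemma prod_gen:
  assumes "p \<in> points G a" "q \<in> points G a" "p' \<in> points G b" "q' \<in> points G b"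
  shows "prod_H (gen a p q) (gen b p' q') = gen (a @ b) (p @ p') (q @ q')"
proof (rule eq_via_upper_bounds[OF coend_complete_lattice])
  fix z assume z: "z \<in> carrier C"
  note P = principal_le[OF coend_complete_lattice z]
  have c2: "compatible (\<lambda>b p' q'. gen (a @ b) (p @ p') (q @ q') \<sqsubseteq>\<^bsub>C\<^esub> z)"
    if "p \<in> points G a" "q \<in> points G a" for a p q
    by (rule prod_compatible_right[OF P that])
  have "prod_H (gen a p q) (gen b p' q') \<sqsubseteq>\<^bsub>C\<^esub> z \<longleftrightarrow>
    allsym (\<lambda>a p q. allsym (\<lambda>b p' q'. gen (a @ b) (p @ p') (q @ q') \<sqsubseteq>\<^bsub>C\<^esub> z) (gen b p' q')) (gen a p q)"
    using assms by (intro prod_principal[OF P] gen_closed)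
  also have "\<dots> \<longleftrightarrow> allsym (\<lambda>b p' q'. gen (a @ b) (p @ p') (q @ q') \<sqsubseteq>\<^bsub>C\<^esub> z) (gen b p' q')"
    using assms by (intro allsym_gen allsym_principal_param gen_closed prod_compatible_left[OF P])
  also have "\<dots> \<longleftrightarrow> gen (a @ b) (p @ p') (q @ q') \<sqsubseteq>\<^bsub>C\<^esub> z"
    using assms by (intro allsym_gen c2)
  finally show "prod_H (gen a p q) (gen b p' q') \<sqsubseteq>\<^bsub>C\<^esub> z \<longleftrightarrow> gen (a @ b) (p @ p') (q @ q') \<sqsubseteq>\<^bsub>C\<^esub> z" .
qed (use assms in \<open>auto intro!: prod_closed gen_closed\<close>)

lemma sup_hom_C: "f \<in> carrier C \<rightarrow> carrier M \<Longrightarrow> complete_lattice M \<Longrightarrow>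
   (\<And>z. z \<in> carrier M \<Longrightarrow> principal_pred C (\<lambda>a. f a \<sqsubseteq>\<^bsub>M\<^esub> z)) \<Longrightarrow> sup_hom H M f"
  by (rule sup_hom_via_principal[OF H_complete_lattice]) simp_all

lemma prod_bi_sup_hom: "bi_sup_hom H H H prod_H"
  unfolding bi_sup_hom_def
proof (intro conjI ballI)
  fix l assume "l \<in> carrier H"
  then show "sup_hom H H (prod_H l)" "sup_hom H H (\<lambda>m. prod_H m l)"
    by (auto intro!: sup_hom_C prod_closed H_complete_lattice prod_principal_right prod_principal_left
        principal_le[OF coend_complete_lattice, simplified])
qed

text \<open>The relation for f, applied to the first tensor factor and then to the second, moves the
  middle index through f.\<close>

lemma comult_compatible:
  assumes B: "biprincipal C C B"
  shows "compatible (\<lambda>a p q. \<forall>l\<in>points G a. B (gen a p l) (gen a l q))"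
proof (rule compatibleI)
  fix f a b p q assume f: "arr f a b" "p \<in> points G a" "q \<in> points G b"
  have 1: "(\<forall>p'. W f p p' \<longrightarrow> B (gen b p' l) (gen b l q)) \<longleftrightarrow> (\<forall>l'. W f l' l \<longrightarrow> B (gen a p l') (gen b l q))"
    if "l \<in> points G b" for l
  proof (rule compatibleD[OF principal_compatible f(1,2) that])
    show "principal_pred C (\<lambda>x. B x (gen b l q))"
      using B gen_closed[OF that f(3)] unfolding biprincipal_def by blast
  qed
  have 2: "(\<forall>l. W f l' l \<longrightarrow> B (gen a p l') (gen b l q)) \<longleftrightarrow> (\<forall>q'. W f q' q \<longrightarrow> B (gen a p l') (gen a l' q'))"
    if "l' \<in> points G a" for l'
  proof (rule compatibleD[OF principal_compatible f(1) that f(3)])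
    show "principal_pred C (B (gen a p l'))"
      using B gen_closed[OF f(2) that] unfolding biprincipal_def by blast
  qed
  have "(\<forall>p'. W f p p' \<longrightarrow> (\<forall>l\<in>points G b. B (gen b p' l) (gen b l q))) \<longleftrightarrow>
    (\<forall>l\<in>points G b. \<forall>l'. W f l' l \<longrightarrow> B (gen a p l') (gen b l q))"
    using 1 by blast
  also have "\<dots> \<longleftrightarrow> (\<forall>l'\<in>points G a. \<forall>l. W f l' l \<longrightarrow> B (gen a p l') (gen b l q))"
    using W_points[OF f(1)] by blast
  also have "\<dots> \<longleftrightarrow> (\<forall>q'. W f q' q \<longrightarrow> (\<forall>l\<in>points G a. B (gen a p l) (gen a l q')))"
    using 2 by blast
  finally show "(\<forall>p'. W f p p' \<longrightarrow> (\<forall>l\<in>points G b. B (gen b p' l) (gen b l q))) \<longleftrightarrow>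
    (\<forall>q'. W f q' q \<longrightarrow> (\<forall>l\<in>points G a. B (gen a p l) (gen a l q')))" .
qed

lemma comult_closed: "S \<in> carrier C \<Longrightarrow> comult H S \<in> carrier T"
proof -
  assume S: "S \<in> carrier C"
  interpret complete_lattice T by (rule T_complete_lattice)
  show ?thesis unfolding H_omega_def using symD[OF S]
    by (auto intro!: sup_closed pure_closed coend_complete_lattice gen_closed)
qed

lemma comult_principal:
  assumes P: "principal_pred T P" and S: "S \<in> carrier C"
  shows "P (comult H S) \<longleftrightarrow> allsym (\<lambda>a p q. \<forall>l\<in>points G a. P (pure C C (gen a p l) (gen a l q))) S"
proof -
  have sub: "{pure C C (gen a p l) (gen a l q) | a p q l. (a, p, q) \<in> S \<and> l \<in> points G a} \<subseteq> carrier T"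
    using symD[OF S] by (auto intro!: pure_closed coend_complete_lattice gen_closed)
  have "P (comult H S) \<longleftrightarrow> (\<forall>x\<in>{pure C C (gen a p l) (gen a l q) | a p q l. (a, p, q) \<in> S \<and> l \<in> points G a}. P x)"
    unfolding H_omega_def using principalD[OF P sub] by simp
  also have "\<dots> \<longleftrightarrow> allsym (\<lambda>a p q. \<forall>l\<in>points G a. P (pure C C (gen a p l) (gen a l q))) S"
    unfolding allsym_def by blast
  finally show ?thesis .
qed

text \<open>Predicates that are principal in both Sweedler components can be checked on symbols.\<close>

lemma comult_ball:
  assumes B: "biprincipal C C B" and S: "S \<in> carrier C"
  shows "(\<forall>(x, y)\<in>comult H S. B x y) \<longleftrightarrow> allsym (\<lambda>a p q. \<forall>l\<in>points G a. B (gen a p l) (gen a l q)) S"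
  unfolding comult_principal[OF biprincipal_lift(1)[OF coend_complete_lattice coend_complete_lattice B] S]
  by (rule allsym_cong[OF S])
    (auto simp: biprincipal_lift(2)[OF coend_complete_lattice coend_complete_lattice B] gen_closed)

lemma comult_ball_gen:
  assumes B: "biprincipal C C B" and "p \<in> points G a" "q \<in> points G a"
  shows "(\<forall>(x, y)\<in>comult H (gen a p q). B x y) \<longleftrightarrow> (\<forall>l\<in>points G a. B (gen a p l) (gen a l q))"
  using assms comult_ball[OF B gen_closed] allsym_gen[OF comult_compatible[OF B]] by simp

lemma comult_ball_principal:
  assumes B: "biprincipal C C B"
  shows "principal_pred C (\<lambda>S. \<forall>(x, y)\<in>comult H S. B x y)"
  using allsym_principal[OF comult_compatible[OF B]] comult_ball[OF B]
  by (subst principal_cong[OF coend_complete_lattice]) auto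

lemma comult_sup_hom: "sup_hom H T (comult H)"
proof (rule sup_hom_C[OF _ T_complete_lattice])
  show "comult H \<in> carrier C \<rightarrow> carrier T" using comult_closed by blast
  fix z assume "z \<in> carrier T"
  from comult_ball_principal[OF biprincipal_tensor[OF this]]
  show "principal_pred C (\<lambda>S. comult H S \<sqsubseteq>\<^bsub>T\<^esub> z)"
    by (subst principal_cong[OF coend_complete_lattice]) auto
qed

lemma comult_mem:
  assumes "S \<in> carrier C" "(x, y) \<in> comult H S"
  shows "x \<in> carrier C" "y \<in> carrier C"
  using tensor_subset[OF comult_closed[OF assms(1)]] assms(2) by auto

lemma counit_iff: "S \<in> carrier C \<Longrightarrow> counit H S \<longleftrightarrow> \<not> allsym (\<lambda>a p q. p \<noteq> q) S"
  unfolding H_omega_def allsym_def by fastforce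

lemma counit_compatible: "compatible (\<lambda>a p q. p \<noteq> q)"
  by (rule compatibleI) auto

lemma counit_principal: "principal_pred C (\<lambda>S. \<not> counit H S)"
  using allsym_principal[OF counit_compatible] counit_iff
  by (subst principal_cong[OF coend_complete_lattice]) auto

lemma counit_gen: "p \<in> points G a \<Longrightarrow> q \<in> points G a \<Longrightarrow> counit H (gen a p q) \<longleftrightarrow> p = q"
  using counit_iff[OF gen_closed] allsym_gen[OF counit_compatible] by auto

section \<open>The bialgebra axioms\<close>

lemma H_sup_le_iff:
  "A \<subseteq> carrier C \<Longrightarrow> z \<in> carrier C \<Longrightarrow> \<Squnion>\<^bsub>H\<^esub> A \<subseteq> z \<longleftrightarrow> (\<forall>a\<in>A. a \<subseteq> z)"
  using sup_le_iff[OF coend_complete_lattice] by simp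

lemma T_sup_le_iff:
  "A \<subseteq> carrier T \<Longrightarrow> z \<in> carrier T \<Longrightarrow> \<Squnion>\<^bsub>T\<^esub> A \<subseteq> z \<longleftrightarrow> (\<forall>a\<in>A. a \<subseteq> z)"
  using sup_le_iff[OF T_complete_lattice] by simp

lemma sup_C_closed: "A \<subseteq> carrier C \<Longrightarrow> \<Squnion>\<^bsub>C\<^esub> A \<in> carrier C"
proof -
  interpret complete_lattice C by (rule coend_complete_lattice)
  show "A \<subseteq> carrier C \<Longrightarrow> \<Squnion>\<^bsub>C\<^esub> A \<in> carrier C" by (rule sup_closed)
qed

lemma C_eqI:
  assumes "a \<in> carrier C" "b \<in> carrier C" "\<And>z. z \<in> carrier C \<Longrightarrow> a \<subseteq> z \<longleftrightarrow> b \<subseteq> z" shows "a = b"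
  using eq_via_upper_bounds[OF coend_complete_lattice assms(1,2)] assms(3) by simp

lemma C_sup_eqI:
  assumes "A \<subseteq> carrier C" "b \<in> carrier C"
    "\<And>z. z \<in> carrier C \<Longrightarrow> (\<forall>a\<in>A. a \<subseteq> z) \<longleftrightarrow> b \<subseteq> z" shows "\<Squnion>\<^bsub>H\<^esub> A = b"
  using C_eqI[of "\<Squnion>\<^bsub>H\<^esub> A" b] sup_C_closed[OF assms(1)] assms H_sup_le_iff by simp

lemma C_sup_eq_supI:
  assumes "A \<subseteq> carrier C" "B \<subseteq> carrier C"
    "\<And>z. z \<in> carrier C \<Longrightarrow> (\<forall>a\<in>A. a \<subseteq> z) \<longleftrightarrow> (\<forall>a\<in>B. a \<subseteq> z)" shows "\<Squnion>\<^bsub>H\<^esub> A = \<Squnion>\<^bsub>H\<^esub> B"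
  using assms sup_C_closed[OF assms(2)] H_sup_le_iff[OF assms(2)] by (intro C_sup_eqI) auto

lemma principal_le_C: "z \<in> carrier C \<Longrightarrow> principal_pred C (\<lambda>a. a \<subseteq> z)"
  using principal_le[OF coend_complete_lattice] by simp

lemma pure_le_T: "l \<in> carrier C \<Longrightarrow> m \<in> carrier C \<Longrightarrow> Z \<in> carrier T \<Longrightarrow> pure C C l m \<subseteq> Z \<longleftrightarrow> (l, m) \<in> Z"
  by (rule pure_le_iff)

lemma pure_C_closed: "l \<in> carrier C \<Longrightarrow> m \<in> carrier C \<Longrightarrow> pure C C l m \<in> carrier T"
  by (intro pure_closed coend_complete_lattice)

lemma hone_eq: "hone H = gen [] [] []" by (simp add: H_omega_def)

lemma hone_closed: "hone H \<in> carrier C" unfolding hone_eq by (rule gen_closed) simp_all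

lemma scal_le_C: "z \<in> carrier C \<Longrightarrow> scal H s a \<subseteq> z \<longleftrightarrow> (s \<longrightarrow> a \<subseteq> z)"
  using scal_le_iff[OF H_complete_lattice, of z s a] by simp

lemma scal_closed_C: "a \<in> carrier C \<Longrightarrow> scal H s a \<in> carrier C"
  using scal_closed[OF H_complete_lattice, of a s] by simp

lemma prod_le_iff:
  assumes "S \<in> carrier C" "U \<in> carrier C" "z \<in> carrier C"
  shows "prod_H S U \<subseteq> z \<longleftrightarrow> allsym (\<lambda>a p q. allsym (\<lambda>b p' q'. (a @ b, p @ p', q @ q') \<in> z) U) S"
proof -
  have "prod_H S U \<subseteq> z \<longleftrightarrow> allsym (\<lambda>a p q. allsym (\<lambda>b p' q'. gen (a @ b) (p @ p') (q @ q') \<subseteq> z) U) S"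
    by (rule prod_principal[OF principal_le_C[OF assms(3)] assms(1,2)])
  also have "\<dots> \<longleftrightarrow> allsym (\<lambda>a p q. allsym (\<lambda>b p' q'. (a @ b, p @ p', q @ q') \<in> z) U) S"
    by (intro allsym_cong assms) (simp add: gen_le_iff assms)
  finally show ?thesis .
qed

lemma mem_principal_left: "Z \<in> carrier T \<Longrightarrow> m \<in> carrier C \<Longrightarrow> principal_pred C (\<lambda>l. (l, m) \<in> Z)"
  and mem_principal_right: "Z \<in> carrier T \<Longrightarrow> l \<in> carrier C \<Longrightarrow> principal_pred C (\<lambda>m. (l, m) \<in> Z)"
  using biprincipal_tensor unfolding biprincipal_def by blast+

lemma allsym_points_append:
  assumes "p \<in> points G a" "q \<in> points G a" "p' \<in> points G b" "q' \<in> points G b"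
  shows "(\<forall>l\<in>points G (a @ b). P l) \<longleftrightarrow> (\<forall>l\<in>points G a. \<forall>l'\<in>points G b. P (l @ l'))"
  by (metis points_append points_appendE)

lemma H_prod_assoc:
  assumes "a \<in> carrier H" "b \<in> carrier H" "c \<in> carrier H"
  shows "prod_H (prod_H a b) c = prod_H a (prod_H b c)"
proof -
  have c: "a \<in> carrier C" "b \<in> carrier C" "c \<in> carrier C" using assms by simp_all
  show ?thesis
  proof (rule C_eqI)
    fix z assume z: "z \<in> carrier C"
    have "prod_H (prod_H a b) c \<subseteq> z \<longleftrightarrow>
      allsym (\<lambda>a p q. allsym (\<lambda>b p' q'. prod_H (gen (a @ b) (p @ p') (q @ q')) c \<subseteq> z) b) a"
      by (rule prod_principal[OF prod_principal_left[OF principal_le_C[OF z] c(3)] c(1,2)])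
    also have "\<dots> \<longleftrightarrow> allsym (\<lambda>a p q. allsym (\<lambda>b p' q'. allsym (\<lambda>d s t.
        gen ((a @ b) @ d) ((p @ p') @ s) ((q @ q') @ t) \<subseteq> z) c) b) a"
      by (intro allsym_cong c, subst principal_allsym[OF prod_principal_right[OF principal_le_C[OF z]] c(3)])
        (auto intro!: gen_closed allsym_cong c simp: prod_gen)
    also have "\<dots> \<longleftrightarrow> allsym (\<lambda>a p q. prod_H (gen a p q) (prod_H b c) \<subseteq> z) a"
      by (intro allsym_cong c, subst prod_principal[OF prod_principal_right[OF principal_le_C[OF z]] c(2,3)])
        (auto intro!: gen_closed allsym_cong c simp: prod_gen)
    also have "\<dots> \<longleftrightarrow> prod_H a (prod_H b c) \<subseteq> z"
      by (rule principal_allsym[OF prod_principal_left[OF principal_le_C[OF z] prod_closed[OF c(2,3)]] c(1), symmetric])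
    finally show "prod_H (prod_H a b) c \<subseteq> z \<longleftrightarrow> prod_H a (prod_H b c) \<subseteq> z" .
  qed (use c in \<open>auto intro!: prod_closed\<close>)
qed

lemma H_one_prod:
  assumes "a \<in> carrier H"
  shows "prod_H (hone H) a = a"
proof -
  have c: "a \<in> carrier C" using assms by simp
  show ?thesis
  proof (rule C_eqI)
    fix z assume z: "z \<in> carrier C"
    have "prod_H (hone H) a \<subseteq> z \<longleftrightarrow> allsym (\<lambda>a p q. prod_H (hone H) (gen a p q) \<subseteq> z) a"
      by (rule principal_allsym[OF prod_principal_right[OF principal_le_C[OF z] hone_closed] c])
    also have "\<dots> \<longleftrightarrow> allsym (\<lambda>a p q. gen a p q \<subseteq> z) a"
      by (intro allsym_cong c) (simp add: hone_eq prod_gen)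
    also have "\<dots> \<longleftrightarrow> a \<subseteq> z" by (rule principal_allsym[OF principal_le_C[OF z] c, symmetric])
    finally show "prod_H (hone H) a \<subseteq> z \<longleftrightarrow> a \<subseteq> z" .
  qed (use c in \<open>auto intro!: prod_closed hone_closed\<close>)
qed

lemma H_prod_one:
  assumes "a \<in> carrier H"
  shows "prod_H a (hone H) = a"
proof -
  have c: "a \<in> carrier C" using assms by simp
  show ?thesis
  proof (rule C_eqI)
    fix z assume z: "z \<in> carrier C"
    have "prod_H a (hone H) \<subseteq> z \<longleftrightarrow> allsym (\<lambda>a p q. prod_H (gen a p q) (hone H) \<subseteq> z) a"
      by (rule principal_allsym[OF prod_principal_left[OF principal_le_C[OF z] hone_closed] c])
    also have "\<dots> \<longleftrightarrow> allsym (\<lambda>a p q. gen a p q \<subseteq> z) a"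
      by (intro allsym_cong c) (simp add: hone_eq prod_gen)
    also have "\<dots> \<longleftrightarrow> a \<subseteq> z" by (rule principal_allsym[OF principal_le_C[OF z] c, symmetric])
    finally show "prod_H a (hone H) \<subseteq> z \<longleftrightarrow> a \<subseteq> z" .
  qed (use c in \<open>auto intro!: prod_closed hone_closed\<close>)
qed

lemma H_coassoc:
  assumes "a \<in> carrier H"
  shows "\<Squnion>\<^bsub>tensor (tensor H H) H\<^esub> {pure (tensor H H) H (pure H H a1 a2) a3 | a1 a2 a3 u.
          (u, a3) \<in> comult H a \<and> (a1, a2) \<in> comult H u} =
      \<Squnion>\<^bsub>tensor (tensor H H) H\<^esub> {pure (tensor H H) H (pure H H a1 a2) a3 | a1 a2 a3 u.
          (a1, u) \<in> comult H a \<and> (a2, a3) \<in> comult H u}"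
proof -
  have c: "a \<in> carrier C" using assms by simp
  let ?T3 = "tensor T C"
  have cl3: "complete_lattice ?T3" by (intro tensor_complete_lattice T_complete_lattice coend_complete_lattice)
  let ?A = "{pure T C (pure C C a1 a2) a3 | a1 a2 a3 u. (u, a3) \<in> comult H a \<and> (a1, a2) \<in> comult H u}"
  let ?B = "{pure T C (pure C C a1 a2) a3 | a1 a2 a3 u. (a1, u) \<in> comult H a \<and> (a2, a3) \<in> comult H u}"
  have pc: "pure T C (pure C C a1 a2) a3 \<in> carrier ?T3"
    if "a1 \<in> carrier C" "a2 \<in> carrier C" "a3 \<in> carrier C" for a1 a2 a3
    using that by (intro pure_closed pure_C_closed T_complete_lattice coend_complete_lattice)
  have memA: "a1 \<in> carrier C \<and> a2 \<in> carrier C \<and> a3 \<in> carrier C"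
    if "(u, a3) \<in> comult H a" "(a1, a2) \<in> comult H u" for a1 a2 a3 u
    using comult_mem[OF c that(1)] comult_mem[OF _ that(2)] by blast
  have memB: "a1 \<in> carrier C \<and> a2 \<in> carrier C \<and> a3 \<in> carrier C"
    if "(a1, u) \<in> comult H a" "(a2, a3) \<in> comult H u" for a1 a2 a3 u
    using comult_mem[OF c that(1)] comult_mem[OF _ that(2)] by blast
  have A: "?A \<subseteq> carrier ?T3" and B: "?B \<subseteq> carrier ?T3"
    using memA memB pc by blast+
  interpret T3: complete_lattice ?T3 by (rule cl3)
  have "\<Squnion>\<^bsub>?T3\<^esub> ?A = \<Squnion>\<^bsub>?T3\<^esub> ?B"
  proof (rule eq_via_upper_bounds[OF cl3 T3.sup_closed[OF A] T3.sup_closed[OF B]])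
    fix z assume z: "z \<in> carrier ?T3"
    have pz: "pure T C (pure C C a1 a2) a3 \<sqsubseteq>\<^bsub>?T3\<^esub> z \<longleftrightarrow> (pure C C a1 a2, a3) \<in> z"
      if "a1 \<in> carrier C" "a2 \<in> carrier C" "a3 \<in> carrier C" for a1 a2 a3
      using pure_le_iff[OF pure_C_closed[OF that(1,2)] that(3) z] by simp
    have z1: "biprincipal C C (\<lambda>a1 a2. (pure C C a1 a2, a3) \<in> z)" if "a3 \<in> carrier C" for a3
      using biprincipal_tensor[OF z] that unfolding biprincipal_def[of T]
      by (intro principal_pure(1)[OF coend_complete_lattice coend_complete_lattice]) blast
    have z2: "principal_pred C (\<lambda>a3. (t, a3) \<in> z)" if "t \<in> carrier T" for t
      using biprincipal_tensor[OF z] that unfolding biprincipal_def by blast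
    have B1: "biprincipal C C (\<lambda>u a3. \<forall>(a1, a2)\<in>comult H u. (pure C C a1 a2, a3) \<in> z)"
      unfolding biprincipal_def
    proof (intro conjI ballI)
      fix u assume u: "u \<in> carrier C"
      have "principal_pred C (\<lambda>a3. (pure C C (fst x) (snd x), a3) \<in> z)" if "x \<in> comult H u" for x
        using comult_mem[OF u, of "fst x" "snd x"] that by (intro z2 pure_C_closed) auto
      from principal_ball[OF this]
      show "principal_pred C (\<lambda>a3. \<forall>(a1, a2)\<in>comult H u. (pure C C a1 a2, a3) \<in> z)"
        by (simp add: case_prod_beta)
    next
      fix a3 assume "a3 \<in> carrier C"
      then show "principal_pred C (\<lambda>u. \<forall>(a1, a2)\<in>comult H u. (pure C C a1 a2, a3) \<in> z)"
        by (intro comult_ball_principal z1)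
    qed
    have z1': "biprincipal C C (\<lambda>a2 a3. (pure C C a1 a2, a3) \<in> z)" if "a1 \<in> carrier C" for a1
      unfolding biprincipal_def
      using z1 that z2 pure_C_closed unfolding biprincipal_def by blast
    have B2: "biprincipal C C (\<lambda>a1 u. \<forall>(a2, a3)\<in>comult H u. (pure C C a1 a2, a3) \<in> z)"
      unfolding biprincipal_def
    proof (intro conjI ballI)
      fix u assume u: "u \<in> carrier C"
      have "principal_pred C (\<lambda>a1. (pure C C a1 (fst x), snd x) \<in> z)" if "x \<in> comult H u" for x
        using comult_mem[OF u, of "fst x" "snd x"] that z1[of "snd x"] unfolding biprincipal_def by auto
      from principal_ball[OF this]
      show "principal_pred C (\<lambda>a1. \<forall>(a2, a3)\<in>comult H u. (pure C C a1 a2, a3) \<in> z)"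
        by (simp add: case_prod_beta)
    next
      fix a1 assume "a1 \<in> carrier C"
      then show "principal_pred C (\<lambda>u. \<forall>(a2, a3)\<in>comult H u. (pure C C a1 a2, a3) \<in> z)"
        by (intro comult_ball_principal z1')
    qed
    have "\<Squnion>\<^bsub>?T3\<^esub> ?A \<sqsubseteq>\<^bsub>?T3\<^esub> z \<longleftrightarrow>
      (\<forall>(u, a3)\<in>comult H a. \<forall>(a1, a2)\<in>comult H u. (pure C C a1 a2, a3) \<in> z)"
    proof -
      have eq: "pure T C (pure C C a1 a2) a3 \<sqsubseteq>\<^bsub>?T3\<^esub> z \<longleftrightarrow> (pure C C a1 a2, a3) \<in> z"
        if "(u, a3) \<in> comult H a" "(a1, a2) \<in> comult H u" for a1 a2 a3 u
        using pz memA[OF that] by blast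
      have "(\<forall>x\<in>?A. x \<sqsubseteq>\<^bsub>?T3\<^esub> z) \<longleftrightarrow> (\<forall>u a3 a1 a2. (u, a3) \<in> comult H a \<longrightarrow> (a1, a2) \<in> comult H u \<longrightarrow>
          pure T C (pure C C a1 a2) a3 \<sqsubseteq>\<^bsub>?T3\<^esub> z)" by blast
      also have "\<dots> \<longleftrightarrow> (\<forall>u a3 a1 a2. (u, a3) \<in> comult H a \<longrightarrow> (a1, a2) \<in> comult H u \<longrightarrow>
          (pure C C a1 a2, a3) \<in> z)" using eq by blast
      finally show ?thesis unfolding sup_le_iff[OF cl3 A z] by blast
    qed
    also have "\<dots> \<longleftrightarrow> allsym (\<lambda>a p q. \<forall>l\<in>points G a. \<forall>(a1, a2)\<in>comult H (gen a p l).
        (pure C C a1 a2, gen a l q) \<in> z) a"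
      by (rule comult_ball[OF B1 c])
    also have "\<dots> \<longleftrightarrow> allsym (\<lambda>a p q. \<forall>l\<in>points G a. \<forall>l'\<in>points G a.
        (pure C C (gen a p l') (gen a l' l), gen a l q) \<in> z) a"
      by (intro allsym_cong[OF c] ball_cong HOL.refl comult_ball_gen z1 gen_closed)
    also have "\<dots> \<longleftrightarrow> allsym (\<lambda>a p q. \<forall>l\<in>points G a. \<forall>l'\<in>points G a.
        (pure C C (gen a p l) (gen a l l'), gen a l' q) \<in> z) a"
      \<comment> \<open>Both sides run over all pairs of middle indices.\<close>
      by (intro allsym_cong[OF c]) blast
    also have "\<dots> \<longleftrightarrow> allsym (\<lambda>a p q. \<forall>l\<in>points G a. \<forall>(a2, a3)\<in>comult H (gen a l q).
        (pure C C (gen a p l) a2, a3) \<in> z) a"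
      by (intro allsym_cong[OF c] ball_cong HOL.refl comult_ball_gen[symmetric] z1' gen_closed)
    also have "\<dots> \<longleftrightarrow> (\<forall>(a1, u)\<in>comult H a. \<forall>(a2, a3)\<in>comult H u. (pure C C a1 a2, a3) \<in> z)"
      by (rule comult_ball[OF B2 c, symmetric])
    also have "\<dots> \<longleftrightarrow> \<Squnion>\<^bsub>?T3\<^esub> ?B \<sqsubseteq>\<^bsub>?T3\<^esub> z"
    proof -
      have eq: "pure T C (pure C C a1 a2) a3 \<sqsubseteq>\<^bsub>?T3\<^esub> z \<longleftrightarrow> (pure C C a1 a2, a3) \<in> z"
        if "(a1, u) \<in> comult H a" "(a2, a3) \<in> comult H u" for a1 a2 a3 u
        using pz memB[OF that] by blast
      have "(\<forall>x\<in>?B. x \<sqsubseteq>\<^bsub>?T3\<^esub> z) \<longleftrightarrow> (\<forall>u a3 a1 a2. (a1, u) \<in> comult H a \<longrightarrow> (a2, a3) \<in> comult H u \<longrightarrow>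
          pure T C (pure C C a1 a2) a3 \<sqsubseteq>\<^bsub>?T3\<^esub> z)" by blast
      also have "\<dots> \<longleftrightarrow> (\<forall>u a3 a1 a2. (a1, u) \<in> comult H a \<longrightarrow> (a2, a3) \<in> comult H u \<longrightarrow>
          (pure C C a1 a2, a3) \<in> z)" using eq by blast
      finally show ?thesis unfolding sup_le_iff[OF cl3 B z] by blast
    qed
    finally show "\<Squnion>\<^bsub>?T3\<^esub> ?A \<sqsubseteq>\<^bsub>?T3\<^esub> z \<longleftrightarrow> \<Squnion>\<^bsub>?T3\<^esub> ?B \<sqsubseteq>\<^bsub>?T3\<^esub> z" .
  qed
  moreover have "tensor T H = ?T3" "pure T H = pure T C"
    using tensor_cong[of T T H C] by simp_all
  ultimately show ?thesis by simp
qed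

lemma H_counit_left:
  assumes "a \<in> carrier H"
  shows "\<Squnion>\<^bsub>H\<^esub> {scal H (counit H a1) a2 | a1 a2. (a1, a2) \<in> comult H a} = a"
proof -
  have c: "a \<in> carrier C" using assms by simp
  show ?thesis
  proof (rule C_sup_eqI[OF _ c])
    show "{scal H (counit H a1) a2 |a1 a2. (a1, a2) \<in> comult H a} \<subseteq> carrier C"
      using comult_mem[OF c] by (auto intro!: scal_closed_C)
    fix z assume z: "z \<in> carrier C"
    have B: "biprincipal C C (\<lambda>a1 a2. counit H a1 \<longrightarrow> a2 \<subseteq> z)"
      unfolding biprincipal_def
      by (intro conjI ballI principal_imp principal_not_imp counit_principal principal_le_C z)
    have "(\<forall>x\<in>{scal H (counit H a1) a2 |a1 a2. (a1, a2) \<in> comult H a}. x \<subseteq> z) \<longleftrightarrow>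
      (\<forall>(a1, a2)\<in>comult H a. counit H a1 \<longrightarrow> a2 \<subseteq> z)"
      unfolding ball_comprehension2 scal_le_C[OF z] by blast
    also have "\<dots> \<longleftrightarrow> allsym (\<lambda>a p q. gen a p q \<subseteq> z) a"
      unfolding comult_ball[OF B c] by (intro allsym_cong[OF c]) (auto simp: counit_gen)
    also have "\<dots> \<longleftrightarrow> a \<subseteq> z" by (rule principal_allsym[OF principal_le_C[OF z] c, symmetric])
    finally show "(\<forall>x\<in>{scal H (counit H a1) a2 |a1 a2. (a1, a2) \<in> comult H a}. x \<subseteq> z) \<longleftrightarrow> a \<subseteq> z" .
  qed
qed

lemma H_counit_right:
  assumes "a \<in> carrier H"
  shows "\<Squnion>\<^bsub>H\<^esub> {scal H (counit H a2) a1 | a1 a2. (a1, a2) \<in> comult H a} = a"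
proof -
  have c: "a \<in> carrier C" using assms by simp
  show ?thesis
  proof (rule C_sup_eqI[OF _ c])
    show "{scal H (counit H a2) a1 |a1 a2. (a1, a2) \<in> comult H a} \<subseteq> carrier C"
      using comult_mem[OF c] by (auto intro!: scal_closed_C)
    fix z assume z: "z \<in> carrier C"
    have B: "biprincipal C C (\<lambda>a1 a2. counit H a2 \<longrightarrow> a1 \<subseteq> z)"
      unfolding biprincipal_def
      by (intro conjI ballI principal_imp principal_not_imp counit_principal principal_le_C z)
    have "(\<forall>x\<in>{scal H (counit H a2) a1 |a1 a2. (a1, a2) \<in> comult H a}. x \<subseteq> z) \<longleftrightarrow>
      (\<forall>(a1, a2)\<in>comult H a. counit H a2 \<longrightarrow> a1 \<subseteq> z)"
      unfolding ball_comprehension2 scal_le_C[OF z] by blast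
    also have "\<dots> \<longleftrightarrow> allsym (\<lambda>a p q. gen a p q \<subseteq> z) a"
      unfolding comult_ball[OF B c] by (intro allsym_cong[OF c]) (auto simp: counit_gen)
    also have "\<dots> \<longleftrightarrow> a \<subseteq> z" by (rule principal_allsym[OF principal_le_C[OF z] c, symmetric])
    finally show "(\<forall>x\<in>{scal H (counit H a2) a1 |a1 a2. (a1, a2) \<in> comult H a}. x \<subseteq> z) \<longleftrightarrow> a \<subseteq> z" .
  qed
qed

lemma H_comult_prod:
  assumes "a \<in> carrier H" "b \<in> carrier H"
  shows "comult H (prod_H a b) =
      \<Squnion>\<^bsub>tensor H H\<^esub> {pure H H (prod_H a1 b1) (prod_H a2 b2) | a1 a2 b1 b2.
          (a1, a2) \<in> comult H a \<and> (b1, b2) \<in> comult H b}"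
proof -
  have c: "a \<in> carrier C" "b \<in> carrier C" using assms by simp_all
  let ?A = "{pure C C (prod_H a1 b1) (prod_H a2 b2) | a1 a2 b1 b2.
          (a1, a2) \<in> comult H a \<and> (b1, b2) \<in> comult H b}"
  have "pure C C (prod_H a1 b1) (prod_H a2 b2) \<in> carrier T"
    if "(a1, a2) \<in> comult H a" "(b1, b2) \<in> comult H b" for a1 a2 b1 b2
    using comult_mem[OF c(1) that(1)] comult_mem[OF c(2) that(2)] by (intro pure_C_closed prod_closed)
  then have A: "?A \<subseteq> carrier T" by blast
  interpret T: complete_lattice T by (rule T_complete_lattice)
  have "comult H (prod_H a b) = \<Squnion>\<^bsub>T\<^esub> ?A"
  proof (rule eq_via_upper_bounds[OF T_complete_lattice])
    fix z assume z: "z \<in> carrier T"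
    note zb = biprincipal_tensor[OF z]
    have inner: "biprincipal C C (\<lambda>b1 b2. (prod_H a1 b1, prod_H a2 b2) \<in> z)"
      "biprincipal C C (\<lambda>a1 a2. (prod_H a1 b1, prod_H a2 b2) \<in> z)"
      if "a1 \<in> carrier C" "a2 \<in> carrier C" "b1 \<in> carrier C" "b2 \<in> carrier C" for a1 a2 b1 b2
      unfolding biprincipal_def using that
      by (auto intro!: prod_principal_left[where P = "\<lambda>l. (l, _) \<in> z"] prod_principal_left[where P = "\<lambda>l. (_, l) \<in> z"]
          prod_principal_right[where P = "\<lambda>l. (l, _) \<in> z"] prod_principal_right[where P = "\<lambda>l. (_, l) \<in> z"]
          mem_principal_left[OF z] mem_principal_right[OF z] prod_closed)
    have outer: "biprincipal C C (\<lambda>a1 a2. \<forall>(b1, b2)\<in>comult H b. (prod_H a1 b1, prod_H a2 b2) \<in> z)"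
    proof -
      have "biprincipal C C (\<lambda>a1 a2. (prod_H a1 (fst x), prod_H a2 (snd x)) \<in> z)" if "x \<in> comult H b" for x
        using comult_mem[OF c(2), of "fst x" "snd x"] that inner(2)[OF c(1,1)] by simp
      then show ?thesis unfolding biprincipal_def case_prod_beta by (auto intro!: principal_ball)
    qed
    have "comult H (prod_H a b) \<sqsubseteq>\<^bsub>T\<^esub> z \<longleftrightarrow> (\<forall>(x, y)\<in>comult H (prod_H a b). (x, y) \<in> z)"
      by auto
    also have "\<dots> \<longleftrightarrow> allsym (\<lambda>a p q. allsym (\<lambda>b p' q'.
        \<forall>(x, y)\<in>comult H (gen (a @ b) (p @ p') (q @ q')). (x, y) \<in> z) b) a"
      by (rule prod_principal[OF comult_ball_principal[OF zb] c])
    also have "\<dots> \<longleftrightarrow> allsym (\<lambda>a p q. allsym (\<lambda>b p' q'. \<forall>l\<in>points G a. \<forall>l'\<in>points G b.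
        (prod_H (gen a p l) (gen b p' l'), prod_H (gen a l q) (gen b l' q')) \<in> z) b) a"
    proof (intro allsym_cong c)
      fix a p q b p' q'
      assume *: "p \<in> points G a" "q \<in> points G a" "p' \<in> points G b" "q' \<in> points G b"
      have "(\<forall>(x, y)\<in>comult H (gen (a @ b) (p @ p') (q @ q')). (x, y) \<in> z) \<longleftrightarrow>
        (\<forall>l\<in>points G (a @ b). (gen (a @ b) (p @ p') l, gen (a @ b) l (q @ q')) \<in> z)"
        using * by (intro comult_ball_gen[OF zb]) auto
      then show "(\<forall>(x, y)\<in>comult H (gen (a @ b) (p @ p') (q @ q')). (x, y) \<in> z) \<longleftrightarrow>
        (\<forall>l\<in>points G a. \<forall>l'\<in>points G b.
        (prod_H (gen a p l) (gen b p' l'), prod_H (gen a l q) (gen b l' q')) \<in> z)"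
        unfolding allsym_points_append[OF *] using * by (simp add: prod_gen)
    qed
    also have "\<dots> \<longleftrightarrow> allsym (\<lambda>a p q. \<forall>l\<in>points G a. allsym (\<lambda>b p' q'. \<forall>l'\<in>points G b.
        (prod_H (gen a p l) (gen b p' l'), prod_H (gen a l q) (gen b l' q')) \<in> z) b) a"
      unfolding allsym_def by (rule ball_cong[OF HOL.refl]) (auto simp: case_prod_beta)
    also have "\<dots> \<longleftrightarrow> allsym (\<lambda>a p q. \<forall>l\<in>points G a. \<forall>(b1, b2)\<in>comult H b.
        (prod_H (gen a p l) b1, prod_H (gen a l q) b2) \<in> z) a"
      by (intro allsym_cong[OF c(1)] ball_cong HOL.refl comult_ball[symmetric] inner(1)[OF _ _ c] gen_closed c)
    also have "\<dots> \<longleftrightarrow> (\<forall>(a1, a2)\<in>comult H a. \<forall>(b1, b2)\<in>comult H b. (prod_H a1 b1, prod_H a2 b2) \<in> z)"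
      by (rule comult_ball[OF outer c(1), symmetric])
    also have "\<dots> \<longleftrightarrow> (\<forall>x\<in>?A. x \<subseteq> z)"
    proof -
      have "pure C C (prod_H a1 b1) (prod_H a2 b2) \<subseteq> z \<longleftrightarrow> (prod_H a1 b1, prod_H a2 b2) \<in> z"
        if "(a1, a2) \<in> comult H a" "(b1, b2) \<in> comult H b" for a1 a2 b1 b2
        using comult_mem[OF c(1) that(1)] comult_mem[OF c(2) that(2)] by (intro pure_le_T prod_closed z)
      then show ?thesis unfolding ball_comprehension4 by blast
    qed
    also have "\<dots> \<longleftrightarrow> \<Squnion>\<^bsub>T\<^esub> ?A \<sqsubseteq>\<^bsub>T\<^esub> z" using T_sup_le_iff[OF A z] by simp
    finally show "comult H (prod_H a b) \<sqsubseteq>\<^bsub>T\<^esub> z \<longleftrightarrow> \<Squnion>\<^bsub>T\<^esub> ?A \<sqsubseteq>\<^bsub>T\<^esub> z" .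
  qed (use c A in \<open>auto intro!: comult_closed prod_closed T.sup_closed\<close>)
  then show ?thesis by simp
qed

lemma H_comult_one:
  shows "comult H (hone H) = pure H H (hone H) (hone H)"
proof -
  have "comult H (hone H) = pure C C (hone H) (hone H)"
  proof (rule eq_via_upper_bounds[OF T_complete_lattice])
    fix z assume z: "z \<in> carrier T"
    have "comult H (hone H) \<subseteq> z \<longleftrightarrow> (\<forall>(x, y)\<in>comult H (gen [] [] []). (x, y) \<in> z)" by (auto simp: hone_eq)
    also have "\<dots> \<longleftrightarrow> (hone H, hone H) \<in> z"
      by (subst comult_ball_gen[OF biprincipal_tensor[OF z]]) (auto simp: hone_eq)
    finally show "comult H (hone H) \<sqsubseteq>\<^bsub>T\<^esub> z \<longleftrightarrow> pure C C (hone H) (hone H) \<sqsubseteq>\<^bsub>T\<^esub> z"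
      using pure_le_T[OF hone_closed hone_closed z] by simp
  qed (auto intro!: comult_closed pure_C_closed hone_closed)
  then show ?thesis by simp
qed

lemma H_counit_prod:
  assumes "a \<in> carrier H" "b \<in> carrier H"
  shows "counit H (prod_H a b) = (counit H a \<and> counit H b)"
proof -
  have c: "a \<in> carrier C" "b \<in> carrier C" using assms by simp_all
  have "\<not> counit H (prod_H a b) \<longleftrightarrow>
    allsym (\<lambda>a p q. allsym (\<lambda>b p' q'. \<not> counit H (gen (a @ b) (p @ p') (q @ q'))) b) a"
    by (rule prod_principal[OF counit_principal c])
  also have "\<dots> \<longleftrightarrow> allsym (\<lambda>a p q. allsym (\<lambda>b p' q'. p \<noteq> q \<or> p' \<noteq> q') b) a"
    by (intro allsym_cong c) (auto simp: counit_gen points_iff)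
  also have "\<dots> \<longleftrightarrow> \<not> (counit H a \<and> counit H b)"
    unfolding counit_iff[OF c(1)] counit_iff[OF c(2)] allsym_def by blast
  finally show ?thesis by blast
qed

lemma H_bialgebra: "suplat_bialgebra H"
proof (intro suplat_bialgebra.intro suplat_bialgebra_axioms.intro H_complete_lattice prod_bi_sup_hom
    H_prod_assoc H_one_prod H_prod_one H_coassoc H_counit_left H_counit_right H_comult_prod
    H_comult_one H_counit_prod)
  show "hone H \<in> carrier H" using hone_closed by simp
  show "sup_hom H (tensor H H) (comult H)" using comult_sup_hom by simp
  show "sup_hom H sup_unit (counit H)" using counit_principal by (simp add: sup_hom_sup_unit)
  show "counit H (hone H) = True" by (simp add: hone_eq counit_gen)
qed

section \<open>The antipode\<close>

text \<open>The transposed matrix coefficient, indexed by the dual object.\<close>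

definition antip :: "'a sym set \<Rightarrow> 'a sym set" where
  "antip S = \<Squnion>\<^bsub>C\<^esub> {gen (dual a) (rev q) (rev p) | a p q. (a, p, q) \<in> S}"

lemma antip_principal:
  assumes P: "principal_pred C P" and S: "S \<in> carrier C"
  shows "P (antip S) \<longleftrightarrow> allsym (\<lambda>a p q. P (gen (dual a) (rev q) (rev p))) S"
proof -
  have sub: "{gen (dual a) (rev q) (rev p) | a p q. (a, p, q) \<in> S} \<subseteq> carrier C"
    using symD[OF S] by (auto intro!: gen_closed)
  show ?thesis unfolding antip_def principalD[OF P sub] allsym_def by blast
qed

lemma antip_closed: "S \<in> carrier C \<Longrightarrow> antip S \<in> carrier C"
  unfolding antip_def using symD by (auto intro!: sup_C_closed gen_closed)

text \<open>The relation for f becomes the relation for the transpose of f.\<close>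

lemma antip_compatible:
  assumes P: "principal_pred C P"
  shows "compatible (\<lambda>a p q. P (gen (dual a) (rev q) (rev p)))"
proof (rule compatibleI)
  fix f a b p q assume f: "arr f a b" "p \<in> points G a" "q \<in> points G b"
  note m = arr_dual_mor[OF f(1)]
  have *: "(\<forall>x. W (dual_mor f) (rev q) x \<longrightarrow> P (gen (dual a) x (rev p))) \<longleftrightarrow>
    (\<forall>y. W (dual_mor f) y (rev p) \<longrightarrow> P (gen (dual b) (rev q) y))"
    using f by (intro compatibleD[OF principal_compatible[OF P] m]) auto
  have 1: "W (dual_mor f) (rev q) x \<longleftrightarrow> W f (rev x) q" for x
  proof (cases "rev x \<in> points G a")
    case True
    then show ?thesis using W_dual_mor[OF f(1) True f(3)] by simp
  next
    case False
    then have "x \<notin> points G (dual a)" using points_simps(3)[of "rev x" a] by simp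
    then show ?thesis using W_points[OF m] W_points[OF f(1)] False by blast
  qed
  have 2: "W (dual_mor f) y (rev p) \<longleftrightarrow> W f p (rev y)" for y
  proof (cases "rev y \<in> points G b")
    case True
    then show ?thesis using W_dual_mor[OF f(1,2) True] by simp
  next
    case False
    then have "y \<notin> points G (dual b)" using points_simps(3)[of "rev y" b] by simp
    then show ?thesis using W_points[OF m] W_points[OF f(1)] False by blast
  qed
  show "(\<forall>p'. W f p p' \<longrightarrow> P (gen (dual b) (rev q) (rev p'))) \<longleftrightarrow>
    (\<forall>q'. W f q' q \<longrightarrow> P (gen (dual a) (rev q') (rev p)))"
    using * unfolding 1 2 by (metis rev_rev_ident)
qed

lemma antip_gen: "p \<in> points G a \<Longrightarrow> q \<in> points G a \<Longrightarrow> antip (gen a p q) = gen (dual a) (rev q) (rev p)"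
proof (rule C_eqI)
  assume *: "p \<in> points G a" "q \<in> points G a"
  fix z assume z: "z \<in> carrier C"
  show "antip (gen a p q) \<subseteq> z \<longleftrightarrow> gen (dual a) (rev q) (rev p) \<subseteq> z"
    unfolding antip_principal[OF principal_le_C[OF z] gen_closed[OF *]]
    by (rule allsym_gen[OF antip_compatible[OF principal_le_C[OF z]] *])
qed (auto intro!: antip_closed gen_closed)

lemma antip_principal_pred:
  assumes P: "principal_pred C P" shows "principal_pred C (\<lambda>S. P (antip S))"
  using allsym_principal[OF antip_compatible[OF P]] antip_principal[OF P]
  by (subst principal_cong[OF coend_complete_lattice]) auto

lemma antip_antip: "S \<in> carrier C \<Longrightarrow> antip (antip S) = S"
proof (rule C_eqI)
  assume S: "S \<in> carrier C"
  fix z assume z: "z \<in> carrier C"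
  have "antip (antip S) \<subseteq> z \<longleftrightarrow> allsym (\<lambda>a p q. antip (gen (dual a) (rev q) (rev p)) \<subseteq> z) S"
    by (rule antip_principal[OF antip_principal_pred[OF principal_le_C[OF z]] S])
  also have "\<dots> \<longleftrightarrow> allsym (\<lambda>a p q. gen a p q \<subseteq> z) S"
    by (intro allsym_cong S) (simp add: antip_gen)
  also have "\<dots> \<longleftrightarrow> S \<subseteq> z" by (rule principal_allsym[OF principal_le_C[OF z] S, symmetric])
  finally show "antip (antip S) \<subseteq> z \<longleftrightarrow> S \<subseteq> z" .
qed (auto intro!: antip_closed)

text \<open>The relation of the coend for the evaluation of a, which is one antipode equation on
  symbols. The other equation is the relation for the coevaluation.\<close>

lemma gen_ev:
  assumes "p \<in> points G a" "q \<in> points G a" "z \<in> carrier C"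
  shows "(\<forall>l\<in>points G a. gen (a @ dual a) (p @ rev q) (l @ rev l) \<subseteq> z) \<longleftrightarrow> (p = q \<longrightarrow> hone H \<subseteq> z)"
proof -
  have "(\<forall>p'. W (ev_word a) (p @ rev q) p' \<longrightarrow> gen [] p' [] \<subseteq> z) \<longleftrightarrow>
    (\<forall>q'. W (ev_word a) q' [] \<longrightarrow> gen (a @ dual a) (p @ rev q) q' \<subseteq> z)"
    using assms by (intro compatibleD[OF principal_compatible[OF principal_le_C] arr_ev_word]) auto
  moreover have "W (ev_word a) (p @ rev q) p' \<longleftrightarrow> p' = [] \<and> p = q" for p'
    using W_ev_word[OF assms(1), of "rev q"] W_points(2)[OF arr_ev_word[of a], where p = "p @ rev q" and q = p'] assms by auto
  moreover have "W (ev_word a) q' [] \<longleftrightarrow> (\<exists>l\<in>points G a. q' = l @ rev l)" for q'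
  proof
    assume w: "W (ev_word a) q' []"
    then obtain l l' where l: "q' = l @ l'" "l \<in> points G a" "l' \<in> points G (dual a)"
      using W_points(1)[OF arr_ev_word] by (meson points_appendE)
    then show "\<exists>l\<in>points G a. q' = l @ rev l" using w W_ev_word by auto
  qed (auto simp: W_ev_word)
  ultimately show ?thesis by (auto simp: hone_eq)
qed

lemma gen_coev:
  assumes "p \<in> points G a" "q \<in> points G a" "z \<in> carrier C"
  shows "(\<forall>l\<in>points G a. gen (dual a @ a) (rev l @ l) (rev p @ q) \<subseteq> z) \<longleftrightarrow> (p = q \<longrightarrow> hone H \<subseteq> z)"
proof -
  have "(\<forall>p'. W (coev_word a) [] p' \<longrightarrow> gen (dual a @ a) p' (rev p @ q) \<subseteq> z) \<longleftrightarrow>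
    (\<forall>q'. W (coev_word a) q' (rev p @ q) \<longrightarrow> gen [] [] q' \<subseteq> z)"
    using assms by (intro compatibleD[OF principal_compatible[OF principal_le_C] arr_coev_word]) auto
  moreover have "W (coev_word a) q' (rev p @ q) \<longleftrightarrow> q' = [] \<and> p = q" for q'
    using W_coev_word[OF _ assms(2), of "rev p"] W_points(1)[OF arr_coev_word[of a], where p = q' and q = "rev p @ q"] assms by auto
  moreover have "W (coev_word a) [] p' \<longleftrightarrow> (\<exists>l\<in>points G a. p' = rev l @ l)" for p'
  proof
    assume w: "W (coev_word a) [] p'"
    then obtain l l' where l: "p' = l' @ l" "l' \<in> points G (dual a)" "l \<in> points G a"
      using W_points(2)[OF arr_coev_word] by (meson points_appendE)
    then show "\<exists>l\<in>points G a. p' = rev l @ l" using w W_coev_word by auto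
  qed (auto simp: W_coev_word)
  ultimately show ?thesis by (auto simp: hone_eq)
qed

lemma counit_scal_le:
  assumes a: "a \<in> carrier C" and z: "z \<in> carrier C"
  shows "allsym (\<lambda>a p q. p = q \<longrightarrow> hone H \<subseteq> z) a \<longleftrightarrow> scal H (counit H a) (hone H) \<subseteq> z"
  unfolding scal_le_C[OF z] counit_iff[OF a] allsym_def by auto

lemma antip_antipode: "antipode H antip"
  unfolding antipode_def
proof (intro conjI ballI)
  show "sup_hom H H antip"
    by (rule sup_hom_C[OF _ H_complete_lattice])
      (auto intro!: antip_closed antip_principal_pred principal_le_C)
  fix a assume "a \<in> carrier H"
  then have a: "a \<in> carrier C" by simp
  show "\<Squnion>\<^bsub>H\<^esub> {prod_H (antip a1) a2 |a1 a2. (a1, a2) \<in> comult H a} = scal H (counit H a) (hone H)"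
  proof (rule C_sup_eqI)
    show "{prod_H (antip a1) a2 |a1 a2. (a1, a2) \<in> comult H a} \<subseteq> carrier C"
      using comult_mem[OF a] by (auto intro!: prod_closed antip_closed)
    show "scal H (counit H a) (hone H) \<in> carrier C" by (intro scal_closed_C hone_closed)
    fix z assume z: "z \<in> carrier C"
    have B: "biprincipal C C (\<lambda>a1 a2. prod_H (antip a1) a2 \<subseteq> z)"
      unfolding biprincipal_def
      by (auto intro!: prod_principal_right principal_le_C z antip_closed
         antip_principal_pred[where P = "\<lambda>S. prod_H S _ \<subseteq> z"] prod_principal_left)
    have "(\<forall>x\<in>{prod_H (antip a1) a2 |a1 a2. (a1, a2) \<in> comult H a}. x \<subseteq> z) \<longleftrightarrow>
      (\<forall>(a1, a2)\<in>comult H a. prod_H (antip a1) a2 \<subseteq> z)" by blast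
    also have "\<dots> \<longleftrightarrow> allsym (\<lambda>a p q. \<forall>l\<in>points G a. prod_H (antip (gen a p l)) (gen a l q) \<subseteq> z) a"
      by (rule comult_ball[OF B a])
    also have "\<dots> \<longleftrightarrow> allsym (\<lambda>a p q. p = q \<longrightarrow> hone H \<subseteq> z) a"
      by (intro allsym_cong a) (simp add: antip_gen prod_gen gen_coev z)
    finally show "(\<forall>x\<in>{prod_H (antip a1) a2 |a1 a2. (a1, a2) \<in> comult H a}. x \<subseteq> z) \<longleftrightarrow>
      scal H (counit H a) (hone H) \<subseteq> z" unfolding counit_scal_le[OF a z] .
  qed
  show "\<Squnion>\<^bsub>H\<^esub> {prod_H a1 (antip a2) |a1 a2. (a1, a2) \<in> comult H a} = scal H (counit H a) (hone H)"
  proof (rule C_sup_eqI)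
    show "{prod_H a1 (antip a2) |a1 a2. (a1, a2) \<in> comult H a} \<subseteq> carrier C"
      using comult_mem[OF a] by (auto intro!: prod_closed antip_closed)
    show "scal H (counit H a) (hone H) \<in> carrier C" by (intro scal_closed_C hone_closed)
    fix z assume z: "z \<in> carrier C"
    have B: "biprincipal C C (\<lambda>a1 a2. prod_H a1 (antip a2) \<subseteq> z)"
      unfolding biprincipal_def
      by (auto intro!: prod_principal_left principal_le_C z antip_closed
         antip_principal_pred[where P = "\<lambda>S. prod_H _ S \<subseteq> z"] prod_principal_right)
    have "(\<forall>x\<in>{prod_H a1 (antip a2) |a1 a2. (a1, a2) \<in> comult H a}. x \<subseteq> z) \<longleftrightarrow>
      (\<forall>(a1, a2)\<in>comult H a. prod_H a1 (antip a2) \<subseteq> z)" by blast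
    also have "\<dots> \<longleftrightarrow> allsym (\<lambda>a p q. \<forall>l\<in>points G a. prod_H (gen a p l) (antip (gen a l q)) \<subseteq> z) a"
      by (rule comult_ball[OF B a])
    also have "\<dots> \<longleftrightarrow> allsym (\<lambda>a p q. p = q \<longrightarrow> hone H \<subseteq> z) a"
      by (intro allsym_cong a) (simp add: antip_gen prod_gen gen_ev z)
    finally show "(\<forall>x\<in>{prod_H a1 (antip a2) |a1 a2. (a1, a2) \<in> comult H a}. x \<subseteq> z) \<longleftrightarrow>
      scal H (counit H a) (hone H) \<subseteq> z" unfolding counit_scal_le[OF a z] .
  qed
qed

lemma H_hopf: "suplat_hopf_algebra H"
proof (intro suplat_hopf_algebra.intro H_bialgebra suplat_hopf_algebra_axioms.intro exI conjI)
  show "antipode H antip" by (rule antip_antipode)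
  show "bij_betw antip (carrier H) (carrier H)"
    by (rule bij_betw_byWitness[where f' = antip]) (auto simp: antip_antip intro: antip_closed)
qed

section \<open>The co-quasitriangular structure\<close>

abbreviation (input) R where "R \<equiv> R_omega G r"

definition allsym2 :: "(obj \<Rightarrow> 'a list \<Rightarrow> 'a list \<Rightarrow> obj \<Rightarrow> 'a list \<Rightarrow> 'a list \<Rightarrow> bool) \<Rightarrow> 'a sym set \<Rightarrow> 'a sym set \<Rightarrow> bool" where
  "allsym2 Q S U \<longleftrightarrow> allsym (\<lambda>a p q. allsym (Q a p q) U) S"

definition bicompatible :: "(obj \<Rightarrow> 'a list \<Rightarrow> 'a list \<Rightarrow> obj \<Rightarrow> 'a list \<Rightarrow> 'a list \<Rightarrow> bool) \<Rightarrow> bool" where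
  "bicompatible Q \<longleftrightarrow>
    (\<forall>b p' q'. p' \<in> points G b \<longrightarrow> q' \<in> points G b \<longrightarrow> compatible (\<lambda>a p q. Q a p q b p' q')) \<and>
    (\<forall>a p q. p \<in> points G a \<longrightarrow> q \<in> points G a \<longrightarrow> compatible (Q a p q))"

lemma allsym2_biprincipal:
  assumes "bicompatible Q" shows "biprincipal C C (allsym2 Q)"
proof -
  have "compatible (\<lambda>a p q. allsym (Q a p q) U)" if "U \<in> carrier C" for U
    using assms that unfolding bicompatible_def by (intro allsym_principal_param) auto
  note c1 = this
  have "compatible (\<lambda>b p' q'. allsym (\<lambda>a p q. Q a p q b p' q') S)" if "S \<in> carrier C" for S
    using assms that unfolding bicompatible_def by (intro allsym_principal_param) auto
  note c2 = this
  have eq: "allsym2 Q S = allsym (\<lambda>b p' q'. allsym (\<lambda>a p q. Q a p q b p' q') S)" for S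
    unfolding allsym2_def by (rule ext) (rule allsym_swap)
  show ?thesis
    unfolding biprincipal_def
  proof (intro conjI ballI)
    fix x assume x: "x \<in> carrier C"
    show "principal_pred C (allsym2 Q x)" unfolding eq by (rule allsym_principal[OF c2[OF x]])
    show "principal_pred C (\<lambda>l. allsym2 Q l x)"
      unfolding allsym2_def by (rule allsym_principal[OF c1[OF x]])
  qed
qed

lemma allsym2_gen:
  assumes Q: "bicompatible Q" and "p \<in> points G a" "q \<in> points G a" "p' \<in> points G b" "q' \<in> points G b"
  shows "allsym2 Q (gen a p q) (gen b p' q') \<longleftrightarrow> Q a p q b p' q'"
proof -
  have "compatible (\<lambda>a p q. allsym (Q a p q) (gen b p' q'))"
    using Q assms unfolding bicompatible_def by (intro allsym_principal_param gen_closed) auto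
  from allsym_gen[OF this assms(2,3)] show ?thesis
    unfolding allsym2_def using Q assms unfolding bicompatible_def by (simp add: allsym_gen)
qed

definition notR :: "obj \<Rightarrow> 'a list \<Rightarrow> 'a list \<Rightarrow> obj \<Rightarrow> 'a list \<Rightarrow> 'a list \<Rightarrow> bool" where
  "notR a p q b p' q' \<longleftrightarrow> kappa_map a b p p' \<noteq> (q', q)"

text \<open>R respects the relations in each argument because the braiding is natural in each argument.\<close>

lemma notR_bicompatible: "bicompatible notR"
  unfolding bicompatible_def
proof (intro conjI allI impI)
  fix c s t assume c: "s \<in> points G c" "t \<in> points G c"
  show "compatible (\<lambda>a p q. notR a p q c s t)"
  proof (rule compatibleI)
    fix f a b p q assume f: "arr f a b" "p \<in> points G a" "q \<in> points G b"
    show "(\<forall>p'. W f p p' \<longrightarrow> notR b p' q c s t) \<longleftrightarrow> (\<forall>q'. W f q' q \<longrightarrow> notR a p q' c s t)"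
      using kappa_map_natural_left[OF f(1,2) c f(3)] W_points[OF f(1)] unfolding notR_def by blast
  qed
  show "compatible (notR c s t)"
  proof (rule compatibleI)
    fix f a b p q assume f: "arr f a b" "p \<in> points G a" "q \<in> points G b"
    show "(\<forall>p'. W f p p' \<longrightarrow> notR c s t b p' q) \<longleftrightarrow> (\<forall>q'. W f q' q \<longrightarrow> notR c s t a p q')"
      using kappa_map_natural_right[OF f(1,2) c f(3)] W_points[OF f(1)] unfolding notR_def by blast
  qed
qed

lemma R_iff:
  assumes "S \<in> carrier C" "U \<in> carrier C" shows "R S U \<longleftrightarrow> \<not> allsym2 notR S U"
proof -
  have "omega_m G r (kappa a b) {p @ p'} = {q' @ q} \<longleftrightarrow> \<not> notR a p q b p' q'"
    if "(a, p, q) \<in> S" "(b, p', q') \<in> U" for a p q b p' q'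
  proof -
    note s = symD[OF assms(1) that(1)] and u = symD[OF assms(2) that(2)]
    obtain t x where k: "kappa_map a b p p' = (t, x)" by fastforce
    have "length t = length q'" using kappa_map_closed[OF k s(1) u(1)] u by (auto simp: points_iff)
    then show ?thesis unfolding omega_m_kappa[OF s(1) u(1)] notR_def k by auto
  qed
  note key = this
  have "R S U \<longleftrightarrow> (\<exists>x\<in>S. \<exists>y\<in>U. \<not> notR (fst x) (fst (snd x)) (snd (snd x)) (fst y) (fst (snd y)) (snd (snd y)))"
    unfolding R_omega_def case_prod_beta by (intro bex_cong HOL.refl key) simp_all
  then show ?thesis unfolding allsym2_def allsym_def case_prod_beta by blast
qed

text \<open>The usual formula for the convolution inverse: apply the antipode to the first argument.\<close>

definition R' where "R' S U \<longleftrightarrow> R (antip S) U"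

lemma R_biprincipal: "biprincipal C C (\<lambda>S U. \<not> R S U)"
  using allsym2_biprincipal[OF notR_bicompatible]
  by (subst biprincipal_cong[OF coend_complete_lattice coend_complete_lattice]) (auto simp: R_iff)

lemma R_gen:
  "p \<in> points G a \<Longrightarrow> q \<in> points G a \<Longrightarrow> p' \<in> points G b \<Longrightarrow> q' \<in> points G b \<Longrightarrow>
    R (gen a p q) (gen b p' q') \<longleftrightarrow> kappa_map a b p p' = (q', q)"
  by (simp add: R_iff gen_closed allsym2_gen[OF notR_bicompatible] notR_def)

lemma R'_biprincipal: "biprincipal C C (\<lambda>S U. \<not> R' S U)"
  unfolding R'_def using R_biprincipal antip_closed antip_principal_pred
  unfolding biprincipal_def by blast

lemma R'_gen:
  "p \<in> points G a \<Longrightarrow> q \<in> points G a \<Longrightarrow> p' \<in> points G b \<Longrightarrow> q' \<in> points G b \<Longrightarrow>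
    R' (gen a p q) (gen b p' q') \<longleftrightarrow> kappa_map a b q q' = (p', p)"
  by (simp add: R'_def antip_gen R_gen kappa_map_dual)

lemma bi_sup_hom_unit:
  "bi_sup_hom H H sup_unit Q \<longleftrightarrow> biprincipal C C (\<lambda>S U. \<not> Q S U)"
  unfolding bi_sup_hom_def biprincipal_def sup_hom_sup_unit by simp

lemma biprincipal_allsym2:
  assumes B: "biprincipal C C B" and S: "S \<in> carrier C" "U \<in> carrier C"
  shows "B S U \<longleftrightarrow> allsym2 (\<lambda>a p q b p' q'. B (gen a p q) (gen b p' q')) S U"
proof -
  have "B S U \<longleftrightarrow> allsym (\<lambda>a p q. B (gen a p q) U) S"
    using B S unfolding biprincipal_def by (intro principal_allsym[where P = "\<lambda>S. B S U"]) auto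
  also have "\<dots> \<longleftrightarrow> allsym2 (\<lambda>a p q b p' q'. B (gen a p q) (gen b p' q')) S U"
    unfolding allsym2_def using B S gen_closed unfolding biprincipal_def
    by (intro allsym_cong principal_allsym) auto
  finally show ?thesis .
qed

lemma biprincipal_eqI:
  assumes "biprincipal C C B" "biprincipal C C B'" "S \<in> carrier C" "U \<in> carrier C"
    and "\<And>a p q b p' q'. p \<in> points G a \<Longrightarrow> q \<in> points G a \<Longrightarrow> p' \<in> points G b \<Longrightarrow> q' \<in> points G b \<Longrightarrow>
      B (gen a p q) (gen b p' q') \<longleftrightarrow> B' (gen a p q) (gen b p' q')"
  shows "B S U \<longleftrightarrow> B' S U"
  unfolding biprincipal_allsym2[OF assms(1,3,4)] biprincipal_allsym2[OF assms(2,3,4)] allsym2_def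
  by (intro allsym_cong assms)

definition conv :: "('a sym set \<Rightarrow> 'a sym set \<Rightarrow> bool) \<Rightarrow> ('a sym set \<Rightarrow> 'a sym set \<Rightarrow> bool) \<Rightarrow>
    'a sym set \<Rightarrow> 'a sym set \<Rightarrow> bool" where
  "conv Q Q' S U \<longleftrightarrow> (\<exists>(a1, a2)\<in>comult H S. \<exists>(b1, b2)\<in>comult H U. Q a1 b1 \<and> Q' a2 b2)"

lemma conv_biprincipal_aux:
  assumes Q: "biprincipal C C (\<lambda>S U. \<not> Q S U)" and Q': "biprincipal C C (\<lambda>S U. \<not> Q' S U)"
  shows "\<And>b1 b2. b1 \<in> carrier C \<Longrightarrow> b2 \<in> carrier C \<Longrightarrow> biprincipal C C (\<lambda>a1 a2. \<not> (Q a1 b1 \<and> Q' a2 b2))"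
    "\<And>a1 a2. a1 \<in> carrier C \<Longrightarrow> a2 \<in> carrier C \<Longrightarrow> biprincipal C C (\<lambda>b1 b2. \<not> (Q a1 b1 \<and> Q' a2 b2))"
proof -
  have conj: "principal_pred C (\<lambda>a. \<not> (P a \<and> X))" "principal_pred C (\<lambda>a. \<not> (X \<and> P a))"
    if "principal_pred C (\<lambda>a. \<not> P a)" for P :: "'a sym set \<Rightarrow> bool" and X
    using that unfolding principal_pred_def by blast+
  fix x y assume xy: "x \<in> carrier C" "y \<in> carrier C"
  show "biprincipal C C (\<lambda>a1 a2. \<not> (Q a1 x \<and> Q' a2 y))" "biprincipal C C (\<lambda>b1 b2. \<not> (Q x b1 \<and> Q' y b2))"
    unfolding biprincipal_def
    by (intro conjI ballI conj; use Q Q' xy in \<open>simp add: biprincipal_def\<close>)+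
qed

lemma conv_biprincipal:
  assumes Q: "biprincipal C C (\<lambda>S U. \<not> Q S U)" and Q': "biprincipal C C (\<lambda>S U. \<not> Q' S U)"
  shows "biprincipal C C (\<lambda>S U. \<not> conv Q Q' S U)"
    and "p \<in> points G a \<Longrightarrow> q \<in> points G a \<Longrightarrow> p' \<in> points G b \<Longrightarrow> q' \<in> points G b \<Longrightarrow>
      conv Q Q' (gen a p q) (gen b p' q') \<longleftrightarrow> (\<exists>l\<in>points G a. \<exists>l'\<in>points G b.
        Q (gen a p l) (gen b p' l') \<and> Q' (gen a l q) (gen b l' q'))"
proof -
  note aux = conv_biprincipal_aux[OF Q Q']
  have eq1: "(\<not> conv Q Q' S U) \<longleftrightarrow> (\<forall>(a1, a2)\<in>comult H S. \<forall>(b1, b2)\<in>comult H U. \<not> (Q a1 b1 \<and> Q' a2 b2))"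
    and eq2: "(\<not> conv Q Q' S U) \<longleftrightarrow> (\<forall>(b1, b2)\<in>comult H U. \<forall>(a1, a2)\<in>comult H S. \<not> (Q a1 b1 \<and> Q' a2 b2))" for S U
    unfolding conv_def by blast+
  have o1: "biprincipal C C (\<lambda>a1 a2. \<forall>(b1, b2)\<in>comult H U. \<not> (Q a1 b1 \<and> Q' a2 b2))" if "U \<in> carrier C" for U
  proof -
    have "biprincipal C C (\<lambda>a1 a2. \<not> (Q a1 (fst x) \<and> Q' a2 (snd x)))" if "x \<in> comult H U" for x
      using comult_mem[OF \<open>U \<in> carrier C\<close>, of "fst x" "snd x"] that by (intro aux) auto
    then show ?thesis unfolding biprincipal_def case_prod_beta by (auto intro!: principal_ball)
  qed
  have o2: "biprincipal C C (\<lambda>b1 b2. \<forall>(a1, a2)\<in>comult H S. \<not> (Q a1 b1 \<and> Q' a2 b2))" if "S \<in> carrier C" for S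
  proof -
    have "biprincipal C C (\<lambda>b1 b2. \<not> (Q (fst x) b1 \<and> Q' (snd x) b2))" if "x \<in> comult H S" for x
      using comult_mem[OF \<open>S \<in> carrier C\<close>, of "fst x" "snd x"] that by (intro aux) auto
    then show ?thesis unfolding biprincipal_def case_prod_beta by (auto intro!: principal_ball)
  qed
  show "biprincipal C C (\<lambda>S U. \<not> conv Q Q' S U)"
    unfolding biprincipal_def
  proof (intro conjI ballI)
    fix S assume "S \<in> carrier C"
    from comult_ball_principal[OF o2[OF this]] show "principal_pred C (\<lambda>U. \<not> conv Q Q' S U)"
      unfolding eq2 .
  next
    fix U assume "U \<in> carrier C"
    from comult_ball_principal[OF o1[OF this]] show "principal_pred C (\<lambda>S. \<not> conv Q Q' S U)"
      unfolding eq1 .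
  qed
  assume p: "p \<in> points G a" "q \<in> points G a" "p' \<in> points G b" "q' \<in> points G b"
  have "(\<not> conv Q Q' (gen a p q) (gen b p' q')) \<longleftrightarrow> (\<forall>l\<in>points G a. \<forall>(b1, b2)\<in>comult H (gen b p' q').
      \<not> (Q (gen a p l) b1 \<and> Q' (gen a l q) b2))"
    unfolding eq1 using p by (intro comult_ball_gen o1 gen_closed)
  also have "\<dots> \<longleftrightarrow> (\<forall>l\<in>points G a. \<forall>l'\<in>points G b. \<not> (Q (gen a p l) (gen b p' l') \<and> Q' (gen a l q) (gen b l' q')))"
    using p by (intro ball_cong HOL.refl comult_ball_gen aux gen_closed)
  finally show "conv Q Q' (gen a p q) (gen b p' q') \<longleftrightarrow> (\<exists>l\<in>points G a. \<exists>l'\<in>points G b.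
        Q (gen a p l) (gen b p' l') \<and> Q' (gen a l q) (gen b l' q'))" by blast
qed

lemma counit_biprincipal: "biprincipal C C (\<lambda>S U. \<not> (counit H S \<and> counit H U))"
  unfolding biprincipal_def
proof (intro conjI ballI)
  fix x
  show "principal_pred C (\<lambda>U. \<not> (counit H x \<and> counit H U))" "principal_pred C (\<lambda>S. \<not> (counit H S \<and> counit H x))"
    using counit_principal unfolding principal_pred_def by blast+
qed

lemma R_convolution_inverse: "convolution_inverse H R R'"
  unfolding convolution_inverse_def bi_sup_hom_unit
proof (intro conjI ballI R'_biprincipal)
  fix S U assume "S \<in> carrier H" "U \<in> carrier H"
  then have S: "S \<in> carrier C" "U \<in> carrier C" by simp_all
  have "(\<not> conv R R' S U) \<longleftrightarrow> (\<not> (counit H S \<and> counit H U))"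
  proof (rule biprincipal_eqI[OF conv_biprincipal(1)[OF R_biprincipal R'_biprincipal] counit_biprincipal S])
    fix a p q b p' q' assume p: "p \<in> points G a" "q \<in> points G a" "p' \<in> points G b" "q' \<in> points G b"
    obtain t x where k: "kappa_map a b p p' = (t, x)" by fastforce
    note tx = kappa_map_closed[OF k p(1,3)]
    have "conv R R' (gen a p q) (gen b p' q') \<longleftrightarrow>
      (\<exists>l\<in>points G a. \<exists>l'\<in>points G b. kappa_map a b p p' = (l', l) \<and> kappa_map a b q q' = (l', l))"
      unfolding conv_biprincipal(2)[OF R_biprincipal R'_biprincipal p] using p by (simp add: R_gen R'_gen cong: bex_cong)
    also have "\<dots> \<longleftrightarrow> p = q \<and> p' = q'" using kappa_map_inj[OF k _ p(1,3,2,4)] k tx by auto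
    finally show "(\<not> conv R R' (gen a p q) (gen b p' q')) \<longleftrightarrow> (\<not> (counit H (gen a p q) \<and> counit H (gen b p' q')))"
      using p by (simp add: counit_gen)
  qed
  then have "conv R R' S U = (counit H S \<and> counit H U)" by blast
  then show "(\<exists>(a1, a2)\<in>comult H S. \<exists>(b1, b2)\<in>comult H U. R a1 b1 \<and> R' a2 b2) = (counit H S \<and> counit H U)"
    unfolding conv_def .
  have "(\<not> conv R' R S U) \<longleftrightarrow> (\<not> (counit H S \<and> counit H U))"
  proof (rule biprincipal_eqI[OF conv_biprincipal(1)[OF R'_biprincipal R_biprincipal] counit_biprincipal S])
    fix a p q b p' q' assume p: "p \<in> points G a" "q \<in> points G a" "p' \<in> points G b" "q' \<in> points G b"
    obtain x t where k: "x \<in> points G a" "t \<in> points G b" "kappa_map a b x t = (p', p)"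
      using kappa_map_surj[OF p(3,1)] by metis
    have "conv R' R (gen a p q) (gen b p' q') \<longleftrightarrow>
      (\<exists>l\<in>points G a. \<exists>l'\<in>points G b. kappa_map a b l l' = (p', p) \<and> kappa_map a b l l' = (q', q))"
      unfolding conv_biprincipal(2)[OF R'_biprincipal R_biprincipal p] using p by (simp add: R_gen R'_gen cong: bex_cong)
    also have "\<dots> \<longleftrightarrow> p = q \<and> p' = q'" using k by auto
    finally show "(\<not> conv R' R (gen a p q) (gen b p' q')) \<longleftrightarrow> (\<not> (counit H (gen a p q) \<and> counit H (gen b p' q')))"
      using p by (simp add: counit_gen)
  qed
  then have "conv R' R S U = (counit H S \<and> counit H U)" by blast
  then show "(\<exists>(a1, a2)\<in>comult H S. \<exists>(b1, b2)\<in>comult H U. R' a1 b1 \<and> R a2 b2) = (counit H S \<and> counit H U)"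
    unfolding conv_def .
qed

text \<open>On symbols R is the graph of a bijection, so the convolution equation leaves only one choice
  for an inverse.\<close>

lemma convolution_inverse_gen:
  assumes Q: "convolution_inverse H R Q"
    and p: "p \<in> points G a" "q \<in> points G a" "p' \<in> points G b" "q' \<in> points G b"
  shows "Q (gen a p q) (gen b p' q') \<longleftrightarrow> kappa_map a b q q' = (p', p)"
proof -
  have B: "biprincipal C C (\<lambda>S U. \<not> Q S U)" using Q unfolding convolution_inverse_def bi_sup_hom_unit by blast
  obtain x t where k: "x \<in> points G a" "t \<in> points G b" "kappa_map a b x t = (p', p)"
    using kappa_map_surj[OF p(3,1)] by metis
  have "conv R Q (gen a x q) (gen b t q') \<longleftrightarrow> (counit H (gen a x q) \<and> counit H (gen b t q'))"
    using Q k p gen_closed unfolding convolution_inverse_def conv_def by simp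
  then have "(\<exists>l\<in>points G a. \<exists>l'\<in>points G b. R (gen a x l) (gen b t l') \<and> Q (gen a l q) (gen b l' q')) \<longleftrightarrow>
      x = q \<and> t = q'"
    using conv_biprincipal(2)[OF R_biprincipal B k(1) p(2) k(2) p(4)] k p by (simp add: counit_gen)
  also have "(\<exists>l\<in>points G a. \<exists>l'\<in>points G b. R (gen a x l) (gen b t l') \<and> Q (gen a l q) (gen b l' q')) \<longleftrightarrow>
      Q (gen a p q) (gen b p' q')"
    using k p by (auto simp: R_gen)
  finally show ?thesis using k kappa_map_inj[OF k(3) _ k(1,2) p(2,4)] by auto
qed

lemma H_coquasitriangular: "coquasitriangular H R"
proof (intro coquasitriangular.intro H_bialgebra coquasitriangular_axioms.intro)
  show "bi_sup_hom H H sup_unit R" unfolding bi_sup_hom_unit by (rule R_biprincipal)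
  show "\<exists>R'. convolution_inverse H R R'" using R_convolution_inverse by blast
next
  fix a b c assume "a \<in> carrier H" "b \<in> carrier H" "c \<in> carrier H"
  then have abc: "a \<in> carrier C" "b \<in> carrier C" "c \<in> carrier C" by simp_all
  have Rl: "principal_pred C (\<lambda>x. \<not> R x y)" and Rr: "principal_pred C (\<lambda>x. \<not> R y x)" if "y \<in> carrier C" for y
    using R_biprincipal that unfolding biprincipal_def by blast+
  have B: "biprincipal C C (\<lambda>c1 c2. \<not> (R b c1 \<and> R a c2))" if "a \<in> carrier C" "b \<in> carrier C" for a b
    by (rule conv_biprincipal_aux(2)[OF R_biprincipal R_biprincipal that(2,1)])
  have "(\<not> R (prod_H a b) c) \<longleftrightarrow> (\<forall>(c1, c2)\<in>comult H c. \<not> (R b c1 \<and> R a c2))"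
  proof -
    have "biprincipal C C (\<lambda>a b. \<not> R (prod_H a b) c)" by (rule prod_biprincipal[OF Rl[OF abc(3)]])
    moreover have "biprincipal C C (\<lambda>a b. \<forall>(c1, c2)\<in>comult H c. \<not> (R b c1 \<and> R a c2))"
    proof -
      have "biprincipal C C (\<lambda>a b. \<not> (R b (fst x) \<and> R a (snd x)))" if "x \<in> comult H c" for x
        using conv_biprincipal_aux(1)[OF R_biprincipal R_biprincipal, of "fst x" "snd x"] that
          comult_mem[OF abc(3), of "fst x" "snd x"] unfolding biprincipal_def by auto
      then show ?thesis unfolding biprincipal_def case_prod_beta by (auto intro!: principal_ball)
    qed
    ultimately show ?thesis
    proof (rule biprincipal_eqI[OF _ _ abc(1,2)])
      fix a p q b p' q' assume p: "p \<in> points G a" "q \<in> points G a" "p' \<in> points G b" "q' \<in> points G b"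
      show "(\<not> R (prod_H (gen a p q) (gen b p' q')) c) \<longleftrightarrow>
        (\<forall>(c1, c2)\<in>comult H c. \<not> (R (gen b p' q') c1 \<and> R (gen a p q) c2))"
        unfolding comult_ball[OF B[OF gen_closed[OF p(1,2)] gen_closed[OF p(3,4)]] abc(3)]
      proof (subst principal_allsym[OF Rr abc(3)])
        show "prod_H (gen a p q) (gen b p' q') \<in> carrier C" using p by (intro prod_closed gen_closed)
        show "allsym (\<lambda>c s t. \<not> R (prod_H (gen a p q) (gen b p' q')) (gen c s t)) c \<longleftrightarrow>
          allsym (\<lambda>c s t. \<forall>l\<in>points G c. \<not> (R (gen b p' q') (gen c s l) \<and> R (gen a p q) (gen c l t))) c"
          using p by (intro allsym_cong abc) (auto simp: prod_gen R_gen kappa_map_append_left)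
      qed
    qed
  qed
  then show "R (prod_H a b) c \<longleftrightarrow> (\<exists>(c1, c2)\<in>comult H c. R b c1 \<and> R a c2)" by blast
  have B': "biprincipal C C (\<lambda>a1 a2. \<not> (R a1 b \<and> R a2 c))" if "b \<in> carrier C" "c \<in> carrier C" for b c
    by (rule conv_biprincipal_aux(1)[OF R_biprincipal R_biprincipal that])
  have "(\<not> R a (prod_H b c)) \<longleftrightarrow> (\<forall>(a1, a2)\<in>comult H a. \<not> (R a1 b \<and> R a2 c))"
  proof -
    have "biprincipal C C (\<lambda>b c. \<not> R a (prod_H b c))" by (rule prod_biprincipal[OF Rr[OF abc(1)]])
    moreover have "biprincipal C C (\<lambda>b c. \<forall>(a1, a2)\<in>comult H a. \<not> (R a1 b \<and> R a2 c))"
    proof -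
      have "biprincipal C C (\<lambda>b c. \<not> (R (fst x) b \<and> R (snd x) c))" if "x \<in> comult H a" for x
        using conv_biprincipal_aux(2)[OF R_biprincipal R_biprincipal, of "fst x" "snd x"] that
          comult_mem[OF abc(1), of "fst x" "snd x"] by auto
      then show ?thesis unfolding biprincipal_def case_prod_beta by (auto intro!: principal_ball)
    qed
    ultimately show ?thesis
    proof (rule biprincipal_eqI[OF _ _ abc(2,3)])
      fix b p q c p' q' assume p: "p \<in> points G b" "q \<in> points G b" "p' \<in> points G c" "q' \<in> points G c"
      show "(\<not> R a (prod_H (gen b p q) (gen c p' q'))) \<longleftrightarrow>
        (\<forall>(a1, a2)\<in>comult H a. \<not> (R a1 (gen b p q) \<and> R a2 (gen c p' q')))"
        unfolding comult_ball[OF B'[OF gen_closed[OF p(1,2)] gen_closed[OF p(3,4)]] abc(1)]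
      proof (subst principal_allsym[OF Rl abc(1)])
        show "prod_H (gen b p q) (gen c p' q') \<in> carrier C" using p by (intro prod_closed gen_closed)
        show "allsym (\<lambda>a s t. \<not> R (gen a s t) (prod_H (gen b p q) (gen c p' q'))) a \<longleftrightarrow>
          allsym (\<lambda>a s t. \<forall>l\<in>points G a. \<not> (R (gen a s l) (gen b p q) \<and> R (gen a l t) (gen c p' q'))) a"
          using p by (intro allsym_cong abc) (auto simp: prod_gen R_gen kappa_map_append_right)
      qed
    qed
  qed
  then show "R a (prod_H b c) \<longleftrightarrow> (\<exists>(a1, a2)\<in>comult H a. R a1 b \<and> R a2 c)" by blast
next
  fix a b assume "a \<in> carrier H" "b \<in> carrier H"
  then have ab: "a \<in> carrier C" "b \<in> carrier C" by simp_all
  show "\<Squnion>\<^bsub>H\<^esub> {scal H (R b1 a1) (prod_H a2 b2) |a1 a2 b1 b2. (a1, a2) \<in> comult H a \<and> (b1, b2) \<in> comult H b} =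
    \<Squnion>\<^bsub>H\<^esub> {scal H (R b2 a2) (prod_H b1 a1) |a1 a2 b1 b2. (a1, a2) \<in> comult H a \<and> (b1, b2) \<in> comult H b}"
  proof (rule C_sup_eq_supI)
    show "{scal H (R b1 a1) (prod_H a2 b2) |a1 a2 b1 b2. (a1, a2) \<in> comult H a \<and> (b1, b2) \<in> comult H b} \<subseteq> carrier C"
      "{scal H (R b2 a2) (prod_H b1 a1) |a1 a2 b1 b2. (a1, a2) \<in> comult H a \<and> (b1, b2) \<in> comult H b} \<subseteq> carrier C"
      using comult_mem[OF ab(1)] comult_mem[OF ab(2)] scal_closed_C prod_closed by blast+
    fix z assume z: "z \<in> carrier C"
    have P1: "biprincipal C C (\<lambda>b a. \<not> \<not> prod_H a b \<subseteq> z)" and P2: "biprincipal C C (\<lambda>b a. \<not> \<not> prod_H b a \<subseteq> z)"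
      using prod_biprincipal[OF principal_le_C[OF z]] unfolding biprincipal_def by auto
    note eq1 = biprincipal_eqI[OF conv_biprincipal(1)[OF R_biprincipal P1] conv_biprincipal(1)[OF P2 R_biprincipal] ab(2,1)]
    have conv: "(\<not> conv R (\<lambda>b a. \<not> prod_H a b \<subseteq> z) b a) \<longleftrightarrow> (\<not> conv (\<lambda>b a. \<not> prod_H b a \<subseteq> z) R b a)"
    proof (rule eq1)
      fix b p q a s t assume p: "p \<in> points G b" "q \<in> points G b" "s \<in> points G a" "t \<in> points G a"
      obtain m l where k: "kappa_map b a p s = (m, l)" by fastforce
      note ml = kappa_map_closed[OF k p(1,3)]
      have "(\<not> conv R (\<lambda>b a. \<not> prod_H a b \<subseteq> z) (gen b p q) (gen a s t)) \<longleftrightarrow>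
        gen (a @ b) (m @ l) (t @ q) \<subseteq> z"
        unfolding conv_biprincipal(2)[OF R_biprincipal P1 p] using p k ml by (auto simp: R_gen prod_gen)
      moreover obtain u v where uv: "u \<in> points G b" "v \<in> points G a" "kappa_map b a u v = (t, q)"
        using kappa_map_surj[OF p(4,2)] by metis
      have "kappa_map b a l l' = (t, q) \<longleftrightarrow> l = u \<and> l' = v" if "l \<in> points G b" "l' \<in> points G a" for l l'
        using kappa_map_inj[OF _ uv(3) that uv(1,2)] uv by blast
      then have "(\<not> conv (\<lambda>b a. \<not> prod_H b a \<subseteq> z) R (gen b p q) (gen a s t)) \<longleftrightarrow>
        gen (b @ a) (p @ s) (u @ v) \<subseteq> z"
        unfolding conv_biprincipal(2)[OF P2 R_biprincipal p] using p uv by (auto simp: R_gen prod_gen)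
      moreover have "gen (a @ b) (m @ l) (t @ q) \<subseteq> z \<longleftrightarrow> gen (b @ a) (p @ s) (u @ v) \<subseteq> z"
      proof -
        \<comment> \<open>The relation of the coend for the braiding of b and a.\<close>
        have c: "(\<forall>p'. W (braid b a) (p @ s) p' \<longrightarrow> gen (a @ b) p' (t @ q) \<subseteq> z) \<longleftrightarrow>
          (\<forall>q'. W (braid b a) q' (t @ q) \<longrightarrow> gen (b @ a) (p @ s) q' \<subseteq> z)"
          using p by (intro compatibleD[OF principal_compatible[OF principal_le_C[OF z]] arr_braid]) auto
        have w: "W (braid b a) (x @ y) p' \<longleftrightarrow> p' = fst (kappa_map b a x y) @ snd (kappa_map b a x y)"
          if "x \<in> points G b" "y \<in> points G a" for x y p'
          using omega_m_kappa[OF that] unfolding kappa_def omega_m_class[OF arr_braid] by auto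
        have "W (braid b a) q' (t @ q) \<longleftrightarrow> q' = u @ v" for q'
        proof
          assume w': "W (braid b a) q' (t @ q)"
          then obtain x y where xy: "q' = x @ y" "x \<in> points G b" "y \<in> points G a"
            using W_points(1)[OF arr_braid] by (meson points_appendE)
          obtain t' q2 where k': "kappa_map b a x y = (t', q2)" by fastforce
          have "t' = t" "q2 = q" using w' w[OF xy(2,3)] xy k' kappa_map_closed[OF k' xy(2,3)] p by (auto simp: points_iff)
          then show "q' = u @ v" using kappa_map_inj[OF _ uv(3) xy(2,3) uv(1,2)] k' xy by blast
        qed (use w uv in auto)
        then show ?thesis using c w[OF p(1,3)] k by simp
      qed
      ultimately show "(\<not> conv R (\<lambda>b a. \<not> prod_H a b \<subseteq> z) (gen b p q) (gen a s t)) \<longleftrightarrow>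
        (\<not> conv (\<lambda>b a. \<not> prod_H b a \<subseteq> z) R (gen b p q) (gen a s t))" by blast
    qed
    show "(\<forall>x\<in>{scal H (R b1 a1) (prod_H a2 b2) |a1 a2 b1 b2. (a1, a2) \<in> comult H a \<and> (b1, b2) \<in> comult H b}. x \<subseteq> z) \<longleftrightarrow>
      (\<forall>x\<in>{scal H (R b2 a2) (prod_H b1 a1) |a1 a2 b1 b2. (a1, a2) \<in> comult H a \<and> (b1, b2) \<in> comult H b}. x \<subseteq> z)"
    proof -
      have "(\<forall>x\<in>{scal H (R b1 a1) (prod_H a2 b2) |a1 a2 b1 b2. (a1, a2) \<in> comult H a \<and> (b1, b2) \<in> comult H b}. x \<subseteq> z) \<longleftrightarrow>
        (\<forall>a1 a2 b1 b2. (a1, a2) \<in> comult H a \<longrightarrow> (b1, b2) \<in> comult H b \<longrightarrow> R b1 a1 \<longrightarrow> prod_H a2 b2 \<subseteq> z)"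
        unfolding ball_comprehension4 scal_le_C[OF z] by blast
      also have "\<dots> \<longleftrightarrow> \<not> conv R (\<lambda>b a. \<not> prod_H a b \<subseteq> z) b a"
        unfolding conv_def by blast
      also have "\<dots> \<longleftrightarrow> \<not> conv (\<lambda>b a. \<not> prod_H b a \<subseteq> z) R b a" by (rule conv)
      also have "\<dots> \<longleftrightarrow> (\<forall>a1 a2 b1 b2. (a1, a2) \<in> comult H a \<longrightarrow> (b1, b2) \<in> comult H b \<longrightarrow> R b2 a2 \<longrightarrow> prod_H b1 a1 \<subseteq> z)"
        unfolding conv_def by blast
      also have "\<dots> \<longleftrightarrow> (\<forall>x\<in>{scal H (R b2 a2) (prod_H b1 a1) |a1 a2 b1 b2. (a1, a2) \<in> comult H a \<and> (b1, b2) \<in> comult H b}. x \<subseteq> z)"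
        unfolding ball_comprehension4 scal_le_C[OF z] by blast
      finally show ?thesis .
    qed
  qed
qed

theorem H_coquasitriangular_hopf: "coquasitriangular_hopf_algebra H R"
  using H_hopf H_coquasitriangular by (simp add: coquasitriangular_hopf_algebra_def)

section \<open>The quotient by D\<close>

text \<open>The representative that contains D in the class of all elements with a given set of values:
  all symbols off the diagonal, and the diagonal symbols with value in A.\<close>

definition val_lift :: "'a set \<Rightarrow> 'a sym set" where
  "val_lift A = {(a, p, q). p \<in> points G a \<and> q \<in> points G a \<and> (p \<noteq> q \<or> word_val a p \<in> A)}"

text \<open>The values of the diagonal symbols below S. The class of S modulo D depends only on this
  set.\<close>

definition vals :: "'a sym set \<Rightarrow> 'a set" where
  "vals S = {word_val a p | a p. (a, p, p) \<in> S}"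

lemma val_lift_closed: "val_lift A \<in> carrier C"
proof -
  have "compatible (\<lambda>a p q. p \<noteq> q \<or> word_val a p \<in> A)"
  proof (rule compatibleI)
    fix f a b p q assume "arr f a b"
    then show "(\<forall>p'. W f p p' \<longrightarrow> p' \<noteq> q \<or> word_val b p' \<in> A) \<longleftrightarrow> (\<forall>q'. W f q' q \<longrightarrow> p \<noteq> q' \<or> word_val a p \<in> A)"
      using word_val_W[where f = f and a = a and b = b and p = p and q = q] by auto
  qed
  then show ?thesis unfolding compatible_iff val_lift_def .
qed

lemma vals_subset: "S \<in> carrier C \<Longrightarrow> vals S \<subseteq> carrier G"
  unfolding vals_def using symD word_val_closed by blast

lemma vals_le_iff: "S \<in> carrier C \<Longrightarrow> vals S \<subseteq> A \<longleftrightarrow> S \<subseteq> val_lift A"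
proof -
  assume S: "S \<in> carrier C"
  have "vals S \<subseteq> A \<longleftrightarrow> (\<forall>a p. (a, p, p) \<in> S \<longrightarrow> word_val a p \<in> A)" unfolding vals_def by blast
  also have "\<dots> \<longleftrightarrow> S \<subseteq> val_lift A" unfolding val_lift_def using symD[OF S] by auto
  finally show ?thesis .
qed

lemma vals_principal: "principal_pred C (\<lambda>S. vals S \<subseteq> A)"
  using principal_le_C[OF val_lift_closed, of A] vals_le_iff
  by (subst principal_cong[OF coend_complete_lattice]) auto

lemma val_lift_mono: "A \<subseteq> B \<Longrightarrow> val_lift A \<subseteq> val_lift B"
  unfolding val_lift_def by blast

lemma val_lift_Lx: "g \<in> carrier G \<Longrightarrow> ([Lx], [g], [g]) \<in> val_lift A \<longleftrightarrow> g \<in> A"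
  by (simp add: val_lift_def word_val_Lx)

lemma vals_val_lift: "A \<subseteq> carrier G \<Longrightarrow> vals (val_lift A) = A"
proof
  show "vals (val_lift A) \<subseteq> A" by (simp add: vals_le_iff val_lift_closed)
  assume A: "A \<subseteq> carrier G"
  show "A \<subseteq> vals (val_lift A)"
  proof
    fix g assume "g \<in> A"
    then show "g \<in> vals (val_lift A)" unfolding vals_def using A val_lift_Lx[of g A] word_val_Lx[of g] by force
  qed
qed

lemma vals_gen:
  assumes "p \<in> points G a" "q \<in> points G a"
  shows "vals (gen a p q) \<subseteq> A \<longleftrightarrow> (p = q \<longrightarrow> word_val a p \<in> A)"
  using assms by (simp add: vals_le_iff gen_closed gen_le_iff val_lift_closed) (auto simp: val_lift_def)

text \<open>The counit vanishes on S iff S has no diagonal symbol, so D consists of the symbols off the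
  diagonal.\<close>

lemma rem_D_eq: "rem_D H = val_lift {}"
  unfolding rem_D_def
proof (rule C_sup_eqI)
  have counit: "counit H h \<longleftrightarrow> \<not> h \<subseteq> val_lift {}" if "h \<in> carrier C" for h
    using symD[OF that] unfolding counit_iff[OF that] val_lift_def allsym_def by blast
  show "{h \<in> carrier H. counit H h = False} \<subseteq> carrier C" by auto
  fix z assume "z \<in> carrier C"
  show "(\<forall>a\<in>{h \<in> carrier H. counit H h = False}. a \<subseteq> z) \<longleftrightarrow> val_lift {} \<subseteq> z"
    (is "?l \<longleftrightarrow> ?r")
  proof
    assume ?l
    moreover have "val_lift {} \<in> {h \<in> carrier H. counit H h = False}"
      using counit[OF val_lift_closed] val_lift_closed by simp
    ultimately show ?r by blast
  next
    assume ?r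
    then show ?l using counit by (metis (mono_tags, lifting) H_simps(1) mem_Collect_eq subset_trans)
  qed
qed (rule val_lift_closed)

text \<open>Above D the relation for f identifies the diagonal symbols at any two points related by f.
  As every point is connected to the one-letter point of its value, membership of a diagonal
  symbol in z depends on its value only.\<close>

lemma val_lift_below:
  assumes z: "z \<in> carrier C" and D: "val_lift {} \<subseteq> z" and S: "S \<subseteq> z"
  shows "val_lift (vals S) \<subseteq> z"
proof
  have inv: "(a, p, p) \<in> z \<longleftrightarrow> ([Lx], [word_val a p], [word_val a p]) \<in> z" if "p \<in> points G a" for a p
  proof (rule invariant_word_val[of "\<lambda>a p. (a, p, p) \<in> z", OF _ that])
    fix f a b p q assume f: "arr f a b" "W f p q"
    note pq = W_points[OF f]
    have off: "(c, s, t) \<in> z" if "s \<in> points G c" "t \<in> points G c" "s \<noteq> t" for c s t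
      using D that by (auto simp: val_lift_def)
    \<comment> \<open>As z contains all symbols off the diagonal, each side of the relation for f has one term to check.\<close>
    have "(\<forall>p'. W f p p' \<longrightarrow> (b, p', q) \<in> z) \<longleftrightarrow> (b, q, q) \<in> z"
      using f(2) off pq W_points[OF f(1)] by metis
    moreover have "(\<forall>q'. W f q' q \<longrightarrow> (a, p, q') \<in> z) \<longleftrightarrow> (a, p, p) \<in> z"
      using f(2) off pq W_points[OF f(1)] by metis
    ultimately show "(a, p, p) \<in> z \<longleftrightarrow> (b, q, q) \<in> z"
      using compatibleD[OF mem_compatible[OF z] f(1) pq] by simp
  qed
  fix x assume "x \<in> val_lift (vals S)"
  then obtain a p q where x: "x = (a, p, q)" "p \<in> points G a" "q \<in> points G a"
    "p \<noteq> q \<or> word_val a p \<in> vals S" unfolding val_lift_def by blast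
  show "x \<in> z"
  proof (cases "p = q")
    case False then show ?thesis using x D by (auto simp: val_lift_def)
  next
    case True
    then obtain a' p' where *: "word_val a p = word_val a' p'" "(a', p', p') \<in> S" using x unfolding vals_def by blast
    then have "(a', p', p') \<in> z" using S by blast
    then show ?thesis using inv[OF x(2)] inv[of p' a'] symD[OF z] * True x by auto
  qed
qed

lemma join_rem_D: "h \<in> carrier C \<Longrightarrow> h \<squnion>\<^bsub>H\<^esub> rem_D H = val_lift (vals h)"
  unfolding join_def rem_D_eq
proof (rule C_sup_eqI)
  assume h: "h \<in> carrier C"
  fix z assume z: "z \<in> carrier C"
  have "h \<subseteq> val_lift (vals h)" using vals_le_iff[OF h, of "vals h"] by simp
  then show "(\<forall>a\<in>{h, val_lift {}}. a \<subseteq> z) \<longleftrightarrow> val_lift (vals h) \<subseteq> z"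
    using val_lift_below[OF z, of h] val_lift_mono[of "{}" "vals h"] by auto
qed (auto simp: val_lift_closed)

text \<open>The class modulo D with value set A. Sending A to this class is the isomorphism of the power
  set of G with the quotient.\<close>

definition val_class :: "'a set \<Rightarrow> 'a sym set set" where
  "val_class A = {k \<in> carrier C. vals k = A}"

lemma val_lift_inj: "A \<subseteq> carrier G \<Longrightarrow> B \<subseteq> carrier G \<Longrightarrow> val_lift A = val_lift B \<longleftrightarrow> A = B"
  using vals_val_lift by metis

lemma val_lift_le_iff: "A \<subseteq> carrier G \<Longrightarrow> val_lift A \<subseteq> val_lift B \<longleftrightarrow> A \<subseteq> B"
  using vals_le_iff[OF val_lift_closed, of A B] vals_val_lift by simp

lemma val_lift_in_val_class: "A \<subseteq> carrier G \<Longrightarrow> val_lift A \<in> val_class A"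
  by (simp add: val_class_def val_lift_closed vals_val_lift)

lemma val_class_inj: "A \<subseteq> carrier G \<Longrightarrow> val_class A = val_class B \<longleftrightarrow> A = B"
  using val_lift_in_val_class[of A] by (auto simp: val_class_def)

lemma rem_proj_eq: "h \<in> carrier C \<Longrightarrow> rem_proj H h = val_class (vals h)"
  unfolding rem_proj_def val_class_def by (auto simp: join_rem_D val_lift_inj vals_subset)

lemma rem_incl_eq: "A \<subseteq> carrier G \<Longrightarrow> rem_incl H (val_class A) = val_lift A"
proof -
  assume "A \<subseteq> carrier G"
  then have "val_lift A \<in> val_class A" by (rule val_lift_in_val_class)
  moreover have "h \<squnion>\<^bsub>H\<^esub> rem_D H = val_lift A" if "h \<in> val_class A" for h
    using that by (auto simp: val_class_def join_rem_D)
  ultimately show ?thesis unfolding rem_incl_def by (intro the_equality) metis+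
qed

abbreviation (input) Q where "Q \<equiv> rem_lattice H"
abbreviation (input) RQ where "RQ \<equiv> rem_quot H"

lemma Q_carrier: "carrier Q = val_class ` Pow (carrier G)"
proof -
  have "rem_proj H ` carrier C = val_class ` Pow (carrier G)"
  proof
    show "rem_proj H ` carrier C \<subseteq> val_class ` Pow (carrier G)" using rem_proj_eq vals_subset by auto
    show "val_class ` Pow (carrier G) \<subseteq> rem_proj H ` carrier C"
    proof
      fix x assume "x \<in> val_class ` Pow (carrier G)"
      then obtain A where "A \<subseteq> carrier G" "x = val_class A" by auto
      then have "x = rem_proj H (val_lift A)" by (simp add: rem_proj_eq val_lift_closed vals_val_lift)
      then show "x \<in> rem_proj H ` carrier C" using val_lift_closed by blast
    qed
  qed
  then show ?thesis by (simp add: rem_lattice_def)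
qed

lemma val_class_closed: "A \<subseteq> carrier G \<Longrightarrow> val_class A \<in> carrier Q"
  by (auto simp: Q_carrier)

lemma val_class_le_iff: "A \<subseteq> carrier G \<Longrightarrow> B \<subseteq> carrier G \<Longrightarrow> val_class A \<sqsubseteq>\<^bsub>Q\<^esub> val_class B \<longleftrightarrow> A \<subseteq> B"
  by (simp add: rem_lattice_def rem_incl_eq val_lift_le_iff)

lemma Q_complete_lattice: "complete_lattice Q"
proof (rule partial_order.complete_latticeI)
  show "partial_order Q"
  proof unfold_locales
    fix x y z assume "x \<in> carrier Q" "y \<in> carrier Q" "z \<in> carrier Q" "x \<sqsubseteq>\<^bsub>Q\<^esub> y" "y \<sqsubseteq>\<^bsub>Q\<^esub> z"
    then show "x \<sqsubseteq>\<^bsub>Q\<^esub> z" unfolding Q_carrier by (auto simp: val_class_le_iff)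
  next
    fix x y assume "x \<in> carrier Q" "y \<in> carrier Q" "x \<sqsubseteq>\<^bsub>Q\<^esub> y" "y \<sqsubseteq>\<^bsub>Q\<^esub> x"
    then have "x = y" unfolding Q_carrier by (auto simp: val_class_le_iff)
    then show "x .=\<^bsub>Q\<^esub> y" by (simp add: rem_lattice_def)
  next
    fix x assume "x \<in> carrier Q" then show "x \<sqsubseteq>\<^bsub>Q\<^esub> x" unfolding Q_carrier by (auto simp: val_class_le_iff)
  qed (auto simp: rem_lattice_def)
  fix X assume X: "X \<subseteq> carrier Q"
  then obtain \<A> where \<A>: "\<A> \<subseteq> Pow (carrier G)" "X = val_class ` \<A>"
    unfolding Q_carrier by (auto elim: subset_imageE)
  have sub: "A \<subseteq> carrier G" if "A \<in> \<A>" for A using \<A>(1) that by blast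
  then have U: "\<Union>\<A> \<subseteq> carrier G" by blast
  have le: "val_class A \<sqsubseteq>\<^bsub>Q\<^esub> val_class B \<longleftrightarrow> A \<subseteq> B" "val_class B \<sqsubseteq>\<^bsub>Q\<^esub> val_class A \<longleftrightarrow> B \<subseteq> A"
    if "A \<in> \<A>" "B \<subseteq> carrier G" for A B
    using val_class_le_iff[OF sub[OF that(1)] that(2)] val_class_le_iff[OF that(2) sub[OF that(1)]] by auto
  have "least Q (val_class (\<Union>\<A>)) (Upper Q X)"
    unfolding least_def
  proof (intro conjI ballI)
    show "Upper Q X \<subseteq> carrier Q" by (auto simp: Upper_def)
    show "val_class (\<Union>\<A>) \<in> Upper Q X"
      unfolding Upper_def \<A>(2) using le(1)[OF _ U] U by (auto intro: val_class_closed)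
    fix y assume "y \<in> Upper Q X"
    then obtain B where B: "y = val_class B" "B \<subseteq> carrier G" "\<forall>A\<in>\<A>. val_class A \<sqsubseteq>\<^bsub>Q\<^esub> val_class B"
      unfolding Upper_def \<A>(2) using sub by (auto simp: Q_carrier)
    then show "val_class (\<Union>\<A>) \<sqsubseteq>\<^bsub>Q\<^esub> y" using val_class_le_iff[OF U B(2)] le(1)[OF _ B(2)] by auto
  qed
  then show "\<exists>s. least Q s (Upper Q X)" by blast
  have "greatest Q (val_class (carrier G \<inter> \<Inter>\<A>)) (Lower Q X)"
    unfolding greatest_def
  proof (intro conjI ballI)
    let ?I = "carrier G \<inter> \<Inter>\<A>"
    have I: "?I \<subseteq> carrier G" by blast
    show "Lower Q X \<subseteq> carrier Q" by (auto simp: Lower_def)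
    show "val_class ?I \<in> Lower Q X"
      unfolding Lower_def \<A>(2) using le(2)[OF _ I] I by (auto intro: val_class_closed)
    fix y assume "y \<in> Lower Q X"
    then obtain B where B: "y = val_class B" "B \<subseteq> carrier G" "\<forall>A\<in>\<A>. val_class B \<sqsubseteq>\<^bsub>Q\<^esub> val_class A"
      unfolding Lower_def \<A>(2) using sub by (auto simp: Q_carrier)
    then show "y \<sqsubseteq>\<^bsub>Q\<^esub> val_class ?I" using val_class_le_iff[OF B(2) I] le(2)[OF _ B(2)] by auto
  qed
  then show "\<exists>i. greatest Q i (Lower Q X)" by blast
qed

lemma Q_sup:
  assumes "\<A> \<subseteq> Pow (carrier G)" shows "\<Squnion>\<^bsub>Q\<^esub> (val_class ` \<A>) = val_class (\<Union>\<A>)"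
proof (rule eq_via_upper_bounds[OF Q_complete_lattice])
  interpret Q: complete_lattice Q by (rule Q_complete_lattice)
  have sub: "val_class ` \<A> \<subseteq> carrier Q" using assms by (auto simp: Q_carrier)
  then show "\<Squnion>\<^bsub>Q\<^esub> (val_class ` \<A>) \<in> carrier Q" by (rule Q.sup_closed)
  show "val_class (\<Union>\<A>) \<in> carrier Q" using assms by (intro val_class_closed) auto
  fix z assume z: "z \<in> carrier Q"
  then obtain B where B: "B \<subseteq> carrier G" "z = val_class B" unfolding Q_carrier by auto
  have "val_class A \<sqsubseteq>\<^bsub>Q\<^esub> z \<longleftrightarrow> A \<subseteq> B" if "A \<in> \<A>" for A using val_class_le_iff[of A B] that assms B by auto
  then show "\<Squnion>\<^bsub>Q\<^esub> (val_class ` \<A>) \<sqsubseteq>\<^bsub>Q\<^esub> z \<longleftrightarrow> val_class (\<Union>\<A>) \<sqsubseteq>\<^bsub>Q\<^esub> z"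
  proof -
    have "\<Union>\<A> \<subseteq> carrier G" using assms by auto
    then have "val_class (\<Union>\<A>) \<sqsubseteq>\<^bsub>Q\<^esub> z \<longleftrightarrow> (\<forall>A\<in>\<A>. A \<subseteq> B)"
      using val_class_le_iff[of "\<Union>\<A>" B] B by (simp add: Sup_le_iff)
    moreover have "\<Squnion>\<^bsub>Q\<^esub> (val_class ` \<A>) \<sqsubseteq>\<^bsub>Q\<^esub> z \<longleftrightarrow> (\<forall>A\<in>\<A>. val_class A \<sqsubseteq>\<^bsub>Q\<^esub> z)"
      using sup_le_iff[OF Q_complete_lattice sub z] by simp
    ultimately show ?thesis
      using \<open>\<And>A. A \<in> \<A> \<Longrightarrow> val_class A \<sqsubseteq>\<^bsub>Q\<^esub> z \<longleftrightarrow> A \<subseteq> B\<close> by simp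
  qed
qed

lemma RQ_simps: "carrier RQ = carrier Q" "le RQ = le Q" "eq RQ = (=)"
  by (simp_all add: rem_quot_def)

lemma RQ_cong: "tensor RQ RQ = tensor Q Q" "pure RQ RQ = pure Q Q" "bottom RQ = bottom Q"
  using gorder_cong[of RQ Q] tensor_cong[of RQ Q RQ Q] RQ_simps by simp_all

lemma Q_bottom: "bottom Q = val_class {}"
proof -
  interpret complete_lattice Q by (rule Q_complete_lattice)
  have "bottom Q \<sqsubseteq>\<^bsub>Q\<^esub> val_class {}" by (rule bottom_lower) (simp add: val_class_closed)
  moreover obtain A where "A \<subseteq> carrier G" "bottom Q = val_class A" using bottom_closed unfolding Q_carrier by auto
  ultimately show ?thesis using val_class_le_iff[of A "{}"] by simp
qed

abbreviation (input) TQ where "TQ \<equiv> tensor Q Q"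

lemma TQ_complete_lattice: "complete_lattice TQ"
  by (intro tensor_complete_lattice Q_complete_lattice)

text \<open>The element of the tensor square of the quotient that corresponds to a set X of pairs, as
  the set of all rectangles in X.\<close>

definition rect :: "('a \<times> 'a) set \<Rightarrow> ('a sym set set \<times> 'a sym set set) set" where
  "rect X = {(val_class A, val_class B) | A B. A \<subseteq> carrier G \<and> B \<subseteq> carrier G \<and> A \<times> B \<subseteq> X}"

lemma rect_iff: "A \<subseteq> carrier G \<Longrightarrow> B \<subseteq> carrier G \<Longrightarrow> (val_class A, val_class B) \<in> rect X \<longleftrightarrow> A \<times> B \<subseteq> X"
  unfolding rect_def using val_class_inj[of A] val_class_inj[of B] by auto

lemma Q_subsetE:
  assumes "X \<subseteq> carrier Q"
  obtains \<A> where "\<A> \<subseteq> Pow (carrier G)" "X = val_class ` \<A>"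
  using assms unfolding Q_carrier by (auto elim: subset_imageE)

lemma rect_closed: "rect X \<in> carrier TQ"
  unfolding tensor_carrier_iff biprincipal_def
proof (intro conjI ballI)
  show "rect X \<subseteq> carrier Q \<times> carrier Q" unfolding rect_def Q_carrier by auto
  fix m assume "m \<in> carrier Q"
  then obtain B where B: "B \<subseteq> carrier G" "m = val_class B" unfolding Q_carrier by auto
  show "principal_pred Q (\<lambda>l. (l, m) \<in> rect X)"
    unfolding principal_pred_def
  proof (intro allI impI)
    fix Y assume "Y \<subseteq> carrier Q"
    then obtain \<A> where A: "\<A> \<subseteq> Pow (carrier G)" "Y = val_class ` \<A>" by (rule Q_subsetE)
    have "(val_class A', m) \<in> rect X \<longleftrightarrow> A' \<times> B \<subseteq> X" if "A' \<in> \<A>" for A'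
      using rect_iff[of A' B] that A B by auto
    moreover have "(val_class (\<Union>\<A>), m) \<in> rect X \<longleftrightarrow> \<Union>\<A> \<times> B \<subseteq> X"
      using rect_iff[of "\<Union>\<A>" B] A B by auto
    ultimately show "(\<Squnion>\<^bsub>Q\<^esub> Y, m) \<in> rect X \<longleftrightarrow> (\<forall>a\<in>Y. (a, m) \<in> rect X)"
      unfolding A(2) Q_sup[OF A(1)] by auto
  qed
  show "principal_pred Q (\<lambda>l. (m, l) \<in> rect X)"
    unfolding principal_pred_def
  proof (intro allI impI)
    fix Y assume "Y \<subseteq> carrier Q"
    then obtain \<A> where A: "\<A> \<subseteq> Pow (carrier G)" "Y = val_class ` \<A>" by (rule Q_subsetE)
    have "(m, val_class A') \<in> rect X \<longleftrightarrow> B \<times> A' \<subseteq> X" if "A' \<in> \<A>" for A'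
      using rect_iff[of B A'] that A B by auto
    moreover have "(m, val_class (\<Union>\<A>)) \<in> rect X \<longleftrightarrow> B \<times> \<Union>\<A> \<subseteq> X"
      using rect_iff[of B "\<Union>\<A>"] A B by auto
    ultimately show "(m, \<Squnion>\<^bsub>Q\<^esub> Y) \<in> rect X \<longleftrightarrow> (\<forall>a\<in>Y. (m, a) \<in> rect X)"
      unfolding A(2) Q_sup[OF A(1)] by auto
  qed
qed

lemma TQ_rect:
  assumes Z: "Z \<in> carrier TQ"
  shows "Z = rect {(g, h). g \<in> carrier G \<and> h \<in> carrier G \<and> (val_class {g}, val_class {h}) \<in> Z}" (is "Z = rect ?X")
proof -
  have val_class_sup: "val_class A = \<Squnion>\<^bsub>Q\<^esub> (val_class ` (\<lambda>g. {g}) ` A)" if "A \<subseteq> carrier G" for A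
    using Q_sup[of "(\<lambda>g. {g}) ` A"] that by auto
  have sub: "val_class ` (\<lambda>g. {g}) ` A \<subseteq> carrier Q" if "A \<subseteq> carrier G" for A
    using that by (auto intro: val_class_closed)
  have bi: "principal_pred Q (\<lambda>l. (l, m) \<in> Z)" "principal_pred Q (\<lambda>l. (m, l) \<in> Z)" if "m \<in> carrier Q" for m
    using biprincipal_tensor[OF Z] that unfolding biprincipal_def by auto
  have "(val_class A, val_class B) \<in> Z \<longleftrightarrow> (val_class A, val_class B) \<in> rect ?X" if AB: "A \<subseteq> carrier G" "B \<subseteq> carrier G" for A B
  proof -
    have "(val_class A, val_class B) \<in> Z \<longleftrightarrow> (\<forall>g\<in>A. (val_class {g}, val_class B) \<in> Z)"
      using principalD[OF bi(1)[OF val_class_closed[OF AB(2)]] sub[OF AB(1)]] val_class_sup[OF AB(1)] by simp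
    also have "\<dots> \<longleftrightarrow> (\<forall>g\<in>A. \<forall>h\<in>B. (val_class {g}, val_class {h}) \<in> Z)"
    proof (intro ball_cong HOL.refl)
      fix g assume "g \<in> A"
      then have "val_class {g} \<in> carrier Q" using AB by (intro val_class_closed) auto
      from principalD[OF bi(2)[OF this] sub[OF AB(2)]] show "(val_class {g}, val_class B) \<in> Z \<longleftrightarrow> (\<forall>h\<in>B. (val_class {g}, val_class {h}) \<in> Z)"
        using val_class_sup[OF AB(2)] by simp
    qed
    also have "\<dots> \<longleftrightarrow> (val_class A, val_class B) \<in> rect ?X" unfolding rect_iff[OF AB] using AB by blast
    finally show ?thesis .
  qed
  moreover have "Z \<subseteq> carrier Q \<times> carrier Q" "rect ?X \<subseteq> carrier Q \<times> carrier Q"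
    using tensor_subset[OF Z] tensor_subset[OF rect_closed[of ?X]] by auto
  ultimately have "x \<in> Z \<longleftrightarrow> x \<in> rect ?X" if "x \<in> carrier Q \<times> carrier Q" for x
    using that unfolding Q_carrier by auto
  then show ?thesis
    using \<open>Z \<subseteq> carrier Q \<times> carrier Q\<close> \<open>rect ?X \<subseteq> carrier Q \<times> carrier Q\<close> by blast
qed

lemma TQ_eqI:
  assumes "s \<in> carrier TQ" "t \<in> carrier TQ" "\<And>X. X \<subseteq> carrier G \<times> carrier G \<Longrightarrow> s \<subseteq> rect X \<longleftrightarrow> t \<subseteq> rect X"
  shows "s = t"
proof (rule eq_via_upper_bounds[OF TQ_complete_lattice assms(1,2)])
  fix z assume "z \<in> carrier TQ"
  show "s \<sqsubseteq>\<^bsub>TQ\<^esub> z \<longleftrightarrow> t \<sqsubseteq>\<^bsub>TQ\<^esub> z"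
    by (subst (1 2) TQ_rect[OF \<open>z \<in> carrier TQ\<close>]) (simp, rule assms(3), auto)
qed

lemma pure_rect: "A \<subseteq> carrier G \<Longrightarrow> B \<subseteq> carrier G \<Longrightarrow> pure Q Q (val_class A) (val_class B) \<subseteq> rect X \<longleftrightarrow> A \<times> B \<subseteq> X"
  by (simp add: pure_le_iff val_class_closed rect_closed rect_iff)

lemma pure_Q_closed: "A \<subseteq> carrier G \<Longrightarrow> B \<subseteq> carrier G \<Longrightarrow> pure Q Q (val_class A) (val_class B) \<in> carrier TQ"
  by (intro pure_closed Q_complete_lattice val_class_closed)

abbreviation (input) proj2 where "proj2 \<equiv> tensor_map Q Q (rem_proj H) (rem_proj H)"

lemma proj2_sub: "t \<in> carrier T \<Longrightarrow> {pure Q Q (rem_proj H l) (rem_proj H m) | l m. (l, m) \<in> t} \<subseteq> carrier TQ"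
proof -
  assume t: "t \<in> carrier T"
  have "pure Q Q (rem_proj H l) (rem_proj H m) \<in> carrier TQ" if "(l, m) \<in> t" for l m
  proof -
    have "l \<in> carrier C" "m \<in> carrier C" using tensor_subset[OF t] that by auto
    then show ?thesis using pure_Q_closed[OF vals_subset vals_subset] by (simp add: rem_proj_eq)
  qed
  then show ?thesis by blast
qed

lemma proj2_closed: "t \<in> carrier T \<Longrightarrow> proj2 t \<in> carrier TQ"
proof -
  assume t: "t \<in> carrier T"
  interpret TQ: complete_lattice TQ by (rule TQ_complete_lattice)
  show ?thesis unfolding tensor_map_def by (intro TQ.sup_closed proj2_sub t)
qed

lemma proj2_rect:
  assumes t: "t \<in> carrier T"
  shows "proj2 t \<subseteq> rect X \<longleftrightarrow> (\<forall>(l, m)\<in>t. vals l \<times> vals m \<subseteq> X)"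
proof -
  have "proj2 t \<subseteq> rect X \<longleftrightarrow> (\<forall>x\<in>{pure Q Q (rem_proj H l) (rem_proj H m) | l m. (l, m) \<in> t}. x \<subseteq> rect X)"
    unfolding tensor_map_def using sup_le_iff[OF TQ_complete_lattice proj2_sub[OF t] rect_closed] by simp
  also have "\<dots> \<longleftrightarrow> (\<forall>(l, m)\<in>t. pure Q Q (rem_proj H l) (rem_proj H m) \<subseteq> rect X)"
    unfolding ball_comprehension2 ..
  also have "\<dots> \<longleftrightarrow> (\<forall>(l, m)\<in>t. vals l \<times> vals m \<subseteq> X)"
  proof -
    have "pure Q Q (rem_proj H l) (rem_proj H m) \<subseteq> rect X \<longleftrightarrow> vals l \<times> vals m \<subseteq> X" if "(l, m) \<in> t" for l m
    proof -
      have "l \<in> carrier C" "m \<in> carrier C" using tensor_subset[OF t] that by auto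
      then show ?thesis using pure_rect[OF vals_subset vals_subset] by (simp add: rem_proj_eq)
    qed
    then show ?thesis by blast
  qed
  finally show ?thesis .
qed

lemma vals_biprincipal: "biprincipal C C (\<lambda>l m. vals l \<times> vals m \<subseteq> X)"
proof -
  have left: "vals l \<times> vals m \<subseteq> X \<longleftrightarrow> vals l \<subseteq> {g. \<forall>h\<in>vals m. (g, h) \<in> X}" for l m by auto
  have right: "vals l \<times> vals m \<subseteq> X \<longleftrightarrow> vals m \<subseteq> {h. \<forall>g\<in>vals l. (g, h) \<in> X}" for l m by auto
  show ?thesis
    unfolding biprincipal_def
  proof (intro conjI ballI)
    fix l show "principal_pred C (\<lambda>m. vals l \<times> vals m \<subseteq> X)" unfolding right by (rule vals_principal)
    show "principal_pred C (\<lambda>m. vals m \<times> vals l \<subseteq> X)" unfolding left by (rule vals_principal)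
  qed
qed

lemma vals_gen_gen:
  assumes "p \<in> points G a" "q \<in> points G a" "s \<in> points G b" "t \<in> points G b"
  shows "vals (gen a p q) \<times> vals (gen b s t) \<subseteq> X \<longleftrightarrow> (p = q \<longrightarrow> s = t \<longrightarrow> (word_val a p, word_val b s) \<in> X)"
proof -
  have v: "vals (gen a p q) = (if p = q then {word_val a p} else {})" if "p \<in> points G a" "q \<in> points G a" for a p q
  proof (cases "p = q")
    case True
    then show ?thesis using vals_gen[OF that] by (simp add: subset_singleton_eqI)
  next
    case False
    then show ?thesis using vals_gen[OF that, of "{}"] by simp
  qed
  show ?thesis unfolding v[OF assms(1,2)] v[OF assms(3,4)] by auto
qed

lemma val_lift_allsym:
  assumes "A \<subseteq> carrier G"
  shows "allsym K (val_lift A) \<longleftrightarrow>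
    (\<forall>a p q. p \<in> points G a \<longrightarrow> q \<in> points G a \<longrightarrow> p \<noteq> q \<or> word_val a p \<in> A \<longrightarrow> K a p q)"
  unfolding allsym_def val_lift_def by auto

section \<open>The remnant group\<close>

text \<open>The quotient has the coproduct of the group algebra, because only the middle indices l = p =
  q contribute.\<close>

lemma comult_RQ_rect:
  assumes A: "A \<subseteq> carrier G"
  shows "comult RQ (val_class A) \<subseteq> rect X \<longleftrightarrow> (\<forall>g\<in>A. (g, g) \<in> X)"
proof -
  have "comult RQ (val_class A) \<subseteq> rect X \<longleftrightarrow> (\<forall>(l, m)\<in>comult H (val_lift A). vals l \<times> vals m \<subseteq> X)"
    using proj2_rect[OF comult_closed[OF val_lift_closed]] A by (simp add: rem_quot_def rem_incl_eq)
  also have "\<dots> \<longleftrightarrow> allsym (\<lambda>a p q. \<forall>l\<in>points G a. vals (gen a p l) \<times> vals (gen a l q) \<subseteq> X) (val_lift A)"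
    by (rule comult_ball[OF vals_biprincipal val_lift_closed])
  also have "\<dots> \<longleftrightarrow> allsym (\<lambda>a p q. p = q \<longrightarrow> (word_val a p, word_val a p) \<in> X) (val_lift A)"
    by (intro allsym_cong val_lift_closed) (auto simp: vals_gen_gen)
  also have "\<dots> \<longleftrightarrow> (\<forall>g\<in>A. (g, g) \<in> X)"
  proof
    assume *: "allsym (\<lambda>a p q. p = q \<longrightarrow> (word_val a p, word_val a p) \<in> X) (val_lift A)"
    show "\<forall>g\<in>A. (g, g) \<in> X"
    proof
      fix g assume "g \<in> A"
      then show "(g, g) \<in> X" using * A word_val_Lx[of g] unfolding val_lift_allsym[OF A]
        by (auto dest!: spec[of _ "[Lx]"] spec[of _ "[g]"])
    qed
  qed (auto simp: val_lift_allsym[OF A])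
  finally show ?thesis .
qed

text \<open>A nonempty set A is group-like iff A \<times> A lies in the diagonal, that is, iff A has one
  element.\<close>

lemma remnant_carrier: "carrier (remnant H) = (\<lambda>g. val_class {g}) ` carrier G"
proof -
  have "comult RQ (val_class A) = pure Q Q (val_class A) (val_class A) \<longleftrightarrow> (\<exists>g. A = {g})" if A: "A \<subseteq> carrier G" "A \<noteq> {}" for A
  proof
    assume eq: "comult RQ (val_class A) = pure Q Q (val_class A) (val_class A)"
    have "comult RQ (val_class A) \<subseteq> rect {(g, g) | g. g \<in> A}" unfolding comult_RQ_rect[OF A(1)] by blast
    then have "A \<times> A \<subseteq> {(g, g) | g. g \<in> A}" unfolding eq using pure_rect A by simp
    then have "g = h" if "g \<in> A" "h \<in> A" for g h using that by auto
    moreover obtain g where "g \<in> A" using A(2) by blast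
    ultimately have "A = {g}" by blast
    then show "\<exists>g. A = {g}" ..
  next
    assume "\<exists>g. A = {g}"
    then obtain g where g: "A = {g}" by blast
    show "comult RQ (val_class A) = pure Q Q (val_class A) (val_class A)"
    proof (rule TQ_eqI)
      show "comult RQ (val_class A) \<in> carrier TQ"
        using A by (simp add: rem_quot_def rem_incl_eq proj2_closed comult_closed val_lift_closed)
      show "pure Q Q (val_class A) (val_class A) \<in> carrier TQ" using A by (intro pure_Q_closed)
      fix X
      show "comult RQ (val_class A) \<subseteq> rect X \<longleftrightarrow> pure Q Q (val_class A) (val_class A) \<subseteq> rect X"
        using comult_RQ_rect[OF A(1), of X] pure_rect[OF A(1) A(1), of X] by (simp add: g)
    qed
  qed
  note key = this
  have "carrier (remnant H) = {q \<in> carrier Q. q \<noteq> val_class {} \<and> comult RQ q = pure Q Q q q}"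
    unfolding remnant_def by (simp add: RQ_simps RQ_cong Q_bottom)
  also have "\<dots> = (\<lambda>g. val_class {g}) ` carrier G"
  proof (intro Set.set_eqI iffI)
    fix q assume "q \<in> {q \<in> carrier Q. q \<noteq> val_class {} \<and> comult RQ q = pure Q Q q q}"
    then obtain A where A: "A \<subseteq> carrier G" "q = val_class A" "A \<noteq> {}" "comult RQ (val_class A) = pure Q Q (val_class A) (val_class A)"
      unfolding Q_carrier by auto
    then obtain g where "A = {g}" using key[OF A(1,3)] by blast
    then show "q \<in> (\<lambda>g. val_class {g}) ` carrier G" using A by auto
  next
    fix q assume "q \<in> (\<lambda>g. val_class {g}) ` carrier G"
    then obtain g where g: "g \<in> carrier G" "q = val_class {g}" by blast
    then show "q \<in> {q \<in> carrier Q. q \<noteq> val_class {} \<and> comult RQ q = pure Q Q q q}"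
      using key[of "{g}"] val_class_closed[of "{g}"] val_class_inj[of "{g}" "{}"] by simp
  qed
  finally show ?thesis .
qed

lemma vals_prod_val_lift:
  assumes g: "g \<in> carrier G" "h \<in> carrier G"
  shows "vals (prod_H (val_lift {g}) (val_lift {h})) = {g \<otimes> h}"
proof (rule subset_singleton_eqI)
  fix X
  have "vals (prod_H (val_lift {g}) (val_lift {h})) \<subseteq> X \<longleftrightarrow> prod_H (val_lift {g}) (val_lift {h}) \<subseteq> val_lift X"
    by (intro vals_le_iff prod_closed val_lift_closed)
  also have "\<dots> \<longleftrightarrow> allsym (\<lambda>a p q. allsym (\<lambda>b p' q'. (a @ b, p @ p', q @ q') \<in> val_lift X) (val_lift {h})) (val_lift {g})"
    by (intro prod_le_iff val_lift_closed)
  also have "\<dots> \<longleftrightarrow> g \<otimes> h \<in> X"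
  proof
    assume *: "allsym (\<lambda>a p q. allsym (\<lambda>b p' q'. (a @ b, p @ p', q @ q') \<in> val_lift X) (val_lift {h})) (val_lift {g})"
    have mem: "([Lx], [g], [g]) \<in> val_lift {g}" "([Lx], [h], [h]) \<in> val_lift {h}"
      using val_lift_Lx[of g "{g}"] val_lift_Lx[of h "{h}"] g by simp_all
    have "([Lx] @ [Lx], [g] @ [h], [g] @ [h]) \<in> val_lift X"
      by (rule allsymD[OF allsymD[OF * mem(1)] mem(2)])
    moreover have "word_val ([Lx] @ [Lx]) ([g] @ [h]) = g \<otimes> h"
      using g by (subst word_val_append) (auto simp: word_val_Lx)
    ultimately show "g \<otimes> h \<in> X" unfolding val_lift_def by auto
  next
    assume X: "g \<otimes> h \<in> X"
    have "(a @ b, p @ p', q @ q') \<in> val_lift X" if "(a, p, q) \<in> val_lift {g}" "(b, p', q') \<in> val_lift {h}" for a p q b p' q'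
    proof -
      have *: "p \<in> points G a" "q \<in> points G a" "p' \<in> points G b" "q' \<in> points G b"
        "p \<noteq> q \<or> word_val a p = g" "p' \<noteq> q' \<or> word_val b p' = h" using that by (auto simp: val_lift_def)
      have "p @ p' = q @ q' \<longleftrightarrow> p = q \<and> p' = q'" using * by (auto simp: points_iff)
      then show ?thesis unfolding val_lift_def using * X by (auto simp: word_val_append)
    qed
    then show "allsym (\<lambda>a p q. allsym (\<lambda>b p' q'. (a @ b, p @ p', q @ q') \<in> val_lift X) (val_lift {h})) (val_lift {g})"
      by (intro allsymI)
  qed
  finally show "vals (prod_H (val_lift {g}) (val_lift {h})) \<subseteq> X \<longleftrightarrow> g \<otimes> h \<in> X" .
qed

lemma remnant_mult:
  "g \<in> carrier G \<Longrightarrow> h \<in> carrier G \<Longrightarrow> val_class {g} \<otimes>\<^bsub>remnant H\<^esub> val_class {h} = val_class {g \<otimes> h}"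
  unfolding remnant_def rem_quot_def
  by (simp add: rem_incl_eq rem_proj_eq prod_closed val_lift_closed vals_prod_val_lift)

lemma remnant_one: "\<one>\<^bsub>remnant H\<^esub> = val_class {\<one>}"
proof -
  have "vals (hone H) = {\<one>}"
    unfolding hone_eq by (rule subset_singleton_eqI) (simp add: vals_gen)
  then show ?thesis unfolding remnant_def rem_quot_def by (simp add: rem_proj_eq hone_closed)
qed

lemma val_class_iso: "(\<lambda>g. val_class {g}) \<in> iso G (remnant H)"
  unfolding iso_def hom_def bij_betw_def
  by (auto simp: remnant_carrier remnant_mult inj_on_def val_class_inj)

lemma remnant_group: "group (remnant H)"
proof -
  have "(\<lambda>g. val_class {g}) \<in> hom G (remnant H)" using val_class_iso by (simp add: iso_def)
  note img = hom_imp_img_group[OF this]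
  have "remnant H\<lparr>carrier := (\<lambda>g. val_class {g}) ` carrier G, one := val_class {\<one>}\<rparr> = remnant H"
    by (rule monoid.equality) (simp_all add: remnant_carrier remnant_one)
  then show ?thesis using img by simp
qed

section \<open>The induced braiding operator\<close>

definition triprincipal :: "('a sym set \<Rightarrow> 'a sym set \<Rightarrow> 'a sym set \<Rightarrow> bool) \<Rightarrow> bool" where
  "triprincipal K \<longleftrightarrow>
    (\<forall>y\<in>carrier C. \<forall>z\<in>carrier C. principal_pred C (\<lambda>x. K x y z)) \<and>
    (\<forall>x\<in>carrier C. \<forall>z\<in>carrier C. principal_pred C (\<lambda>y. K x y z)) \<and>
    (\<forall>x\<in>carrier C. \<forall>y\<in>carrier C. principal_pred C (\<lambda>z. K x y z))"

lemma comult3_mem: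
  assumes "S \<in> carrier C" "(x, y, z) \<in> comult3 H S"
  shows "x \<in> carrier C" "y \<in> carrier C" "z \<in> carrier C"
proof -
  obtain u where "(x, u) \<in> comult H S" "(y, z) \<in> comult H u" using assms(2) unfolding comult3_def by auto
  then show "x \<in> carrier C" "y \<in> carrier C" "z \<in> carrier C"
    using comult_mem[OF assms(1)] comult_mem by blast+
qed

text \<open>Evaluates threefold Sweedler expressions on symbols.\<close>

lemma comult3_ball:
  assumes K: "triprincipal K" and S: "S \<in> carrier C"
  shows "(\<forall>(x, y, z)\<in>comult3 H S. K x y z) \<longleftrightarrow>
    allsym (\<lambda>a p q. \<forall>l\<in>points G a. \<forall>l'\<in>points G a. K (gen a p l) (gen a l l') (gen a l' q)) S"
proof -
  have inner: "biprincipal C C (K x)" if "x \<in> carrier C" for x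
    using K that unfolding triprincipal_def biprincipal_def by blast
  have outer: "biprincipal C C (\<lambda>x u. \<forall>(y, z)\<in>comult H u. K x y z)"
    unfolding biprincipal_def
  proof (intro conjI ballI)
    fix u assume u: "u \<in> carrier C"
    show "principal_pred C (\<lambda>v. \<forall>(y, z)\<in>comult H v. K u y z)"
      by (rule comult_ball_principal[OF inner[OF u]])
    have "principal_pred C (\<lambda>x. K x (fst w) (snd w))" if "w \<in> comult H u" for w
      using K comult_mem[OF u, of "fst w" "snd w"] that unfolding triprincipal_def by simp
    then show "principal_pred C (\<lambda>x. \<forall>(y, z)\<in>comult H u. K x y z)"
      unfolding case_prod_beta by (rule principal_ball)
  qed
  have "(\<forall>(x, y, z)\<in>comult3 H S. K x y z) \<longleftrightarrow> (\<forall>(x, u)\<in>comult H S. \<forall>(y, z)\<in>comult H u. K x y z)"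
    unfolding comult3_def by blast
  also have "\<dots> \<longleftrightarrow> allsym (\<lambda>a p q. \<forall>l\<in>points G a. \<forall>(y, z)\<in>comult H (gen a l q). K (gen a p l) y z) S"
    by (rule comult_ball[OF outer S])
  also have "\<dots> \<longleftrightarrow> allsym (\<lambda>a p q. \<forall>l\<in>points G a. \<forall>l'\<in>points G a. K (gen a p l) (gen a l l') (gen a l' q)) S"
    by (intro allsym_cong S ball_cong HOL.refl comult_ball_gen inner gen_closed)
  finally show ?thesis .
qed

lemma Gamma_rect:
  assumes a: "a \<in> carrier C" and b: "b \<in> carrier C"
  shows "Gamma H R a b \<in> carrier T" and "proj2 (Gamma H R a b) \<subseteq> rect X \<longleftrightarrow>
    (\<forall>(a1, a2, a3)\<in>comult3 H a. \<forall>(b1, b2, b3)\<in>comult3 H b.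
      R a1 b1 \<longrightarrow> conv_inv H R a3 b3 \<longrightarrow> vals b2 \<times> vals a2 \<subseteq> X)"
proof -
  interpret T: complete_lattice T by (rule T_complete_lattice)
  let ?A = "{scal T (R a1 b1 \<and> conv_inv H R a3 b3) (pure C C b2 a2)
       | a1 a2 a3 b1 b2 b3. (a1, a2, a3) \<in> comult3 H a \<and> (b1, b2, b3) \<in> comult3 H b}"
  have "scal T s (pure C C b2 a2) \<in> carrier T"
    if "(a1, a2, a3) \<in> comult3 H a" "(b1, b2, b3) \<in> comult3 H b" for s a1 a2 a3 b1 b2 b3
    using comult3_mem[OF a that(1)] comult3_mem[OF b that(2)]
    by (intro scal_closed T_complete_lattice pure_C_closed)
  then have A: "?A \<subseteq> carrier T" by blast
  have G: "Gamma H R a b = \<Squnion>\<^bsub>T\<^esub> ?A" unfolding Gamma_def by simp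
  show GT: "Gamma H R a b \<in> carrier T" unfolding G by (rule T.sup_closed[OF A])
  let ?P = "\<lambda>t. \<forall>(l, m)\<in>t. vals l \<times> vals m \<subseteq> X"
  note lift = biprincipal_lift[OF coend_complete_lattice coend_complete_lattice vals_biprincipal]
  have "?P (\<Squnion>\<^bsub>T\<^esub> {})" using principalD[OF lift(1), of "{}"] by simp
  moreover have "\<Squnion>\<^bsub>T\<^esub> {} = bottom T"
    using T.weak_sup_empty T.eq_is_equal by simp
  ultimately have bot: "?P (bottom T)" by simp
  have scal: "?P (scal T s (pure C C b2 a2)) \<longleftrightarrow> (s \<longrightarrow> vals b2 \<times> vals a2 \<subseteq> X)"
    if "a2 \<in> carrier C" "b2 \<in> carrier C" for s a2 b2
    using bot lift(2)[OF that(2,1)] by (simp add: scal_def)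
  have "proj2 (Gamma H R a b) \<subseteq> rect X \<longleftrightarrow> ?P (\<Squnion>\<^bsub>T\<^esub> ?A)"
    using proj2_rect[OF GT] unfolding G .
  also have "\<dots> \<longleftrightarrow> (\<forall>x\<in>?A. ?P x)" by (rule principalD[OF lift(1) A])
  also have "\<dots> \<longleftrightarrow> (\<forall>(a1, a2, a3)\<in>comult3 H a. \<forall>(b1, b2, b3)\<in>comult3 H b.
      ?P (scal T (R a1 b1 \<and> conv_inv H R a3 b3) (pure C C b2 a2)))"
    unfolding ball_comprehension6 ..
  also have "\<dots> \<longleftrightarrow> (\<forall>(a1, a2, a3)\<in>comult3 H a. \<forall>(b1, b2, b3)\<in>comult3 H b.
      R a1 b1 \<longrightarrow> conv_inv H R a3 b3 \<longrightarrow> vals b2 \<times> vals a2 \<subseteq> X)"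
  proof (intro ball_cong HOL.refl, clarify, intro ball_cong HOL.refl, clarify)
    fix a1 a2 a3 b1 b2 b3 assume "(a1, a2, a3) \<in> comult3 H a" "(b1, b2, b3) \<in> comult3 H b"
    note mem = comult3_mem(2)[OF a this(1)] comult3_mem(2)[OF b this(2)]
    show "?P (scal T (R a1 b1 \<and> conv_inv H R a3 b3) (pure C C b2 a2)) \<longleftrightarrow>
      (R a1 b1 \<longrightarrow> conv_inv H R a3 b3 \<longrightarrow> vals b2 \<times> vals a2 \<subseteq> X)"
      unfolding imp_conjL[symmetric] by (rule scal[OF mem])
  qed
  finally show "proj2 (Gamma H R a b) \<subseteq> rect X \<longleftrightarrow>
    (\<forall>(a1, a2, a3)\<in>comult3 H a. \<forall>(b1, b2, b3)\<in>comult3 H b.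
      R a1 b1 \<longrightarrow> conv_inv H R a3 b3 \<longrightarrow> vals b2 \<times> vals a2 \<subseteq> X)" .
qed

text \<open>Only diagonal middle factors have values. For these the factors R and its inverse say that
  (p, s) and (q, t) are crossed to the same pair, so p = q and s = t, and the crossing acts on
  values by r.\<close>

lemma Gamma_val_lift:
  assumes g: "g \<in> carrier G" "h \<in> carrier G"
  shows "proj2 (Gamma H R (val_lift {g}) (val_lift {h})) \<subseteq> rect X \<longleftrightarrow> r (g, h) \<in> X"
proof -
  let ?R' = "conv_inv H R"
  have inv: "convolution_inverse H R ?R'"
    unfolding conv_inv_def by (rule someI[of "convolution_inverse H R" R']) (rule R_convolution_inverse)
  have R': "biprincipal C C (\<lambda>x y. \<not> ?R' x y)"
    using inv unfolding convolution_inverse_def bi_sup_hom_unit by blast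
  let ?F = "\<lambda>a1 a2 a3 b1 b2 b3. R a1 b1 \<longrightarrow> ?R' a3 b3 \<longrightarrow> vals b2 \<times> vals a2 \<subseteq> X"
  have pa: "principal_pred C (\<lambda>x. \<not> R x y)" "principal_pred C (\<lambda>x. \<not> R y x)"
    "principal_pred C (\<lambda>x. \<not> ?R' x y)" "principal_pred C (\<lambda>x. \<not> ?R' y x)"
    "principal_pred C (\<lambda>x. vals x \<times> vals y \<subseteq> X)" "principal_pred C (\<lambda>x. vals y \<times> vals x \<subseteq> X)"
    if "y \<in> carrier C" for y
    using R_biprincipal R' vals_biprincipal[of X] that unfolding biprincipal_def by blast+
  have tri_b: "triprincipal (?F a1 a2 a3)"
    if "a1 \<in> carrier C" "a2 \<in> carrier C" "a3 \<in> carrier C" for a1 a2 a3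
    unfolding triprincipal_def using that
    by (intro conjI ballI principal_not_imp principal_imp pa)
  have tri_a: "triprincipal (\<lambda>a1 a2 a3. ?F a1 a2 a3 b1 b2 b3)"
    if "b1 \<in> carrier C" "b2 \<in> carrier C" "b3 \<in> carrier C" for b1 b2 b3
    unfolding triprincipal_def using that
    by (intro conjI ballI principal_not_imp principal_imp pa)
  have outer: "triprincipal (\<lambda>a1 a2 a3. \<forall>(b1, b2, b3)\<in>comult3 H (val_lift {h}). ?F a1 a2 a3 b1 b2 b3)"
  proof -
    have "triprincipal (\<lambda>a1 a2 a3. ?F a1 a2 a3 (fst w) (fst (snd w)) (snd (snd w)))"
      if "w \<in> comult3 H (val_lift {h})" for w
      using comult3_mem[OF val_lift_closed, of "fst w" "fst (snd w)" "snd (snd w)"] that by (intro tri_a) simp_all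
    then show ?thesis unfolding triprincipal_def case_prod_beta
      by (intro conjI ballI principal_ball) blast+
  qed
  have "proj2 (Gamma H R (val_lift {g}) (val_lift {h})) \<subseteq> rect X \<longleftrightarrow>
    (\<forall>(a1, a2, a3)\<in>comult3 H (val_lift {g}). \<forall>(b1, b2, b3)\<in>comult3 H (val_lift {h}). ?F a1 a2 a3 b1 b2 b3)"
    by (rule Gamma_rect(2)[OF val_lift_closed val_lift_closed])
  also have "\<dots> \<longleftrightarrow> allsym (\<lambda>a p q. \<forall>l\<in>points G a. \<forall>l'\<in>points G a.
     \<forall>(b1, b2, b3)\<in>comult3 H (val_lift {h}). ?F (gen a p l) (gen a l l') (gen a l' q) b1 b2 b3) (val_lift {g})"
    by (rule comult3_ball[OF outer val_lift_closed])
  also have "\<dots> \<longleftrightarrow> allsym (\<lambda>a p q. \<forall>l\<in>points G a. \<forall>l'\<in>points G a.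
     allsym (\<lambda>b s t. \<forall>m\<in>points G b. \<forall>m'\<in>points G b.
       ?F (gen a p l) (gen a l l') (gen a l' q) (gen b s m) (gen b m m') (gen b m' t)) (val_lift {h})) (val_lift {g})"
    by (intro allsym_cong val_lift_closed ball_cong HOL.refl comult3_ball tri_b gen_closed)
  also have "\<dots> \<longleftrightarrow> allsym (\<lambda>a p q. \<forall>l\<in>points G a. \<forall>l'\<in>points G a.
     allsym (\<lambda>b s t. \<forall>m\<in>points G b. \<forall>m'\<in>points G b.
       kappa_map a b p s = (m, l) \<longrightarrow> kappa_map a b q t = (m', l') \<longrightarrow> m = m' \<longrightarrow> l = l' \<longrightarrow>
       (word_val b m, word_val a l) \<in> X) (val_lift {h})) (val_lift {g})"
    by (intro allsym_cong val_lift_closed ball_cong HOL.refl)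
      (simp add: R_gen convolution_inverse_gen[OF inv] vals_gen_gen)
  also have "\<dots> \<longleftrightarrow> r (g, h) \<in> X"
  proof
    assume *: "allsym (\<lambda>a p q. \<forall>l\<in>points G a. \<forall>l'\<in>points G a.
     allsym (\<lambda>b s t. \<forall>m\<in>points G b. \<forall>m'\<in>points G b.
       kappa_map a b p s = (m, l) \<longrightarrow> kappa_map a b q t = (m', l') \<longrightarrow> m = m' \<longrightarrow> l = l' \<longrightarrow>
       (word_val b m, word_val a l) \<in> X) (val_lift {h})) (val_lift {g})"
    have mem: "([Lx], [g], [g]) \<in> val_lift {g}" "([Lx], [h], [h]) \<in> val_lift {h}"
      using val_lift_Lx[of g "{g}"] val_lift_Lx[of h "{h}"] g by simp_all
    have pts: "[g] \<in> points G [Lx]" "[h] \<in> points G [Lx]" using g by simp_all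
    obtain m l where k: "kappa_map [Lx] [Lx] [g] [h] = (m, l)" by fastforce
    note ml = kappa_map_closed[OF k pts]
    have "(word_val [Lx] m, word_val [Lx] l) \<in> X"
      using * mem ml k unfolding allsym_def by blast
    then show "r (g, h) \<in> X" using r_word_val[OF k pts] g by (simp add: word_val_Lx)
  next
    assume X: "r (g, h) \<in> X"
    have "(word_val b m, word_val a l) \<in> X"
      if "(a, p, q) \<in> val_lift {g}" "(b, s, t) \<in> val_lift {h}" "m \<in> points G b" "l \<in> points G a"
        "kappa_map a b p s = (m, l)" "kappa_map a b q t = (m, l)" for a p q b s t m l
    proof -
      have pts: "p \<in> points G a" "q \<in> points G a" "s \<in> points G b" "t \<in> points G b"
        using that by (auto simp: val_lift_def)
      have "p = q" "s = t" using kappa_map_inj[OF that(5,6) pts(1,3,2,4)] by auto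
      then have "word_val a p = g" "word_val b s = h" using that(1,2) by (auto simp: val_lift_def)
      then show ?thesis using r_word_val[OF that(5) pts(1,3)] X by simp
    qed
    then show "allsym (\<lambda>a p q. \<forall>l\<in>points G a. \<forall>l'\<in>points G a.
     allsym (\<lambda>b s t. \<forall>m\<in>points G b. \<forall>m'\<in>points G b.
       kappa_map a b p s = (m, l) \<longrightarrow> kappa_map a b q t = (m', l') \<longrightarrow> m = m' \<longrightarrow> l = l' \<longrightarrow>
       (word_val b m, word_val a l) \<in> X) (val_lift {h})) (val_lift {g})"
      unfolding allsym_def by blast
  qed
  finally show ?thesis .
qed

lemma induced_braiding_eq:
  assumes g: "g \<in> carrier G" "h \<in> carrier G" and r: "r (g, h) = (g', h')"
  shows "induced_braiding H R (val_class {g}, val_class {h}) = (val_class {g'}, val_class {h'})"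
proof -
  have c: "g' \<in> carrier G" "h' \<in> carrier G" using r_closed[OF r g] by auto
  have eq: "proj2 (Gamma H R (val_lift {g}) (val_lift {h})) = pure Q Q (val_class {x}) (val_class {y}) \<longleftrightarrow> x = g' \<and> y = h'"
    if "x \<in> carrier G" "y \<in> carrier G" for x y
  proof
    assume *: "proj2 (Gamma H R (val_lift {g}) (val_lift {h})) = pure Q Q (val_class {x}) (val_class {y})"
    have "pure Q Q (val_class {x}) (val_class {y}) \<subseteq> rect {(g', h')}" unfolding *[symmetric] Gamma_val_lift[OF g] r by simp
    then show "x = g' \<and> y = h'" using that pure_rect[of "{x}" "{y}" "{(g', h')}"] by simp
  next
    assume "x = g' \<and> y = h'"
    then show "proj2 (Gamma H R (val_lift {g}) (val_lift {h})) = pure Q Q (val_class {x}) (val_class {y})"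
      using c r by (intro TQ_eqI proj2_closed Gamma_rect(1) val_lift_closed pure_Q_closed)
        (auto simp: Gamma_val_lift[OF g] pure_rect)
  qed
  have tm: "tensor_map RQ RQ = (tensor_map Q Q :: ('a sym set \<Rightarrow> _) \<Rightarrow> ('a sym set \<Rightarrow> _) \<Rightarrow> _)"
    by (intro ext) (simp add: tensor_map_def RQ_cong)
  have "induced_braiding H R (val_class {g}, val_class {h}) = (THE x. (\<lambda>(g1, h1). g1 \<in> carrier (remnant H) \<and>
      h1 \<in> carrier (remnant H) \<and> proj2 (Gamma H R (val_lift {g}) (val_lift {h})) = pure Q Q g1 h1) x)"
    unfolding induced_braiding_def using g by (simp add: rem_incl_eq RQ_cong tm)
  also have "\<dots> = (val_class {g'}, val_class {h'})"
  proof (rule the_equality)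
    show "(\<lambda>(g1, h1). g1 \<in> carrier (remnant H) \<and> h1 \<in> carrier (remnant H) \<and>
      proj2 (Gamma H R (val_lift {g}) (val_lift {h})) = pure Q Q g1 h1) (val_class {g'}, val_class {h'})"
      using eq[OF c] c by (simp add: remnant_carrier)
    fix x assume "(\<lambda>(g1, h1). g1 \<in> carrier (remnant H) \<and> h1 \<in> carrier (remnant H) \<and>
      proj2 (Gamma H R (val_lift {g}) (val_lift {h})) = pure Q Q g1 h1) x"
    then show "x = (val_class {g'}, val_class {h'})" unfolding remnant_carrier using eq by auto
  qed
  finally show ?thesis .
qed

lemma remnant_recovers:
  "\<exists>\<phi> \<in> iso (remnant H) G.
     \<forall>g \<in> carrier (remnant H). \<forall>h \<in> carrier (remnant H).
       map_prod \<phi> \<phi> (induced_braiding H R (g, h)) = r (\<phi> g, \<phi> h)"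
proof (rule bexI[OF _ iso_set_sym[OF val_class_iso]], intro ballI)
  let ?\<phi> = "inv_into (carrier G) (\<lambda>g. val_class {g})"
  have \<phi>: "?\<phi> (val_class {g}) = g" if "g \<in> carrier G" for g
    by (rule inv_into_f_f) (use that in \<open>auto simp: inj_on_def val_class_inj\<close>)
  fix x y assume "x \<in> carrier (remnant H)" "y \<in> carrier (remnant H)"
  then obtain g h where gh: "x = val_class {g}" "y = val_class {h}" "g \<in> carrier G" "h \<in> carrier G"
    unfolding remnant_carrier by auto
  obtain g' h' where r: "r (g, h) = (g', h')" by fastforce
  then show "map_prod ?\<phi> ?\<phi> (induced_braiding H R (x, y)) = r (?\<phi> x, ?\<phi> y)"
    unfolding gh(1,2) induced_braiding_eq[OF gh(3,4) r] using \<phi> gh r_closed[OF r gh(3,4)] by simp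
qed

end

theorem theorem5p2:
  fixes G :: "('g, 'm) monoid_scheme" and r :: "'g \<times> 'g \<Rightarrow> 'g \<times> 'g"
  assumes "group G" and "braiding_operator G r"
  shows "coquasitriangular_hopf_algebra (H_omega G r) (R_omega G r) \<and>
    group (remnant (H_omega G r)) \<and>
    (\<exists>\<phi> \<in> iso (remnant (H_omega G r)) G.
       \<forall>g \<in> carrier (remnant (H_omega G r)). \<forall>h \<in> carrier (remnant (H_omega G r)).
         map_prod \<phi> \<phi> (induced_braiding (H_omega G r) (R_omega G r) (g, h)) = r (\<phi> g, \<phi> h))"
proof -
  interpret braided_group G r
    using assms by (intro braided_group.intro braided_group_axioms.intro)
  show ?thesis using H_coquasitriangular_hopf remnant_group remnant_recovers by blast
qed

end
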